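(* Let $\Sigma=\{0,1,\dots,|\Sigma|-1\}$ be both the pattern alphabet and the text alphabet, and let $P\in\Sigma^m$ be a pattern of length $m$. There is a randomised algorithm for the streaming parameterized matching problem for $P$ that takes $O(1)$ worst-case time per arriving text character and uses $O(|\Sigma|\log m)$ words of space. For any constant $c$, the algorithm can be made such that the probability that it outputs correctly at all alignments of a text of length $n$ is at least $1-1/n^c$.
   Context: Two strings $S,S'$ of equal length $m$ parameterize match (p-match) if there is an injective function $f$ with $S'[j]=f(S[j])$ for all $j\in\{0,\dots,m-1\}$. In the streaming parameterized matching problem the pattern $P$ of length $m$ is known in advance (and may be preprocessed) and the text $T$ arrives one symbol at a time; after $T[i]$ arrives and before $T[i+1]$ arrives, the algorithm must output whether $P$ p-matches $T[(i-m+1)..i]$ (the injective map may differ for each $i$). The model of computation is the word RAM with word size $\Theta(\log n)$, where $n$ is the length of the text stream. *)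

theory Defs
  imports "HOL-Probability.Probability_Mass_Function"
begin

section \<open>Parameterized matching\<close>

definition p_match :: "'a set \<Rightarrow> 'a list \<Rightarrow> 'a list \<Rightarrow> bool" where
  "p_match A S S' \<longleftrightarrow> length S = length S' \<and>
     (\<exists>f. f ` A \<subseteq> A \<and> inj_on f A \<and> (\<forall>j<length S. S' ! j = f (S ! j)))"

text \<open>The part of \<open>T\<close> at positions \<open>i - m + 1, \<dots>, i\<close>; meaningful for \<open>m \<le> i + 1\<close>.\<close>

definition window :: "'a list \<Rightarrow> nat \<Rightarrow> nat \<Rightarrow> 'a list" where
  "window T m i = take m (drop (i + 1 - m) T)"

section \<open>A randomised word RAM\<close>

text \<open>
  Words are natural numbers below \<open>2 ^ w\<close>. The word size \<open>w\<close> is a parameter of the semantics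
  rather than a type because it varies with the input. The program is fixed code; the memory is
  a list of words whose length is the number of available cells. Cells outside the list
  do not exist: reading one yields 0 and writing one has no effect, so no information can be
  kept beyond the available space. There are no further registers.
\<close>

datatype binop = Add | Sub | Mul | Div | Mod | And | Or | Xor | Shl | Shr

fun eval_op :: "nat \<Rightarrow> binop \<Rightarrow> nat \<Rightarrow> nat \<Rightarrow> nat" where
  "eval_op w Add x y = (x + y) mod 2 ^ w"
| "eval_op w Sub x y = (x + 2 ^ w - y) mod 2 ^ w"
| "eval_op w Mul x y = (x * y) mod 2 ^ w"
| "eval_op w Div x y = x div y"
| "eval_op w Mod x y = x mod y"
| "eval_op w And x y = and x y"
| "eval_op w Or x y = or x y"
| "eval_op w Xor x y = xor x y"
| "eval_op w Shl x y = push_bit y x mod 2 ^ w"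
| "eval_op w Shr x y = drop_bit y x"

datatype instr =
    Const nat nat           \<comment> \<open>cell, immediate value\<close>
  | Arith binop nat nat nat \<comment> \<open>destination cell, operand cells\<close>
  | Load nat nat            \<comment> \<open>destination cell, cell holding the source address\<close>
  | Store nat nat           \<comment> \<open>cell holding the destination address, source cell\<close>
  | Rand nat                \<comment> \<open>destination cell of a fresh uniform random word\<close>
  | Jump nat
  | Jump_less nat nat nat   \<comment> \<open>compared cells, target\<close>

type_synonym prog = "instr list"
type_synonym memory = "nat list"
type_synonym config = "nat \<times> memory" \<comment> \<open>program counter and memory\<close>

definition rd :: "memory \<Rightarrow> nat \<Rightarrow> nat" where
  "rd M a = (if a < length M then M ! a else 0)"

fun exec :: "nat \<Rightarrow> instr \<Rightarrow> config \<Rightarrow> config pmf" where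
  "exec w (Const i k) (pc, M) = return_pmf (Suc pc, M[i := k mod 2 ^ w])"
| "exec w (Arith b i j k) (pc, M) = return_pmf (Suc pc, M[i := eval_op w b (rd M j) (rd M k)])"
| "exec w (Load i j) (pc, M) = return_pmf (Suc pc, M[i := rd M (rd M j)])"
| "exec w (Store i j) (pc, M) = return_pmf (Suc pc, M[rd M i := rd M j])"
| "exec w (Rand i) (pc, M) = map_pmf (\<lambda>r. (Suc pc, M[i := r])) (pmf_of_set {0..<2 ^ w})"
| "exec w (Jump l) (pc, M) = return_pmf (l, M)"
| "exec w (Jump_less i j l) (pc, M) = return_pmf (if rd M i < rd M j then l else Suc pc, M)"

definition halted :: "prog \<Rightarrow> config \<Rightarrow> bool" where
  "halted Q c \<longleftrightarrow> length Q \<le> fst c"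

definition step :: "nat \<Rightarrow> prog \<Rightarrow> config \<Rightarrow> config pmf" where
  "step w Q c = (if halted Q c then return_pmf c else exec w (Q ! fst c) c)"

text \<open>At most \<open>t\<close> instructions, each of unit cost.\<close>

primrec run :: "nat \<Rightarrow> prog \<Rightarrow> nat \<Rightarrow> config \<Rightarrow> config pmf" where
  "run w Q 0 c = return_pmf c"
| "run w Q (Suc t) c = bind_pmf (step w Q c) (run w Q t)"

section \<open>Streaming\<close>

text \<open>
  An arriving symbol is put into cell 0 and the program is started from its first instruction;
  everything it remembers from earlier symbols is in the memory. When it halts, cell 0 holds the
  answer, any nonzero word meaning yes. The answer is \<open>None\<close> if the program has not
  halted after \<open>t\<close> instructions.
\<close>

definition answer :: "prog \<Rightarrow> config \<Rightarrow> bool option" where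
  "answer Q c = (if halted Q c then Some (rd (snd c) 0 \<noteq> 0) else None)"

primrec stream :: "nat \<Rightarrow> prog \<Rightarrow> nat \<Rightarrow> nat list \<Rightarrow> memory \<Rightarrow> bool option list pmf" where
  "stream w Q t [] M = return_pmf []"
| "stream w Q t (x # T) M =
     bind_pmf (run w Q t (0, M[0 := x])) (\<lambda>c.
       map_pmf ((#) (answer Q c)) (stream w Q t T (snd c)))"

text \<open>
  The pattern is preprocessed by a program of its own, which has all \<open>2 ^ w\<close> addressable
  cells at its disposal and is given the text length, the pattern length, the alphabet size
  and the pattern.
\<close>

definition preproc_init :: "nat \<Rightarrow> nat \<Rightarrow> nat \<Rightarrow> nat list \<Rightarrow> config" where
  "preproc_init w n s P =
     (0, [n, length P, s] @ P @ replicate (2 ^ w - (3 + length P)) 0)"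

text \<open>
  Preprocess with \<open>R\<close> for (at most) \<open>N\<close> instructions, hand over only the first \<open>S\<close> memory
  cells, then stream the text \<open>T\<close> through \<open>Q\<close>, with at most \<open>t\<close> instructions per symbol.
\<close>

definition transcript ::
  "nat \<Rightarrow> prog \<Rightarrow> nat \<Rightarrow> prog \<Rightarrow> nat \<Rightarrow> nat \<Rightarrow> nat \<Rightarrow> nat list \<Rightarrow> nat list \<Rightarrow> bool option list pmf" where
  "transcript w R N Q t S s P T =
     bind_pmf (run w R N (preproc_init w (length T) s P)) (\<lambda>c. stream w Q t T (take S (snd c)))"

end

theory Submission
  imports Defs "HOL-Number_Theory.Cong"
begin

text \<open>
  Replace every symbol by the distance to its previous occurrence (\<open>0\<close> if there is none). A window
  p-matches the pattern iff its distances, set to \<open>0\<close> where they leave the window, are those of the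
  pattern. On a stretch of the pattern without zeros this truncation cannot matter, so there plain
  fingerprints of text prefixes decide whether an occurrence of a pattern prefix extends.

  The shortest prefix without a period of size \<open>O(|\<Sigma>| log m)\<close> is found directly: one keeps the
  leftmost start from which the text has the period of that prefix (less its last position) and a
  truncated sliding fingerprint of one period. From there a chain of \<open>h = O(|\<Sigma>| log m)\<close> levels
  leads to the pattern. A level extends the prefix by a run of its period, by a single zero, or by a
  zero-free stretch shorter than its period. By a Fine--Wilf argument the length covered in a zero-free
  stretch grows geometrically, and there are at most \<open>|\<Sigma>|\<close> zeros. Periods exceed \<open>2 h\<close> plus the
  extension, so each level has at most one pending occurrence even if only one level is visited per
  arriving symbol; the last \<open>2 h\<close> pattern symbols, which absorb the delay, are checked by another
  sliding fingerprint. The fingerprints are polynomial hashes at a random point modulo a prime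
  \<open>p > (2 n)\<^sup>A\<close>, and a union bound over all compared substrings bounds the failure probability.
\<close>

section \<open>Predecessor distances\<close>

text \<open>The obstacle is that truncation depends on where a window starts: the fingerprint of a
  window cannot be derived from those of two text prefixes, because each position whose previous
  occurrence lies outside must be set to 0. A nonzero pattern value removes the problem, since a
  truncated value that is nonzero equals the untruncated one; a single zero can be tested by looking
  at one text value. Elsewhere a window is maintained explicitly, which is affordable for short
  windows only: with each symbol at most one entry changes by truncation, and the time of this
  change is known as soon as the entry is read. Constant worst-case time excludes serving all levels
  for each symbol, which is why the work is spread over a sweep and why all conditions on periods
  carry an additive slack. Halting is proved apart from correctness, by the absence of backward
  jumps, as it must hold for unlucky random words too. Powers of 2 n rather than n keep the bounds
  effective for n = 1.\<close>

definition tr :: "nat \<Rightarrow> nat \<Rightarrow> nat" where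
  "tr k x = (if x \<le> k then x else 0)"

text \<open>The distance from position \<open>i\<close> to the previous occurrence of its symbol, \<open>0\<close> if there is none.\<close>

definition pd :: "'a list \<Rightarrow> nat \<Rightarrow> nat" where
  "pd T i = (if \<exists>d. 1 \<le> d \<and> d \<le> i \<and> T ! (i - d) = T ! i
     then LEAST d. 1 \<le> d \<and> d \<le> i \<and> T ! (i - d) = T ! i else 0)"

lemma tr_0 [simp]: "tr k 0 = 0"
  by (simp add: tr_def)

lemma tr_tr [simp]: "tr k (tr l x) = tr (min k l) x"
  by (auto simp: tr_def)

lemma pd_cases:
  obtains "pd T i = 0" "\<And>d. 1 \<le> d \<Longrightarrow> d \<le> i \<Longrightarrow> T ! (i - d) \<noteq> T ! i"
  | "1 \<le> pd T i" "pd T i \<le> i" "T ! (i - pd T i) = T ! i"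
    "\<And>d. 1 \<le> d \<Longrightarrow> d < pd T i \<Longrightarrow> T ! (i - d) \<noteq> T ! i"
proof (cases "\<exists>d. 1 \<le> d \<and> d \<le> i \<and> T ! (i - d) = T ! i")
  case True
  let ?P = "\<lambda>d. 1 \<le> d \<and> d \<le> i \<and> T ! (i - d) = T ! i"
  have e: "pd T i = (LEAST d. ?P d)" using True by (simp add: pd_def)
  have P: "?P (pd T i)" unfolding e using True by (rule LeastI_ex)
  have "T ! (i - d) \<noteq> T ! i" if "1 \<le> d" "d < pd T i" for d
    using not_less_Least[of d ?P] that P unfolding e by auto
  then show thesis using that(2) P by blast
next
  case False
  then have "pd T i = 0" unfolding pd_def by (rule if_not_P)
  then show thesis using that(1) False by blast
qed

lemma pd_le: "pd T i \<le> i"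
  by (cases rule: pd_cases[of T i]) auto

lemma pd_eqI:
  assumes "1 \<le> d" "d \<le> i" "T ! (i - d) = T ! i" "\<And>d'. 1 \<le> d' \<Longrightarrow> d' < d \<Longrightarrow> T ! (i - d') \<noteq> T ! i"
  shows "pd T i = d"
proof (cases rule: pd_cases[of T i])
  case 1
  then show ?thesis using assms by blast
next
  case 2
  then show ?thesis using assms by (metis linorder_neqE_nat)
qed

lemma pd_0I: "(\<And>d. 1 \<le> d \<Longrightarrow> d \<le> i \<Longrightarrow> T ! (i - d) \<noteq> T ! i) \<Longrightarrow> pd T i = 0"
  by (cases rule: pd_cases[of T i]) auto

text \<open>The nearest earlier occurrence either lies in the window, and then it is the nearest one
  there as well, or it lies before the window, and then there is none inside.\<close>

lemma pd_drop_take: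
  assumes "j < l" "x + l \<le> length T"
  shows "pd (take l (drop x T)) j = tr j (pd T (x + j))"
proof -
  have n: "take l (drop x T) ! (j - d) = T ! (x + j - d)" if "d \<le> j" for d
    using assms that by simp
  have n0: "take l (drop x T) ! j = T ! (x + j)" using assms by simp
  show ?thesis
  proof (cases "1 \<le> pd T (x + j) \<and> pd T (x + j) \<le> j")
    case True
    have "pd (take l (drop x T)) j = pd T (x + j)"
      by (cases rule: pd_cases[of T "x + j"]) (use True n n0 in \<open>auto intro!: pd_eqI\<close>)
    then show ?thesis using True by (simp add: tr_def)
  next
    case False
    have "pd (take l (drop x T)) j = 0"
    proof (rule pd_0I)
      fix d assume d: "1 \<le> d" "d \<le> j"
      have "T ! (x + j - d) \<noteq> T ! (x + j)"
        by (cases rule: pd_cases[of T "x + j"]) (use False d in auto)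
      then show "take l (drop x T) ! (j - d) \<noteq> take l (drop x T) ! j" using n n0 d by simp
    qed
    then show ?thesis using False by (auto simp: tr_def)
  qed
qed

section \<open>Equality patterns of strings and parameterized matching\<close>

lemma pd_eq_iff_same_pattern:
  assumes "\<forall>j<m. pd P j = pd W j"
  shows "i \<le> j \<Longrightarrow> j < m \<Longrightarrow> P ! i = P ! j \<longleftrightarrow> W ! i = W ! j"
proof (induction j arbitrary: i rule: less_induct)
  case (less j)
  show ?case
  proof (cases "i = j")
    case False
    then have ij: "i < j" using less by simp
    \<comment> \<open>If \<open>d\<close> is 0 or reaches further back than \<open>i\<close>, the
      symbols at \<open>i\<close> and \<open>j\<close> differ in both strings. Otherwise both
      strings repeat at \<open>j - d\<close> the symbol of \<open>j\<close>, and the smaller pair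
      \<open>i\<close>, \<open>j - d\<close> decides.\<close>
    define d where "d = pd P j"
    have dW: "pd W j = d" using assms less d_def by auto
    have d1: "1 \<le> j - i" "j - i \<le> j" "j - (j - i) = i" using ij by auto
    show ?thesis
    proof (cases "d = 0 \<or> j - i < d")
      case True
      have "P ! i \<noteq> P ! j" by (cases rule: pd_cases[of P j]) (use True d1 d_def ij in force)+
      moreover have "W ! i \<noteq> W ! j" by (cases rule: pd_cases[of W j]) (use True d1 dW ij in force)+
      ultimately show ?thesis by blast
    next
      case False
      then have "P ! (j - d) = P ! j" by (cases rule: pd_cases[of P j]) (auto simp: d_def)
      moreover have "W ! (j - d) = W ! j" using False dW by (cases rule: pd_cases[of W j]) auto
      moreover have "P ! i = P ! (j - d) \<longleftrightarrow> W ! i = W ! (j - d)"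
        using less.IH[of "j - d" i] False ij less.prems by auto
      ultimately show ?thesis by simp
    qed
  qed simp
qed

lemma pd_cong_pattern:
  assumes "\<And>i. i \<le> j \<Longrightarrow> P ! i = P ! j \<longleftrightarrow> W ! i = W ! j"
  shows "pd P j = pd W j"
  unfolding pd_def using assms by (intro if_cong arg_cong[where f = Least]) (auto simp: fun_eq_iff)

text \<open>\<open>p_match\<close> asks for an injection of the whole alphabet into itself, while
  two strings determine it only on the symbols occurring in the pattern. In a finite alphabet
  equally many symbols remain on both sides, and any bijection between them completes the
  map.\<close>

lemma inj_extend:
  assumes "finite A" "B \<subseteq> A" "inj_on g B" "g ` B \<subseteq> A"
  obtains f where "inj_on f A" "f ` A \<subseteq> A" "\<And>x. x \<in> B \<Longrightarrow> f x = g x"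
proof -
  have fB: "finite B" "finite (g ` B)" using assms finite_subset by auto
  have "card (A - B) = card (A - g ` B)"
    using assms fB by (simp add: card_Diff_subset card_image)
  then obtain h where h: "bij_betw h (A - B) (A - g ` B)"
    using finite_same_card_bij[of "A - B" "A - g ` B"] assms by auto
  let ?f = "\<lambda>x. if x \<in> B then g x else h x"
  have "inj_on ?f A"
  proof (rule inj_onI)
    fix x y assume xy: "x \<in> A" "y \<in> A" "?f x = ?f y"
    have hi: "h z \<in> A - g ` B" if "z \<in> A" "z \<notin> B" for z using h that by (auto simp: bij_betw_def)
    have "h x = h y \<Longrightarrow> x \<notin> B \<Longrightarrow> y \<notin> B \<Longrightarrow> x = y"
      using h xy(1,2) by (auto simp: bij_betw_def dest: inj_onD)
    moreover have "g u \<noteq> h v" if "u \<in> B" "v \<in> A" "v \<notin> B" for u v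
      using hi[of v] that by (metis DiffE imageI)
    moreover have "g x = g y \<Longrightarrow> x \<in> B \<Longrightarrow> y \<in> B \<Longrightarrow> x = y" using assms(3) by (rule inj_onD)
    ultimately show "x = y" using xy by (cases "x \<in> B"; cases "y \<in> B") (simp_all, metis)
  qed
  moreover have "?f ` A \<subseteq> A" using h assms by (auto simp: bij_betw_def)
  ultimately show thesis using that[of ?f] by auto
qed

lemma p_match_iff_pd:
  assumes "finite A" "set P \<subseteq> A" "set W \<subseteq> A" "length P = m" "length W = m"
  shows "p_match A P W \<longleftrightarrow> (\<forall>j<m. pd W j = pd P j)"
proof
  assume "p_match A P W"
  then obtain f where f: "inj_on f A" "\<forall>j<m. W ! j = f (P ! j)" using assms by (auto simp: p_match_def)
  show "\<forall>j<m. pd W j = pd P j"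
  proof (intro allI impI pd_cong_pattern)
    fix j i assume ij: "j < m" "i \<le> j"
    then have "P ! i \<in> A" "P ! j \<in> A" using assms by auto
    then have "(f (P ! i) = f (P ! j)) = (P ! i = P ! j)" by (rule inj_on_eq_iff[OF f(1)])
    moreover have "W ! i = f (P ! i)" "W ! j = f (P ! j)" using f(2) ij by auto
    ultimately show "(W ! i = W ! j) = (P ! i = P ! j)" by (simp only:)
  qed
next
  assume "\<forall>j<m. pd W j = pd P j"
  then have e: "P ! i = P ! j \<longleftrightarrow> W ! i = W ! j" if "i < m" "j < m" for i j
    using pd_eq_iff_same_pattern[of m P W i j] pd_eq_iff_same_pattern[of m P W j i] that by (metis nat_le_linear)
  \<comment> \<open>The image is read off at the first occurrence; by \<open>e\<close> every other
    occurrence gives the same symbol.\<close>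
  define g where "g x = W ! (LEAST i. i < m \<and> P ! i = x)" for x
  have g: "g (P ! j) = W ! j" if "j < m" for j
  proof -
    have "(LEAST i. i < m \<and> P ! i = P ! j) < m \<and> P ! (LEAST i. i < m \<and> P ! i = P ! j) = P ! j"
      by (rule LeastI[of _ j]) (use that in simp)
    then have "W ! (LEAST i. i < m \<and> P ! i = P ! j) = W ! j" using e[OF _ that] by blast
    then show ?thesis by (simp add: g_def)
  qed
  have "inj_on g (set P)"
  proof (rule inj_onI)
    fix x y assume "x \<in> set P" "y \<in> set P" and xy: "g x = g y"
    then obtain i j where "i < m" "x = P ! i" "j < m" "y = P ! j"
      using assms(4) by (metis in_set_conv_nth)
    then show "x = y" using e[of i j] g xy by simp
  qed
  moreover have "g ` set P \<subseteq> A" using g assms by (force simp: in_set_conv_nth)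
  ultimately obtain f where "inj_on f A" "f ` A \<subseteq> A" "\<And>x. x \<in> set P \<Longrightarrow> f x = g x"
    using inj_extend[of A "set P" g] assms by metis
  then show "p_match A P W" using g assms unfolding p_match_def by (metis nth_mem)
qed

text \<open>A zero marks the first occurrence of a symbol, so positions with a zero carry pairwise
  different symbols. This limits the number of zero steps among the levels.\<close>

lemma card_pd_zeros: "card {j. j < length P \<and> pd P j = 0} \<le> card (set P)"
proof (rule card_inj_on_le[where f = "\<lambda>j. P ! j"])
  have *: "P ! i \<noteq> P ! j" if "i < j" "pd P j = 0" for i j
  proof (cases rule: pd_cases[of P j])
    case 1
    show ?thesis using 1(2)[of "j - i"] that by simp
  qed (use that in auto)
  show "inj_on (\<lambda>j. P ! j) {j. j < length P \<and> pd P j = 0}"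
  proof (rule inj_onI)
    fix i j assume "i \<in> {j. j < length P \<and> pd P j = 0}" "j \<in> {j. j < length P \<and> pd P j = 0}" "P ! i = P ! j"
    then show "i = j" using *[of i j] *[of j i] by (cases i j rule: linorder_cases) auto
  qed
qed auto

section \<open>Matching prefixes\<close>

text \<open>What two occurrences at distance \<open>q\<close> force on their overlap. Distances that
  lead before the start of the later occurrence read as 0 there, hence the truncation on one side
  only.\<close>

definition perd :: "(nat \<Rightarrow> nat) \<Rightarrow> nat \<Rightarrow> nat \<Rightarrow> bool" where
  "perd \<pi> l q \<longleftrightarrow> (\<forall>j<l - q. \<pi> j = tr j (\<pi> (j + q)))"

text \<open>An occurrence of the prefix of length \<open>l\<close> ends just before position \<open>x\<close>.\<close>

definition em :: "(nat \<Rightarrow> nat) \<Rightarrow> (nat \<Rightarrow> nat) \<Rightarrow> nat \<Rightarrow> nat \<Rightarrow> bool" where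
  "em \<pi> \<tau> l x \<longleftrightarrow> l \<le> x \<and> (\<forall>j<l. tr j (\<tau> (x - l + j)) = \<pi> j)"

definition nz :: "(nat \<Rightarrow> nat) \<Rightarrow> nat \<Rightarrow> nat \<Rightarrow> bool" where
  "nz \<pi> a b \<longleftrightarrow> (\<forall>j. a \<le> j \<and> j < b \<longrightarrow> \<pi> j \<noteq> 0)"

lemma perd_mono: "perd \<pi> l q \<Longrightarrow> l' \<le> l \<Longrightarrow> perd \<pi> l' q"
  unfolding perd_def by (meson diff_le_mono less_le_trans)

text \<open>Truncating at \<open>j + q\<close> and then at \<open>j\<close> is truncating at
  \<open>j\<close>, so the one-sided truncation does not spoil the additivity of periods.\<close>

lemma perd_add:
  assumes "perd \<pi> l q" "perd \<pi> l q'"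
  shows "perd \<pi> l (q + q')"
  unfolding perd_def
proof (intro allI impI)
  fix j assume j: "j < l - (q + q')"
  have "\<pi> j = tr j (\<pi> (j + q))" using assms(1) j by (simp add: perd_def)
  also have "\<pi> (j + q) = tr (j + q) (\<pi> (j + q + q'))" using assms(2) j by (simp add: perd_def)
  finally show "\<pi> j = tr j (\<pi> (j + (q + q')))" by (simp add: ac_simps)
qed

lemma em_spacing:
  assumes "em \<pi> \<tau> l x" "em \<pi> \<tau> l (x + q)"
  shows "perd \<pi> l q"
  unfolding perd_def
proof (intro allI impI)
  fix j assume j: "j < l - q"
  have l: "l \<le> x" using assms(1) by (simp add: em_def)
  have "\<pi> j = tr j (\<tau> (x + q - l + j))" using assms(2) j unfolding em_def by (metis add_lessD1 less_diff_conv)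
  also have "x + q - l + j = x - l + (j + q)" using l by simp
  also have "tr j (\<tau> (x - l + (j + q))) = tr j (tr (j + q) (\<tau> (x - l + (j + q))))" by (simp add: min_def)
  also have "tr (j + q) (\<tau> (x - l + (j + q))) = \<pi> (j + q)"
    using assms(1) j unfolding em_def by (metis add.commute less_diff_conv)
  finally show "\<pi> j = tr j (\<pi> (j + q))" .
qed

section \<open>Extending an occurrence\<close>

lemma em_append:
  assumes "l \<le> l'"
  shows "em \<pi> \<tau> l' y \<longleftrightarrow> l' \<le> y \<and> em \<pi> \<tau> l (y - (l' - l)) \<and>
    (\<forall>j<l' - l. tr (l + j) (\<tau> (y - (l' - l) + j)) = \<pi> (l + j))"
    (is "?L \<longleftrightarrow> l' \<le> y \<and> ?A \<and> ?B")
proof (cases "l' \<le> y")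
  case True
  have e: "y - (l' - l) - l = y - l'" using assms True by simp
  have "?L \<longleftrightarrow> (\<forall>j<l. tr j (\<tau> (y - l' + j)) = \<pi> j) \<and> (\<forall>j. l \<le> j \<and> j < l' \<longrightarrow> tr j (\<tau> (y - l' + j)) = \<pi> j)"
    using True assms unfolding em_def by (metis less_le_trans not_le)
  also have "(\<forall>j<l. tr j (\<tau> (y - l' + j)) = \<pi> j) \<longleftrightarrow> ?A"
    using True assms unfolding em_def e by auto
  also have "(\<forall>j. l \<le> j \<and> j < l' \<longrightarrow> tr j (\<tau> (y - l' + j)) = \<pi> j) \<longleftrightarrow> ?B"
  proof -
    have "(\<forall>j. l \<le> j \<and> j < l' \<longrightarrow> Q j) \<longleftrightarrow> (\<forall>j<l' - l. Q (l + j))" for Q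
      by (metis add.commute le_add1 le_add_diff_inverse less_diff_conv)
    moreover have "y - (l' - l) + j = y - l' + (l + j)" for j using True assms by simp
    ultimately show ?thesis by presburger
  qed
  finally show ?thesis using True by simp
qed (simp add: em_def)

lemma em_zero:
  assumes "\<pi> l = 0" "0 < y"
  shows "em \<pi> \<tau> (Suc l) y \<longleftrightarrow> em \<pi> \<tau> l (y - 1) \<and> tr l (\<tau> (y - 1)) = 0"
  using em_append[of l "Suc l" \<pi> \<tau> y] assms by (auto simp: em_def)

lemma tr_eq_nonzero: "b \<noteq> 0 \<Longrightarrow> b \<le> k \<Longrightarrow> tr k x = b \<longleftrightarrow> x = b"
  by (auto simp: tr_def)

text \<open>A nonzero value that survives truncation equals the value before truncation. So
  untruncated text distances can be compared wherever the window starts, which is what makes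
  fingerprints of text prefixes applicable.\<close>

lemma em_nonzero:
  assumes "l \<le> l'" "nz \<pi> l l'" "\<And>j. \<pi> j \<le> j"
  shows "em \<pi> \<tau> l' y \<longleftrightarrow> l' \<le> y \<and> em \<pi> \<tau> l (y - (l' - l)) \<and>
    (\<forall>j<l' - l. \<tau> (y - (l' - l) + j) = \<pi> (l + j))"
proof -
  have "tr (l + j) (\<tau> (y - (l' - l) + j)) = \<pi> (l + j) \<longleftrightarrow> \<tau> (y - (l' - l) + j) = \<pi> (l + j)"
    if "j < l' - l" for j
    using tr_eq_nonzero[of "\<pi> (l + j)" "l + j"] assms that by (auto simp: nz_def)
  then show ?thesis unfolding em_append[OF assms(1)] by auto
qed

section \<open>Multiples of a period and the least period\<close>

lemma perd_mult:
  assumes "perd \<pi> l q" "\<And>j. \<pi> j \<le> j"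
  shows "perd \<pi> l (k * q)"
proof (induction k)
  case 0
  show ?case using assms(2) by (simp add: perd_def tr_def)
next
  case (Suc k)
  then show ?case using perd_add[OF assms(1) Suc.IH] by simp
qed

lemma perd_self: "l \<le> q \<Longrightarrow> perd \<pi> l q"
  by (simp add: perd_def)

definition per :: "(nat \<Rightarrow> nat) \<Rightarrow> nat \<Rightarrow> nat" where
  "per \<pi> l = (LEAST q. 1 \<le> q \<and> perd \<pi> l q)"

lemma per_ex: "1 \<le> Suc l \<and> perd \<pi> l (Suc l)"
  by (simp add: perd_self)

lemma per: "1 \<le> per \<pi> l" "perd \<pi> l (per \<pi> l)"
  unfolding per_def using LeastI[of "\<lambda>q. 1 \<le> q \<and> perd \<pi> l q", OF per_ex] by auto

lemma per_le: "1 \<le> q \<Longrightarrow> perd \<pi> l q \<Longrightarrow> per \<pi> l \<le> q"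
  unfolding per_def by (rule Least_le) simp

lemma per_le_length: "1 \<le> l \<Longrightarrow> per \<pi> l \<le> l"
  by (simp add: per_le perd_self)

lemma per_mono: "l \<le> l' \<Longrightarrow> per \<pi> l \<le> per \<pi> l'"
  using per per_le perd_mono by metis

lemma em_gap:
  assumes "em \<pi> \<tau> l x" "em \<pi> \<tau> l y" "x < y"
  shows "x + per \<pi> l \<le> y"
proof -
  have "perd \<pi> l (y - x)" using em_spacing[of \<pi> \<tau> l x "y - x"] assms by simp
  then have "per \<pi> l \<le> y - x" using assms(3) by (intro per_le) auto
  then show ?thesis using assms(3) by linarith
qed

lemma perd_shift:
  assumes "perd \<pi> l q" "\<pi> j \<noteq> 0" "j + q < l"
  shows "\<pi> (j + q) = \<pi> j"
  using assms by (auto simp: perd_def less_diff_conv tr_def split: if_splits)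

lemma perd_shift_mult:
  assumes "perd \<pi> l q" "\<And>j. \<pi> j \<le> j" "\<pi> j \<noteq> 0" "j + k * q < l"
  shows "\<pi> (j + k * q) = \<pi> j"
  using perd_shift[OF perd_mult[OF assms(1,2)] assms(3,4)] .

text \<open>A run of \<open>t + 1\<close> occurrences at distance \<open>q\<close> is one occurrence of a prefix longer by \<open>t q\<close>:
  past its first \<open>l\<close> positions that prefix repeats the predecessor distances of its last period.\<close>

lemma em_run:
  assumes le: "\<And>j. \<pi> j \<le> j" and q: "1 \<le> q" "q \<le> l" and p: "perd \<pi> (l + t * q) q"
    and nz: "nz \<pi> (l - q) l"
  shows "em \<pi> \<tau> (l + t * q) y \<longleftrightarrow> (\<forall>k\<le>t. k * q \<le> y \<and> em \<pi> \<tau> l (y - k * q))"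
proof
  assume L: "em \<pi> \<tau> (l + t * q) y"
  show "\<forall>k\<le>t. k * q \<le> y \<and> em \<pi> \<tau> l (y - k * q)"
  proof (intro allI impI)
    fix k assume k: "k \<le> t"
    \<comment> \<open>The occurrence that ends \<open>k * q\<close> before \<open>y\<close> starts
      \<open>i\<close> positions into the long one, and \<open>i\<close> is a multiple of the
      period.\<close>
    define i where "i = (t - k) * q"
    have i: "t * q = k * q + i" using k by (simp add: i_def flip: distrib_right)
    have y: "l + t * q \<le> y" using L by (simp add: em_def)
    have pi: "perd \<pi> (l + t * q) i" unfolding i_def by (rule perd_mult[OF p le])
    have "tr j (\<tau> (y - k * q - l + j)) = \<pi> j" if j: "j < l" for j
    proof -
      have "\<pi> j = tr j (\<pi> (j + i))" using pi j i by (simp add: perd_def)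
      also have "\<pi> (j + i) = tr (j + i) (\<tau> (y - (l + t * q) + (j + i)))"
        using L[unfolded em_def, THEN conjunct2, rule_format, of "j + i"] j i by simp
      also have "y - (l + t * q) + (j + i) = y - k * q - l + j" using y i by simp
      finally show ?thesis by (simp add: min_def)
    qed
    then show "k * q \<le> y \<and> em \<pi> \<tau> l (y - k * q)" using y i by (simp add: em_def)
  qed
next
  assume R: "\<forall>k\<le>t. k * q \<le> y \<and> em \<pi> \<tau> l (y - k * q)"
  then have y: "l + t * q \<le> y" by (force simp: em_def)
  have "tr j (\<tau> (y - (l + t * q) + j)) = \<pi> j" if j: "j < l + t * q" for j
  proof -
    text \<open>The occurrence with index \<open>i\<close> counted from the left covers position \<open>j\<close>, in its last
      period unless \<open>i = 0\<close>.\<close>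
    define i where "i = (if j < l then 0 else (j - (l - q)) div q)"
    have i: "i * q \<le> j" "j - i * q < l" "i \<le> t" "i = 0 \<or> l - q \<le> j - i * q"
    proof -
      define c where "c = (j - (l - q)) div q * q"
      have *: "c \<le> j - (l - q)" by (simp add: c_def)
      have **: "j - (l - q) < c + q"
        using q dividend_less_div_times[of q "j - (l - q)"] by (simp add: c_def)
      have ic: "i * q = (if j < l then 0 else c)" by (simp add: i_def c_def)
      have i0: "j < l \<Longrightarrow> i = 0" by (simp add: i_def)
      show "i * q \<le> j" "i = 0 \<or> l - q \<le> j - i * q" "j - i * q < l"
        unfolding ic using * ** q i0 by (cases "j < l"; simp; linarith)+
      have "j - (l - q) < (t + 1) * q" using j q by auto
      then have "(j - (l - q)) div q < t + 1" by (rule less_mult_imp_div_less)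
      then show "i \<le> t" by (simp add: i_def)
    qed
    define k where "k = t - i"
    have k: "k \<le> t" "t * q = k * q + i * q" using i by (auto simp: k_def simp flip: distrib_right)
    have "em \<pi> \<tau> l (y - k * q)" using R k by blast
    then have "tr (j - i * q) (\<tau> (y - k * q - l + (j - i * q))) = \<pi> (j - i * q)"
      using i(2) unfolding em_def by blast
    moreover have "y - k * q - l + (j - i * q) = y - (l + t * q) + j" using y k i by simp
    ultimately have e: "tr (j - i * q) (\<tau> (y - (l + t * q) + j)) = \<pi> (j - i * q)" by simp
    show ?thesis
    proof (cases "i = 0")
      case False
      \<comment> \<open>Here \<open>j\<close> falls into the last period of the covering occurrence,
        where the pattern has no zeros. Truncation is invisible there, and pattern and text values
        carry over exactly.\<close>
      then have n: "\<pi> (j - i * q) \<noteq> 0" using i nz by (auto simp: nz_def)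
      have "\<pi> j = \<pi> (j - i * q)"
        using perd_shift_mult[OF p le n, of i] i j by simp
      moreover have "\<tau> (y - (l + t * q) + j) = \<pi> (j - i * q)"
        using e n tr_eq_nonzero le by blast
      moreover have "\<pi> (j - i * q) \<le> j" using le[of "j - i * q"] by simp
      ultimately show ?thesis by (simp add: tr_def)
    qed (use e in simp)
  qed
  then show "em \<pi> \<tau> (l + t * q) y" using y by (simp add: em_def)
qed

subsection \<open>Runs\<close>

text \<open>Periodicity of the text from \<open>a\<close> to \<open>e\<close> as seen by a window
  that starts at \<open>a\<close>: both values are truncated at the offset of the earlier position.
  A later start truncates more, so validity is inherited by later starts.\<close>

definition runok :: "(nat \<Rightarrow> nat) \<Rightarrow> nat \<Rightarrow> nat \<Rightarrow> nat \<Rightarrow> bool" where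
  "runok \<tau> q a e \<longleftrightarrow> (\<forall>x. a + q \<le> x \<and> x < e \<longrightarrow> tr (x - q - a) (\<tau> (x - q)) = tr (x - q - a) (\<tau> x))"

lemma runok_Suc:
  "runok \<tau> q a (Suc e) \<longleftrightarrow> runok \<tau> q a e \<and>
     (a + q \<le> e \<longrightarrow> tr (e - q - a) (\<tau> (e - q)) = tr (e - q - a) (\<tau> e))"
  unfolding runok_def by (auto simp: less_Suc_eq)

text \<open>A string with the same period as the pattern prefix is determined by its last period.\<close>

lemma em_base:
  assumes p: "perd \<pi> (l - 1) q" and q: "1 \<le> q" and l: "1 \<le> l"
  defines "r \<equiv> min (q + 1) l"
  shows "em \<pi> \<tau> l e \<longleftrightarrow> l \<le> e \<and> runok \<tau> q (e - l) (e - 1) \<and>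
    (\<forall>j<r. tr (l - r + j) (\<tau> (e - r + j)) = \<pi> (l - r + j))"
    (is "?L \<longleftrightarrow> l \<le> e \<and> ?A \<and> ?B")
proof (cases "l \<le> e")
  case le: True
  \<comment> \<open>The period is assumed only for the prefix without its last position, so one
    position more than a period is compared directly.\<close>
  have rl: "r \<le> l" by (simp add: r_def)
  have B: "?B \<longleftrightarrow> (\<forall>j. l - r \<le> j \<and> j < l \<longrightarrow> tr j (\<tau> (e - l + j)) = \<pi> j)"
  proof -
    have A1: "(\<forall>j<r. Q (l - r + j)) \<longleftrightarrow> (\<forall>j. l - r \<le> j \<and> j < l \<longrightarrow> Q j)" for Q
    proof safe
      fix j assume "\<forall>j<r. Q (l - r + j)" "l - r \<le> j" "j < l"
      then show "Q j" using rl by (auto dest: spec[of _ "j - (l - r)"])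
    next
      fix j assume "\<forall>j. l - r \<le> j \<and> j < l \<longrightarrow> Q j" "j < r"
      moreover have "l - r \<le> l - r + j" "j < r \<Longrightarrow> l - r + j < l" using rl by auto
      ultimately show "Q (l - r + j)" by blast
    qed
    have A2: "e - r + j = e - l + (l - r + j)" for j using le rl by simp
    show ?thesis unfolding A2 by (rule A1)
  qed
  show ?thesis
  proof
    assume L: ?L
    have m: "tr j (\<tau> (e - l + j)) = \<pi> j" if "j < l" for j using L that unfolding em_def by blast
    have ?A unfolding runok_def
    proof (intro allI impI, elim conjE)
      fix x assume x: "e - l + q \<le> x" "x < e - 1"
      define j where "j = x - q - (e - l)"
      have j: "j + q < l - 1" "x - q = e - l + j" "x = e - l + (j + q)" using x le by (auto simp: j_def)
      have "tr j (\<tau> (e - l + j)) = \<pi> j" using m j by simp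
      also have "\<dots> = tr j (\<pi> (j + q))" using p j by (simp add: perd_def)
      also have "\<pi> (j + q) = tr (j + q) (\<tau> (e - l + (j + q)))" using m[of "j + q"] j by simp
      finally have "tr j (\<tau> (e - l + j)) = tr j (\<tau> (e - l + (j + q)))" by (simp add: min_def)
      then show "tr (x - q - (e - l)) (\<tau> (x - q)) = tr (x - q - (e - l)) (\<tau> x)"
        using j by (simp add: j_def[symmetric])
    qed
    then show "l \<le> e \<and> ?A \<and> ?B" using B m le by simp
  next
    assume R: "l \<le> e \<and> ?A \<and> ?B"
    have "tr j (\<tau> (e - l + j)) = \<pi> j" if "j < l" for j
      using that
    \<comment> \<open>Backwards from the end: outside the last \<open>r\<close> positions the value
      at \<open>j\<close> is inherited from \<open>j + q\<close>, on the pattern side by its period,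
      on the text side by the run.\<close>
    proof (induction "l - j" arbitrary: j rule: less_induct)
      case less
      show ?case
      proof (cases "l - r \<le> j")
        case True
        then show ?thesis using R B less by blast
      next
        case False
        then have j: "j + q < l - 1" by (auto simp: r_def split: if_splits)
        have "tr (j + q) (\<tau> (e - l + (j + q))) = \<pi> (j + q)" using less(1)[of "j + q"] j q by simp
        then have "tr j (\<tau> (e - l + (j + q))) = tr j (\<pi> (j + q))"
          by (metis le_add1 min.absorb1 tr_tr)
        also have "\<dots> = \<pi> j" using p j by (simp add: perd_def)
        finally have "tr j (\<tau> (e - l + (j + q))) = \<pi> j" .
        moreover have "tr j (\<tau> (e - l + j)) = tr j (\<tau> (e - l + (j + q)))"
        proof -
          have x: "e - l + q \<le> e - l + (j + q)" "e - l + (j + q) < e - 1"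
            "e - l + (j + q) - q - (e - l) = j" "e - l + (j + q) - q = e - l + j" using j le by auto
          then show ?thesis using R unfolding runok_def by metis
        qed
        ultimately show ?thesis by simp
      qed
    qed
    then show ?L using le by (simp add: em_def)
  qed
qed (simp add: em_def)

section \<open>The level decomposition of the pattern\<close>

text \<open>The last period before \<open>L\<close> has to be free of zeros too: this is the
  condition under which \<open>em_run\<close> turns a chain of occurrences into one longer
  occurrence.\<close>

definition runs :: "(nat \<Rightarrow> nat) \<Rightarrow> nat \<Rightarrow> nat \<Rightarrow> nat \<Rightarrow> nat \<Rightarrow> bool" where
  "runs \<pi> E L q t \<longleftrightarrow> perd \<pi> (L + t * q) q \<and> L + t * q \<le> E \<and> nz \<pi> (L - q) (L + t * q)"

text \<open>The maximal number of further periods. The alternative \<open>t \<ge> E\<close> makes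
  this a bounded search, the form in which the preprocessing computes it.\<close>

definition nt :: "(nat \<Rightarrow> nat) \<Rightarrow> nat \<Rightarrow> nat \<Rightarrow> nat" where
  "nt \<pi> E L = (LEAST t. t \<ge> E \<or> \<not> runs \<pi> E L (per \<pi> L) (Suc t))"

text \<open>Where a fingerprinted extension stops: at the next zero, at \<open>E\<close>, or as soon
  as it is within \<open>sl\<close> of a whole period. The slack keeps extension plus delay within
  the period, so that an occurrence is settled before the next one needs its place.\<close>

definition hs :: "(nat \<Rightarrow> nat) \<Rightarrow> nat \<Rightarrow> nat \<Rightarrow> nat \<Rightarrow> nat" where
  "hs \<pi> E sl L = (LEAST l. l \<ge> E \<or> L < l \<and> (\<pi> l = 0 \<or> L + per \<pi> L \<le> l + sl))"

definition nxt :: "(nat \<Rightarrow> nat) \<Rightarrow> nat \<Rightarrow> nat \<Rightarrow> nat \<Rightarrow> nat" where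
  "nxt \<pi> E sl L = (if E \<le> L then L else if \<pi> L = 0 then Suc L
     else if nt \<pi> E L > 0 then L + nt \<pi> E L * per \<pi> L else hs \<pi> E sl L)"

lemma nz_mono: "nz \<pi> a b \<Longrightarrow> a \<le> a' \<Longrightarrow> b' \<le> b \<Longrightarrow> nz \<pi> a' b'"
  by (auto simp: nz_def)

lemma nz_join: "nz \<pi> a b \<Longrightarrow> nz \<pi> b' c \<Longrightarrow> b' \<le> b \<Longrightarrow> nz \<pi> a c"
  by (auto simp: nz_def) (metis le_trans nat_le_linear not_le)

lemma runs_mono:
  assumes "runs \<pi> E L q t" "t' \<le> t"
  shows "runs \<pi> E L q t'"
proof -
  have "L + t' * q \<le> L + t * q" using assms by simp
  then show ?thesis using assms perd_mono[of \<pi> "L + t * q" q "L + t' * q"] nz_mono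
    unfolding runs_def by (meson le_refl le_trans)
qed

text \<open>A period is at least 1, so a run as long as the search bound would end beyond
  \<open>E\<close>. The bounded search therefore yields the true maximum.\<close>

lemma nt_max: "\<not> runs \<pi> E L (per \<pi> L) (Suc (nt \<pi> E L))"
proof -
  let ?P = "\<lambda>t. t \<ge> E \<or> \<not> runs \<pi> E L (per \<pi> L) (Suc t)"
  have "?P (nt \<pi> E L)" unfolding nt_def by (rule LeastI[of ?P E]) simp
  moreover have "\<not> runs \<pi> E L (per \<pi> L) (Suc t)" if "t \<ge> E" for t
  proof -
    have "Suc t \<le> Suc t * per \<pi> L" using per(1)[of \<pi> L] by (metis mult_le_mono2 nat_mult_1_right)
    then show ?thesis using that unfolding runs_def by linarith
  qed
  ultimately show ?thesis by blast
qed

lemma nt_runs: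
  assumes "nt \<pi> E L > 0"
  shows "runs \<pi> E L (per \<pi> L) (nt \<pi> E L)"
proof -
  obtain t where t: "nt \<pi> E L = Suc t" using assms by (cases "nt \<pi> E L") auto
  have "\<not> (t \<ge> E \<or> \<not> runs \<pi> E L (per \<pi> L) (Suc t))"
    using not_less_Least[of t "\<lambda>t. t \<ge> E \<or> \<not> runs \<pi> E L (per \<pi> L) (Suc t)"] t
    unfolding nt_def by linarith
  then show ?thesis using t by simp
qed

lemma hs_props:
  assumes "L < E" "sl < per \<pi> L" "\<pi> L \<noteq> 0"
  shows "L < hs \<pi> E sl L" "hs \<pi> E sl L \<le> E" "nz \<pi> L (hs \<pi> E sl L)"
    "hs \<pi> E sl L + sl \<le> L + per \<pi> L \<or> hs \<pi> E sl L = Suc L"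
    "hs \<pi> E sl L < E \<Longrightarrow> \<pi> (hs \<pi> E sl L) \<noteq> 0 \<Longrightarrow> L + per \<pi> L \<le> hs \<pi> E sl L + sl"
proof -
  let ?P = "\<lambda>l. l \<ge> E \<or> L < l \<and> (\<pi> l = 0 \<or> L + per \<pi> L \<le> l + sl)"
  let ?h = "hs \<pi> E sl L"
  have P: "?P ?h" unfolding hs_def by (rule LeastI[of ?P E]) simp
  have n: "\<not> ?P l" if "l < ?h" for l using that not_less_Least[of l ?P] unfolding hs_def by blast
  show "L < ?h" using P assms by auto
  show "?h \<le> E" unfolding hs_def by (rule Least_le) simp
  show "nz \<pi> L ?h" using n assms(3) unfolding nz_def by (metis le_neq_implies_less)
  show "?h + sl \<le> L + per \<pi> L \<or> ?h = Suc L"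
  proof (cases "?h = Suc L")
    case False
    then have "\<not> L + per \<pi> L \<le> ?h - 1 + sl" using n[of "?h - 1"] \<open>L < ?h\<close> by simp
    then show ?thesis using \<open>L < ?h\<close> by linarith
  qed simp
  show "?h < E \<Longrightarrow> \<pi> ?h \<noteq> 0 \<Longrightarrow> L + per \<pi> L \<le> ?h + sl" using P by auto
qed

text \<open>The Fine--Wilf argument: inside a stretch without zeros, where predecessor distances simply
  repeat, a period that breaks at position \<open>l\<close> can only be followed by a long one.\<close>

lemma fine_wilf:
  assumes le: "\<And>j. \<pi> j \<le> j" and p: "perd \<pi> l q" "\<not> perd \<pi> (Suc l) q" "perd \<pi> (Suc l) q'"
    and nz: "nz \<pi> a (Suc l)" and q: "1 \<le> q" "1 \<le> q'"
  shows "l < a + q + q'"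
proof (rule ccontr)
  assume "\<not> ?thesis"
  then have l: "a + q + q' \<le> l" by simp
  \<comment> \<open>Consider \<open>j\<close>, \<open>j + q\<close>, \<open>j + q'\<close> and
    \<open>l = j + q + q'\<close>. Three of the four sides of this parallelogram are equalities by
    the known periods; the fourth, from \<open>j + q'\<close> to \<open>l\<close>, is the missing
    instance of the period \<open>q\<close>.\<close>
  define j where "j = l - q - q'"
  have j: "a \<le> j" "j + q + q' = l" using l by (auto simp: j_def)
  have n: "\<pi> i \<noteq> 0" if "j \<le> i" "i \<le> l" for i using nz that j by (auto simp: nz_def)
  have 1: "\<pi> (j + q') = \<pi> j" using perd_shift[OF p(3), of j] n[of j] j q by simp
  have 2: "\<pi> (j + q) = \<pi> j" using perd_shift[OF p(1), of j] n[of j] j q by simp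
  have 3: "\<pi> (j + q + q') = \<pi> (j + q)" using perd_shift[OF p(3), of "j + q"] n[of "j + q"] j q by simp
  have "\<pi> (l - q) = \<pi> l" using 1 2 3 j by (metis add.assoc add.commute add_diff_cancel_left')
  moreover have "l - q = j + q'" using j by simp
  ultimately have "\<pi> (l - q) = tr (l - q) (\<pi> l)" using le[of "l - q"] by (simp add: tr_def)
  then have "perd \<pi> (Suc l) q" using p(1) l unfolding perd_def
    by (metis Suc_diff_le add_diff_cancel_left' add_leD1 add.commute le_add_diff_inverse2 less_Suc_eq linorder_not_le trans_le_add2 le_add2 add_leD2)
  then show False using p by blast
qed

section \<open>Growth of the covered length inside zero-free stretches\<close>

locale levels =
  fixes \<pi> :: "nat \<Rightarrow> nat" and E sl L0 :: nat
  assumes le: "\<And>j. \<pi> j \<le> j" and L01: "1 \<le> L0" and per_large: "2 * sl < per \<pi> L0"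
begin

abbreviation "nx \<equiv> nxt \<pi> E sl"

lemma per_gt: "L0 \<le> L \<Longrightarrow> 2 * sl < per \<pi> L"
  using per_mono[of L0 L \<pi>] per_large by simp

lemma nx_le_E: "L0 \<le> L \<Longrightarrow> L \<le> E \<Longrightarrow> nx L \<le> E"
  using hs_props[of L E sl \<pi>] per_gt[of L] nt_runs[of \<pi> E L] by (auto simp: nxt_def runs_def)

lemma nx_gt: "L0 \<le> L \<Longrightarrow> L < E \<Longrightarrow> L < nx L"
  using hs_props[of L E sl \<pi>] per_gt[of L] per(1)[of \<pi> L] by (auto simp: nxt_def)

lemma nx_ge: "L0 \<le> L \<Longrightarrow> L \<le> nx L"
  using nx_gt[of L] by (cases "L < E") (auto simp: nxt_def)

text \<open>A run covers whole periods. A fingerprinted extension that is not cut short by a zero or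
  by \<open>E\<close> stops at most \<open>sl\<close> before a whole period, and
  \<open>per_large\<close> makes \<open>sl\<close> less than half of it.\<close>

lemma nx_half:
  assumes "L0 \<le> L" "nx L < E" "nz \<pi> L (Suc (nx L))"
  shows "per \<pi> L \<le> 2 * (nx L - L)"
proof -
  have L: "L < E" using assms nx_ge[of L] by simp
  have n: "\<pi> L \<noteq> 0" "\<pi> (nx L) \<noteq> 0" using assms nx_ge[of L] by (auto simp: nz_def)
  show ?thesis
  proof (cases "nt \<pi> E L > 0")
    case True
    then have "nx L - L = nt \<pi> E L * per \<pi> L" using n L by (simp add: nxt_def)
    moreover have "per \<pi> L \<le> nt \<pi> E L * per \<pi> L" using True by simp
    ultimately show ?thesis by simp
  next
    case False
    then have "nx L = hs \<pi> E sl L" using n L by (simp add: nxt_def)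
    then have "L + per \<pi> L \<le> nx L + sl" using hs_props(5)[of L E sl \<pi>] L n assms per_gt[of L] by simp
    then show ?thesis using per_gt[OF assms(1)] by linarith
  qed
qed

lemma nx_pow_ge: "L0 \<le> L \<Longrightarrow> L \<le> (nx ^^ k) L"
  by (induction k) (auto intro: nx_ge le_trans)

lemma nx_pow_mono:
  assumes "L0 \<le> L" "k \<le> k'"
  shows "(nx ^^ k) L \<le> (nx ^^ k') L"
  using assms(2)
proof (induction k' rule: dec_induct)
  case (step n)
  have "L0 \<le> (nx ^^ n) L" using nx_pow_ge[of L n] assms by simp
  then show ?case using step nx_ge[of "(nx ^^ n) L"] by simp
qed simp

text \<open>Four steps inside a zero-free stretch starting at \<open>a\<close> enlarge its covered part by a factor \<open>9/8\<close>.\<close>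

lemma four_steps:
  assumes L: "L0 \<le> L" "a < L" and nz: "nz \<pi> a (Suc ((nx ^^ 4) L))" and E: "(nx ^^ 4) L < E"
  shows "9 * (L - a) \<le> 8 * ((nx ^^ 4) L - a)"
proof -
  define M where "M i = (nx ^^ i) L" for i
  define y where "y = L - a"
  have M0: "M 0 = L" and MS: "M (Suc i) = nx (M i)" for i by (simp_all add: M_def)
  have mono: "i \<le> j \<Longrightarrow> M i \<le> M j" for i j using nx_pow_mono L by (simp add: M_def)
  have LM: "L \<le> M i" for i using mono[of 0 i] M0 by simp
  then have M0': "L0 \<le> M i" for i using L le_trans by blast
  have M4: "M 4 < E" "nz \<pi> a (Suc (M 4))" using E nz by (simp_all add: M_def)
  have ME: "M i < E" if "i \<le> 4" for i using mono[OF that] M4 by simp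
  have half: "per \<pi> (M i) \<le> 2 * (M (Suc i) - M i)" if "i < 4" for i
    unfolding MS
  proof (rule nx_half[OF M0'])
    show "nx (M i) < E" using ME[of "Suc i"] that MS by simp
    have "a \<le> M i" using LM[of i] L by simp
    then show "nz \<pi> (M i) (Suc (nx (M i)))"
      using nz_mono[OF M4(2), of "M i" "Suc (M (Suc i))"] mono[of "Suc i" 4] that MS by simp
  qed
  \<comment> \<open>If some period on the way is at least \<open>y / 4\<close>, the step taken there
    gains half of it, hence at least \<open>y / 8\<close>. This is the origin of the factor
    9/8.\<close>
  have grow: "9 * y \<le> 8 * (M 4 - a)" if "i < 4" "y \<le> 4 * per \<pi> (M i)" for i
  proof -
    have "M (Suc i) \<le> M 4" using mono that by simp
    then show ?thesis using half[OF that(1)] that LM[of i] L unfolding y_def by linarith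
  qed
  define q where "q = per \<pi> L"
  have q1: "1 \<le> q" unfolding q_def by (rule per)
  have qle: "q \<le> per \<pi> (M i)" for i unfolding q_def by (rule per_mono[OF LM])
  show ?thesis
  proof (cases "y \<le> 4 * q")
    case True
    then show ?thesis using grow[of 0] M0 by (simp add: q_def y_def M_def)
  next
    case small: False
    show ?thesis
    proof (cases "\<exists>i<4. per \<pi> (M i) \<noteq> q")
      \<comment> \<open>The period changes on the way. Fine-Wilf at a break of \<open>q\<close>
        bounds \<open>y\<close> by \<open>q\<close> plus the new period; as
        \<open>y > 4 * q\<close>, the new period is larger than \<open>y / 4\<close>.\<close>
      case True
      then obtain i where i: "i < 4" "per \<pi> (M i) \<noteq> q" by blast
      have "\<not> perd \<pi> (M i) q" using i qle[of i] per_le[OF q1, of \<pi> "M i"] by auto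
      moreover have "perd \<pi> L q" unfolding q_def by (rule per)
      ultimately obtain l where l: "L \<le> l" "l < M i" "perd \<pi> l q" "\<not> perd \<pi> (Suc l) q"
      proof -
        assume *: "\<And>l. L \<le> l \<Longrightarrow> l < M i \<Longrightarrow> perd \<pi> l q \<Longrightarrow> \<not> perd \<pi> (Suc l) q \<Longrightarrow> thesis"
        have "perd \<pi> l q" if "L \<le> l" "l \<le> M i" "\<not> thesis" for l
          using that
        proof (induction l rule: dec_induct)
          case base
          show ?case by fact
        next
          case (step l)
          then show ?case using *[of l] by auto
        qed
        then show thesis using LM[of i] \<open>\<not> perd \<pi> (M i) q\<close> by blast
      qed
      have "perd \<pi> (Suc l) (per \<pi> (M i))" by (rule perd_mono[OF per(2)]) (use l in simp)
      moreover have "nz \<pi> a (Suc l)" using nz_mono[OF M4(2)] l mono[of i 4] i by simp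
      ultimately have "l < a + q + per \<pi> (M i)"
        using fine_wilf[OF le l(3,4) _ _ q1 per(1)] by blast
      then have "y < q + per \<pi> (M i)" using l q1 unfolding y_def by linarith
      then show ?thesis using grow[OF i(1)] small unfolding y_def M_def by linarith
    next
      case False
      then have pq: "per \<pi> (M i) = q" if "i < 4" for i using that by blast
      have n0: "\<pi> (M i) \<noteq> 0" if "i \<le> 4" for i
        using M4(2) mono[OF that] LM[of i] L unfolding nz_def by simp
      have nzq: "nz \<pi> (M i - q) b" if "b \<le> Suc (M 4)" for i b
        by (rule nz_mono[OF M4(2)]) (use small LM[of i] that in \<open>simp_all add: y_def\<close>)
      \<comment> \<open>With an unchanged period two consecutive runs would form a single longer
        one, against maximality. So one of the first two steps is not a run.\<close>
      obtain i where i: "i < 2" "\<not> nt \<pi> E (M i) > 0"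
      proof (cases "nt \<pi> E (M 0) > 0 \<and> nt \<pi> E (M 1) > 0")
        case True
        have r0: "runs \<pi> E (M 0) q (nt \<pi> E (M 0))" using nt_runs[of \<pi> E "M 0"] True pq[of 0] by simp
        have m1: "M 1 = M 0 + nt \<pi> E (M 0) * q"
          using True n0[of 0] ME[of 0] pq[of 0] MS[of 0] by (simp add: nxt_def)
        have r1: "runs \<pi> E (M 1) q 1"
          using nt_runs[of \<pi> E "M 1"] True pq[of 1] runs_mono[of \<pi> E "M 1" q "nt \<pi> E (M 1)" 1] by simp
        have e: "M 1 + 1 * q = M 0 + Suc (nt \<pi> E (M 0)) * q" using m1 by simp
        have "nz \<pi> (M 0 - q) (M 1 + 1 * q)"
          by (rule nz_join[of _ _ "M 1" "M 1 - q"]) (use r0 r1 m1 in \<open>auto simp: runs_def\<close>)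
        then have "runs \<pi> E (M 0) q (Suc (nt \<pi> E (M 0)))"
          using r1 unfolding runs_def e by blast
        then show thesis using nt_max[of \<pi> E "M 0"] pq[of 0] by simp
      qed (use that[of 0] that[of 1] in auto)
      \<comment> \<open>Yet two steps of at least half a period each leave room for a whole period,
        and the stretch has period \<open>q\<close> and no zeros. A run was possible after
        all.\<close>
      have "\<not> runs \<pi> E (M i) q 1" using nt_max[of \<pi> E "M i"] i pq[of i] by simp
      moreover have b: "M i + q \<le> M (i + 2)"
        using half[of i] half[of "Suc i"] pq[of i] pq[of "Suc i"] i mono[of i "Suc i"] mono[of "Suc i" "i+2"]
        by (simp add: numeral_2_eq_2)
      moreover have "perd \<pi> (M (i + 2)) q" using per(2)[of \<pi> "M (i + 2)"] pq[of "i + 2"] i by simp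
      then have "perd \<pi> (M i + q) q" using b perd_mono by blast
      moreover have "M (i + 2) \<le> M 4" using mono i by simp
      ultimately have False using nzq[of "M i + q" i] M4 unfolding runs_def by simp
      then show ?thesis ..
    qed
  qed
qed

lemma gap_growth:
  assumes L: "L0 \<le> L" "a < L" and nz: "nz \<pi> a (Suc ((nx ^^ (4 * k)) L))" and E: "(nx ^^ (4 * k)) L < E"
  shows "9 ^ k * (L - a) \<le> 8 ^ k * ((nx ^^ (4 * k)) L - a)"
  using nz E
proof (induction k)
  case (Suc k)
  let ?M = "(nx ^^ (4 * k)) L"
  have e: "(nx ^^ (4 * Suc k)) L = (nx ^^ 4) ?M"
  proof -
    have "4 * Suc k = 4 + 4 * k" by simp
    then show ?thesis by (simp only: funpow_add o_apply)
  qed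
  have ge: "L \<le> ?M" using nx_pow_ge L by blast
  have m: "?M \<le> (nx ^^ (4 * Suc k)) L" using nx_pow_mono[OF L(1)] by simp
  have "nz \<pi> a (Suc ?M)" using nz_mono[OF Suc.prems(1)] m by simp
  then have 1: "9 ^ k * (L - a) \<le> 8 ^ k * (?M - a)" using Suc m by simp
  have 2: "9 * (?M - a) \<le> 8 * ((nx ^^ 4) ?M - a)"
    by (rule four_steps) (use ge L Suc.prems e in auto)
  have "9 ^ Suc k * (L - a) = 9 * (9 ^ k * (L - a))" by (simp only: power_Suc mult.assoc)
  also have "\<dots> \<le> 9 * (8 ^ k * (?M - a))" using 1 by (rule mult_le_mono2)
  also have "\<dots> = 8 ^ k * (9 * (?M - a))" by (simp only: mult.left_commute)
  also have "\<dots> \<le> 8 ^ k * (8 * ((nx ^^ 4) ?M - a))" using 2 by (rule mult_le_mono2)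
  also have "\<dots> = 8 ^ Suc k * ((nx ^^ 4) ?M - a)" by (simp only: power_Suc mult.assoc mult.left_commute)
  finally show ?case unfolding e .
qed simp

section \<open>Counting zeros to bound the number of levels\<close>

definition Z :: "nat \<Rightarrow> nat" where
  "Z L = card {j. L \<le> j \<and> j < E \<and> \<pi> j = 0}"

lemma Z_less:
  assumes "L \<le> j" "j < L'" "j < E" "\<pi> j = 0"
  shows "Z L' < Z L"
proof -
  have "{j. L' \<le> j \<and> j < E \<and> \<pi> j = 0} \<subseteq> {j. L \<le> j \<and> j < E \<and> \<pi> j = 0} - {j}" using assms by auto
  then have "Z L' \<le> card ({j. L \<le> j \<and> j < E \<and> \<pi> j = 0} - {j})"
    unfolding Z_def by (rule card_mono[rotated]) simp
  also have "\<dots> < Z L" unfolding Z_def by (rule card_Diff1_less) (use assms in auto)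
  finally show ?thesis .
qed

text \<open>The first step covers at least one position. Without a zero, the next
  \<open>4 * k\<close> steps would multiply this by \<open>(9/8) ^ k\<close>, which is more than
  \<open>E\<close>. So there is a zero among the covered positions, and one last step passes beyond
  it.\<close>

lemma gap_steps:
  assumes L: "L0 \<le> L" "L < E" and k: "8 ^ k * E < 9 ^ k" and nE: "(nx ^^ (4 * k + 2)) L < E"
  shows "Z ((nx ^^ (4 * k + 2)) L) < Z L"
proof -
  define a where "a = L"
  let ?L1 = "nx L" let ?M = "(nx ^^ (4 * k)) ?L1"
  have e: "(nx ^^ (4 * k + 2)) L = nx ?M"
  proof -
    have "4 * k + 2 = Suc (4 * k + 1)" by simp
    then have "(nx ^^ (4 * k + 2)) L = nx ((nx ^^ (4 * k + 1)) L)" by (simp only: funpow.simps o_apply)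
    also have "(nx ^^ (4 * k + 1)) L = ?M" by (simp only: funpow_add o_apply) simp
    finally show ?thesis .
  qed
  have L1: "L < ?L1" using nx_gt L by simp
  have M1: "?L1 \<le> ?M" using nx_pow_ge[of ?L1 "4 * k"] L L1 by simp
  then have LM: "L0 \<le> ?M" using L L1 by simp
  have ME: "?M < E" using nE nx_ge[OF LM] unfolding e by simp
  have MN: "?M < nx ?M" using nx_gt[OF LM ME] .
  have "\<not> nz \<pi> L (Suc ?M)"
  proof
    assume "nz \<pi> L (Suc ?M)"
    then have "9 ^ k * (?L1 - L) \<le> 8 ^ k * (?M - L)"
      using gap_growth[of ?L1 L k] L L1 ME by simp
    moreover have "9 ^ k * 1 \<le> 9 ^ k * (?L1 - L)" using L1 by (intro mult_left_mono) auto
    moreover have "8 ^ k * (?M - L) \<le> 8 ^ k * E" using ME by (intro mult_left_mono) auto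
    ultimately show False using k by linarith
  qed
  then obtain j where "L \<le> j" "j \<le> ?M" "\<pi> j = 0" by (auto simp: nz_def less_Suc_eq_le)
  then show ?thesis unfolding e using Z_less[of L j "nx ?M"] MN ME by simp
qed

text \<open>Each block of \<open>4 * k + 2\<close> steps consumes a zero unless it reaches
  \<open>E\<close>. As \<open>E\<close> is a fixed point of the step, surplus steps do no
  harm.\<close>

lemma steps_bound:
  assumes L: "L0 \<le> L" "L \<le> E" and k: "8 ^ k * E < 9 ^ k"
  shows "(nx ^^ ((4 * k + 2) * Suc (Z L))) L = E"
  using L
proof (induction "Z L" arbitrary: L rule: less_induct)
  case less
  let ?K = "4 * k + 2"
  have stay: "(nx ^^ i) E = E" for i by (induction i) (simp_all add: nxt_def)
  have leE: "(nx ^^ i) L \<le> E" for i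
    using less(2,3) nx_pow_ge[of L] by (induction i) (auto intro!: nx_le_E intro: le_trans)
  let ?M = "(nx ^^ ?K) L"
  have split: "(nx ^^ (i + ?K)) L = (nx ^^ i) ?M" for i by (simp only: funpow_add o_apply)
  show ?case
  proof (cases "?M = E")
    case True
    have "(nx ^^ (?K * Suc (Z L))) L = (nx ^^ (?K * Z L)) ?M"
      using split[of "?K * Z L"] by (simp only: mult_Suc_right add.commute)
    then show ?thesis by (simp only: True stay)
  next
    case False
    then have ME: "?M < E" using leE[of ?K] by simp
    then have "L < E" using nx_pow_ge[of L ?K] less by simp
    then have zl: "Z ?M < Z L" using gap_steps[OF less(2) _ k] ME by simp
    have r: "(nx ^^ (?K * Suc (Z ?M))) ?M = E"
      by (rule less(1)[OF zl]) (use less(2) nx_pow_ge[of L ?K] leE[of ?K] in auto)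
    obtain d where d: "Z L = Suc (Z ?M) + d" using zl by (metis less_iff_Suc_add add_Suc)
    have "?K * Suc (Z L) = (?K * d + ?K * Suc (Z ?M)) + ?K"
      unfolding d by (simp add: algebra_simps)
    then have "(nx ^^ (?K * Suc (Z L))) L = (nx ^^ (?K * d)) ((nx ^^ (?K * Suc (Z ?M))) ?M)"
      using split[of "?K * d + ?K * Suc (Z ?M)"] by (simp only: funpow_add o_apply)
    then show ?thesis by (simp only: r stay)
  qed
qed

end

section \<open>Fingerprints\<close>

text \<open>Horner's scheme with the oldest entry as leading coefficient. It stays an exact natural
  number and is reduced modulo \<open>p\<close> only where it is stored or compared.\<close>

primrec hh :: "nat \<Rightarrow> (nat \<Rightarrow> nat) \<Rightarrow> nat \<Rightarrow> nat" where
  "hh r u 0 = 0"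
| "hh r u (Suc n) = hh r u n * r + u n"

lemma hh_split: "hh r u (x + n) = hh r u x * r ^ n + hh r (\<lambda>i. u (x + i)) n"
  by (induction n) (simp_all add: algebra_simps)

lemma hh_cong: "(\<And>i. i < n \<Longrightarrow> u i = v i) \<Longrightarrow> hh r u n = hh r v n"
  by (induction n) simp_all

section \<open>Collisions as roots modulo a prime\<close>

primrec hpoly :: "(nat \<Rightarrow> int) \<Rightarrow> nat \<Rightarrow> int poly" where
  "hpoly u 0 = 0"
| "hpoly u (Suc n) = pCons (u n) (hpoly u n)"

lemma poly_hpoly: "poly (hpoly (\<lambda>i. int (u i) - int (v i)) n) (int r) = int (hh r u n) - int (hh r v n)"
proof (induction n)
  case (Suc n)
  show ?case unfolding hpoly.simps poly_pCons Suc.IH by (simp add: algebra_simps)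
qed simp

lemma degree_hpoly: "degree (hpoly u n) \<le> n"
  by (induction n) (auto intro: order_trans[OF degree_pCons_le])

lemma coeff_hpoly: "i < n \<Longrightarrow> coeff (hpoly u n) (n - 1 - i) = u i"
proof (induction n)
  case (Suc n)
  show ?case
  proof (cases "i = n")
    case False
    then have "Suc n - 1 - i = Suc (n - 1 - i)" "i < n" using Suc by auto
    then show ?thesis using Suc.IH by simp
  qed simp
qed simp

text \<open>Lagrange's bound, by splitting off linear factors with synthetic division. The argument
  stays with integer polynomials: \<open>[:int p:] dvd f\<close> expresses that all coefficients
  vanish modulo \<open>p\<close>.\<close>

lemma card_roots_mod_prime:
  fixes f :: "int poly" and p :: nat
  assumes p: "prime p" and f: "\<not> [:int p:] dvd f"
  shows "card {r \<in> {0..<p}. int p dvd poly f (int r)} \<le> degree f"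
  using f
proof (induction "degree f" arbitrary: f rule: less_induct)
  case less
  let ?R = "\<lambda>f. {r \<in> {0..<p}. int p dvd poly f (int r)}"
  show ?case
  proof (cases "?R f = {}")
    case False
    then obtain a where a: "a < p" "int p dvd poly f (int a)" by auto
    define g where "g = synthetic_div f (int a)"
    have fg: "f = pCons (poly f (int a)) 0 + [:- int a, 1:] * g"
      using synthetic_div_correct'[of "int a" f] by (simp add: g_def add.commute)
    have dg: "degree g = degree f - 1" by (simp add: g_def degree_synthetic_div)
    have ng: "\<not> [:int p:] dvd g"
    proof
      assume "[:int p:] dvd g"
      moreover have "[:int p:] dvd pCons (poly f (int a)) 0" using a(2) by (simp add: const_poly_dvd_iff coeff_pCons split: nat.split)
      ultimately have "[:int p:] dvd f" by (subst fg) (intro dvd_add dvd_mult)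
      then show False using less.prems by blast
    qed
    have d0: "degree f \<noteq> 0"
    proof
      assume "degree f = 0"
      then obtain c where "f = [:c:]" by (rule degree_eq_zeroE)
      then have "int p dvd c" using a by simp
      then obtain d where "c = int p * d" ..
      then have "f = [:int p:] * [:d:]" using \<open>f = [:c:]\<close> by simp
      then show False using less.prems by (metis dvd_triv_left)
    qed
    have "?R f \<subseteq> insert a (?R g)"
    proof
      fix r assume r: "r \<in> ?R f"
      have "poly f (int r) = poly f (int a) + (int r - int a) * poly g (int r)"
        by (subst (1) fg) (simp add: algebra_simps)
      then have "int p dvd (int r - int a) * poly g (int r)"
        using r a by (metis (no_types, lifting) dvd_add_right_iff mem_Collect_eq)
      then have "int p dvd (int r - int a) \<or> int p dvd poly g (int r)"
        using p by (simp add: prime_dvd_mult_iff)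
      moreover have "r = a" if "int p dvd (int r - int a)"
      proof -
        have "\<bar>int r - int a\<bar> < int p" using r a by auto
        then have "int r - int a = 0" using that by (metis abs_of_nat dvd_imp_le_int not_less)
        then show ?thesis by simp
      qed
      ultimately show "r \<in> insert a (?R g)" using r by blast
    qed
    then have "card (?R f) \<le> card (insert a (?R g))" by (intro card_mono) auto
    also have "\<dots> \<le> Suc (card (?R g))" by (rule card_insert_le_m1) auto
    also have "card (?R g) \<le> degree g" by (rule less.hyps) (use dg d0 ng in auto)
    finally show ?thesis using dg d0 by simp
  next
    case True
    then show ?thesis by (metis card.empty le0)
  qed
qed

text \<open>Entries below \<open>p\<close> that differ stay different modulo \<open>p\<close>. So
  the difference polynomial does not vanish modulo \<open>p\<close>, and a collision is one of its
  roots.\<close>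

lemma card_collisions:
  assumes p: "prime (p::nat)" and uv: "\<And>i. i < n \<Longrightarrow> u i < p" "\<And>i. i < n \<Longrightarrow> v i < p"
    and ne: "i < n" "u i \<noteq> v i"
  shows "card {r \<in> {0..<p}. hh r u n mod p = hh r v n mod p} \<le> n"
proof -
  let ?f = "hpoly (\<lambda>i. int (u i) - int (v i)) n"
  have "\<not> [:int p:] dvd ?f"
  proof
    assume "[:int p:] dvd ?f"
    then have "int p dvd coeff ?f (n - 1 - i)" by (simp add: const_poly_dvd_iff)
    then have d: "int p dvd int (u i) - int (v i)" using coeff_hpoly[OF ne(1)] by simp
    have "\<bar>int (u i) - int (v i)\<bar> < int p" using uv[OF ne(1)] by auto
    then have "int (u i) - int (v i) = 0" using d by (metis abs_of_nat dvd_imp_le_int not_less)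
    then show False using ne by simp
  qed
  from card_roots_mod_prime[OF p this]
  have "card {r \<in> {0..<p}. int p dvd poly ?f (int r)} \<le> n" using degree_hpoly le_trans by blast
  moreover have "int p dvd poly ?f (int r) \<longleftrightarrow> hh r u n mod p = hh r v n mod p" for r
    unfolding poly_hpoly by (metis mod_eq_dvd_iff of_nat_eq_iff of_nat_mod)
  ultimately show ?thesis by simp
qed

section \<open>A prime in a given range\<close>

text \<open>The reciprocal entries of Leibniz' harmonic triangle divide every common multiple of
  \<open>1, \<dots>, n + 1\<close>. They make it exponentially large, which a gap between primes would not allow.\<close>

lemma leibniz_triangle:
  assumes D: "\<And>j. 1 \<le> j \<Longrightarrow> j \<le> Suc n \<Longrightarrow> j dvd (D::nat)" and k: "k \<le> n"
  shows "Suc n * (n choose k) dvd D"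
  using assms
proof (induction k arbitrary: n)
  case (Suc k)
  then obtain n' where n: "n = Suc n'" by (cases n) auto
  let ?a = "Suc n' * (n' choose k)" and ?b = "Suc n * (n choose k)" and ?c = "Suc n * (n choose Suc k)"
  have a: "?a dvd D" by (rule Suc.IH) (use Suc.prems n in auto)
  have b: "?b dvd D" by (rule Suc.IH) (use Suc.prems in auto)
  have pos: "?a > 0" "?b > 0" "?c > 0" using Suc.prems n by simp_all
  have 1: "Suc k * (n choose Suc k) = n * (n' choose k)"
    using Suc_times_binomial_eq[of n' k] n by (simp add: mult.commute)
  have 2: "(n choose k) * (n - k) = n * (n' choose k)"
    using binomial_absorb_comp[of n k] n by (simp add: mult.commute)
  \<comment> \<open>The recurrence of the harmonic triangle. Multiplied by \<open>D\<close>, it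
    writes \<open>D / ?c\<close> as a difference of two integers.\<close>
  have key: "1 / real ?c = 1 / real ?a - 1 / real ?b"
  proof -
    define x where "x = real (n' choose k)"
    have x: "x > 0" using Suc.prems n by (simp add: x_def)
    have c: "real (n choose Suc k) = real n * x / real (Suc k)"
      using arg_cong[OF 1, of real] by (simp add: x_def field_simps)
    have bb: "real (n choose k) = real n * x / (real n - real k)"
      using arg_cong[OF 2, of real] Suc.prems by (simp add: x_def field_simps of_nat_diff)
    have pos: "real n - real k > 0" "real n > 0" using Suc.prems by auto
    have a1: "1 / real ?c = (real k + 1) / ((real n + 1) * (real n * x))"
      unfolding of_nat_mult c by (simp add: add.commute mult.assoc)
    have a2: "1 / real ?b = (real n - real k) / ((real n + 1) * (real n * x))"
      unfolding of_nat_mult bb by (simp add: add.commute mult.assoc)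
    have "1 / real ?c + 1 / real ?b = ((real k + 1) + (real n - real k)) / ((real n + 1) * (real n * x))"
      unfolding a1 a2 by (rule add_divide_distrib[symmetric])
    also have "(real k + 1) + (real n - real k) = real n + 1" by simp
    also have "(real n + 1) / ((real n + 1) * (real n * x)) = 1 / (real n * x)"
      using pos by simp
    also have "\<dots> = 1 / real ?a" using n by (simp add: x_def algebra_simps)
    finally show ?thesis by simp
  qed
  have "real D / real ?c = real D / real ?a - real D / real ?b"
    using key by (metis (no_types, opaque_lifting) mult.right_neutral right_diff_distrib times_divide_eq_right)
  also have "\<dots> = real (D div ?a) - real (D div ?b)" using a b by (simp add: real_of_nat_div)
  also have "\<dots> = of_int (int (D div ?a) - int (D div ?b))" by simp
  finally have e: "real D / real ?c = of_int (int (D div ?a) - int (D div ?b))" .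
  have "real ?c \<noteq> 0" using pos(3) by linarith
  then have "real D = of_int (int (D div ?a) - int (D div ?b)) * real ?c"
    by (rule iffD1[OF nonzero_divide_eq_eq _ ]) (rule e)
  then have "real_of_int (int D) = real_of_int ((int (D div ?a) - int (D div ?b)) * int ?c)"
    by (simp only: of_int_mult of_int_of_nat_eq)
  then have "int D = (int (D div ?a) - int (D div ?b)) * int ?c" by (simp only: of_int_eq_iff)
  then have "int ?c dvd int D" by (rule dvdI[OF trans[OF _ mult.commute]])
  then show ?case by (simp only: int_dvd_int_iff)
qed simp

text \<open>The least common multiple of 1, ..., \<open>M\<close> has one factor for each prime,
  namely its largest power not exceeding \<open>M\<close>.\<close>

lemma common_multiple:
  fixes M :: nat
  assumes "1 \<le> M"
  obtains D where "D > 0" "\<And>j. 1 \<le> j \<Longrightarrow> j \<le> M \<Longrightarrow> j dvd D" "D \<le> M ^ card {p. prime p \<and> p \<le> M}"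
proof -
  let ?S = "{p. prime p \<and> p \<le> M}"
  have fin: "finite ?S" by simp
  define e where "e p = (GREATEST k. p ^ k \<le> M)" for p :: nat
  have bd: "k \<le> M" if "p ^ k \<le> M" "prime p" for p k :: nat
    using that less_exp[of k] prime_ge_2_nat[of p] power_mono[of 2 p k] by linarith
  have e: "p ^ e p \<le> M" "\<And>k. p ^ k \<le> M \<Longrightarrow> k \<le> e p" if "prime p" for p
    unfolding e_def
  proof -
    show "p ^ (GREATEST k. p ^ k \<le> M) \<le> M"
      by (rule GreatestI_nat[of _ 0 M]) (use assms bd that in auto)
    show "k \<le> (GREATEST k. p ^ k \<le> M)" if "p ^ k \<le> M" for k
      by (rule Greatest_le_nat[of _ _ M]) (use that bd \<open>prime p\<close> in auto)
  qed
  define D where "D = (\<Prod>p\<in>?S. p ^ e p)"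
  have D0: "D > 0" unfolding D_def by (rule prod_pos) (auto dest: prime_gt_0_nat)
  have "j dvd D" if j: "1 \<le> j" "j \<le> M" for j
  proof (rule multiplicity_le_imp_dvd)
    fix p :: nat assume p: "prime p"
    have pj: "p ^ multiplicity p j \<le> M"
      using j dvd_imp_le[OF multiplicity_dvd[of p j]] by simp
    show "multiplicity p j \<le> multiplicity p D"
    proof (cases "p \<le> M")
      case True
      have "p ^ e p dvd D" unfolding D_def by (rule dvd_prodI) (use fin p True in auto)
      then have "e p \<le> multiplicity p D"
        using D0 p by (intro multiplicity_geI) auto
      then show ?thesis using e(2)[OF p pj] by simp
    next
      case False
      then have "\<not> p dvd j" using j by (auto dest: dvd_imp_le)
      then show ?thesis by (simp add: not_dvd_imp_multiplicity_0)
    qed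
  qed (use j in auto)
  moreover have "D \<le> (\<Prod>p\<in>?S. M)" unfolding D_def by (rule prod_mono) (use e in auto)
  ultimately show thesis using D0 that by simp
qed

text \<open>Put \<open>N = X ^ 2\<close>. Without a prime in the range, all primes up to
  \<open>2 * N + 1\<close> are at most \<open>X\<close>, so
  \<open>2 ^ N \<le> (2 * N choose N) \<le> (2 * N + 1) ^ X\<close>, that is
  \<open>2 ^ X \<le> 2 * X ^ 2 + 1\<close>. This fails from \<open>X = 7\<close> on. A quadratic
  range is good enough, since the prime has to be polynomial in \<open>n\<close> only.\<close>

lemma prime_between:
  assumes X: "7 \<le> (X::nat)"
  obtains p where "prime p" "X < p" "p \<le> 2 * X ^ 2 + 1"
proof (rule ccontr)
  assume n: "\<not> thesis"
  define N where "N = X ^ 2"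
  let ?S = "{p. prime p \<and> p \<le> Suc (2 * N)}"
  have sub: "?S \<subseteq> {1..X}"
  proof
    fix p :: nat assume p: "p \<in> ?S"
    then have "\<not> X < p" using n that[of p] by (auto simp: N_def)
    then show "p \<in> {1..X}" using p prime_ge_1_nat by auto
  qed
  then have card: "card ?S \<le> X" using card_mono[OF _ sub] by simp
  obtain D where D: "D > 0" "\<And>j. 1 \<le> j \<Longrightarrow> j \<le> Suc (2 * N) \<Longrightarrow> j dvd D" "D \<le> Suc (2 * N) ^ card ?S"
    using common_multiple[of "Suc (2 * N)"] by auto
  have "Suc (2 * N) * (2 * N choose N) dvd D" by (rule leibniz_triangle) (use D in auto)
  then have "(2 * N choose N) \<le> D" using D(1)
    by (metis dvd_imp_le dvd_mult_right)
  also have "\<dots> \<le> Suc (2 * N) ^ X"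
    using D(3) power_increasing[OF card, of "Suc (2 * N)"] by simp
  finally have 1: "(2 * N choose N) \<le> Suc (2 * N) ^ X" .
  have "2 ^ n \<le> (2 * n choose n)" for n :: nat
  proof (induction n)
    case (Suc n)
    have a: "Suc n * (2 * Suc n choose Suc n) = 2 * Suc (2 * n) * (2 * n choose n)"
    proof -
      have "Suc n * (Suc (Suc (2 * n)) choose Suc n) = Suc (Suc (2 * n)) * (Suc (2 * n) choose n)"
        by (rule Suc_times_binomial)
      moreover have "Suc n * (Suc (2 * n) choose n) = Suc (2 * n) * (2 * n choose n)"
        using Suc_times_binomial_eq[of "2 * n" n] binomial_symmetric[of n "Suc (2 * n)"] by (simp add: Suc_diff_le)
      moreover have "Suc (Suc (2 * n)) * (Suc (2 * n) choose n) = 2 * (Suc n * (Suc (2 * n) choose n))" by simp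
      ultimately show ?thesis by (metis mult.assoc mult_2 mult_Suc_right add_2_eq_Suc)
    qed
    have "Suc n * 2 ^ Suc n \<le> 2 * Suc (2 * n) * 2 ^ n" by simp
    also have "\<dots> \<le> Suc n * (2 * Suc n choose Suc n)" unfolding a using Suc by (intro mult_left_mono) auto
    finally show ?case by (metis Suc_mult_le_cancel1)
  qed simp
  then have "2 ^ N \<le> Suc (2 * N) ^ X" using 1 le_trans by blast
  then have "(2 ^ X) ^ X \<le> Suc (2 * N) ^ X" by (simp add: N_def power2_eq_square power_mult)
  then have "2 ^ X \<le> Suc (2 * N)"
    using X by (metis not_less power_strict_mono zero_le less_le_trans zero_less_numeral)
  moreover have "Suc (2 * X ^ 2) < 2 ^ X"
    using X
  proof (induction X rule: dec_induct)
    case (step k)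
    have "Suc (2 * (Suc k)\<^sup>2) \<le> 2 * Suc (2 * k\<^sup>2)"
    proof -
      define q where "q = k\<^sup>2"
      have "7 * k \<le> q" unfolding q_def power2_eq_square using step(1) by (rule mult_le_mono1)
      moreover have "1 \<le> k" using step(1) by simp
      moreover have e: "(Suc k)\<^sup>2 = q + 2 * k + 1" by (simp add: power2_eq_square q_def)
      ultimately show ?thesis unfolding e q_def[symmetric] by simp
    qed
    then show ?case using step by simp
  qed simp
  ultimately show False by (simp add: N_def)
qed

section \<open>A sliding fingerprint with truncation\<close>

text \<open>
  \<open>wv \<tau> L l e\<close> lists the last \<open>l\<close> predecessor distances of the text of length \<open>e\<close>, truncated as
  if the text began \<open>L\<close> positions before its end.
\<close>

definition wv :: "(nat \<Rightarrow> nat) \<Rightarrow> nat \<Rightarrow> nat \<Rightarrow> nat \<Rightarrow> nat \<Rightarrow> nat" where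
  "wv \<tau> L l e j = (if e + j < l then 0 else tr (L - l + j) (\<tau> (e + j - l)))"

text \<open>The previous occurrence of the symbol at position \<open>x\<close> leaves the window at time \<open>e\<close>.\<close>

definition event :: "(nat \<Rightarrow> nat) \<Rightarrow> nat \<Rightarrow> nat \<Rightarrow> nat \<Rightarrow> nat \<Rightarrow> bool" where
  "event \<tau> L l e x \<longleftrightarrow> x < e \<and> e < x + l \<and> \<tau> x + e = x + L"

text \<open>The position that leaves the window is determined by \<open>e\<close> and
  \<open>L\<close>, and by \<open>inj\<close> it is the predecessor of one position only. Hence one
  correction per symbol suffices.\<close>

lemma event_unique:
  assumes inj: "\<And>x y. \<tau> x \<noteq> 0 \<Longrightarrow> \<tau> y \<noteq> 0 \<Longrightarrow> x - \<tau> x = y - \<tau> y \<Longrightarrow> x = y"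
    and "l \<le> L" "event \<tau> L l e x" "event \<tau> L l e y"
  shows "x = y"
proof (rule inj)
  show "\<tau> x \<noteq> 0" "\<tau> y \<noteq> 0" "x - \<tau> x = y - \<tau> y" using assms(2-) by (auto simp: event_def)
qed

lemma hh_add_one:
  assumes "j < n" "\<And>i. i < n \<Longrightarrow> u i = (if i = j then v i + d else v i)"
  shows "hh r u n = hh r v n + d * r ^ (n - 1 - j)"
  using assms
proof (induction n)
  case (Suc n)
  show ?case
  proof (cases "j = n")
    case True
    have "hh r u n = hh r v n" by (rule hh_cong) (use Suc.prems True in auto)
    then show ?thesis using Suc.prems(2)[of n] True by simp
  next
    case False
    then have "hh r u n = hh r v n + d * r ^ (n - 1 - j)" using Suc by auto
    moreover have "Suc n - 1 - j = Suc (n - 1 - j)" using False Suc.prems(1) by auto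
    ultimately show ?thesis using Suc.prems(2)[of n] False by (simp add: algebra_simps)
  qed
qed simp

text \<open>Sliding by one symbol drops the oldest entry, appends the new one, and clears at most
  one entry in between, that of the event. The losses stand on the left-hand side to avoid
  subtraction of naturals.\<close>

lemma wv_step:
  assumes inj: "\<And>x y. \<tau> x \<noteq> 0 \<Longrightarrow> \<tau> y \<noteq> 0 \<Longrightarrow> x - \<tau> x = y - \<tau> y \<Longrightarrow> x = y"
    and l: "1 \<le> l" "l \<le> L"
    and ev: "(\<And>x. \<not> event \<tau> L l e x) \<Longrightarrow> E = 0"
    and ev0: "\<And>x. event \<tau> L l e x \<Longrightarrow> E = \<tau> x * r ^ (e - x)"
  shows "hh r (wv \<tau> L l (Suc e)) l + wv \<tau> L l e 0 * r ^ l + E = hh r (wv \<tau> L l e) l * r + tr (L - 1) (\<tau> e)"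
proof -
  obtain k where k: "l = Suc k" using l by (cases l) auto
  let ?u = "\<lambda>j. wv \<tau> L l e (1 + j)" and ?v = "wv \<tau> L l (Suc e)"
  have shift: "hh r ?u k * r = hh r ?v k * r + E"
  proof (cases "\<exists>x. event \<tau> L l e x")
    case True
    then obtain x where x: "event \<tau> L l e x" by blast
    \<comment> \<open>The index of \<open>x\<close> in the window at time
      \<open>Suc e\<close>.\<close>
    define j where "j = x + l - e - 1"
    have j: "j < k" "e + j + 1 - l = x" "l \<le> e + j + 1" using x k by (auto simp: event_def j_def)
    have u: "?u i = (if i = j then ?v i + \<tau> x else ?v i)" if i: "i < k" for i
    proof (cases "l \<le> e + i + 1")
      case True
      have e: "?u i = tr (Suc (L - l + i)) (\<tau> (e + i + 1 - l))" "?v i = tr (L - l + i) (\<tau> (e + i + 1 - l))"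
        using True by (auto simp: wv_def)
      show ?thesis
      proof (cases "\<tau> (e + i + 1 - l) = Suc (L - l + i)")
        case t: True
        then have "event \<tau> L l e (e + i + 1 - l)" using True i k l by (auto simp: event_def)
        then have "e + i + 1 - l = x" using event_unique[OF inj l(2) _ x] by blast
        then show ?thesis using j True t unfolding e by (auto simp: tr_def)
      next
        case False
        then have "i \<noteq> j" using x j k l by (auto simp: event_def)
        then show ?thesis using False unfolding e by (auto simp: tr_def)
      qed
    next
      case False
      then show ?thesis using j by (auto simp: wv_def)
    qed
    have "hh r ?u k = hh r ?v k + \<tau> x * r ^ (k - 1 - j)" by (rule hh_add_one[OF j(1) u])
    moreover have "e - x = Suc (k - 1 - j)" using j k x by (auto simp: event_def)
    ultimately show ?thesis using ev0[OF x] by (simp add: algebra_simps)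
  next
    case False
    then have "E = 0" using ev by blast
    have "?u i = ?v i" if i: "i < k" for i
    proof (cases "l \<le> e + i + 1")
      case True
      have e: "?u i = tr (Suc (L - l + i)) (\<tau> (e + i + 1 - l))" "?v i = tr (L - l + i) (\<tau> (e + i + 1 - l))"
        using True by (auto simp: wv_def)
      have "\<not> event \<tau> L l e (e + i + 1 - l)" using False by blast
      then have "\<tau> (e + i + 1 - l) \<noteq> Suc (L - l + i)" using True i k l by (auto simp: event_def)
      then show ?thesis unfolding e by (auto simp: tr_def)
    qed (auto simp: wv_def)
    then have "hh r ?u k = hh r ?v k" by (rule hh_cong)
    then show ?thesis using \<open>E = 0\<close> by simp
  qed
  have "hh r (wv \<tau> L l e) l = wv \<tau> L l e 0 * r ^ k + hh r ?u k"
    using hh_split[of r "wv \<tau> L l e" 1 k] k by simp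
  then have "hh r (wv \<tau> L l e) l * r = wv \<tau> L l e 0 * r ^ l + (hh r ?v k * r + E)"
    using k shift by (simp add: algebra_simps)
  moreover have "hh r ?v l = hh r ?v k * r + tr (L - 1) (\<tau> e)"
    using k l by (simp add: wv_def)
  ultimately show ?thesis by simp
qed

text \<open>Subtraction modulo \<open>p\<close> without leaving the naturals: \<open>p\<close> minus
  a residue is added instead. The left-hand side has the shape of the expression evaluated in
  \<open>bWin\<close>.\<close>

lemma mod_sub_update:
  fixes p :: nat
  assumes p: "0 < p" and "h' + x + y = h * r + v"
  shows "(h mod p * r + v + (p - x mod p) + (p - y mod p)) mod p = h' mod p"
proof -
  let ?N = "h mod p * r + v + (p - x mod p) + (p - y mod p)"
  have d: "int z = int p * int (z div p) + int (z mod p)" for z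
    by (metis mult_div_mod_eq of_nat_add of_nat_mult)
  have le: "x mod p \<le> p" "y mod p \<le> p" using p by (simp_all add: less_imp_le)
  have "int ?N = int (h mod p) * int r + int v + (int p - int (x mod p)) + (int p - int (y mod p))"
    using le by (simp add: of_nat_diff)
  also have "\<dots> = int h * int r + int v - int x - int y +
      int p * (2 + int (x div p) + int (y div p) - int (h div p) * int r)"
    unfolding d[of h] d[of x] d[of y] by (simp add: algebra_simps)
  also have "int h * int r + int v - int x - int y = int h'"
    using arg_cong[OF assms(2), of int] by simp
  finally have "int (?N mod p) = int (h' mod p)" by (simp add: zmod_int)
  then show ?thesis by (simp only: of_nat_eq_iff)
qed

lemma wv_match:
  assumes "l \<le> L" "L \<le> e"
  shows "wv \<tau> L l e j = tr (L - l + j) (\<tau> (e - l + j))"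
  using assms by (auto simp: wv_def)

section \<open>The round-robin sweep over the levels\<close>

text \<open>
  \<open>Ev g x\<close>: an occurrence of the prefix of level \<open>g\<close> ends at \<open>x\<close>. A sweep started at time \<open>\<kappa>\<close> visits
  one level per arriving symbol; level \<open>g\<close> then settles every occurrence whose next checkpoint
  \<open>x + len g\<close> is at most \<open>\<kappa>\<close>. Levels below \<open>gp\<close> have been visited in the current sweep.
\<close>

locale sweep =
  fixes Ev :: "nat \<Rightarrow> nat \<Rightarrow> bool" and h :: nat and len rho kind :: "nat \<Rightarrow> nat"
  assumes gap: "\<And>g x y. g \<le> h \<Longrightarrow> Ev g x \<Longrightarrow> Ev g y \<Longrightarrow> x < y \<Longrightarrow> x + rho g \<le> y"
    and pos: "\<And>g x. g \<le> h \<Longrightarrow> Ev g x \<Longrightarrow> 0 < x"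
    and room: "\<And>g. g < h \<Longrightarrow> 2 * h + len g \<le> rho g"
    and prev: "\<And>g y. g < h \<Longrightarrow> Ev (Suc g) y \<Longrightarrow> len g \<le> y \<and> Ev g (y - len g)"
    and run_len: "\<And>g. g < h \<Longrightarrow> kind g = 0 \<Longrightarrow> len g = 0"
begin

text \<open>The time up to which level \<open>g\<close> has settled all checkpoints: the start of
  the current sweep if the level has been visited in it, otherwise that of the previous sweep,
  \<open>h\<close> symbols earlier. Subtraction stopping at 0 fits the beginning of the
  stream.\<close>

definition om :: "nat \<Rightarrow> nat \<Rightarrow> nat \<Rightarrow> nat" where
  "om gp \<kappa> g = (if g < gp then \<kappa> else \<kappa> - h)"

text \<open>The time up to which level \<open>g\<close> has been told its occurrences: without delay
  at level 0, otherwise as far as level \<open>g - 1\<close> has settled its checkpoints.\<close>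

definition al :: "nat \<Rightarrow> nat \<Rightarrow> nat \<Rightarrow> nat \<Rightarrow> nat" where
  "al e gp \<kappa> g = (if g = 0 then e else om gp \<kappa> (g - 1))"

definition is_last :: "(nat \<Rightarrow> bool) \<Rightarrow> nat \<Rightarrow> nat \<Rightarrow> bool" where
  "is_last A b x \<longleftrightarrow> A x \<and> x \<le> b \<and> (\<forall>y. A y \<and> y \<le> b \<longrightarrow> y \<le> x)"

text \<open>\<open>Suc x\<close> encodes an occurrence, 0 none. As one number is stored per level,
  the equivalence also claims that at most one occurrence is waiting. The top level has no
  checkpoint and keeps its latest occurrence.\<close>

definition pend_ok :: "nat \<Rightarrow> nat \<Rightarrow> nat \<Rightarrow> (nat \<Rightarrow> nat) \<Rightarrow> bool" where
  "pend_ok e gp \<kappa> pend \<longleftrightarrow>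
     (\<forall>g<h. \<forall>x. pend g = Suc x \<longleftrightarrow> Ev g x \<and> x \<le> al e gp \<kappa> g \<and> om gp \<kappa> g < x + len g) \<and>
     (\<forall>x. pend h = Suc x \<longleftrightarrow> is_last (Ev h) (al e gp \<kappa> h) x)"

text \<open>\<open>rs\<close> is the first member of the chain of occurrences at distance
  \<open>r\<close> that ends in the latest one. A run of \<open>t + 1\<close> occurrences is then
  recognised by a single comparison.\<close>

definition run_ok :: "nat \<Rightarrow> nat \<Rightarrow> nat \<Rightarrow> nat \<Rightarrow> nat \<Rightarrow> bool" where
  "run_ok g b r lx rs \<longleftrightarrow> (\<forall>x. lx = Suc x \<longleftrightarrow> is_last (Ev g) b x) \<and>
     (\<forall>x. lx = Suc x \<longrightarrow> (\<forall>t. rs + t * r \<le> x \<longleftrightarrow> (\<forall>k\<le>t. k * r \<le> x \<and> Ev g (x - k * r))))"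

definition runs_ok :: "nat \<Rightarrow> nat \<Rightarrow> (nat \<Rightarrow> nat) \<Rightarrow> (nat \<Rightarrow> nat) \<Rightarrow> bool" where
  "runs_ok gp \<kappa> lx rs \<longleftrightarrow> (\<forall>g<h. kind g = 0 \<longrightarrow> run_ok g (om gp \<kappa> g) (rho g) (lx g) (rs g))"

lemma is_last_unique: "is_last A b x \<Longrightarrow> is_last A b y \<Longrightarrow> x = y"
  by (auto simp: is_last_def intro: antisym)

lemma not_Ev_0 [simp]: "g \<le> h \<Longrightarrow> \<not> Ev g 0"
  using pos by blast

lemma not_last_0 [simp]: "g \<le> h \<Longrightarrow> \<not> is_last (Ev g) 0 x"
  by (cases x) (simp_all add: is_last_def)

lemma all_le_Suc: "(\<forall>k\<le>Suc n. P k) \<longleftrightarrow> P 0 \<and> (\<forall>k\<le>n. P (Suc k))"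
  by (metis Suc_le_mono le0 not0_implies_Suc)

section \<open>Start of the stream, arrival of an occurrence, start of a sweep\<close>

lemma pend_init:
  assumes "\<And>g. g \<le> h \<Longrightarrow> pend g = 0"
  shows "pend_ok 0 h 0 pend"
  using assms unfolding pend_ok_def is_last_def al_def om_def by (auto split: if_splits)

lemma runs_init:
  assumes "\<And>g. g \<le> h \<Longrightarrow> lx g = 0"
  shows "runs_ok h 0 lx rs"
  using assms unfolding runs_ok_def run_ok_def om_def by simp

text \<open>Storing the new occurrence loses nothing. The checkpoint of an older one still waiting
  at level 0 would be later than \<kappa> - h, while the time is at most \<kappa> + h; the two would
  be closer than \<open>2 * h + len 0\<close>.\<close>

lemma pend_arrive:
  assumes ok: "pend_ok e gp \<kappa> pend" and e: "h \<noteq> 0 \<Longrightarrow> Suc e \<le> \<kappa> + h" and gp: "gp \<le> h" and "\<kappa> \<le> e"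
  shows "pend_ok (Suc e) gp \<kappa> (pend(0 := if Ev 0 (Suc e) then Suc (Suc e) else pend 0))"
    (is "pend_ok _ _ _ ?pend")
proof (cases "h = 0")
  case True
  have "pend 0 = Suc x \<longleftrightarrow> is_last (Ev 0) e x" for x using ok True unfolding pend_ok_def al_def by simp
  then have "?pend 0 = Suc x \<longleftrightarrow> is_last (Ev 0) (Suc e) x" for x
    by (auto simp: is_last_def le_Suc_eq)
  then show ?thesis using True unfolding pend_ok_def al_def by simp
next
  case False
  have a: "al (Suc e) gp \<kappa> g = (if g = 0 then Suc e else al e gp \<kappa> g)" for g by (simp add: al_def)
  have old: "pend g = Suc x \<longleftrightarrow> Ev g x \<and> x \<le> al e gp \<kappa> g \<and> om gp \<kappa> g < x + len g" if "g < h" for g x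
    using ok that by (simp add: pend_ok_def)
  have 0: "?pend 0 = Suc x \<longleftrightarrow> Ev 0 x \<and> x \<le> Suc e \<and> om gp \<kappa> 0 < x + len 0" for x
  proof (cases "Ev 0 (Suc e)")
    case True
    have "\<not> (Ev 0 y \<and> y \<le> e \<and> om gp \<kappa> 0 < y + len 0)" for y
    proof
      assume y: "Ev 0 y \<and> y \<le> e \<and> om gp \<kappa> 0 < y + len 0"
      then have "y + rho 0 \<le> Suc e" using gap[of 0 y "Suc e"] True by simp
      moreover have "\<kappa> - h \<le> om gp \<kappa> 0" by (simp add: om_def)
      moreover have "2 * h + len 0 \<le> rho 0" using room False by simp
      ultimately show False using y e False by linarith
    qed
    moreover have "om gp \<kappa> 0 < Suc e + len 0" using assms(4) by (auto simp: om_def)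
    ultimately show ?thesis using True by (auto simp: le_Suc_eq)
  next
    case False
    then show ?thesis using old[of 0] \<open>h \<noteq> 0\<close> by (auto simp: al_def le_Suc_eq)
  qed
  show ?thesis unfolding pend_ok_def a
  proof (intro conjI allI impI)
    fix g x assume g: "g < h"
    show "?pend g = Suc x \<longleftrightarrow> Ev g x \<and> x \<le> (if g = 0 then Suc e else al e gp \<kappa> g) \<and> om gp \<kappa> g < x + len g"
      using 0[of x] old[OF g, of x] by (cases "g = 0") simp_all
  next
    fix x
    show "?pend h = Suc x \<longleftrightarrow> is_last (Ev h) (if h = 0 then Suc e else al e gp \<kappa> h) x"
      using ok False by (simp add: pend_ok_def)
  qed
qed

text \<open>When a sweep begins \<open>h\<close> symbols after the previous one, levels visited
  before count as not yet visited now, and the two cases of \<open>om\<close> give the same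
  bound.\<close>

lemma om_reset: "\<kappa>' - h = \<kappa> \<Longrightarrow> g < h \<Longrightarrow> om 0 \<kappa>' g = om h \<kappa> g"
  by (simp add: om_def)

lemma pend_reset:
  assumes "pend_ok e h \<kappa> pend" "\<kappa>' - h = \<kappa>"
  shows "pend_ok e 0 \<kappa>' pend"
proof -
  have "al e 0 \<kappa>' g = al e h \<kappa> g" if "g \<le> h" for g
    using om_reset[OF assms(2), of "g - 1"] that by (auto simp: al_def)
  then show ?thesis using assms(1) om_reset[OF assms(2)] unfolding pend_ok_def by simp
qed

lemma runs_reset: "runs_ok h \<kappa> lx rs \<Longrightarrow> \<kappa>' - h = \<kappa> \<Longrightarrow> runs_ok 0 \<kappa>' lx rs"
  using om_reset unfolding runs_ok_def by simp

definition visit :: "nat \<Rightarrow> nat \<Rightarrow> (nat \<Rightarrow> nat) \<Rightarrow> (nat \<Rightarrow> nat)" where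
  "visit g \<kappa> pend = (case pend g of 0 \<Rightarrow> pend | Suc x \<Rightarrow>
     if x + len g \<le> \<kappa>
     then (if Ev (Suc g) (x + len g) then (pend(Suc g := Suc (x + len g)))(g := 0) else pend(g := 0))
     else pend)"

section \<open>The visit of one level\<close>

context
  fixes e g \<kappa> pend
  assumes ok: "pend_ok e g \<kappa> pend" and g: "g < h" and ke: "\<kappa> \<le> e"
begin

lemma old: "i < h \<Longrightarrow> pend i = Suc x \<longleftrightarrow> Ev i x \<and> x \<le> al e g \<kappa> i \<and> om g \<kappa> i < x + len i"
  using ok by (simp add: pend_ok_def)

lemma al_g: "\<kappa> \<le> al e g \<kappa> g"
  using ke by (simp add: al_def om_def)

text \<open>The checkpoints between the last two sweep starts are settled now, and an occurrence of
  the next level ending there extends an occurrence of level \<open>g\<close> that has been waiting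
  since.\<close>

lemma new_end:
  assumes "Ev (Suc g) y" "\<kappa> - h < y" "y \<le> \<kappa>"
  obtains x where "pend g = Suc x" "y = x + len g"
proof -
  have p: "len g \<le> y" "Ev g (y - len g)" using prev[OF g assms(1)] by auto
  have "pend g = Suc (y - len g)"
    using old[OF g, of "y - len g"] p assms al_g by (simp add: om_def)
  then show thesis by (rule that) (use p in simp)
qed

lemma visit_g:
  "visit g \<kappa> pend g = Suc x \<longleftrightarrow> Ev g x \<and> x \<le> al e g \<kappa> g \<and> \<kappa> < x + len g"
proof -
  have "visit g \<kappa> pend g = Suc x \<longleftrightarrow> pend g = Suc x \<and> \<kappa> < x + len g"
    by (auto simp: visit_def split: nat.split)
  also have "\<dots> \<longleftrightarrow> Ev g x \<and> x \<le> al e g \<kappa> g \<and> \<kappa> < x + len g"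
    using old[OF g, of x] by (auto simp: om_def)
  finally show ?thesis .
qed

lemma visit_other: "i \<noteq> g \<Longrightarrow> i \<noteq> Suc g \<Longrightarrow> visit g \<kappa> pend i = pend i"
  by (auto simp: visit_def split: nat.split)

lemma visit_next_cases:
  obtains x where "visit g \<kappa> pend (Suc g) = Suc (x + len g)" "Ev (Suc g) (x + len g)"
      "\<kappa> - h < x + len g" "x + len g \<le> \<kappa>"
      "\<And>y. Ev (Suc g) y \<Longrightarrow> y \<le> \<kappa> \<Longrightarrow> \<kappa> - h < y \<Longrightarrow> y = x + len g"
  | "visit g \<kappa> pend (Suc g) = pend (Suc g)" "\<And>y. Ev (Suc g) y \<Longrightarrow> y \<le> \<kappa> \<Longrightarrow> y \<le> \<kappa> - h"
proof (cases "\<exists>x. pend g = Suc x \<and> x + len g \<le> \<kappa> \<and> Ev (Suc g) (x + len g)")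
  case True
  then obtain x where x: "pend g = Suc x" "x + len g \<le> \<kappa>" "Ev (Suc g) (x + len g)" by blast
  show thesis
  proof (rule that(1))
    show "visit g \<kappa> pend (Suc g) = Suc (x + len g)" using x by (simp add: visit_def)
    show "\<kappa> - h < x + len g" using old[OF g, of x] x by (simp add: om_def)
    show "y = x + len g" if "Ev (Suc g) y" "y \<le> \<kappa>" "\<kappa> - h < y" for y
      using new_end[OF that(1,3,2)] x by auto
  qed (use x in auto)
next
  case False
  show thesis
  proof (rule that(2))
    show "visit g \<kappa> pend (Suc g) = pend (Suc g)" using False by (auto simp: visit_def split: nat.split)
    show "y \<le> \<kappa> - h" if y: "Ev (Suc g) y" "y \<le> \<kappa>" for y
    proof (rule ccontr)
      assume "\<not> y \<le> \<kappa> - h"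
      then obtain x where "pend g = Suc x" "y = x + len g" using new_end[OF y(1) _ y(2)] by auto
      then show False using False y by auto
    qed
  qed
qed

lemma visit_next:
  assumes "Suc g < h"
  shows "visit g \<kappa> pend (Suc g) = Suc y \<longleftrightarrow> Ev (Suc g) y \<and> y \<le> \<kappa> \<and> \<kappa> - h < y + len (Suc g)"
proof -
  have o: "pend (Suc g) = Suc y \<longleftrightarrow> Ev (Suc g) y \<and> y \<le> \<kappa> - h \<and> \<kappa> - h < y + len (Suc g)" for y
    using old[OF assms, of y] by (simp add: al_def om_def)
  show ?thesis
  proof (cases rule: visit_next_cases)
    case (1 x)
    have "y = x + len g" if y: "Ev (Suc g) y" "y \<le> \<kappa>" "\<kappa> - h < y + len (Suc g)"
    proof (rule ccontr)
      assume n: "y \<noteq> x + len g"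
      then have "y \<le> \<kappa> - h" using 1(5)[OF y(1,2)] by (meson not_le)
      \<comment> \<open>Two occurrences of level \<open>Suc g\<close> that need the slot at the same
        time would be closer than \<open>2 * h + len (Suc g)\<close>, which \<open>room\<close>
        excludes.\<close>
      then have "y + rho (Suc g) \<le> x + len g" using gap[of "Suc g" y "x + len g"] 1(2,3) y assms by simp
      then show False using room[OF assms] 1(3,4) y g by linarith
    qed
    moreover have "\<kappa> - h < x + len g + len (Suc g)" using 1(3) by simp
    ultimately show ?thesis using 1(1,2,4) by (metis nat.inject)
  next
    case 2
    then show ?thesis using o[of y] by (metis diff_le_self le_trans)
  qed
qed

lemma visit_last:
  assumes "Suc g = h"
  shows "visit g \<kappa> pend h = Suc y \<longleftrightarrow> is_last (Ev h) \<kappa> y"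
proof -
  have o: "pend h = Suc y \<longleftrightarrow> is_last (Ev h) (\<kappa> - h) y" for y
    using ok assms unfolding pend_ok_def by (auto simp: al_def om_def)
  show ?thesis
  proof (cases rule: visit_next_cases)
    case (1 x)
    have "is_last (Ev h) \<kappa> (x + len g)"
      unfolding is_last_def
    proof (intro conjI allI impI)
      fix y assume "Ev h y \<and> y \<le> \<kappa>"
      then show "y \<le> x + len g" using 1(5)[of y] 1(3) assms by (cases "\<kappa> - h < y") auto
    qed (use 1(2,4) assms in auto)
    then show ?thesis using 1(1) is_last_unique assms by (metis nat.inject)
  next
    case 2
    have "Ev h y \<and> y \<le> \<kappa> \<longleftrightarrow> Ev h y \<and> y \<le> \<kappa> - h" for y
      using 2(2)[of y] assms by (auto intro: le_trans)
    then have "is_last (Ev h) \<kappa> y \<longleftrightarrow> is_last (Ev h) (\<kappa> - h) y"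
      unfolding is_last_def by metis
    then show ?thesis using 2(1) o assms by simp
  qed
qed

lemma pend_visit: "pend_ok e (Suc g) \<kappa> (visit g \<kappa> pend)"
  unfolding pend_ok_def
proof (intro conjI allI impI)
  fix i x assume i: "i < h"
  consider "i = g" | "i = Suc g" | "i \<noteq> g" "i \<noteq> Suc g" by blast
  then show "visit g \<kappa> pend i = Suc x \<longleftrightarrow> Ev i x \<and> x \<le> al e (Suc g) \<kappa> i \<and> om (Suc g) \<kappa> i < x + len i"
  proof cases
    case 1
    have "al e (Suc g) \<kappa> g = al e g \<kappa> g" by (auto simp: al_def om_def)
    then show ?thesis using visit_g[of x] 1 by (simp add: om_def)
  next
    case 2
    then show ?thesis using visit_next[of x] i by (simp add: om_def al_def)
  next
    case 3
    then have "al e (Suc g) \<kappa> i = al e g \<kappa> i" "om (Suc g) \<kappa> i = om g \<kappa> i" by (auto simp: al_def om_def)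
    then show ?thesis using old[OF i, of x] visit_other[OF 3] by simp
  qed
next
  fix x
  show "visit g \<kappa> pend h = Suc x \<longleftrightarrow> is_last (Ev h) (al e (Suc g) \<kappa> h) x"
  proof (cases "Suc g = h")
    case True
    then have "al e (Suc g) \<kappa> h = \<kappa>" by (auto simp: al_def om_def)
    then show ?thesis using visit_last[OF True, of x] by simp
  next
    case False
    then have "al e (Suc g) \<kappa> h = al e g \<kappa> h" using g by (auto simp: al_def om_def)
    then show ?thesis using ok visit_other[of h] False g by (simp add: pend_ok_def)
  qed
qed

text \<open>A chain continues exactly if the new occurrence lies \<open>rho g\<close> after the
  latest known one: occurrences are never closer, and every earlier one is already known to this
  level. The comparison is with \<open>Suc x\<close> because \<open>lx\<close> stores an end plus
  one.\<close>

lemma run_visit: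
  assumes k: "kind g = 0" and rn: "run_ok g (\<kappa> - h) (rho g) lx rs"
  shows "run_ok g \<kappa> (rho g)
     (case pend g of 0 \<Rightarrow> lx | Suc x \<Rightarrow> if x \<le> \<kappa> then Suc x else lx)
     (case pend g of 0 \<Rightarrow> rs | Suc x \<Rightarrow> if x \<le> \<kappa> \<and> \<not> (lx \<noteq> 0 \<and> lx + rho g = Suc x) then x else rs)"
proof (cases "\<exists>x. pend g = Suc x \<and> x \<le> \<kappa>")
  case False
  have "Ev g y \<Longrightarrow> y \<le> \<kappa> \<Longrightarrow> y \<le> \<kappa> - h" for y
    using old[OF g, of y] run_len[OF g k] al_g False by (auto simp: om_def)
  then have "Ev g y \<and> y \<le> \<kappa> \<longleftrightarrow> Ev g y \<and> y \<le> \<kappa> - h" for y by (auto intro: le_trans)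
  then have "is_last (Ev g) \<kappa> y \<longleftrightarrow> is_last (Ev g) (\<kappa> - h) y" for y
    unfolding is_last_def by metis
  then have "run_ok g \<kappa> (rho g) lx rs" using rn by (simp add: run_ok_def)
  moreover have "(case pend g of 0 \<Rightarrow> lx | Suc x \<Rightarrow> if x \<le> \<kappa> then Suc x else lx) = lx"
    using False by (auto split: nat.split)
  moreover have "(case pend g of 0 \<Rightarrow> rs | Suc x \<Rightarrow> if x \<le> \<kappa> \<and> \<not> (lx \<noteq> 0 \<and> lx + rho g = Suc x) then x else rs) = rs"
    using False by (auto split: nat.split)
  ultimately show ?thesis by simp
next
  case True
  then obtain x where x: "pend g = Suc x" "x \<le> \<kappa>" by blast
  have Ex: "Ev g x" "\<kappa> - h < x" using old[OF g, of x] x run_len[OF g k] by (auto simp: om_def)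
  have only: "y = x" if "Ev g y" "y \<le> \<kappa>" "\<kappa> - h < y" for y
    using old[OF g, of y] that x run_len[OF g k] al_g by (auto simp: om_def)
  have last: "is_last (Ev g) \<kappa> x" unfolding is_last_def
  proof (intro conjI allI impI)
    fix y assume "Ev g y \<and> y \<le> \<kappa>"
    then show "y \<le> x" using only[of y] Ex by (cases "\<kappa> - h < y") auto
  qed (use Ex x in auto)
  have before: "y \<le> \<kappa> - h" if "Ev g y" "y < x" for y
    using gap[of g y x] that Ex x room[OF g] g by linarith
  have rho: "1 \<le> rho g" using room[OF g] g by linarith
  define rs' where "rs' = (if \<not> (lx \<noteq> 0 \<and> lx + rho g = Suc x) then x else rs)"
  have "rs' + t * rho g \<le> x \<longleftrightarrow> (\<forall>k\<le>t. k * rho g \<le> x \<and> Ev g (x - k * rho g))" for t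
  proof (cases "lx \<noteq> 0 \<and> lx + rho g = Suc x")
    case True
    then obtain y where y: "lx = Suc y" "x = y + rho g" by (cases lx) auto
    have r: "rs + t * rho g \<le> y \<longleftrightarrow> (\<forall>k\<le>t. k * rho g \<le> y \<and> Ev g (y - k * rho g))" for t
      using rn y by (simp add: run_ok_def)
    have "Ev g y" using rn y by (auto simp: run_ok_def is_last_def)
    show ?thesis
    proof (cases t)
      case 0
      have "rs \<le> y" using r[of 0] \<open>Ev g y\<close> by simp
      then show ?thesis using 0 True y Ex by (simp add: rs'_def)
    next
      case (Suc t')
      have "rs' + t * rho g \<le> x \<longleftrightarrow> rs + t' * rho g \<le> y" using True y Suc by (simp add: rs'_def)
      also have "\<dots> \<longleftrightarrow> (\<forall>k\<le>t'. k * rho g \<le> y \<and> Ev g (y - k * rho g))" by (rule r)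
      also have "\<dots> \<longleftrightarrow> (\<forall>k\<le>t'. Suc k * rho g \<le> x \<and> Ev g (x - Suc k * rho g))" using y by simp
      also have "\<dots> \<longleftrightarrow> (\<forall>k\<le>t. k * rho g \<le> x \<and> Ev g (x - k * rho g))"
        unfolding Suc all_le_Suc using Ex by simp
      finally show ?thesis .
    qed
  next
    case False
    then have rs': "rs' = x" by (simp add: rs'_def)
    have no: "\<not> (rho g \<le> x \<and> Ev g (x - rho g))"
    proof
      assume A: "rho g \<le> x \<and> Ev g (x - rho g)"
      then have b: "x - rho g \<le> \<kappa> - h" using before rho by simp
      have "is_last (Ev g) (\<kappa> - h) (x - rho g)"
        unfolding is_last_def using A b
      proof (intro conjI allI impI)
        fix y assume y: "Ev g y \<and> y \<le> \<kappa> - h"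
        show "y \<le> x - rho g" using gap[of g y x] y Ex g by linarith
      qed auto
      then have "lx = Suc (x - rho g)" using rn by (simp add: run_ok_def)
      then show False using False A by simp
    qed
    show ?thesis
    proof (cases "t = 0")
      case True
      then show ?thesis using rs' Ex by simp
    next
      case t: False
      have "\<not> rs' + t * rho g \<le> x" using rs' t rho by simp
      moreover have "\<not> (\<forall>k\<le>t. k * rho g \<le> x \<and> Ev g (x - k * rho g))"
      proof
        assume "\<forall>k\<le>t. k * rho g \<le> x \<and> Ev g (x - k * rho g)"
        then have "1 * rho g \<le> x \<and> Ev g (x - 1 * rho g)" by (rule allE[of _ 1]) (use t in simp)
        then show False using no by simp
      qed
      ultimately show ?thesis by blast
    qed
  qed
  then have "run_ok g \<kappa> (rho g) (Suc x) rs'"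
    using last is_last_unique by (auto simp: run_ok_def)
  then show ?thesis using x by (simp add: rs'_def)
qed

end

text \<open>By now the top level knows every occurrence that ended at least \<open>2 * h\<close>
  symbols ago. A later one would end more than \<open>d\<close> further on, hence after
  \<open>e\<close>; so the one in question is the latest.\<close>

lemma tail_pend:
  assumes ok: "pend_ok e gp \<kappa> pend" and ke: "\<kappa> \<le> e" "h \<noteq> 0 \<Longrightarrow> e < \<kappa> + h" and "gp \<le> h"
    and d: "d \<le> e" "2 * h \<le> d" "d < rho h"
  shows "pend h = Suc (e - d) \<longleftrightarrow> Ev h (e - d)"
proof -
  have "is_last (Ev h) (al e gp \<kappa> h) (e - d)" if E: "Ev h (e - d)"
    unfolding is_last_def
  proof (intro conjI allI impI E)
    show "e - d \<le> al e gp \<kappa> h" using ke d by (auto simp: al_def om_def)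
    fix y assume y: "Ev h y \<and> y \<le> al e gp \<kappa> h"
    then have "y \<le> e" using ke by (auto simp: al_def om_def split: if_splits)
    then show "y \<le> e - d" using gap[of h "e - d" y] y E d by (cases "y \<le> e - d") auto
  qed
  then show ?thesis using ok by (auto simp: pend_ok_def is_last_def)
qed

end

section \<open>A structured language and its compilation\<close>

text \<open>Memory consists of \<open>TD\<close> temporaries, then \<open>NR\<close> registers, and the heap from cell \<open>KC\<close> on;
  \<open>AK\<close> arrays share the heap by interleaving.\<close>

definition TD :: nat where "TD = 40"
definition NR :: nat where "NR = 80"
definition KC :: nat where "KC = TD + NR"
definition AK :: nat where "AK = 20"

text \<open>Registers and heap as total functions into unbounded naturals. Overflow and range
  conditions are kept apart, in \<open>ok\<close> and \<open>cok\<close>, so that values can be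
  computed without a word size.\<close>

type_synonym st = "(nat \<Rightarrow> nat) \<times> (nat \<Rightarrow> nat)"

datatype aop = Pl | Ti | Di | Mo | Sh

datatype exp = N nat | V nat | Ld exp | B aop exp exp | Sb exp exp | Lt exp exp
  | Ite exp exp exp | Lst nat exp exp

datatype com = Skip | Asg nat exp | Sto exp exp | Sq com com | If exp com com | For nat nat exp com

fun aval :: "aop \<Rightarrow> nat \<Rightarrow> nat \<Rightarrow> nat" where
  "aval Pl x y = x + y"
| "aval Ti x y = x * y"
| "aval Di x y = x div y"
| "aval Mo x y = x mod y"
| "aval Sh x y = x * 2 ^ y"

fun bop :: "aop \<Rightarrow> binop" where
  "bop Pl = Add" | "bop Ti = Mul" | "bop Di = Div" | "bop Mo = Mod" | "bop Sh = Shl"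

definition setr :: "nat \<Rightarrow> nat \<Rightarrow> st \<Rightarrow> st" where
  "setr x v s = ((fst s)(x := v), snd s)"

definition seth :: "nat \<Rightarrow> nat \<Rightarrow> st \<Rightarrow> st" where
  "seth a v s = (fst s, (snd s)(a := v))"

primrec ev :: "exp \<Rightarrow> st \<Rightarrow> nat" where
  "ev (N k) s = k"
| "ev (V x) s = fst s x"
| "ev (Ld e) s = snd s (ev e s)"
| "ev (B q a b) s = aval q (ev a s) (ev b s)"
| "ev (Sb a b) s = ev a s - ev b s"
| "ev (Lt a b) s = (if ev a s < ev b s then 1 else 0)"
| "ev (Ite c a b) s = (if ev c s \<noteq> 0 then ev a s else ev b s)"
| "ev (Lst x b e) s = (LEAST v. v \<ge> ev b s \<or> ev e (setr x v s) \<noteq> 0)"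

text \<open>No intermediate result overflows and every access stays inside the \<open>J\<close> heap cells.\<close>

primrec ok :: "nat \<Rightarrow> nat \<Rightarrow> exp \<Rightarrow> st \<Rightarrow> bool" where
  "ok w J (N k) s \<longleftrightarrow> k < 2 ^ w"
| "ok w J (V x) s \<longleftrightarrow> True"
| "ok w J (Ld e) s \<longleftrightarrow> ok w J e s \<and> ev e s < J"
| "ok w J (B q a b) s \<longleftrightarrow> ok w J a s \<and> ok w J b s \<and> aval q (ev a s) (ev b s) < 2 ^ w"
| "ok w J (Sb a b) s \<longleftrightarrow> ok w J a s \<and> ok w J b s"
| "ok w J (Lt a b) s \<longleftrightarrow> ok w J a s \<and> ok w J b s"
| "ok w J (Ite c a b) s \<longleftrightarrow> ok w J c s \<and> (if ev c s \<noteq> 0 then ok w J a s else ok w J b s)"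
| "ok w J (Lst x b e) s \<longleftrightarrow> ok w J b s \<and>
     (\<forall>v<ev b s. (\<forall>u<v. ev e (setr x u s) = 0) \<longrightarrow> ok w J e (setr x v s))"

text \<open>\<open>For\<close> evaluates its bound once, into register \<open>y\<close>, and leaves
  \<open>x\<close> at the bound, just as the compiled loop does.\<close>

primrec cex :: "com \<Rightarrow> st \<Rightarrow> st" where
  "cex Skip s = s"
| "cex (Asg x e) s = setr x (ev e s) s"
| "cex (Sto a e) s = seth (ev a s) (ev e s) s"
| "cex (Sq c d) s = cex d (cex c s)"
| "cex (If e c d) s = (if ev e s \<noteq> 0 then cex c s else cex d s)"
| "cex (For x y e c) s = setr x (ev e s)
     (fold (\<lambda>j s. cex c (setr x j s)) [0..<ev e s] (setr y (ev e s) s))"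

primrec cok :: "nat \<Rightarrow> nat \<Rightarrow> com \<Rightarrow> st \<Rightarrow> bool" where
  "cok w J Skip s \<longleftrightarrow> True"
| "cok w J (Asg x e) s \<longleftrightarrow> ok w J e s"
| "cok w J (Sto a e) s \<longleftrightarrow> ok w J a s \<and> ok w J e s \<and> ev a s < J"
| "cok w J (Sq c d) s \<longleftrightarrow> cok w J c s \<and> cok w J d (cex c s)"
| "cok w J (If e c d) s \<longleftrightarrow> ok w J e s \<and> (if ev e s \<noteq> 0 then cok w J c s else cok w J d s)"
| "cok w J (For x y e c) s \<longleftrightarrow> ok w J e s \<and> (\<forall>j<ev e s. cok w J c
     (setr x j (fold (\<lambda>j s. cex c (setr x j s)) [0..<j] (setr y (ev e s) s))))"

subsection \<open>Compilation\<close>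

primrec clen :: "exp \<Rightarrow> nat" where
  "clen (N k) = 1"
| "clen (V x) = 2"
| "clen (Ld e) = clen e + 3"
| "clen (B q a b) = clen a + clen b + 1"
| "clen (Sb a b) = clen a + clen b + 4"
| "clen (Lt a b) = clen a + clen b + 4"
| "clen (Ite c a b) = clen c + clen a + clen b + 3"
| "clen (Lst x b e) = clen b + clen e + 13"

text \<open>The value ends up in cell \<open>k\<close>; operands are evaluated in \<open>k\<close>,
  \<open>k + 1\<close> and so on, as on a stack. Jumps are absolute, hence the parameter
  \<open>pc\<close>. Copying a cell is done by adding 0.\<close>

primrec comp :: "exp \<Rightarrow> nat \<Rightarrow> nat \<Rightarrow> instr list" where
  "comp (N n) pc k = [Const k n]"
| "comp (V x) pc k = [Const k 0, Arith Add k (TD + x) k]"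
| "comp (Ld e) pc k = comp e pc k @ [Const (k+1) KC, Arith Add k k (k+1), Load k k]"
| "comp (B q a b) pc k = comp a pc k @ comp b (pc + clen a) (k+1) @ [Arith (bop q) k k (k+1)]"
| "comp (Sb a b) pc k = comp a pc k @ comp b (pc + clen a) (k+1) @
     [Jump_less k (k+1) (pc + clen a + clen b + 3), Arith Sub k k (k+1),
      Jump (pc + clen a + clen b + 4), Const k 0]"
| "comp (Lt a b) pc k = comp a pc k @ comp b (pc + clen a) (k+1) @
     [Jump_less k (k+1) (pc + clen a + clen b + 3), Const k 0,
      Jump (pc + clen a + clen b + 4), Const k 1]"
| "comp (Ite c a b) pc k = comp c pc k @
     [Const (k+1) 0, Jump_less (k+1) k (pc + clen c + 3 + clen b)] @
     comp b (pc + clen c + 2) k @ [Jump (pc + clen c + 3 + clen b + clen a)] @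
     comp a (pc + clen c + 3 + clen b) k"
| "comp (Lst x b e) pc k = comp b pc k @
     [Const (k+1) 0, Arith Add (k+1) (TD+x) (k+1), Const (TD+x) 0,
      Jump_less (TD+x) k (pc + clen b + 5), Jump (pc + clen b + clen e + 10)] @
     comp e (pc + clen b + 5) (k+2) @
     [Const (k+3) 0, Jump_less (k+3) (k+2) (pc + clen b + clen e + 10), Const (k+3) 1,
      Arith Add (TD+x) (TD+x) (k+3), Jump (pc + clen b + 3),
      Const (k+2) 0, Arith Add k (TD+x) (k+2), Arith Add (TD+x) (k+1) (k+2)]"

primrec wf :: "exp \<Rightarrow> nat \<Rightarrow> bool" where
  "wf (N n) k \<longleftrightarrow> k < TD"
| "wf (V x) k \<longleftrightarrow> k < TD \<and> x < NR"
| "wf (Ld e) k \<longleftrightarrow> k + 1 < TD \<and> wf e k"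
| "wf (B q a b) k \<longleftrightarrow> wf a k \<and> wf b (k+1)"
| "wf (Sb a b) k \<longleftrightarrow> wf a k \<and> wf b (k+1)"
| "wf (Lt a b) k \<longleftrightarrow> wf a k \<and> wf b (k+1)"
| "wf (Ite c a b) k \<longleftrightarrow> k + 1 < TD \<and> wf c k \<and> wf a k \<and> wf b k"
| "wf (Lst x b e) k \<longleftrightarrow> k + 3 < TD \<and> x < NR \<and> wf b k \<and> wf e (k+2)"

text \<open>Without the search \<open>Lst\<close> all jumps go forward, and the length of the code
  bounds the running time.\<close>

primrec lf :: "exp \<Rightarrow> bool" where
  "lf (N n) \<longleftrightarrow> True"
| "lf (V x) \<longleftrightarrow> True"
| "lf (Ld e) \<longleftrightarrow> lf e"
| "lf (B q a b) \<longleftrightarrow> lf a \<and> lf b"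
| "lf (Sb a b) \<longleftrightarrow> lf a \<and> lf b"
| "lf (Lt a b) \<longleftrightarrow> lf a \<and> lf b"
| "lf (Ite c a b) \<longleftrightarrow> lf c \<and> lf a \<and> lf b"
| "lf (Lst x b e) \<longleftrightarrow> False"

primrec cclen :: "com \<Rightarrow> nat" where
  "cclen Skip = 0"
| "cclen (Asg x e) = clen e + 2"
| "cclen (Sto a e) = clen a + clen e + 3"
| "cclen (Sq c d) = cclen c + cclen d"
| "cclen (If e c d) = clen e + cclen c + cclen d + 3"
| "cclen (For x y e c) = clen e + cclen c + 8"

primrec ccomp :: "com \<Rightarrow> nat \<Rightarrow> instr list" where
  "ccomp Skip pc = []"
| "ccomp (Asg x e) pc = comp e pc 1 @ [Const 2 0, Arith Add (TD+x) 1 2]"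
| "ccomp (Sto a e) pc = comp a pc 1 @ comp e (pc + clen a) 2 @
     [Const 3 KC, Arith Add 1 1 3, Store 1 2]"
| "ccomp (Sq c d) pc = ccomp c pc @ ccomp d (pc + cclen c)"
| "ccomp (If e c d) pc = comp e pc 1 @
     [Const 2 0, Jump_less 2 1 (pc + clen e + 3 + cclen d)] @
     ccomp d (pc + clen e + 2) @ [Jump (pc + clen e + 3 + cclen d + cclen c)] @
     ccomp c (pc + clen e + 3 + cclen d)"
| "ccomp (For x y e c) pc = comp e pc 1 @
     [Const 2 0, Arith Add (TD+y) 1 2, Const (TD+x) 0,
      Jump_less (TD+x) (TD+y) (pc + clen e + 5), Jump (pc + clen e + cclen c + 8)] @
     ccomp c (pc + clen e + 5) @
     [Const 2 1, Arith Add (TD+x) (TD+x) 2, Jump (pc + clen e + 3)]"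

primrec asgd :: "com \<Rightarrow> nat set" where
  "asgd Skip = {}"
| "asgd (Asg x e) = {x}"
| "asgd (Sto a e) = {}"
| "asgd (Sq c d) = asgd c \<union> asgd d"
| "asgd (If e c d) = asgd c \<union> asgd d"
| "asgd (For x y e c) = insert x (insert y (asgd c))"

primrec cwf :: "com \<Rightarrow> bool" where
  "cwf Skip \<longleftrightarrow> True"
| "cwf (Asg x e) \<longleftrightarrow> wf e 1 \<and> x < NR"
| "cwf (Sto a e) \<longleftrightarrow> wf a 1 \<and> wf e 2"
| "cwf (Sq c d) \<longleftrightarrow> cwf c \<and> cwf d"
| "cwf (If e c d) \<longleftrightarrow> wf e 1 \<and> cwf c \<and> cwf d"
| "cwf (For x y e c) \<longleftrightarrow> wf e 1 \<and> x < NR \<and> y < NR \<and> x \<noteq> y \<and> x \<notin> asgd c \<and> y \<notin> asgd c \<and> cwf c"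

primrec clf :: "com \<Rightarrow> bool" where
  "clf Skip \<longleftrightarrow> True"
| "clf (Asg x e) \<longleftrightarrow> lf e"
| "clf (Sto a e) \<longleftrightarrow> lf a \<and> lf e"
| "clf (Sq c d) \<longleftrightarrow> clf c \<and> clf d"
| "clf (If e c d) \<longleftrightarrow> lf e \<and> clf c \<and> clf d"
| "clf (For x y e c) \<longleftrightarrow> False"

lemma length_comp [simp]: "length (comp e pc k) = clen e"
  by (induction e arbitrary: pc k) auto

lemma length_ccomp [simp]: "length (ccomp c pc) = cclen c"
  by (induction c arbitrary: pc) auto

subsection \<open>Correctness of the compilation\<close>

lemma run_add: "run w Q (a + b) c = bind_pmf (run w Q a c) (run w Q b)"
  by (induction a arbitrary: c) (auto simp: bind_return_pmf bind_assoc_pmf intro!: bind_pmf_cong)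

definition rt :: "nat \<Rightarrow> prog \<Rightarrow> nat \<Rightarrow> config \<Rightarrow> config \<Rightarrow> bool" where
  "rt w Q t c c' \<longleftrightarrow> run w Q t c = return_pmf c'"

lemma rt_0 [simp]: "rt w Q 0 c c' \<longleftrightarrow> c = c'"
  by (auto simp: rt_def)

lemma rt_trans: "rt w Q a c c' \<Longrightarrow> rt w Q b c' c'' \<Longrightarrow> rt w Q (a + b) c c''"
  by (simp add: rt_def run_add bind_return_pmf)

lemma rt_Suc:
  assumes "exec w (Q ! pc) (pc, M) = return_pmf c'" "pc < length Q" "rt w Q t c' c''"
  shows "rt w Q (Suc t) (pc, M) c''"
  using assms by (simp add: rt_def step_def halted_def bind_return_pmf)

definition code_at :: "prog \<Rightarrow> nat \<Rightarrow> instr list \<Rightarrow> bool" where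
  "code_at Q pc xs \<longleftrightarrow> (\<forall>i<length xs. pc + i < length Q \<and> Q ! (pc + i) = xs ! i)"

lemma code_at_Nil [simp]: "code_at Q pc []"
  by (simp add: code_at_def)

lemma code_at_Cons [simp]:
  "code_at Q pc (x # xs) \<longleftrightarrow> pc < length Q \<and> Q ! pc = x \<and> code_at Q (Suc pc) xs"
proof
  assume L: "code_at Q pc (x # xs)"
  have "pc + Suc i < length Q \<and> Q ! (pc + Suc i) = xs ! i" if "i < length xs" for i
    using L[unfolded code_at_def, rule_format, of "Suc i"] that by simp
  then show "pc < length Q \<and> Q ! pc = x \<and> code_at Q (Suc pc) xs"
    using L[unfolded code_at_def, rule_format, of 0] by (simp add: code_at_def)
next
  assume "pc < length Q \<and> Q ! pc = x \<and> code_at Q (Suc pc) xs"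
  then show "code_at Q pc (x # xs)"
    unfolding code_at_def by (metis Suc_less_eq add_Suc_shift length_Cons not0_implies_Suc nth_Cons_0 nth_Cons_Suc add_0_right)
qed

lemma code_at_append [simp]:
  "code_at Q pc (xs @ ys) \<longleftrightarrow> code_at Q pc xs \<and> code_at Q (pc + length xs) ys"
  by (induction xs arbitrary: pc) auto

definition sim :: "nat \<Rightarrow> nat \<Rightarrow> st \<Rightarrow> memory \<Rightarrow> bool" where
  "sim w J s M \<longleftrightarrow> length M = KC + J \<and> KC + J \<le> 2 ^ w \<and>
     (\<forall>x<NR. M ! (TD + x) = fst s x) \<and> (\<forall>a<J. M ! (KC + a) = snd s a) \<and>
     (\<forall>i<length M. M ! i < 2 ^ w)"

lemma eval_aop: "x < 2 ^ w \<Longrightarrow> aval q x y < 2 ^ w \<Longrightarrow> eval_op w (bop q) x y = aval q x y"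
  by (cases q) (auto simp: push_bit_nat_def)

lemma sim_temp: "sim w J s M \<Longrightarrow> k < TD \<Longrightarrow> v < 2 ^ w \<Longrightarrow> sim w J s (M[k := v])"
  by (auto simp: sim_def nth_list_update KC_def)

lemma sim_reg: "sim w J s M \<Longrightarrow> x < NR \<Longrightarrow> v < 2 ^ w \<Longrightarrow> sim w J (setr x v s) (M[TD + x := v])"
  by (auto simp: sim_def nth_list_update KC_def setr_def)

lemma sim_heap: "sim w J s M \<Longrightarrow> a < J \<Longrightarrow> v < 2 ^ w \<Longrightarrow> sim w J (seth a v s) (M[KC + a := v])"
  by (auto simp: sim_def nth_list_update KC_def seth_def)

lemma sim_D:
  assumes "sim w J s M"
  shows "k < TD \<Longrightarrow> k < length M" "x < NR \<Longrightarrow> TD + x < length M" "a < J \<Longrightarrow> KC + a < length M"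
    "x < NR \<Longrightarrow> M ! (TD + x) = fst s x" "a < J \<Longrightarrow> M ! (KC + a) = snd s a"
    "x < NR \<Longrightarrow> fst s x < 2 ^ w" "a < J \<Longrightarrow> snd s a < 2 ^ w"
    "k < TD \<Longrightarrow> M ! k < 2 ^ w" "KC + J \<le> 2 ^ w"
  using assms unfolding sim_def KC_def by (auto, (metis add_less_cancel_left trans_less_add1 add.assoc)+)

text \<open>Straight-line code is deterministic and advances the program counter uniformly, so a
  block of it is evaluated by folding its effect on the memory.\<close>

fun mx :: "nat \<Rightarrow> instr \<Rightarrow> memory \<Rightarrow> memory" where
  "mx w (Const i k) M = M[i := k mod 2 ^ w]"
| "mx w (Arith b i j k) M = M[i := eval_op w b (rd M j) (rd M k)]"
| "mx w (Load i j) M = M[i := rd M (rd M j)]"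
| "mx w (Store i j) M = M[rd M i := rd M j]"
| "mx w _ M = M"

fun simple :: "instr \<Rightarrow> bool" where
  "simple (Rand i) = False"
| "simple (Jump l) = False"
| "simple (Jump_less i j l) = False"
| "simple _ = True"

lemma rt_simple:
  "code_at Q pc xs \<Longrightarrow> list_all simple xs \<Longrightarrow>
   rt w Q (length xs) (pc, M) (pc + length xs, fold (mx w) xs M)"
proof (induction xs arbitrary: pc M)
  case (Cons x xs)
  have "exec w (Q ! pc) (pc, M) = return_pmf (Suc pc, mx w x M)"
    using Cons.prems by (cases x) auto
  from rt_Suc[OF this _ Cons.IH] Cons.prems show ?case by simp
qed simp

lemma rt_jump:
  assumes "pc < length Q" "Q ! pc = Jump l"
  shows "rt w Q 1 (pc, M) (l, M)"
  using rt_Suc[of w Q pc M "(l, M)" 0 "(l, M)"] assms by simp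

lemma rt_jump_less:
  assumes "pc < length Q" "Q ! pc = Jump_less i j l"
  shows "rt w Q 1 (pc, M) (if rd M i < rd M j then l else Suc pc, M)"
  using rt_Suc[of w Q pc M _ 0] assms by simp

text \<open>Protects the lower part of the evaluation stack while an operand is evaluated from cell
  \<open>k\<close> on.\<close>

definition upto_eq :: "nat \<Rightarrow> memory \<Rightarrow> memory \<Rightarrow> bool" where
  "upto_eq k M M' \<longleftrightarrow> (\<forall>i<k. M' ! i = M ! i)"

lemma upto_eq_refl [simp]: "upto_eq k M M"
  by (simp add: upto_eq_def)

lemma upto_eq_trans: "upto_eq k M M' \<Longrightarrow> upto_eq k' M' M'' \<Longrightarrow> k \<le> k' \<Longrightarrow> upto_eq k M M''"
  by (simp add: upto_eq_def)

lemma upto_eq_upd: "upto_eq k M M' \<Longrightarrow> k \<le> i \<Longrightarrow> upto_eq k M (M'[i := v])"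
  by (simp add: upto_eq_def)

lemma upto_eq_nth: "upto_eq k M M' \<Longrightarrow> i < k \<Longrightarrow> M' ! i = M ! i"
  by (simp add: upto_eq_def)

lemma wf_less: "wf e k \<Longrightarrow> k < TD"
  by (induction e arbitrary: k) force+

lemma sim_setr_same: "sim w J s M \<Longrightarrow> setr x (fst s x) s = s"
  by (simp add: setr_def)

lemma setr_setr [simp]: "setr x u (setr x v s) = setr x u s"
  by (simp add: setr_def)

lemma sim_rd:
  assumes "sim w J s M"
  shows "k < TD \<Longrightarrow> rd M k = M ! k" "x < NR \<Longrightarrow> rd M (TD + x) = fst s x"
    "a < J \<Longrightarrow> rd M (KC + a) = snd s a"
  using sim_D[OF assms] by (auto simp: rd_def)

lemma ok_less: "ok w J e s \<Longrightarrow> sim w J s M \<Longrightarrow> wf e k \<Longrightarrow> ev e s < 2 ^ w"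
proof (induction e arbitrary: k s M)
  case (Sb a b)
  then show ?case by simp (meson less_imp_diff_less)
next
  case (Lt a b)
  have "(1::nat) < 2 ^ w \<or> 2 ^ w = (1::nat)" by (metis less_one linorder_neqE_nat one_le_numeral one_le_power not_less)
  moreover have "KC \<le> 2 ^ w" using Lt.prems by (auto simp: sim_def)
  then have "2 ^ w \<noteq> (1::nat)" unfolding KC_def TD_def by linarith
  ultimately show ?case by auto
next
  case (Lst x b e)
  have "ev (Lst x b e) s \<le> ev b s" by (auto intro: Least_le)
  also have "\<dots> < 2 ^ w" using Lst.IH(1)[of s M k] Lst.prems by simp
  finally show ?case .
qed (auto simp: sim_D split: if_splits)

text \<open>A time bound is claimed for loop-free code only; the searches of the preprocessing
  merely have to terminate.\<close>

definition compiled :: "nat \<Rightarrow> nat \<Rightarrow> exp \<Rightarrow> bool" where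
  "compiled w J e \<longleftrightarrow> (\<forall>Q pc k s M. code_at Q pc (comp e pc k) \<longrightarrow> sim w J s M \<longrightarrow>
     ok w J e s \<longrightarrow> wf e k \<longrightarrow>
     (\<exists>t M'. rt w Q t (pc, M) (pc + clen e, M') \<and> sim w J s M' \<and> M' ! k = ev e s \<and>
       upto_eq k M M' \<and> (lf e \<longrightarrow> t \<le> clen e)))"

lemma compiledD:
  assumes "compiled w J e" "code_at Q pc (comp e pc k)" "sim w J s M" "ok w J e s" "wf e k"
  obtains t M' where "rt w Q t (pc, M) (pc + clen e, M')" "sim w J s M'" "M' ! k = ev e s"
    "upto_eq k M M'" "lf e \<Longrightarrow> t \<le> clen e"
  using assms unfolding compiled_def by blast

lemma TD_less: "sim w J s M \<Longrightarrow> k \<le> TD \<Longrightarrow> k < 2 ^ w"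
  by (simp add: sim_def KC_def NR_def)

lemma compiled_binary:
  assumes "compiled w J a" "compiled w J b"
    and "code_at Q pc (comp a pc k @ comp b (pc + clen a) (k+1))"
    and "sim w J s M" "ok w J a s" "ok w J b s" "wf a k" "wf b (k+1)"
  obtains t M' where "rt w Q t (pc, M) (pc + clen a + clen b, M')" "sim w J s M'"
    "M' ! k = ev a s" "M' ! (k+1) = ev b s" "upto_eq k M M'" "lf a \<Longrightarrow> lf b \<Longrightarrow> t \<le> clen a + clen b"
proof -
  obtain t1 M1 where 1: "rt w Q t1 (pc, M) (pc + clen a, M1)" "sim w J s M1" "M1 ! k = ev a s"
    "upto_eq k M M1" "lf a \<Longrightarrow> t1 \<le> clen a"
    using compiledD[OF assms(1), of Q pc k s M] assms by auto
  obtain t2 M2 where 2: "rt w Q t2 (pc + clen a, M1) (pc + clen a + clen b, M2)" "sim w J s M2"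
    "M2 ! (k+1) = ev b s" "upto_eq (k+1) M1 M2" "lf b \<Longrightarrow> t2 \<le> clen b"
    using compiledD[OF assms(2), of Q "pc + clen a" "k+1" s M1] assms 1(2) by auto
  show thesis
  proof (rule that[of "t1 + t2" M2])
    show "M2 ! k = ev a s" using 2(4) 1(3) by (simp add: upto_eq_def)
    show "upto_eq k M M2" by (rule upto_eq_trans[OF 1(4) 2(4)]) simp
  qed (use 1 2 rt_trans add_mono in auto)
qed

lemma compiled_N: "compiled w J (N n)"
  unfolding compiled_def
proof (intro allI impI)
  fix Q pc k s M
  assume A: "code_at Q pc (comp (N n) pc k)" "sim w J s M" "ok w J (N n) s" "wf (N n) k"
  have "rt w Q 1 (pc, M) (pc + 1, M[k := n])"
    using rt_simple[OF A(1), of w M] A(3) by simp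
  then show "\<exists>t M'. rt w Q t (pc, M) (pc + clen (N n), M') \<and> sim w J s M' \<and> M' ! k = ev (N n) s \<and>
       upto_eq k M M' \<and> (lf (N n) \<longrightarrow> t \<le> clen (N n))"
    using A by (intro exI[of _ 1] exI[of _ "M[k := n]"]) (auto simp: sim_temp sim_D upto_eq_upd)
qed

lemma compiled_V: "compiled w J (V x)"
  unfolding compiled_def
proof (intro allI impI)
  fix Q pc k s M
  assume A: "code_at Q pc (comp (V x) pc k)" "sim w J s M" "ok w J (V x) s" "wf (V x) k"
  have l: "fst s x < 2 ^ w" using A sim_D(6) by auto
  have "rd (M[k := 0]) (TD + x) = fst s x"
    using A sim_D[OF A(2)] by (auto simp: rd_def nth_list_update)
  then have "rt w Q 2 (pc, M) (pc + 2, M[k := fst s x])"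
    using rt_simple[OF A(1), of w M] A l sim_D[OF A(2)] by (simp add: numeral_2_eq_2 rd_def)
  then show "\<exists>t M'. rt w Q t (pc, M) (pc + clen (V x), M') \<and> sim w J s M' \<and> M' ! k = ev (V x) s \<and>
       upto_eq k M M' \<and> (lf (V x) \<longrightarrow> t \<le> clen (V x))"
    using A l by (intro exI[of _ 2] exI[of _ "M[k := fst s x]"]) (auto simp: sim_temp sim_D upto_eq_upd)
qed

lemma compiled_Ld:
  assumes "compiled w J e"
  shows "compiled w J (Ld e)"
  unfolding compiled_def
proof (intro allI impI)
  fix Q pc k s M
  assume A: "code_at Q pc (comp (Ld e) pc k)" "sim w J s M" "ok w J (Ld e) s" "wf (Ld e) k"
  obtain t M1 where 1: "rt w Q t (pc, M) (pc + clen e, M1)" "sim w J s M1" "M1 ! k = ev e s"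
    "upto_eq k M M1" "lf e \<Longrightarrow> t \<le> clen e"
    using compiledD[OF assms, of Q pc k s M] A by auto
  let ?xs = "[Const (k+1) KC, Arith Add k k (k+1), Load k k]"
  let ?M2 = "M1[k + 1 := KC, k := snd s (ev e s)]"
  have b: "ev e s < J" "k + 1 < TD" using A by auto
  have K: "KC < 2 ^ w" "KC + ev e s < 2 ^ w" using A(2) b by (auto simp: sim_def)
  have m: "k < length M1" "k + 1 < length M1" "KC + ev e s < length M1" using sim_D[OF 1(2)] b by auto
  have r: "rd (M1[k + 1 := KC, k := ev e s + KC]) (ev e s + KC) = snd s (ev e s)"
    using m b sim_D(5)[OF 1(2), of "ev e s"] by (auto simp: rd_def nth_list_update KC_def add.commute)
  have "fold (mx w) ?xs M1 = ?M2"
    using K m b 1(3) r by (simp add: rd_def add.commute list_update_swap[of "k+1" k])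
  then have "rt w Q (length ?xs) (pc + clen e, M1) (pc + clen e + length ?xs, ?M2)"
    using rt_simple[of Q "pc + clen e" ?xs w M1] A(1) by simp
  from rt_trans[OF 1(1) this] have "rt w Q (t + 3) (pc, M) (pc + clen (Ld e), ?M2)"
    by (simp add: ac_simps numeral_3_eq_3)
  moreover have "sim w J s ?M2"
    using b K sim_D(7)[OF 1(2) b(1)] by (intro sim_temp 1(2)) auto
  moreover have "upto_eq k M ?M2" using 1(4) by (auto intro!: upto_eq_upd)
  ultimately show "\<exists>t M'. rt w Q t (pc, M) (pc + clen (Ld e), M') \<and> sim w J s M' \<and> M' ! k = ev (Ld e) s \<and>
       upto_eq k M M' \<and> (lf (Ld e) \<longrightarrow> t \<le> clen (Ld e))"
    using m 1(5) by (intro exI[of _ "t + 3"] exI[of _ ?M2]) auto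
qed

lemma compiled_B:
  assumes "compiled w J a" "compiled w J b"
  shows "compiled w J (B q a b)"
  unfolding compiled_def
proof (intro allI impI)
  fix Q pc k s M
  assume A: "code_at Q pc (comp (B q a b) pc k)" "sim w J s M" "ok w J (B q a b) s" "wf (B q a b) k"
  obtain t M1 where 1: "rt w Q t (pc, M) (pc + clen a + clen b, M1)" "sim w J s M1"
    "M1 ! k = ev a s" "M1 ! (k+1) = ev b s" "upto_eq k M M1" "lf a \<Longrightarrow> lf b \<Longrightarrow> t \<le> clen a + clen b"
    using compiled_binary[OF assms, of Q pc k s M] A by auto
  have b: "k + 1 < TD" "k < TD" using A wf_less by auto
  let ?M2 = "M1[k := ev (B q a b) s]"
  have m: "k < length M1" "k + 1 < length M1" using sim_D[OF 1(2)] b by auto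
  have l: "ev a s < 2 ^ w" "aval q (ev a s) (ev b s) < 2 ^ w"
    using ok_less[of w J a s M k] A by auto
  have "fold (mx w) [Arith (bop q) k k (k+1)] M1 = ?M2"
    using m 1 l by (simp add: rd_def eval_aop)
  then have "rt w Q 1 (pc + clen a + clen b, M1) (pc + clen a + clen b + 1, ?M2)"
    using rt_simple[of Q "pc + clen a + clen b" "[Arith (bop q) k k (k+1)]" w M1] A(1) by (simp add: ac_simps)
  from rt_trans[OF 1(1) this] have "rt w Q (t + 1) (pc, M) (pc + clen (B q a b), ?M2)"
    by (simp add: ac_simps)
  moreover have "sim w J s ?M2"
    using b l by (intro sim_temp 1(2)) auto
  moreover have "upto_eq k M ?M2" using 1(5) by (auto intro!: upto_eq_upd)
  ultimately show "\<exists>t M'. rt w Q t (pc, M) (pc + clen (B q a b), M') \<and> sim w J s M' \<and> M' ! k = ev (B q a b) s \<and>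
       upto_eq k M M' \<and> (lf (B q a b) \<longrightarrow> t \<le> clen (B q a b))"
    using m 1(6) by (intro exI[of _ "t + 1"] exI[of _ ?M2]) auto
qed

text \<open>The four instructions that end the code of \<open>Sb\<close> and \<open>Lt\<close>.\<close>

lemma rt_select:
  assumes c: "code_at Q q [Jump_less k (k+1) (q+3), x, Jump (q+4), Const k v]" "simple x"
    and m: "k < length M" "k + 1 < length M" "v < 2 ^ w"
  shows "\<exists>t\<le>4. rt w Q t (q, M) (q + 4, if M ! k < M ! (k+1) then M[k := v] else mx w x M)"
proof (cases "M ! k < M ! (k+1)")
  case True
  have "rt w Q 1 (q, M) (q + 3, M)"
    using rt_jump_less[of q Q k "k+1" "q+3" w M] c m True by (simp add: rd_def)
  moreover have "rt w Q 1 (q + 3, M) (q + 4, M[k := v])"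
    using rt_simple[of Q "q+3" "[Const k v]" w M] c m by (simp add: numeral_3_eq_3 eval_nat_numeral)
  ultimately show ?thesis using True rt_trans by (intro exI[of _ "1 + 1"]) fastforce
next
  case False
  have "rt w Q 1 (q, M) (Suc q, M)"
    using rt_jump_less[of q Q k "k+1" "q+3" w M] c m False by (simp add: rd_def)
  moreover have "rt w Q 1 (Suc q, M) (Suc q + 1, mx w x M)"
    using rt_simple[of Q "Suc q" "[x]" w M] c m by simp
  moreover have "rt w Q 1 (Suc q + 1, mx w x M) (q + 4, mx w x M)"
    using rt_jump[of "Suc q + 1" Q "q + 4"] c by simp
  ultimately have "rt w Q (1 + 1 + 1) (q, M) (q + 4, mx w x M)" using rt_trans by blast
  then show ?thesis using False by (intro exI[of _ "1 + 1 + 1"]) simp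
qed

text \<open>Machine subtraction wraps around, whereas \<open>Sb\<close> stops at 0; the code
  therefore compares before it subtracts.\<close>

lemma compiled_Sb:
  assumes "compiled w J a" "compiled w J b"
  shows "compiled w J (Sb a b)"
  unfolding compiled_def
proof (intro allI impI)
  fix Q pc k s M
  assume A: "code_at Q pc (comp (Sb a b) pc k)" "sim w J s M" "ok w J (Sb a b) s" "wf (Sb a b) k"
  obtain t M1 where 1: "rt w Q t (pc, M) (pc + clen a + clen b, M1)" "sim w J s M1"
    "M1 ! k = ev a s" "M1 ! (k+1) = ev b s" "upto_eq k M M1" "lf a \<Longrightarrow> lf b \<Longrightarrow> t \<le> clen a + clen b"
    using compiled_binary[OF assms, of Q pc k s M] A by auto
  have b: "k + 1 < TD" "k < TD" using A wf_less by auto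
  let ?M2 = "M1[k := ev (Sb a b) s]"
  have m: "k < length M1" "k + 1 < length M1" using sim_D[OF 1(2)] b by auto
  have l: "ev a s < 2 ^ w"
    using ok_less[of w J a s M k] A by auto
  obtain t2 where 2: "t2 \<le> 4" "rt w Q t2 (pc + clen a + clen b, M1) (pc + clen a + clen b + 4, ?M2)"
  proof -
    have "(ev a s + 2 ^ w - ev b s) mod 2 ^ w = ev a s - ev b s" if "ev b s \<le> ev a s"
    proof -
      have *: "ev a s + 2 ^ w - ev b s = ev a s - ev b s + 2 ^ w" using that by simp
      show ?thesis unfolding * using l by simp
    qed
    then have "(if M1 ! k < M1 ! (k+1) then M1[k := 0] else mx w (Arith Sub k k (k+1)) M1) = ?M2"
      using m 1 l by (auto simp: rd_def)
    then show thesis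
      using rt_select[of Q "pc + clen a + clen b" k "Arith Sub k k (k+1)" 0 M1 w] A(1) m that
      by (auto simp: ac_simps)
  qed
  from rt_trans[OF 1(1) 2(2)] have "rt w Q (t + t2) (pc, M) (pc + clen (Sb a b), ?M2)"
    by (simp add: ac_simps)
  moreover have "sim w J s ?M2"
    using b l by (intro sim_temp 1(2)) auto
  moreover have "upto_eq k M ?M2" using 1(5) by (auto intro!: upto_eq_upd)
  ultimately show "\<exists>t M'. rt w Q t (pc, M) (pc + clen (Sb a b), M') \<and> sim w J s M' \<and> M' ! k = ev (Sb a b) s \<and>
       upto_eq k M M' \<and> (lf (Sb a b) \<longrightarrow> t \<le> clen (Sb a b))"
    using m 1(6) 2(1) by (intro exI[of _ "t + t2"] exI[of _ ?M2]) auto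
qed

lemma compiled_Lt:
  assumes "compiled w J a" "compiled w J b"
  shows "compiled w J (Lt a b)"
  unfolding compiled_def
proof (intro allI impI)
  fix Q pc k s M
  assume A: "code_at Q pc (comp (Lt a b) pc k)" "sim w J s M" "ok w J (Lt a b) s" "wf (Lt a b) k"
  obtain t M1 where 1: "rt w Q t (pc, M) (pc + clen a + clen b, M1)" "sim w J s M1"
    "M1 ! k = ev a s" "M1 ! (k+1) = ev b s" "upto_eq k M M1" "lf a \<Longrightarrow> lf b \<Longrightarrow> t \<le> clen a + clen b"
    using compiled_binary[OF assms, of Q pc k s M] A by auto
  have b: "k + 1 < TD" "k < TD" using A wf_less by auto
  let ?M2 = "M1[k := ev (Lt a b) s]"
  have m: "k < length M1" "k + 1 < length M1" using sim_D[OF 1(2)] b by auto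
  have l: "(1::nat) < 2 ^ w" using TD_less[OF A(2), of 1] by (simp add: TD_def)
  obtain t2 where 2: "t2 \<le> 4" "rt w Q t2 (pc + clen a + clen b, M1) (pc + clen a + clen b + 4, ?M2)"
  proof -
    have "(if M1 ! k < M1 ! (k+1) then M1[k := 1] else mx w (Const k 0) M1) = ?M2"
      using m 1 l by (auto simp: rd_def)
    then show thesis
      using rt_select[of Q "pc + clen a + clen b" k "Const k 0" 1 M1 w] A(1) m l that
      by (auto simp: ac_simps)
  qed
  from rt_trans[OF 1(1) 2(2)] have "rt w Q (t + t2) (pc, M) (pc + clen (Lt a b), ?M2)"
    by (simp add: ac_simps)
  moreover have "sim w J s ?M2"
    using b l by (intro sim_temp 1(2)) auto
  moreover have "upto_eq k M ?M2" using 1(5) by (auto intro!: upto_eq_upd)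
  ultimately show "\<exists>t M'. rt w Q t (pc, M) (pc + clen (Lt a b), M') \<and> sim w J s M' \<and> M' ! k = ev (Lt a b) s \<and>
       upto_eq k M M' \<and> (lf (Lt a b) \<longrightarrow> t \<le> clen (Lt a b))"
    using m 1(6) 2(1) by (intro exI[of _ "t + t2"] exI[of _ ?M2]) auto
qed

text \<open>Ends in the branch taken, with the jump instruction after the else branch still to come.\<close>

lemma rt_branch:
  assumes c: "code_at Q q [Const (k+1) 0, Jump_less (k+1) k l]"
    and s: "sim w J s M" "k + 1 < TD"
  shows "\<exists>M'. rt w Q 2 (q, M) (if M ! k \<noteq> 0 then l else q + 2, M') \<and> sim w J s M' \<and> upto_eq (k+1) M M'"
proof -
  let ?M = "M[k+1 := 0]"
  have m: "k < length M" "k + 1 < length M" using sim_D[OF s(1)] s by auto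
  have "rt w Q 1 (q, M) (Suc q, ?M)"
    using rt_simple[of Q q "[Const (k+1) 0]" w M] c by simp
  moreover have "rt w Q 1 (Suc q, ?M) (if M ! k \<noteq> 0 then l else q + 2, ?M)"
    using rt_jump_less[of "Suc q" Q "k+1" k l w ?M] c m by (simp add: rd_def split: if_splits)
  ultimately have "rt w Q (1 + 1) (q, M) (if M ! k \<noteq> 0 then l else q + 2, ?M)" using rt_trans by blast
  moreover have "sim w J s ?M" using s by (intro sim_temp) auto
  ultimately show ?thesis by (metis one_add_one upto_eq_refl upto_eq_upd le_refl)
qed

lemma compiled_Ite:
  assumes "compiled w J c" "compiled w J a" "compiled w J b"
  shows "compiled w J (Ite c a b)"
  unfolding compiled_def
proof (intro allI impI)
  fix Q pc k s M
  assume A: "code_at Q pc (comp (Ite c a b) pc k)" "sim w J s M" "ok w J (Ite c a b) s" "wf (Ite c a b) k"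
  obtain t M1 where 1: "rt w Q t (pc, M) (pc + clen c, M1)" "sim w J s M1" "M1 ! k = ev c s"
    "upto_eq k M M1" "lf c \<Longrightarrow> t \<le> clen c"
    using compiledD[OF assms(1), of Q pc k s M] A by auto
  obtain M2 where 2: "rt w Q 2 (pc + clen c, M1) (if ev c s \<noteq> 0 then pc + clen c + 3 + clen b else pc + clen c + 2, M2)"
    "sim w J s M2" "upto_eq (k+1) M1 M2"
    using rt_branch[of Q "pc + clen c" k "pc + clen c + 3 + clen b" w J s M1] A 1 by auto
  have u2: "upto_eq k M M2" by (rule upto_eq_trans[OF 1(4) 2(3)]) simp
  note t2 = rt_trans[OF 1(1) 2(1)]
  show "\<exists>t M'. rt w Q t (pc, M) (pc + clen (Ite c a b), M') \<and> sim w J s M' \<and> M' ! k = ev (Ite c a b) s \<and>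
       upto_eq k M M' \<and> (lf (Ite c a b) \<longrightarrow> t \<le> clen (Ite c a b))"
  proof (cases "ev c s \<noteq> 0")
    case True
    obtain t3 M3 where 3: "rt w Q t3 (pc + clen c + 3 + clen b, M2) (pc + clen c + 3 + clen b + clen a, M3)"
      "sim w J s M3" "M3 ! k = ev a s" "upto_eq k M2 M3" "lf a \<Longrightarrow> t3 \<le> clen a"
      using compiledD[OF assms(2), of Q "pc + clen c + 3 + clen b" k s M2] A 2 True by (auto simp: ac_simps eval_nat_numeral)
    have "rt w Q (t + 2 + t3) (pc, M) (pc + clen (Ite c a b), M3)"
      using rt_trans[OF t2, of t3 "(pc + clen (Ite c a b), M3)"] True 3(1) by (simp add: ac_simps eval_nat_numeral)
    then show ?thesis using 3 True 1(5) upto_eq_trans[OF u2 3(4)]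
      by (intro exI[of _ "t + 2 + t3"] exI[of _ M3]) auto
  next
    case False
    obtain t3 M3 where 3: "rt w Q t3 (pc + clen c + 2, M2) (pc + clen c + 2 + clen b, M3)"
      "sim w J s M3" "M3 ! k = ev b s" "upto_eq k M2 M3" "lf b \<Longrightarrow> t3 \<le> clen b"
      using compiledD[OF assms(3), of Q "pc + clen c + 2" k s M2] A 2 False by (auto simp: ac_simps eval_nat_numeral)
    have 4: "rt w Q 1 (pc + clen c + 2 + clen b, M3) (pc + clen (Ite c a b), M3)"
      using rt_jump[of "pc + clen c + 2 + clen b" Q "pc + clen c + 3 + clen b + clen a" w M3] A(1) by (simp add: ac_simps eval_nat_numeral)
    have "rt w Q (t + 2 + t3 + 1) (pc, M) (pc + clen (Ite c a b), M3)"
      using rt_trans[OF rt_trans[OF t2, of t3] 4] False 3(1) by (simp add: eval_nat_numeral)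
    then show ?thesis using 3 False 1(5) upto_eq_trans[OF u2 3(4)]
      by (intro exI[of _ "t + 2 + t3 + 1"] exI[of _ M3]) auto
  qed
qed

text \<open>Temporary cell \<open>k + 1\<close> keeps the register \<open>x\<close> while the loop uses it as a counter.\<close>

lemma rt_search:
  assumes e: "compiled w J e"
    and c: "code_at Q q ([Jump_less (TD+x) k (q + 2), Jump (q + clen e + 7)] @ comp e (q + 2) (k+2) @
      [Const (k+3) 0, Jump_less (k+3) (k+2) (q + clen e + 7), Const (k+3) 1,
       Arith Add (TD+x) (TD+x) (k+3), Jump q])"
    and x: "x < NR" "k + 3 < TD" "wf e (k+2)"
    and okb: "\<And>v. v < n \<Longrightarrow> (\<forall>u<v. ev e (setr x u s) = 0) \<Longrightarrow> ok w J e (setr x v s)"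
  shows "sim w J (setr x v s) M \<Longrightarrow> M ! k = n \<Longrightarrow> v \<le> n \<Longrightarrow> \<forall>u<v. ev e (setr x u s) = 0 \<Longrightarrow>
     \<exists>t M'. rt w Q t (q, M) (q + clen e + 7, M') \<and> upto_eq (k+2) M M' \<and>
       sim w J (setr x (LEAST v. n \<le> v \<or> ev e (setr x v s) \<noteq> 0) s) M'"
proof (induction "n - v" arbitrary: v M)
  case 0
  have v: "v = n" using 0 by simp
  have rd: "rd M (TD + x) = v" "rd M k = n"
    using sim_rd(2)[OF 0(2) x(1)] sim_rd(1)[OF 0(2), of k] x 0 by (auto simp: setr_def)
  have L: "(LEAST v. n \<le> v \<or> ev e (setr x v s) \<noteq> 0) = v"
    using 0(5) v by (intro Least_equality) (auto simp: not_less[symmetric])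
  have "rt w Q 1 (q, M) (Suc q, M)"
    using rt_jump_less[of q Q "TD+x" k "q+2" w M] c rd v by simp
  moreover have "rt w Q 1 (Suc q, M) (q + clen e + 7, M)"
    using rt_jump[of "Suc q" Q "q + clen e + 7"] c by simp
  ultimately have "rt w Q (1 + 1) (q, M) (q + clen e + 7, M)" by (rule rt_trans)
  then show ?case using 0(2) L by (metis upto_eq_refl)
next
  case (Suc d)
  have v: "v < n" using Suc by simp
  let ?s = "setr x v s"
  have rd: "rd M (TD + x) = v" "rd M k = n"
    using sim_rd(2)[OF Suc(3) x(1)] sim_rd(1)[OF Suc(3), of k] x Suc by (auto simp: setr_def)
  have 1: "rt w Q 1 (q, M) (q + 2, M)"
    using rt_jump_less[of q Q "TD+x" k "q+2" w M] c rd v by simp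
  obtain t2 M2 where 2: "rt w Q t2 (q + 2, M) (q + 2 + clen e, M2)" "sim w J ?s M2"
    "M2 ! (k+2) = ev e ?s" "upto_eq (k+2) M M2"
  proof -
    have "code_at Q (q + 2) (comp e (q + 2) (k + 2))" "ok w J e ?s" using c okb[OF v Suc(6)] by auto
    from compiledD[OF e this(1) Suc(3) this(2) x(3)] show ?thesis using that by blast
  qed
  let ?M3 = "M2[k+3 := 0]"
  have m: "k + 3 < length M2" "k + 2 < length M2" using sim_D(1)[OF 2(2)] x by auto
  have 3: "rt w Q 1 (q + 2 + clen e, M2) (q + 3 + clen e, ?M3)"
    using rt_simple[of Q "q + 2 + clen e" "[Const (k+3) 0]" w M2] c by (simp add: eval_nat_numeral)
  have s3: "sim w J ?s ?M3" using 2(2) x by (intro sim_temp) auto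
  have u3: "upto_eq (k+2) M ?M3" using 2(4) by (intro upto_eq_upd) auto
  have 4: "rt w Q 1 (q + 3 + clen e, ?M3) (if ev e ?s \<noteq> 0 then q + clen e + 7 else q + 4 + clen e, ?M3)"
    using rt_jump_less[of "q + 3 + clen e" Q "k+3" "k+2" "q + clen e + 7" w ?M3] c m 2(3)
    by (simp add: eval_nat_numeral rd_def ac_simps split: if_splits)
  note 14 = rt_trans[OF rt_trans[OF rt_trans[OF 1 2(1)] 3] 4]
  show ?case
  proof (cases "ev e ?s = 0")
    case False
    have L: "(LEAST v. n \<le> v \<or> ev e (setr x v s) \<noteq> 0) = v"
      using Suc(6) v False by (intro Least_equality) (auto simp: not_less[symmetric])
    show ?thesis using 14 False s3 u3 L by auto
  next
    case True
    let ?M4 = "?M3[k+3 := 1]"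
    let ?M5 = "?M4[TD + x := v + 1]"
    have w1: "(1::nat) < 2 ^ w" using TD_less[OF 2(2), of 1] by (simp add: TD_def)
    have w0: "w \<noteq> 0" using w1 by (cases w) auto
    have wv: "v + 1 < 2 ^ w" using v sim_D(8)[OF Suc(3), of k] x Suc(4) by auto
    have tx: "TD + x < length M2" "M2 ! (TD + x) = v"
      using sim_D(2,4)[OF 2(2) x(1)] by (auto simp: setr_def)
    have f: "fold (mx w) [Const (k+3) 1, Arith Add (TD+x) (TD+x) (k+3)] ?M3 = ?M5"
      using m tx w0 wv x by (simp add: rd_def nth_list_update)
    have "rt w Q 2 (q + 4 + clen e, ?M3) (q + 6 + clen e, ?M5)"
      using rt_simple[of Q "q + 4 + clen e" "[Const (k+3) 1, Arith Add (TD+x) (TD+x) (k+3)]" w ?M3] c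
      unfolding f by (simp add: eval_nat_numeral)
    moreover have "rt w Q 1 (q + 6 + clen e, ?M5) (q, ?M5)"
      using rt_jump[of "q + 6 + clen e" Q q] c by (simp add: eval_nat_numeral)
    ultimately have 5: "rt w Q (2+1) (q + 4 + clen e, ?M3) (q, ?M5)" by (rule rt_trans)
    have s5: "sim w J (setr x (v+1) s) ?M5"
      using sim_reg[OF sim_temp[OF s3, of "k+3" 1] x(1) wv] x w1 by simp
    have u5: "upto_eq (k+2) M ?M5" using upto_eq_upd[OF upto_eq_upd[OF 2(4), of "k+3" 1], of "TD+x" "v+1"] x by simp
    have "\<exists>t M'. rt w Q t (q, ?M5) (q + clen e + 7, M') \<and> upto_eq (k+2) ?M5 M' \<and>
       sim w J (setr x (LEAST v. n \<le> v \<or> ev e (setr x v s) \<noteq> 0) s) M'"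
    proof (rule Suc(1))
      show "d = n - (v+1)" using Suc(2) by simp
      show "\<forall>u<v+1. ev e (setr x u s) = 0" using Suc(6) True by (auto simp: less_Suc_eq)
      show "?M5 ! k = n" using upto_eq_nth[OF u5, of k] Suc(4) by simp
    qed (use s5 v in auto)
    then obtain t6 M6 where 6: "rt w Q t6 (q, ?M5) (q + clen e + 7, M6)" "upto_eq (k+2) ?M5 M6"
       "sim w J (setr x (LEAST v. n \<le> v \<or> ev e (setr x v s) \<noteq> 0) s) M6" by blast
    have t14: "rt w Q (1 + t2 + 1 + 1) (q, M) (q + 4 + clen e, ?M3)" using 14 True by simp
    show ?thesis using rt_trans[OF rt_trans[OF t14 5] 6(1)] 6(3) upto_eq_trans[OF u5 6(2)] by blast
  qed
qed

lemma compiled_Lst: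
  assumes "compiled w J b" "compiled w J e"
  shows "compiled w J (Lst x b e)"
  unfolding compiled_def
proof (intro allI impI)
  fix Q pc k s M
  assume A: "code_at Q pc (comp (Lst x b e) pc k)" "sim w J s M" "ok w J (Lst x b e) s" "wf (Lst x b e) k"
  obtain t1 M1 where 1: "rt w Q t1 (pc, M) (pc + clen b, M1)" "sim w J s M1" "M1 ! k = ev b s"
    "upto_eq k M M1"
  proof -
    have "code_at Q pc (comp b pc k)" "ok w J b s" "wf b k" using A by auto
    from compiledD[OF assms(1) this(1) A(2) this(2,3)] show ?thesis using that by blast
  qed
  have x: "k + 3 < TD" "x < NR" "wf e (k+2)" using A by auto
  have m: "k < length M1" "k + 1 < length M1" "TD + x < length M1"
    using sim_D(1,2)[OF 1(2)] x by auto
  let ?o = "fst s x"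
  let ?M2 = "M1[k+1 := ?o, TD + x := 0]"
  let ?xs = "[Const (k+1) 0, Arith Add (k+1) (TD+x) (k+1), Const (TD+x) 0]"
  have o: "?o < 2 ^ w" "M1 ! (TD + x) = ?o" using sim_D(4,6)[OF 1(2)] x by auto
  have f: "fold (mx w) ?xs M1 = ?M2" using m o x by (simp add: rd_def nth_list_update)
  have 2: "rt w Q 3 (pc + clen b, M1) (pc + clen b + 3, ?M2)"
    using rt_simple[of Q "pc + clen b" ?xs w M1] A(1) unfolding f by (simp add: eval_nat_numeral)
  have s2: "sim w J (setr x 0 s) ?M2"
    using sim_reg[OF sim_temp[OF 1(2), of "k+1" ?o] x(2), of 0] x o by simp
  have u2: "upto_eq k M ?M2" using 1(4) x by (intro upto_eq_upd) auto
  let ?q = "pc + clen b + 3"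
  let ?v = "LEAST v. ev b s \<le> v \<or> ev e (setr x v s) \<noteq> 0"
  have "\<exists>t M'. rt w Q t (?q, ?M2) (?q + clen e + 7, M') \<and> upto_eq (k+2) ?M2 M' \<and>
       sim w J (setr x ?v s) M'"
  proof (rule rt_search[OF assms(2), of Q ?q x k "ev b s" s 0])
    show "code_at Q ?q ([Jump_less (TD+x) k (?q + 2), Jump (?q + clen e + 7)] @ comp e (?q + 2) (k+2) @
      [Const (k+3) 0, Jump_less (k+3) (k+2) (?q + clen e + 7), Const (k+3) 1,
       Arith Add (TD+x) (TD+x) (k+3), Jump ?q])"
      using A(1) by (simp add: eval_nat_numeral ac_simps)
    show "\<And>v. v < ev b s \<Longrightarrow> (\<forall>u<v. ev e (setr x u s) = 0) \<Longrightarrow> ok w J e (setr x v s)"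
      using A(3) by simp
    show "?M2 ! k = ev b s" using 1(3) x by (simp add: nth_list_update)
  qed (use x s2 in auto)
  then obtain t3 M3 where 3: "rt w Q t3 (?q, ?M2) (?q + clen e + 7, M3)" "upto_eq (k+2) ?M2 M3"
    "sim w J (setr x ?v s) M3" by blast
  have v: "fst (setr x ?v s) x = ?v" by (simp add: setr_def)
  have m3: "k < length M3" "k + 1 < length M3" "k + 2 < length M3" "TD + x < length M3" "M3 ! (TD + x) = ?v" "?v < 2 ^ w"
    using sim_D(1,2)[OF 3(3)] x sim_D(4,6)[OF 3(3) x(2)] unfolding v by auto
  have k1: "M3 ! (k+1) = ?o" using upto_eq_nth[OF 3(2), of "k+1"] m x by (simp add: nth_list_update)
  let ?ys = "[Const (k+2) 0, Arith Add k (TD+x) (k+2), Arith Add (TD+x) (k+1) (k+2)]"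
  let ?M4 = "M3[k + 2 := 0, k := ?v, TD + x := ?o]"
  have g: "fold (mx w) ?ys M3 = ?M4" using m3 k1 o x by (simp add: rd_def nth_list_update)
  have 4: "rt w Q 3 (?q + clen e + 7, M3) (pc + clen (Lst x b e), ?M4)"
    using rt_simple[of Q "?q + clen e + 7" ?ys w M3] A(1) unfolding g
    by (simp add: eval_nat_numeral ac_simps)
  have s4: "sim w J s ?M4"
    using sim_reg[OF sim_temp[OF sim_temp[OF 3(3), of "k+2" 0] , of k ?v] x(2) o(1)] x m3
    by (simp add: sim_setr_same[OF 1(2)])
  have "upto_eq k ?M2 M3" using 3(2) by (simp add: upto_eq_def)
  then have "upto_eq k M M3" using u2 upto_eq_trans by blast
  then have u4: "upto_eq k M ?M4" using x by (intro upto_eq_upd) auto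
  show "\<exists>t M'. rt w Q t (pc, M) (pc + clen (Lst x b e), M') \<and> sim w J s M' \<and> M' ! k = ev (Lst x b e) s \<and>
       upto_eq k M M' \<and> (lf (Lst x b e) \<longrightarrow> t \<le> clen (Lst x b e))"
    using rt_trans[OF rt_trans[OF rt_trans[OF 1(1) 2] 3(1)] 4] s4 u4 m3 x
    by (intro exI conjI) (auto simp: nth_list_update)
qed

lemma compiled: "compiled w J e"
  by (induction e) (simp_all only: compiled_N compiled_V compiled_Ld compiled_B compiled_Sb compiled_Lt
    compiled_Ite compiled_Lst)

definition ccompiled :: "nat \<Rightarrow> nat \<Rightarrow> com \<Rightarrow> bool" where
  "ccompiled w J c \<longleftrightarrow> (\<forall>Q pc s M. code_at Q pc (ccomp c pc) \<longrightarrow> sim w J s M \<longrightarrow>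
     cok w J c s \<longrightarrow> cwf c \<longrightarrow>
     (\<exists>t M'. rt w Q t (pc, M) (pc + cclen c, M') \<and> sim w J (cex c s) M' \<and> (clf c \<longrightarrow> t \<le> cclen c)))"

lemma ccompiledD:
  assumes "ccompiled w J c" "code_at Q pc (ccomp c pc)" "sim w J s M" "cok w J c s" "cwf c"
  obtains t M' where "rt w Q t (pc, M) (pc + cclen c, M')" "sim w J (cex c s) M'"
    "clf c \<Longrightarrow> t \<le> cclen c"
  using assms unfolding ccompiled_def by blast

lemma rt_move:
  assumes "code_at Q q [Const 2 0, Arith Add (TD+x) 1 2]" "sim w J s M" "x < NR" "M ! 1 = v"
  shows "\<exists>M'. rt w Q 2 (q, M) (q + 2, M') \<and> sim w J (setr x v s) M'"
proof -
  let ?M = "M[2 := 0, TD + x := v]"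
  have t: "1 < TD" "2 < TD" by (auto simp: TD_def)
  have m: "1 < length M" "2 < length M" using sim_D(1)[OF assms(2)] t by auto
  have v: "v < 2 ^ w" using sim_D(8)[OF assms(2) t(1)] assms(4) by simp
  have f: "fold (mx w) [Const 2 0, Arith Add (TD+x) 1 2] M = ?M"
    using m v assms(4) by (simp add: rd_def nth_list_update)
  have "rt w Q 2 (q, M) (q + 2, ?M)"
    using rt_simple[of Q q "[Const 2 0, Arith Add (TD+x) 1 2]" w M] assms(1) unfolding f
    by (simp add: eval_nat_numeral)
  moreover have "sim w J (setr x v s) ?M"
    using sim_reg[OF sim_temp[OF assms(2) t(2), of 0] assms(3) v] by simp
  ultimately show ?thesis by blast
qed

lemma ccompiled_Asg: "ccompiled w J (Asg x e)"
  unfolding ccompiled_def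
proof (intro allI impI)
  fix Q pc s M
  assume A: "code_at Q pc (ccomp (Asg x e) pc)" "sim w J s M" "cok w J (Asg x e) s" "cwf (Asg x e)"
  obtain t1 M1 where 1: "rt w Q t1 (pc, M) (pc + clen e, M1)" "sim w J s M1" "M1 ! 1 = ev e s"
    "lf e \<Longrightarrow> t1 \<le> clen e"
  proof -
    have "code_at Q pc (comp e pc 1)" "ok w J e s" "wf e 1" using A by auto
    from compiledD[OF compiled this(1) A(2) this(2,3)] show ?thesis using that by blast
  qed
  obtain M2 where 2: "rt w Q 2 (pc + clen e, M1) (pc + clen e + 2, M2)" "sim w J (setr x (ev e s) s) M2"
    using rt_move[of Q "pc + clen e" x w J s M1 "ev e s"] A 1 by (auto simp del: code_at_Cons)
  show "\<exists>t M'. rt w Q t (pc, M) (pc + cclen (Asg x e), M') \<and> sim w J (cex (Asg x e) s) M' \<and>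
      (clf (Asg x e) \<longrightarrow> t \<le> cclen (Asg x e))"
    using rt_trans[OF 1(1) 2(1)] 2(2) 1(4) by (intro exI[of _ "t1 + 2"] exI[of _ M2]) (auto simp: ac_simps)
qed

lemma ccompiled_Sto: "ccompiled w J (Sto a e)"
  unfolding ccompiled_def
proof (intro allI impI)
  fix Q pc s M
  assume A: "code_at Q pc (ccomp (Sto a e) pc)" "sim w J s M" "cok w J (Sto a e) s" "cwf (Sto a e)"
  have c: "code_at Q pc (comp a pc 1 @ comp e (pc + clen a) (1+1))"
    "code_at Q (pc + clen a + clen e) [Const 3 KC, Arith Add 1 1 3, Store 1 2]"
    using A(1) by (auto simp del: code_at_Cons simp: eval_nat_numeral ac_simps)
  obtain t1 M1 where 1: "rt w Q t1 (pc, M) (pc + clen a + clen e, M1)" "sim w J s M1"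
    "M1 ! 1 = ev a s" "M1 ! (1+1) = ev e s" "lf a \<Longrightarrow> lf e \<Longrightarrow> t1 \<le> clen a + clen e"
  proof -
    have "ok w J a s" "ok w J e s" "wf a 1" "wf e (1+1)" using A by (auto simp: numeral_2_eq_2)
    from compiled_binary[OF compiled compiled c(1) A(2) this] show ?thesis using that by blast
  qed
  have t: "1 < TD" "2 < TD" "3 < TD" by (auto simp: TD_def)
  have m: "1 < length M1" "2 < length M1" "3 < length M1" using sim_D(1)[OF 1(2)] t by auto
  have b: "ev a s < J" using A by simp
  have K: "KC < 2 ^ w" "KC + ev a s < 2 ^ w" using A(2) b by (auto simp: sim_def)
  have v: "ev e s < 2 ^ w" using sim_D(8)[OF 1(2) t(2)] 1(4) by (simp add: numeral_2_eq_2)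
  let ?M2 = "M1[3 := KC, 1 := KC + ev a s, KC + ev a s := ev e s]"
  have f: "fold (mx w) [Const 3 KC, Arith Add 1 1 3, Store 1 2] M1 = ?M2"
    using m K 1(3,4) by (simp add: rd_def nth_list_update add.commute numeral_2_eq_2)
  have 2: "rt w Q 3 (pc + clen a + clen e, M1) (pc + cclen (Sto a e), ?M2)"
    using rt_simple[OF c(2), of w M1] unfolding f by (simp add: eval_nat_numeral ac_simps)
  have "sim w J (seth (ev a s) (ev e s) s) ?M2"
    using t K by (intro sim_heap sim_temp 1(2) b v) auto
  then show "\<exists>t M'. rt w Q t (pc, M) (pc + cclen (Sto a e), M') \<and> sim w J (cex (Sto a e) s) M' \<and>
      (clf (Sto a e) \<longrightarrow> t \<le> cclen (Sto a e))"
    using rt_trans[OF 1(1) 2(1)] 1(5) by (intro exI[of _ "t1 + 3"] exI[of _ ?M2]) (auto simp: ac_simps)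
qed

lemma ccompiled_Sq:
  assumes "ccompiled w J c" "ccompiled w J d"
  shows "ccompiled w J (Sq c d)"
  unfolding ccompiled_def
proof (intro allI impI)
  fix Q pc s M
  assume A: "code_at Q pc (ccomp (Sq c d) pc)" "sim w J s M" "cok w J (Sq c d) s" "cwf (Sq c d)"
  obtain t1 M1 where 1: "rt w Q t1 (pc, M) (pc + cclen c, M1)" "sim w J (cex c s) M1"
    "clf c \<Longrightarrow> t1 \<le> cclen c"
    using ccompiledD[OF assms(1), of Q pc s M] A by auto
  obtain t2 M2 where 2: "rt w Q t2 (pc + cclen c, M1) (pc + cclen c + cclen d, M2)"
    "sim w J (cex d (cex c s)) M2" "clf d \<Longrightarrow> t2 \<le> cclen d"
    using ccompiledD[OF assms(2), of Q "pc + cclen c" "cex c s" M1] A 1 by auto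
  show "\<exists>t M'. rt w Q t (pc, M) (pc + cclen (Sq c d), M') \<and> sim w J (cex (Sq c d) s) M' \<and>
      (clf (Sq c d) \<longrightarrow> t \<le> cclen (Sq c d))"
    using rt_trans[OF 1(1) 2(1)] 2 1 by (intro exI[of _ "t1 + t2"] exI[of _ M2]) (auto simp: ac_simps)
qed

lemma ccompiled_If:
  assumes "ccompiled w J c" "ccompiled w J d"
  shows "ccompiled w J (If e c d)"
  unfolding ccompiled_def
proof (intro allI impI)
  fix Q pc s M
  assume A: "code_at Q pc (ccomp (If e c d) pc)" "sim w J s M" "cok w J (If e c d) s" "cwf (If e c d)"
  have c: "code_at Q pc (comp e pc 1)"
    "code_at Q (pc + clen e) [Const (1+1) 0, Jump_less (1+1) 1 (pc + clen e + 3 + cclen d)]"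
    "code_at Q (pc + clen e + 2) (ccomp d (pc + clen e + 2))"
    "code_at Q (pc + clen e + 2 + cclen d) [Jump (pc + clen e + 3 + cclen d + cclen c)]"
    "code_at Q (pc + clen e + 3 + cclen d) (ccomp c (pc + clen e + 3 + cclen d))"
    using A(1) by (auto simp: eval_nat_numeral ac_simps)
  obtain t1 M1 where 1: "rt w Q t1 (pc, M) (pc + clen e, M1)" "sim w J s M1" "M1 ! 1 = ev e s"
    "lf e \<Longrightarrow> t1 \<le> clen e"
  proof -
    have "code_at Q pc (comp e pc 1)" "ok w J e s" "wf e 1" using A by auto
    from compiledD[OF compiled this(1) A(2) this(2,3)] show ?thesis using that by blast
  qed
  obtain M2 where 2: "rt w Q 2 (pc + clen e, M1)
      (if ev e s \<noteq> 0 then pc + clen e + 3 + cclen d else pc + clen e + 2, M2)" "sim w J s M2"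
    using rt_branch[OF c(2) 1(2)] 1(3) by (auto simp: TD_def)
  note t2 = rt_trans[OF 1(1) 2(1)]
  show "\<exists>t M'. rt w Q t (pc, M) (pc + cclen (If e c d), M') \<and> sim w J (cex (If e c d) s) M' \<and>
      (clf (If e c d) \<longrightarrow> t \<le> cclen (If e c d))"
  proof (cases "ev e s \<noteq> 0")
    case True
    obtain t3 M3 where 3: "rt w Q t3 (pc + clen e + 3 + cclen d, M2) (pc + clen e + 3 + cclen d + cclen c, M3)"
      "sim w J (cex c s) M3" "clf c \<Longrightarrow> t3 \<le> cclen c"
      using ccompiledD[OF assms(1) c(5) 2(2)] A True by auto
    have "rt w Q (t1 + 2 + t3) (pc, M) (pc + cclen (If e c d), M3)"
      using rt_trans[OF t2, of t3 "(pc + cclen (If e c d), M3)"] True 3(1) by (simp add: ac_simps eval_nat_numeral)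
    then show ?thesis using 3 True 1(4) by (intro exI[of _ "t1 + 2 + t3"] exI[of _ M3]) auto
  next
    case False
    obtain t3 M3 where 3: "rt w Q t3 (pc + clen e + 2, M2) (pc + clen e + 2 + cclen d, M3)"
      "sim w J (cex d s) M3" "clf d \<Longrightarrow> t3 \<le> cclen d"
      using ccompiledD[OF assms(2) c(3) 2(2)] A False by auto
    have 4: "rt w Q 1 (pc + clen e + 2 + cclen d, M3) (pc + cclen (If e c d), M3)"
      using rt_jump[of "pc + clen e + 2 + cclen d" Q "pc + clen e + 3 + cclen d + cclen c" w M3] c(4)
      by (simp add: ac_simps)
    have "rt w Q (t1 + 2 + t3 + 1) (pc, M) (pc + cclen (If e c d), M3)"
      using rt_trans[OF rt_trans[OF t2, of t3] 4] False 3(1) by simp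
    then show ?thesis using 3 False 1(4) by (intro exI[of _ "t1 + 2 + t3 + 1"] exI[of _ M3]) auto
  qed
qed

lemma fold_preserves:
  assumes "\<And>j s. P s \<Longrightarrow> P (f j s)" "P s"
  shows "P (fold f xs s)"
  using assms(2) by (induction xs arbitrary: s) (auto intro: assms(1))

lemma cex_unassigned: "x \<notin> asgd c \<Longrightarrow> fst (cex c s) x = fst s x"
proof (induction c arbitrary: s)
  case (For y z e c)
  have "fst (fold (\<lambda>j s. cex c (setr y j s)) [0..<n] s') x = fst s x" if "fst s' x = fst s x" for s' n
    by (rule fold_preserves[where P = "\<lambda>s'. fst s' x = fst s x"]) (use For that in \<open>auto simp: setr_def\<close>)
  then show ?case using For by (simp add: setr_def)
qed (auto simp: setr_def seth_def)

text \<open>By \<open>cwf\<close> the body assigns neither the counter \<open>x\<close> nor the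
  bound \<open>y\<close>, so both survive each round, and the compiled test sees the same values as
  the fold.\<close>

lemma ccompiled_For:
  assumes "ccompiled w J c"
  shows "ccompiled w J (For x y e c)"
  unfolding ccompiled_def
proof (intro allI impI)
  fix Q pc s M
  assume A: "code_at Q pc (ccomp (For x y e c) pc)" "sim w J s M" "cok w J (For x y e c) s" "cwf (For x y e c)"
  define n where "n = ev e s"
  define st where "st j = fold (\<lambda>j s. cex c (setr x j s)) [0..<j] (setr y n s)" for j
  define q where "q = pc + clen e + 3"
  have x: "x < NR" "y < NR" "x \<noteq> y" "x \<notin> asgd c" "y \<notin> asgd c" "cwf c" "wf e 1" using A by auto
  have okc: "cok w J c (setr x j (st j))" if "j < n" for j
    using A(3) that by (simp add: n_def st_def)
  have sS: "st (Suc j) = cex c (setr x j (st j))" for j by (simp add: st_def)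
  have sy: "fst (st j) y = n" for j
    by (induction j) (use x in \<open>auto simp: sS cex_unassigned setr_def, simp add: st_def setr_def\<close>)
  have c: "code_at Q pc (comp e pc 1)"
    "code_at Q (pc + clen e) [Const 2 0, Arith Add (TD+y) 1 2]"
    "code_at Q (pc + clen e + 2) [Const (TD+x) 0]"
    "code_at Q q [Jump_less (TD+x) (TD+y) (q + 2), Jump (q + cclen c + 5)]"
    "code_at Q (q + 2) (ccomp c (q + 2))"
    "code_at Q (q + 2 + cclen c) [Const 2 1, Arith Add (TD+x) (TD+x) 2, Jump q]"
    using A(1) by (auto simp: eval_nat_numeral ac_simps q_def)
  obtain t1 M1 where 1: "rt w Q t1 (pc, M) (pc + clen e, M1)" "sim w J s M1" "M1 ! 1 = n"
  proof -
    have "code_at Q pc (comp e pc 1)" "ok w J e s" "wf e 1" using A by auto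
    from compiledD[OF compiled this(1) A(2) this(2,3)] show ?thesis using that n_def by blast
  qed
  obtain M2 where 2: "rt w Q 2 (pc + clen e, M1) (pc + clen e + 2, M2)" "sim w J (setr y n s) M2"
    using rt_move[OF c(2) 1(2) x(2) 1(3)] by auto
  let ?M3 = "M2[TD + x := 0]"
  have 3: "rt w Q 1 (pc + clen e + 2, M2) (q, ?M3)"
    using rt_simple[OF c(3), of w M2] by (simp add: q_def eval_nat_numeral)
  have s3: "sim w J (setr x 0 (st 0)) ?M3"
    using sim_reg[OF 2(2) x(1), of 0] by (simp add: st_def)
  have t: "2 < TD" by (simp add: TD_def)
  have w1: "(1::nat) < 2 ^ w" using TD_less[OF A(2), of 1] by (simp add: TD_def)
  have loop: "\<exists>t M'. rt w Q t (q, M) (q + cclen c + 5, M') \<and> sim w J (setr x n (st n)) M'"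
    if "sim w J (setr x j (st j)) M" "j \<le> n" for j M
    using that
  proof (induction "n - j" arbitrary: j M)
    case 0
    have j: "j = n" using 0 by simp
    have rd: "rd M (TD + x) = n" "rd M (TD + y) = n"
      using sim_rd(2)[OF 0(2)] x sy j by (auto simp: setr_def)
    have "rt w Q 1 (q, M) (Suc q, M)"
      using rt_jump_less[of q Q "TD+x" "TD+y" "q+2" w M] c(4) rd by simp
    moreover have "rt w Q 1 (Suc q, M) (q + cclen c + 5, M)"
      using rt_jump[of "Suc q" Q "q + cclen c + 5"] c(4) by simp
    ultimately have "rt w Q (1 + 1) (q, M) (q + cclen c + 5, M)" by (rule rt_trans)
    then show ?case using 0 j by auto
  next
    case (Suc d)
    have j: "j < n" using Suc by simp
    have djn: "d = n - Suc j" using Suc(2) by simp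
    have rd: "rd M (TD + x) = j" "rd M (TD + y) = n"
      using sim_rd(2)[OF Suc(3)] x sy by (auto simp: setr_def)
    have a: "rt w Q 1 (q, M) (q + 2, M)"
      using rt_jump_less[of q Q "TD+x" "TD+y" "q+2" w M] c(4) rd j by simp
    obtain t4 M4 where 4: "rt w Q t4 (q + 2, M) (q + 2 + cclen c, M4)" "sim w J (st (Suc j)) M4"
      using ccompiledD[OF assms c(5) Suc(3) okc[OF j] x(6)] sS by metis
    have jx: "fst (st (Suc j)) x = j" using x by (simp add: sS cex_unassigned setr_def)
    have m: "2 < length M4" "TD + x < length M4" "M4 ! (TD + x) = j"
      using sim_D(1,2,4)[OF 4(2)] t x jx by auto
    have n: "n < 2 ^ w" using sim_D(6)[OF 4(2) x(2)] sy by simp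
    let ?M5 = "M4[2 := 1, TD + x := j + 1]"
    have w0: "w \<noteq> 0" using w1 by (cases w) auto
    have f: "fold (mx w) [Const 2 1, Arith Add (TD+x) (TD+x) 2] M4 = ?M5"
      using m w0 n j t by (simp add: rd_def nth_list_update)
    have 5: "rt w Q 2 (q + 2 + cclen c, M4) (q + 4 + cclen c, ?M5)"
      using rt_simple[of Q "q + 2 + cclen c" "[Const 2 1, Arith Add (TD+x) (TD+x) 2]" w M4] c(6)
      unfolding f by (simp add: eval_nat_numeral)
    have 6: "rt w Q 1 (q + 4 + cclen c, ?M5) (q, ?M5)"
      using rt_jump[of "q + 4 + cclen c" Q q] c(6) by (simp add: eval_nat_numeral)
    have "sim w J (setr x (Suc j) (st (Suc j))) ?M5"
      using sim_reg[OF sim_temp[OF 4(2) t w1] x(1), of "j+1"] n j by simp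
    then obtain t7 M7 where 7: "rt w Q t7 (q, ?M5) (q + cclen c + 5, M7)" "sim w J (setr x n (st n)) M7"
      using Suc(1)[of "Suc j" ?M5] djn j by auto
    show ?case using rt_trans[OF rt_trans[OF rt_trans[OF rt_trans[OF a 4(1)] 5] 6] 7(1)] 7(2) by blast
  qed
  obtain t4 M4 where 4: "rt w Q t4 (q, ?M3) (q + cclen c + 5, M4)" "sim w J (setr x n (st n)) M4"
    using loop[OF s3] by auto
  have q: "q + cclen c + 5 = pc + cclen (For x y e c)" by (simp add: q_def)
  have "cex (For x y e c) s = setr x n (st n)" by (simp add: n_def st_def)
  then show "\<exists>t M'. rt w Q t (pc, M) (pc + cclen (For x y e c), M') \<and>
      sim w J (cex (For x y e c) s) M' \<and> (clf (For x y e c) \<longrightarrow> t \<le> cclen (For x y e c))"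
    using rt_trans[OF rt_trans[OF rt_trans[OF 1(1) 2(1)] 3] 4(1)] 4(2) unfolding q by auto
qed

lemma ccompiled: "ccompiled w J c"
proof (induction c)
  case Skip
  show ?case by (auto simp: ccompiled_def intro!: exI[of _ "0::nat"])
qed (simp_all only: ccompiled_Asg ccompiled_Sto ccompiled_Sq ccompiled_If ccompiled_For)

subsection \<open>Interleaved arrays\<close>

text \<open>With interleaving, a prefix of the memory contains a prefix of each array. The long
  tables of the preprocessing are thus cut down to the streaming space by handing over the first
  cells.\<close>

definition Arr :: "nat \<Rightarrow> exp \<Rightarrow> exp" where
  "Arr k e = Ld (B Pl (B Ti (N AK) e) (N k))"

definition StA :: "nat \<Rightarrow> exp \<Rightarrow> exp \<Rightarrow> com" where
  "StA k e v = Sto (B Pl (B Ti (N AK) e) (N k)) v"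

definition arr :: "st \<Rightarrow> nat \<Rightarrow> nat \<Rightarrow> nat" where
  "arr s k j = snd s (AK * j + k)"

definition seta :: "nat \<Rightarrow> nat \<Rightarrow> nat \<Rightarrow> st \<Rightarrow> st" where
  "seta k j v s = seth (AK * j + k) v s"

lemma ev_Arr [simp]: "ev (Arr k e) s = arr s k (ev e s)"
  by (simp add: Arr_def arr_def)

lemma cex_StA [simp]: "cex (StA k e v) s = seta k (ev e s) (ev v s) s"
  by (simp add: StA_def seta_def)

lemma AK_inj:
  assumes "k < AK" "k' < AK"
  shows "AK * j + k = AK * j' + k' \<longleftrightarrow> k = k' \<and> j = j'"
proof
  assume "AK * j + k = AK * j' + k'"
  then have "(AK * j + k) mod AK = (AK * j' + k') mod AK" "(AK * j + k) div AK = (AK * j' + k') div AK" by simp_all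
  then show "k = k' \<and> j = j'" using assms by simp
qed simp

lemma fst_setr [simp]: "fst (setr x v s) y = (if y = x then v else fst s y)"
  by (simp add: setr_def)

lemma fst_seta [simp]: "fst (seta k j v s) = fst s"
  by (simp add: seta_def seth_def)

lemma fst_seth [simp]: "fst (seth a v s) = fst s"
  by (simp add: seth_def)

lemma snd_setr [simp]: "snd (setr x v s) = snd s"
  by (simp add: setr_def)

lemma arr_setr [simp]: "arr (setr x v s) = arr s"
  by (simp add: arr_def fun_eq_iff)

lemma arr_seta [simp]: "k < AK \<Longrightarrow> k' < AK \<Longrightarrow>
    arr (seta k j v s) k' j' = (if k' = k \<and> j' = j then v else arr s k' j')"
  by (auto simp: arr_def seta_def seth_def AK_inj)

definition fits :: "nat \<Rightarrow> nat \<Rightarrow> bool" where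
  "fits w J \<longleftrightarrow> KC + J \<le> 2 ^ w"

lemma ok_Arr [simp]: "fits w J \<Longrightarrow> ok w J (Arr k e) s \<longleftrightarrow> ok w J e s \<and> AK * ev e s + k < J"
  by (auto simp: Arr_def fits_def KC_def TD_def AK_def)

lemma cok_StA [simp]: "fits w J \<Longrightarrow>
    cok w J (StA k e v) s \<longleftrightarrow> ok w J e s \<and> ok w J v s \<and> AK * ev e s + k < J"
  by (auto simp: StA_def fits_def KC_def TD_def AK_def)

definition Ne :: "exp \<Rightarrow> exp \<Rightarrow> exp" where "Ne a b = B Pl (Lt a b) (Lt b a)"
definition Eqq :: "exp \<Rightarrow> exp \<Rightarrow> exp" where "Eqq a b = Ite (Ne a b) (N 0) (N 1)"
text \<open>Lazy: the right operand is evaluated only after the left one has succeeded, so that a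
  range test can guard an array access.\<close>

definition An :: "exp \<Rightarrow> exp \<Rightarrow> exp" where "An a b = Ite a b (N 0)"
definition Nt :: "exp \<Rightarrow> exp" where "Nt a = Ite a (N 0) (N 1)"
definition Or :: "exp \<Rightarrow> exp \<Rightarrow> exp" where "Or a b = Ite a (N 1) b"

lemma ev_Ne [simp]: "ev (Ne a b) s = (if ev a s = ev b s then 0 else 1)"
  by (simp add: Ne_def)

lemma ev_Eqq [simp]: "ev (Eqq a b) s = (if ev a s = ev b s then 1 else 0)"
  by (simp add: Eqq_def)

lemma ev_An: "ev (An a b) s \<noteq> 0 \<longleftrightarrow> ev a s \<noteq> 0 \<and> ev b s \<noteq> 0"
  by (simp add: An_def)

lemma ev_An_pos [simp]: "0 < ev (An a b) s \<longleftrightarrow> 0 < ev a s \<and> 0 < ev b s"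
  by (simp add: An_def)

lemma ev_An_0 [simp]: "ev (An a b) s = 0 \<longleftrightarrow> ev a s = 0 \<or> ev b s = 0"
  by (simp add: An_def)

lemma ev_Nt [simp]: "ev (Nt a) s = (if ev a s = 0 then 1 else 0)"
  by (simp add: Nt_def)

lemma ev_Or_pos [simp]: "0 < ev (Or a b) s \<longleftrightarrow> 0 < ev a s \<or> 0 < ev b s"
  by (simp add: Or_def)

lemma ev_Or_0 [simp]: "ev (Or a b) s = 0 \<longleftrightarrow> ev a s = 0 \<and> ev b s = 0"
  by (simp add: Or_def)

lemma fits_2: "fits w J \<Longrightarrow> 2 < (2::nat) ^ w"
  by (simp add: fits_def KC_def TD_def)

lemma ok_Ne [simp]: "fits w J \<Longrightarrow> ok w J (Ne a b) s \<longleftrightarrow> ok w J a s \<and> ok w J b s"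
  using fits_2[of w J] by (auto simp: Ne_def)

lemma ok_Eqq [simp]: "fits w J \<Longrightarrow> ok w J (Eqq a b) s \<longleftrightarrow> ok w J a s \<and> ok w J b s"
  using fits_2[of w J] by (auto simp: Eqq_def)

lemma ok_An [simp]: "fits w J \<Longrightarrow> ok w J (An a b) s \<longleftrightarrow> ok w J a s \<and> (ev a s \<noteq> 0 \<longrightarrow> ok w J b s)"
  using fits_2[of w J] by (auto simp: An_def)

lemma ok_Nt [simp]: "fits w J \<Longrightarrow> ok w J (Nt a) s \<longleftrightarrow> ok w J a s"
  using fits_2[of w J] by (auto simp: Nt_def)

lemma ok_Or [simp]: "fits w J \<Longrightarrow> ok w J (Or a b) s \<longleftrightarrow> ok w J a s \<and> (ev a s = 0 \<longrightarrow> ok w J b s)"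
  using fits_2[of w J] by (auto simp: Or_def)

section \<open>The streaming program\<close>

text \<open>\<open>rX\<close> is the arrived symbol, \<open>rI\<close> the number of symbols read,
  \<open>rF\<close> the fingerprint of the text, \<open>rA\<close> the start of the current run and
  \<open>rO\<close> its value before the last update, \<open>rH0\<close> and \<open>rH1\<close> the
  fingerprints of the two windows, \<open>rK\<close> and \<open>rG\<close> start and position of the
  sweep, \<open>rZ\<close> the answer. Registers 10 to 21 hold constants of the preprocessing, those
  from 30 on are scratch.\<close>

abbreviation (input) "rX \<equiv> 0::nat"
abbreviation (input) "rI \<equiv> 9::nat"
abbreviation (input) "rF \<equiv> 2::nat"
abbreviation (input) "rA \<equiv> 3::nat"
abbreviation (input) "rH0 \<equiv> 4::nat"
abbreviation (input) "rH1 \<equiv> 5::nat"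
abbreviation (input) "rK \<equiv> 6::nat"
abbreviation (input) "rG \<equiv> 7::nat"
abbreviation (input) "rZ \<equiv> 8::nat"
abbreviation (input) "rP \<equiv> 10::nat"
abbreviation (input) "rR \<equiv> 11::nat"
abbreviation (input) "rC \<equiv> 12::nat"
abbreviation (input) "rRho \<equiv> 13::nat"
abbreviation (input) "rL0 \<equiv> 14::nat"
abbreviation (input) "rW0 \<equiv> 15::nat"
abbreviation (input) "rT0 \<equiv> 16::nat"
abbreviation (input) "rD \<equiv> 17::nat"
abbreviation (input) "rW1 \<equiv> 18::nat"
abbreviation (input) "rM \<equiv> 19::nat"
abbreviation (input) "rT1 \<equiv> 20::nat"
abbreviation (input) "rNh \<equiv> 21::nat"
abbreviation (input) "rTau \<equiv> 30::nat"
abbreviation (input) "rO \<equiv> 31::nat"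
abbreviation (input) "rVo \<equiv> 32::nat"
abbreviation (input) "rX1 \<equiv> 33::nat"
abbreviation (input) "rEv \<equiv> 34::nat"
abbreviation (input) "rU \<equiv> 35::nat"
abbreviation (input) "rB \<equiv> 36::nat"

text \<open>\<open>aLast\<close> maps a symbol to its last position plus one. \<open>aTr\<close> and
  \<open>aFr\<close> are rings of recent distances and prefix fingerprints, \<open>aS0\<close> and
  \<open>aS1\<close> calendars of the events of the two windows. \<open>aPend\<close> and
  \<open>aPf\<close> hold the pending occurrence of a level and the text fingerprint at its end,
  \<open>aLx\<close> and \<open>aRs\<close> its chain; \<open>aKd\<close>, \<open>aLen\<close>,
  \<open>aA\<close>, \<open>aB\<close> describe the extension to the next level.\<close>

abbreviation (input) "aLast \<equiv> 0::nat"
abbreviation (input) "aTr \<equiv> 14::nat"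
abbreviation (input) "aFr \<equiv> 2::nat"
abbreviation (input) "aS0 \<equiv> 3::nat"
abbreviation (input) "aS1 \<equiv> 4::nat"
abbreviation (input) "aPw \<equiv> 5::nat"
abbreviation (input) "aPend \<equiv> 6::nat"
abbreviation (input) "aPf \<equiv> 7::nat"
abbreviation (input) "aLen \<equiv> 8::nat"
abbreviation (input) "aA \<equiv> 9::nat"
abbreviation (input) "aB \<equiv> 10::nat"
abbreviation (input) "aLx \<equiv> 11::nat"
abbreviation (input) "aRs \<equiv> 12::nat"
abbreviation (input) "aKd \<equiv> 13::nat"

abbreviation (input) "Plus \<equiv> B Pl"
abbreviation (input) "Times \<equiv> B Ti"
abbreviation (input) "Modu \<equiv> B Mo"

definition bIn :: com where
  "bIn = Sq (Asg rTau (Ite (Arr aLast (V rX)) (Sb (Plus (V rI) (N 1)) (Arr aLast (V rX))) (N 0)))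
    (Sq (StA aLast (V rX) (Plus (V rI) (N 1)))
    (Sq (StA aTr (Modu (V rI) (V rC)) (V rTau))
        (Asg rF (Modu (Plus (Times (V rF) (V rR)) (V rTau)) (V rP)))))"

text \<open>\<open>rO\<close> keeps the previous start because the base test uses the run without
  the newest position.\<close>

definition bRun :: com where
  "bRun = Sq (Asg rO (V rA)) (If (Lt (V rI) (V rRho)) Skip
    (Sq (Asg rU (Arr aTr (Modu (Sb (V rI) (V rRho)) (V rC))))
    (If (Ne (V rU) (V rTau))
      (Sq (Asg rB (Sb (Sb (Plus (V rI) (N 1)) (V rRho))
            (Ite (V rU) (Ite (V rTau) (Ite (Lt (V rU) (V rTau)) (V rU) (V rTau)) (V rU)) (V rTau))))
          (If (Lt (V rA) (V rB)) (Asg rA (V rB)) Skip))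
      Skip)))"

text \<open>\<open>rVo\<close> is the outgoing contribution, \<open>rEv\<close> that of the entry
  cleared by the event of this time. The calendar is never erased, so an entry found in it is
  trusted only after checking that it is an event. Finally the current position is entered under the
  time at which its predecessor leaves the window.\<close>

definition bWin :: "nat \<Rightarrow> nat \<Rightarrow> nat \<Rightarrow> nat \<Rightarrow> com" where
  "bWin H L W S =
    Sq (Asg rVo (Ite (Lt (V rI) (V W)) (N 0)
         (Ite (Lt (Sb (V L) (V W)) (Arr aTr (Modu (Sb (V rI) (V W)) (V rC)))) (N 0)
           (Times (Arr aTr (Modu (Sb (V rI) (V W)) (V rC))) (Arr aPw (V W))))))
    (Sq (Asg rX1 (Arr S (Modu (V rI) (V rC))))
    (Sq (Asg rEv (Ite (An (V rX1) (An (Lt (Sb (V rX1) (N 1)) (V rI))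
             (An (Lt (V rI) (Plus (Sb (V rX1) (N 1)) (V W)))
               (Eqq (Plus (Arr aTr (Modu (Sb (V rX1) (N 1)) (V rC))) (V rI))
                    (Plus (Sb (V rX1) (N 1)) (V L))))))
          (Times (Arr aTr (Modu (Sb (V rX1) (N 1)) (V rC))) (Arr aPw (Sb (V rI) (Sb (V rX1) (N 1)))))
          (N 0)))
    (Sq (Asg H (Modu (Plus (Plus (Plus (Times (V H) (V rR)) (Ite (Lt (V rTau) (V L)) (V rTau) (N 0)))
            (Sb (V rP) (Modu (V rVo) (V rP)))) (Sb (V rP) (Modu (V rEv) (V rP)))) (V rP)))
     (If (An (V rTau) (An (Lt (V rTau) (V L)) (Lt (Sb (V L) (V W)) (V rTau))))
       (StA S (Modu (Sb (Plus (V rI) (V L)) (V rTau)) (V rC)) (Plus (V rI) (N 1)))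
       Skip))))"

definition bAdv :: com where
  "bAdv = Sq (Asg rI (Plus (V rI) (N 1))) (StA aFr (Modu (V rI) (V rC)) (V rF))"

definition bBase :: com where
  "bBase = If (An (Nt (Lt (V rI) (V rL0))) (An (Nt (Lt (V rI) (Plus (V rO) (V rL0)))) (Eqq (V rH0) (V rT0))))
     (Sq (StA aPend (N 0) (Plus (V rI) (N 1))) (StA aPf (N 0) (V rF))) Skip"

definition bReset :: com where
  "bReset = If (Lt (V rG) (V rNh)) Skip (Sq (Asg rK (V rI)) (Asg rG (N 0)))"

text \<open>\<open>rX1\<close> is the end of the pending occurrence, \<open>rEv\<close> its next checkpoint, \<open>rB\<close> the verdict.\<close>

definition bVerd :: com where
  "bVerd = If (Arr aKd (V rG))
    (Asg rB (Ite (Lt (Arr aKd (V rG)) (N 2))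
       (Or (Nt (Arr aTr (Modu (V rX1) (V rC)))) (Lt (Arr aA (V rG)) (Arr aTr (Modu (V rX1) (V rC)))))
       (Eqq (Arr aFr (Modu (V rEv) (V rC)))
          (Modu (Plus (Times (Arr aPf (V rG)) (Arr aA (V rG))) (Arr aB (V rG))) (V rP)))))
    (Sq (If (An (Arr aLx (V rG)) (Eqq (Plus (Arr aLx (V rG)) (Arr aA (V rG))) (Plus (V rX1) (N 1))))
          Skip (StA aRs (V rG) (V rX1)))
    (Sq (StA aLx (V rG) (Plus (V rX1) (N 1)))
        (Asg rB (Nt (Lt (V rX1) (Plus (Arr aRs (V rG)) (Arr aB (V rG))))))))"

definition bProm :: com where
  "bProm = Sq (If (V rB)
      (Sq (StA aPend (Plus (V rG) (N 1)) (Plus (V rEv) (N 1)))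
          (StA aPf (Plus (V rG) (N 1)) (Arr aFr (Modu (V rEv) (V rC)))))
      Skip)
    (StA aPend (V rG) (N 0))"

definition bVisit :: com where
  "bVisit = If (Arr aPend (V rG))
    (Sq (Asg rX1 (Sb (Arr aPend (V rG)) (N 1)))
    (Sq (Asg rEv (Plus (V rX1) (Arr aLen (V rG))))
    (If (Lt (V rK) (V rEv)) Skip (Sq bVerd bProm))))
    Skip"

definition bSweep :: com where
  "bSweep = Sq bReset (If (Lt (V rG) (V rNh)) (Sq bVisit (Asg rG (Plus (V rG) (N 1)))) Skip)"

text \<open>\<open>aPend\<close> stores an end plus one; the occurrence asked for ended
  \<open>rD\<close> symbols ago.\<close>

definition bAns :: com where
  "bAns = Asg rZ (An (Arr aPend (V rNh))
     (An (Eqq (Plus (Arr aPend (V rNh)) (V rD)) (Plus (V rI) (N 1))) (Eqq (V rH1) (V rT1))))"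

definition bAll :: com where
  "bAll = Sq bIn (Sq bRun (Sq (bWin rH0 rL0 rW0 aS0) (Sq (bWin rH1 rM rW1 aS1)
     (Sq bAdv (Sq bBase (Sq bSweep bAns))))))"

section \<open>Frame conditions\<close>

definition same :: "nat set \<Rightarrow> nat set \<Rightarrow> st \<Rightarrow> st \<Rightarrow> bool" where
  "same Rg As s s' \<longleftrightarrow> (\<forall>y. y \<notin> Rg \<longrightarrow> fst s' y = fst s y) \<and> (\<forall>k<AK. k \<notin> As \<longrightarrow> arr s' k = arr s k)"

text \<open>Recognises the address expressions produced by \<open>StA\<close>; a store through any
  other address is assumed to hit every array.\<close>

definition target :: "exp \<Rightarrow> nat set" where
  "target a = (case a of B Pl (B Ti (N q) f) (N k) \<Rightarrow> if q = AK \<and> k < AK then {k} else UNIV | _ \<Rightarrow> UNIV)"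

primrec stor :: "com \<Rightarrow> nat set" where
  "stor Skip = {}"
| "stor (Asg x e) = {}"
| "stor (Sto a e) = target a"
| "stor (Sq c d) = stor c \<union> stor d"
| "stor (If e c d) = stor c \<union> stor d"
| "stor (For x y e c) = stor c"

lemma stor_StA [simp]: "k < AK \<Longrightarrow> stor (StA k e v) = {k}"
  by (simp add: StA_def target_def)

lemma asgd_StA [simp]: "asgd (StA k e v) = {}"
  by (simp add: StA_def)

lemma stor_frame:
  assumes "k < AK" "k \<notin> stor c"
  shows "arr (cex c s) k = arr s k"
  using assms
proof (induction c arbitrary: s)
  case (Sto a e)
  have "target a \<noteq> UNIV" using Sto by auto
  then obtain f k' where a: "a = B Pl (B Ti (N AK) f) (N k')" "k' < AK" "target a = {k'}"
    unfolding target_def by (auto split: exp.splits aop.splits if_splits)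
  then have "cex (Sto a e) s = seta k' (ev f s) (ev e s) s" "k \<noteq> k'" using Sto by (auto simp: seta_def)
  then show ?case using Sto a by (auto simp: fun_eq_iff)
next
  case (For x y e c)
  have "arr (fold (\<lambda>j s. cex c (setr x j s)) [0..<n] s') k = arr s k" if "arr s' k = arr s k" for s' n
    by (rule fold_preserves[where P = "\<lambda>s'. arr s' k = arr s k"]) (use For that in auto)
  then show ?case using For by simp
qed auto

lemma same_cex: "asgd c \<subseteq> Rg \<Longrightarrow> stor c \<subseteq> As \<Longrightarrow> same Rg As s (cex c s)"
  unfolding same_def using cex_unassigned stor_frame by blast

lemma arr_seta_other: "k < AK \<Longrightarrow> k' < AK \<Longrightarrow> k' \<noteq> k \<Longrightarrow> arr (seta k j v s) k' = arr s k'"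
  by (rule ext) simp

lemma arr_seta_same: "k < AK \<Longrightarrow> arr (seta k j v s) k = (arr s k)(j := v)"
  by (rule ext) simp

section \<open>Text-side invariants: distances, runs and windows\<close>

locale text_stream =
  fixes T P :: "nat list" and n m sg w J p r C :: nat
  assumes lenT: "length T = n" and setT: "set T \<subseteq> {0..<sg}"
    and fit: "fits w J" and sgC: "sg \<le> C" and CJ: "AK * C + AK \<le> J"
    and p: "prime p" "n + 2 \<le> p" "C \<le> p" "m + 2 \<le> p" "4 * p * p < 2 ^ w" and rp: "r < p"
begin

definition \<tau> :: "nat \<Rightarrow> nat" where "\<tau> = pd T"
definition \<pi> :: "nat \<Rightarrow> nat" where "\<pi> = pd P"

lemma \<tau>_le: "\<tau> i \<le> i" by (simp add: \<tau>_def pd_le)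
lemma \<pi>_le: "\<pi> i \<le> i" by (simp add: \<pi>_def pd_le)

lemma pp: "p \<le> p * p" "1 \<le> p" "0 < p" "4 * p \<le> 4 * p * p" "p * p < 2 ^ w" "p < 2 ^ w" "4 * p < 2 ^ w" "4 * (p * p) < 2 ^ w"
  using p by (auto intro: le_less_trans[OF _ p(5)])

lemma small: "x \<le> 4 * p \<Longrightarrow> x < 2 ^ w"
  using pp by linarith

lemma mps: "y mod p < 2 ^ w"
  using pp mod_less_divisor[of p y] by linarith

lemma mCs: "0 < C \<Longrightarrow> y mod C < 2 ^ w"
  using pp p(3) mod_less_divisor[of C y] by linarith

lemma idx: "j < C \<Longrightarrow> k < AK \<Longrightarrow> AK * j + k < J" "j \<le> C \<Longrightarrow> k < AK \<Longrightarrow> AK * j + k < J"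
proof -
  show "j \<le> C \<Longrightarrow> k < AK \<Longrightarrow> AK * j + k < J"
    using CJ mult_le_mono2[of j C AK] by linarith
  then show "j < C \<Longrightarrow> k < AK \<Longrightarrow> AK * j + k < J" by simp
qed

definition last_ok :: "nat \<Rightarrow> (nat \<Rightarrow> nat) \<Rightarrow> bool" where
  "last_ok e f \<longleftrightarrow> (\<forall>x<sg. f x \<le> e \<and> (f x \<noteq> 0 \<longrightarrow> T ! (f x - 1) = x) \<and> (\<forall>j<e. T ! j = x \<longrightarrow> j < f x))"

lemma last_ok_tau:
  assumes l: "last_ok e f" and e: "e < n"
  shows "(if f (T ! e) \<noteq> 0 then e + 1 - f (T ! e) else 0) = \<tau> e"
proof -
  have x: "T ! e < sg" using setT lenT e by (metis atLeastLessThan_iff nth_mem subsetD)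
  let ?f = "f (T ! e)"
  have f: "?f \<le> e" "?f \<noteq> 0 \<longrightarrow> T ! (?f - 1) = T ! e" "\<And>j. j < e \<Longrightarrow> T ! j = T ! e \<Longrightarrow> j < ?f"
    using l x by (auto simp: last_ok_def)
  show ?thesis
  proof (cases "?f = 0")
    case True
    have "pd T e = 0" by (rule pd_0I) (use f True in \<open>metis diff_less less_le_trans less_nat_zero_code zero_less_one\<close>)
    then show ?thesis using True by (simp add: \<tau>_def)
  next
    case False
    have "pd T e = e + 1 - ?f"
    proof (rule pd_eqI)
      show "1 \<le> e + 1 - ?f" "e + 1 - ?f \<le> e" using f False by auto
      have "e - (e + 1 - ?f) = ?f - 1" using f False by auto
      then show "T ! (e - (e + 1 - ?f)) = T ! e" using f(2) False by simp
      fix d assume d: "1 \<le> d" "d < e + 1 - ?f"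
      then show "T ! (e - d) \<noteq> T ! e" using f(3)[of "e - d"] by auto
    qed
    then show ?thesis using False by (simp add: \<tau>_def)
  qed
qed

lemma last_ok_Suc:
  assumes l: "last_ok e f"
  shows "last_ok (Suc e) (f(T ! e := Suc e))"
  using l unfolding last_ok_def by (auto simp: less_Suc_eq le_Suc_eq)

definition ring_tr :: "nat \<Rightarrow> (nat \<Rightarrow> nat) \<Rightarrow> bool" where
  "ring_tr e f \<longleftrightarrow> (\<forall>x<e. e \<le> x + C \<longrightarrow> f (x mod C) = \<tau> x)"

text \<open>Indexed by prefix lengths instead of positions: length \<open>e\<close> itself is
  present already, and length 0, which is never written, is left out.\<close>

definition ring_fr :: "nat \<Rightarrow> (nat \<Rightarrow> nat) \<Rightarrow> bool" where
  "ring_fr e f \<longleftrightarrow> (\<forall>x. 1 \<le> x \<and> x \<le> e \<and> e < x + C \<longrightarrow> f (x mod C) = hh r \<tau> x mod p)"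

lemma mod_inj: "x mod C = y mod C \<Longrightarrow> x < y + C \<Longrightarrow> y < x + C \<Longrightarrow> x = y"
proof (induction x y rule: linorder_wlog)
  case (le x y)
  then have "C dvd y - x" by (metis mod_eq_dvd_iff_nat)
  then show ?case using le by (metis add_diff_inverse_nat dvd_imp_le le_antisym less_diff_conv2 nat_add_left_cancel_less not_le zero_less_diff)
next
  case (sym x y)
  then show ?case by auto
qed

lemma ring_tr_Suc: "ring_tr e f \<Longrightarrow> ring_tr (Suc e) (f(e mod C := \<tau> e))"
  unfolding ring_tr_def
proof (intro allI impI)
  fix x assume f: "\<forall>x<e. e \<le> x + C \<longrightarrow> f (x mod C) = \<tau> x" and x: "x < Suc e" "Suc e \<le> x + C"
  show "(f(e mod C := \<tau> e)) (x mod C) = \<tau> x"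
  proof (cases "x = e")
    case False
    then have "x mod C \<noteq> e mod C" using mod_inj[of x e] x by auto
    then show ?thesis using f x False by simp
  qed simp
qed

lemma ring_fr_Suc: "ring_fr e f \<Longrightarrow> ring_fr (Suc e) (f(Suc e mod C := hh r \<tau> (Suc e) mod p))"
  unfolding ring_fr_def
proof (intro allI impI)
  fix x assume f: "\<forall>x. 1 \<le> x \<and> x \<le> e \<and> e < x + C \<longrightarrow> f (x mod C) = hh r \<tau> x mod p"
    and x: "1 \<le> x \<and> x \<le> Suc e \<and> Suc e < x + C"
  show "(f(Suc e mod C := hh r \<tau> (Suc e) mod p)) (x mod C) = hh r \<tau> x mod p"
  proof (cases "x = Suc e")
    case False
    then have "x mod C \<noteq> Suc e mod C" using mod_inj[of x "Suc e"] x by auto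
    then show ?thesis using f x False by simp
  qed simp
qed

definition base :: "nat \<Rightarrow> st \<Rightarrow> bool" where
  "base e s \<longleftrightarrow> fst s rI = e \<and> fst s rP = p \<and> fst s rR = r \<and> fst s rC = C"

lemma bIn:
  assumes b: "base e s" and e: "e < n" and X: "fst s rX = T ! e" and F: "fst s rF = hh r \<tau> e mod p"
    and l: "last_ok e (arr s aLast)" and t: "ring_tr e (arr s aTr)"
  shows "cok w J bIn s" "fst (cex bIn s) rTau = \<tau> e" "fst (cex bIn s) rF = hh r \<tau> (Suc e) mod p"
    "last_ok (Suc e) (arr (cex bIn s) aLast)" "ring_tr (Suc e) (arr (cex bIn s) aTr)"
    "same {rTau, rF} {aLast, aTr} s (cex bIn s)"
proof -
  have x: "T ! e < sg" using setT lenT e by (metis atLeastLessThan_iff nth_mem subsetD)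
  have C: "0 < C" "T ! e < C" using x sgC by auto
  have tau: "(if 0 < arr s aLast (T ! e) then Suc e - arr s aLast (T ! e) else 0) = \<tau> e"
    using last_ok_tau[OF l e] by (simp split: if_splits)
  have le: "\<tau> e \<le> p" using \<tau>_le[of e] e p by simp
  have hl: "hh r \<tau> e mod p < p" using pp by simp
  have Fr: "hh r \<tau> e mod p * r \<le> p * p" using hl rp by (intro mult_le_mono) auto
  have Fs: "hh r \<tau> e mod p * r + \<tau> e < 2 ^ w" using Fr le pp by linarith
  have Fm: "(hh r \<tau> e mod p * r + \<tau> e) mod p = hh r \<tau> (Suc e) mod p"
    by simp (metis mod_add_left_eq mod_mult_left_eq)
  have S: "Suc e < 2 ^ w" "hh r \<tau> e mod p * r < 2 ^ w" using e p Fr pp by (auto intro!: small)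
  note [simp] = b[unfolded base_def] X F fit
  have ev1: "ev (Ite (Arr aLast (V rX)) (Sb (Plus (V rI) (N 1)) (Arr aLast (V rX))) (N 0)) s = \<tau> e"
    using tau by (simp split: if_splits)
  have m1: "e mod C < C" using C by simp
  have mC: "e mod C < C" "e mod C < 2 ^ w" "T ! e < 2 ^ w" using m1 C p(3) pp(6) by linarith+
  have s: "cex bIn s = setr rF (hh r \<tau> (Suc e) mod p) (seta aTr (e mod C) (\<tau> e) (seta aLast (T ! e) (Suc e) (setr rTau (\<tau> e) s)))"
    unfolding bIn_def cex.simps ev1 by (simp add: Fm del: hh.simps)
  show "cok w J bIn s"
    unfolding bIn_def cok.simps cex.simps ev1
    using C S Fs mC mps idx(1)[of "T ! e" 0] idx(1)[of "e mod C" aTr] by (simp add: AK_def)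
  show "fst (cex bIn s) rTau = \<tau> e" "fst (cex bIn s) rF = hh r \<tau> (Suc e) mod p"
    unfolding s by (simp_all del: hh.simps)
  have "arr (cex bIn s) aLast = (arr s aLast)(T ! e := Suc e)"
    unfolding s by (simp add: arr_seta_other arr_seta_same AK_def)
  then show "last_ok (Suc e) (arr (cex bIn s) aLast)" using last_ok_Suc[OF l] by simp
  have "arr (cex bIn s) aTr = (arr s aTr)(e mod C := \<tau> e)"
    unfolding s by (simp add: arr_seta_other arr_seta_same AK_def)
  then show "ring_tr (Suc e) (arr (cex bIn s) aTr)" using ring_tr_Suc[OF t] by simp
  show "same {rTau, rF} {aLast, aTr} s (cex bIn s)"
    by (rule same_cex) (simp_all add: bIn_def AK_def)
qed

text \<open>The valid starts are closed under going right, so their least element represents them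
  all.\<close>

definition run_start :: "nat \<Rightarrow> nat \<Rightarrow> nat \<Rightarrow> bool" where
  "run_start \<rho> e a \<longleftrightarrow> a \<le> e \<and> (\<forall>q. a \<le> q \<longleftrightarrow> runok \<tau> \<rho> q e)"

lemma tr_eq_iff: "tr k u = tr k v \<longleftrightarrow> u = v \<or> (u = 0 \<or> k < u) \<and> (v = 0 \<or> k < v)"
  by (auto simp: tr_def)

text \<open>The newest position adds one comparison. If \<open>u\<close> and \<open>v\<close>
  differ, they agree after truncation only if every nonzero one of them is cut off, that is at
  offsets below the smaller nonzero value; \<open>b\<close> is the least start with such an
  offset.\<close>

lemma run_start_Suc:
  assumes a: "run_start \<rho> e a" and rho: "1 \<le> \<rho>"
  defines "u \<equiv> \<tau> (e - \<rho>)" and "v \<equiv> \<tau> e"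
  defines "b \<equiv> e + 1 - \<rho> - (if u \<noteq> 0 then (if v \<noteq> 0 then (if u < v then u else v) else u) else v)"
  shows "run_start \<rho> (Suc e) (if e < \<rho> \<or> u = v then a else if a < b then b else a)"
proof -
  have ae: "a \<le> e" and r: "\<And>q. a \<le> q \<longleftrightarrow> runok \<tau> \<rho> q e" using a by (auto simp: run_start_def)
  show ?thesis
  proof (cases "e < \<rho> \<or> u = v")
    case True
    then have "q + \<rho> \<le> e \<longrightarrow> tr (e - \<rho> - q) (\<tau> (e - \<rho>)) = tr (e - \<rho> - q) (\<tau> e)" for q
      by (auto simp: u_def v_def)
    then have "runok \<tau> \<rho> q (Suc e) \<longleftrightarrow> a \<le> q" for q unfolding runok_Suc using r by blast
    then show ?thesis using True ae unfolding run_start_def by simp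
  next
    case False
    define d where "d = (if u \<noteq> 0 then (if v \<noteq> 0 then (if u < v then u else v) else u) else v)"
    have d: "1 \<le> d" using False by (auto simp: d_def)
    have "(q + \<rho> \<le> e \<longrightarrow> tr (e - \<rho> - q) u = tr (e - \<rho> - q) v) \<longleftrightarrow> b \<le> q" for q
    proof -
      have "tr (e - \<rho> - q) u = tr (e - \<rho> - q) v \<longleftrightarrow> e - \<rho> - q < d"
        using False unfolding tr_eq_iff d_def by auto
      then show ?thesis using False d rho unfolding b_def d_def[symmetric] by auto
    qed
    then have "runok \<tau> \<rho> q (Suc e) \<longleftrightarrow> a \<le> q \<and> b \<le> q" for q
      unfolding runok_Suc using r by (simp add: u_def v_def)
    moreover have "b \<le> Suc e" by (simp add: b_def)
    moreover have "(if e < \<rho> \<or> u = v then a else if a < b then b else a) = max a b"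
      using False by simp
    ultimately show ?thesis using ae unfolding run_start_def by simp
  qed
qed

lemma ring_trD: "ring_tr e f \<Longrightarrow> x < e \<Longrightarrow> e \<le> x + C \<Longrightarrow> f (x mod C) = \<tau> x"
  by (simp add: ring_tr_def)

lemma bRun:
  assumes b: "base e s" and e: "e < n" and tau: "fst s rTau = \<tau> e"
    and t: "ring_tr (Suc e) (arr s aTr)" and a: "run_start \<rho> e (fst s rA)"
    and rho: "fst s rRho = \<rho>" "1 \<le> \<rho>" "\<rho> < C"
  shows "cok w J bRun s" "fst (cex bRun s) rO = fst s rA" "run_start \<rho> (Suc e) (fst (cex bRun s) rA)"
    "same {rO, rU, rB, rA} {} s (cex bRun s)"
proof -
  note [simp] = b[unfolded base_def] tau rho fit
  have u: "\<not> e < \<rho> \<Longrightarrow> arr s aTr ((e - \<rho>) mod C) = \<tau> (e - \<rho>)"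
  proof -
    assume "\<not> e < \<rho>"
    then have "e - \<rho> < Suc e" "Suc e \<le> e - \<rho> + C" using rho by linarith+
    then show ?thesis by (rule ring_trD[OF t])
  qed
  have S: "Suc e < 2 ^ w" "(1::nat) < 2 ^ w" using e p pp by (auto intro!: small)
  have C: "(e - \<rho>) mod C < C" using rho(3) by (intro mod_less_divisor) linarith
  then have mC: "(e - \<rho>) mod C < 2 ^ w" using p pp by linarith
  define u v where "u = \<tau> (e - \<rho>)" and "v = \<tau> e"
  define b where "b = e + 1 - \<rho> - (if u \<noteq> 0 then (if v \<noteq> 0 then (if u < v then u else v) else u) else v)"
  define s1 where "s1 = setr rO (fst s rA) s"
  define s2 where "s2 = setr rU u s1"
  let ?EB = "Sb (Sb (Plus (V rI) (N 1)) (V rRho))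
            (Ite (V rU) (Ite (V rTau) (Ite (Lt (V rU) (V rTau)) (V rU) (V rTau)) (V rU)) (V rTau))"
  have evB: "ev ?EB s2 = b" by (simp add: b_def s2_def s1_def v_def)
  have okB: "ok w J ?EB s2" using S by (simp add: s2_def s1_def)
  have s1: "cex (Asg rO (V rA)) s = s1" by (simp add: s1_def)
  have r: "fst s1 rI = e" "fst s1 rRho = \<rho>" "fst s1 rA = fst s rA" by (simp_all add: s1_def)
  have U: "\<not> e < \<rho> \<Longrightarrow> cex (Asg rU (Arr aTr (Modu (Sb (V rI) (V rRho)) (V rC)))) s1 = s2"
    using u by (simp add: s1_def s2_def u_def)
  have okU: "ok w J (Arr aTr (Modu (Sb (V rI) (V rRho)) (V rC))) s1"
    using mC C idx(1)[of "(e - \<rho>) mod C" aTr] by (simp add: s1_def AK_def)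
  have ne: "ev (Ne (V rU) (V rTau)) s2 \<noteq> 0 \<longleftrightarrow> u \<noteq> v" by (simp add: s2_def s1_def v_def)
  have rA2: "fst s2 rA = fst s rA" "fst s2 rO = fst s rA" by (simp_all add: s2_def s1_def)
  have cx: "cex bRun s = (if e < \<rho> then s1 else if u = v then s2 else
      if fst s rA < b then setr rA b (setr rB b s2) else setr rB b s2)"
  proof (cases "e < \<rho>")
    case True
    then show ?thesis unfolding bRun_def by (simp add: r s1_def)
  next
    case False
    show ?thesis
      unfolding bRun_def cex.simps(4,5) s1 U[OF False] cex.simps(2)[of rB] evB ne
      using False r rA2 by simp
  qed
  show "cok w J bRun s"
  proof (cases "e < \<rho>")
    case True
    then show ?thesis unfolding bRun_def by (simp add: r s1_def)
  next
    case False
    show ?thesis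
      unfolding bRun_def cok.simps(4,5,2) cex.simps(4,5) s1 U[OF False] cex.simps(2)[of rB] evB ne
      using False r okU okB by simp
  qed
  show "fst (cex bRun s) rO = fst s rA" unfolding cx by (simp add: rA2 s1_def)
  have "fst (cex bRun s) rA = (if e < \<rho> \<or> u = v then fst s rA else if fst s rA < b then b else fst s rA)"
    unfolding cx using rA2 r by simp
  then show "run_start \<rho> (Suc e) (fst (cex bRun s) rA)"
    using run_start_Suc[OF a rho(2)] unfolding b_def u_def v_def by simp
  show "same {rO, rU, rB, rA} {} s (cex bRun s)"
    by (rule same_cex) (simp_all add: bRun_def)
qed

text \<open>Only events still to come are recorded, each in the slot of its time modulo
  \<open>C\<close>. The other slots may hold anything.\<close>

definition sched :: "nat \<Rightarrow> nat \<Rightarrow> nat \<Rightarrow> (nat \<Rightarrow> nat) \<Rightarrow> bool" where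
  "sched L l e f \<longleftrightarrow> (\<forall>x<e. \<tau> x \<noteq> 0 \<and> e \<le> x - \<tau> x + L \<and> x < x - \<tau> x + L \<and> x - \<tau> x + L < x + l
     \<longrightarrow> f ((x - \<tau> x + L) mod C) = Suc x)"

text \<open>If two positions had the same predecessor, the earlier of them would be a nearer
  occurrence for the later one.\<close>

lemma \<tau>_inj: "\<tau> x \<noteq> 0 \<Longrightarrow> \<tau> y \<noteq> 0 \<Longrightarrow> x - \<tau> x = y - \<tau> y \<Longrightarrow> x = y"
proof (induction x y rule: linorder_wlog)
  case (le x y)
  show ?case
  proof (rule ccontr)
    assume "x \<noteq> y"
    then have xy: "x < y" using le by simp
    have "T ! (x - \<tau> x) = T ! x" using le(2) unfolding \<tau>_def by (cases rule: pd_cases[of T x]) auto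
    moreover have "T ! (y - \<tau> y) = T ! y" using le(3) unfolding \<tau>_def by (cases rule: pd_cases[of T y]) auto
    moreover have d: "1 \<le> y - x" "y - x < \<tau> y" "y - (y - x) = x"
      using xy le(2,4) \<tau>_le[of x] \<tau>_le[of y] by auto
    moreover have "T ! x \<noteq> T ! y"
    proof (cases rule: pd_cases[of T y])
      case 1
      then show ?thesis using le(3) by (simp add: \<tau>_def)
    next
      case 2
      show ?thesis using 2(4)[of "y - x"] d by (simp add: \<tau>_def)
    qed
    ultimately show False using le(4) by simp
  qed
qed auto

text \<open>The new entry overwrites no other one that is still needed: the times of pending events
  span less than \<open>C\<close>, so equal slots mean equal times, hence equal predecessors and
  equal positions.\<close>

lemma sched_Suc:
  assumes s: "sched L l e f" and lC: "l < C" and lL: "l \<le> L"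
  shows "sched L l (Suc e) (if \<tau> e \<noteq> 0 \<and> \<tau> e < L \<and> L - l < \<tau> e
     then f((e + L - \<tau> e) mod C := Suc e) else f)"
    (is "sched _ _ _ ?f")
  unfolding sched_def
proof (intro allI impI, elim conjE)
  fix x assume x: "x < Suc e" "\<tau> x \<noteq> 0" "Suc e \<le> x - \<tau> x + L" "x < x - \<tau> x + L" "x - \<tau> x + L < x + l"
  have te: "\<tau> e \<le> e" "\<tau> x \<le> x" by (rule \<tau>_le)+
  show "?f ((x - \<tau> x + L) mod C) = Suc x"
  proof (cases "x = e")
    case True
    have c: "\<tau> e \<noteq> 0" "\<tau> e < L" "L - l < \<tau> e" using x te lL True by auto
    have eq: "x - \<tau> x + L = e + L - \<tau> e" using te True by simp
    show ?thesis unfolding eq using c True by simp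
  next
    case False
    then have old: "f ((x - \<tau> x + L) mod C) = Suc x"
      using s[unfolded sched_def, rule_format, of x] x by simp
    have "(e + L - \<tau> e) mod C \<noteq> (x - \<tau> x + L) mod C" if c: "\<tau> e \<noteq> 0" "\<tau> e < L" "L - l < \<tau> e"
    proof
      assume "(e + L - \<tau> e) mod C = (x - \<tau> x + L) mod C"
      then have "e + L - \<tau> e = x - \<tau> x + L" by (rule mod_inj) (use c x te lC lL False in linarith)+
      then have "x - \<tau> x = e - \<tau> e" using te by linarith
      then show False using \<tau>_inj[of x e] x c False by simp
    qed
    then show ?thesis using old by auto
  qed
qed

lemma sched_event:
  assumes s: "sched L l e f" and ev: "event \<tau> L l e x" and "l \<le> L"
  shows "f (e mod C) = Suc x"
proof -
  have x: "x < e" "e < x + l" "\<tau> x + e = x + L" using ev by (auto simp: event_def)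
  then have "x - \<tau> x + L = e" using \<tau>_le[of x] by linarith
  moreover have "\<tau> x \<noteq> 0" using x assms(3) by auto
  ultimately show ?thesis using s[unfolded sched_def, rule_format, of x] x by simp
qed

lemma bWin:
  assumes b: "base e s" and e: "e < n" and tau: "fst s rTau = \<tau> e"
    and t: "ring_tr (Suc e) (arr s aTr)"
    and H: "H \<in> {rH0, rH1}" "fst s H = hh r (wv \<tau> L l e) l mod p"
    and Lr: "Lr \<in> {rL0, rM}" "fst s Lr = L" and Wr: "Wr \<in> {rW0, rW1}" "fst s Wr = l"
    and S: "S \<in> {aS0, aS1}" "sched L l e (arr s S)"
    and l: "1 \<le> l" "l \<le> L" "l < C" and Lm: "L \<le> m"
    and pw: "\<And>d. d \<le> l \<Longrightarrow> arr s aPw d = r ^ d mod p"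
  shows "cok w J (bWin H Lr Wr S) s" "fst (cex (bWin H Lr Wr S) s) H = hh r (wv \<tau> L l (Suc e)) l mod p"
    "sched L l (Suc e) (arr (cex (bWin H Lr Wr S) s) S)"
    "same {rVo, rX1, rEv, H} {S} s (cex (bWin H Lr Wr S) s)"
proof -
  note [simp] = b[unfolded base_def] tau fit
  have Hne: "H \<noteq> rVo" "H \<noteq> rX1" "H \<noteq> rEv" "H \<noteq> rI" "H \<noteq> rP" "H \<noteq> rC" "H \<noteq> rTau" "H \<noteq> rR" "H \<noteq> Lr" "H \<noteq> Wr"
    "Lr \<noteq> rVo" "Lr \<noteq> rX1" "Lr \<noteq> rEv" "Wr \<noteq> rVo" "Wr \<noteq> rX1" "Wr \<noteq> rEv" "S \<noteq> aTr" "S \<noteq> aPw"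
    using H(1) Lr(1) Wr(1) S(1) by auto
  have SA [simp]: "S < AK" using S(1) by (auto simp: AK_def)
  note [simp] = Hne Hne[symmetric] Lr(2) Wr(2) H(2)
  have C: "0 < C" using l by simp
  define X where "X = arr s S (e mod C)"
  define x where "x = X - 1"
  \<comment> \<open>What the program checks before it trusts the slot. Conversely, by
    \<open>sched_event\<close> the slot does hold the event of this time whenever there is
    one.\<close>
  define cond where "cond \<longleftrightarrow> X \<noteq> 0 \<and> x < e \<and> e < x + l \<and> arr s aTr (x mod C) + e = x + L"
  have tr: "arr s aTr (y mod C) = \<tau> y" if "y < e" "e < y + l" for y
    using ring_trD[OF t, of y] that l by simp
  have cond: "cond \<longleftrightarrow> X \<noteq> 0 \<and> event \<tau> L l e x"
    using tr[of x] unfolding cond_def event_def by auto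
  have evX: "X = Suc y" if "event \<tau> L l e y" for y
    using sched_event[OF S(2) that l(2)] by (simp add: X_def)
  have cond_ev: "cond \<longleftrightarrow> (\<exists>y. event \<tau> L l e y)"
    using cond evX by (auto simp: x_def)
  define Ev where "Ev = (if cond then \<tau> x * (r ^ (e - x) mod p) else 0)"
  define Ev' where "Ev' = (if cond then \<tau> x * r ^ (e - x) else 0)"
  define Vo where "Vo = (if e < l then 0 else if L - l < \<tau> (e - l) then 0 else \<tau> (e - l) * (r ^ l mod p))"
  have tro: "\<not> e < l \<Longrightarrow> arr s aTr ((e - l) mod C) = \<tau> (e - l)"
  proof -
    assume "\<not> e < l"
    then have "e - l < Suc e" "Suc e \<le> e - l + C" using l by linarith+
    then show ?thesis by (rule ring_trD[OF t])
  qed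
  have evVo: "ev (Ite (Lt (V rI) (V Wr)) (N 0)
         (Ite (Lt (Sb (V Lr) (V Wr)) (Arr aTr (Modu (Sb (V rI) (V Wr)) (V rC)))) (N 0)
           (Times (Arr aTr (Modu (Sb (V rI) (V Wr)) (V rC))) (Arr aPw (V Wr))))) s = Vo"
    using tro pw[of l] by (simp add: Vo_def)
  have wv0: "wv \<tau> L l e 0 * (r ^ l mod p) = Vo" by (simp add: wv_def Vo_def tr_def)
  have evmod: "Ev' mod p = Ev mod p" by (simp add: Ev_def Ev'_def mod_mult_right_eq)
  have step: "hh r (wv \<tau> L l (Suc e)) l + wv \<tau> L l e 0 * r ^ l + Ev' =
      hh r (wv \<tau> L l e) l * r + tr (L - 1) (\<tau> e)"
  proof (rule wv_step[OF \<tau>_inj l(1,2)])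
    have "x = y" if "event \<tau> L l e y" for y using evX[OF that] by (simp add: x_def)
    then show "Ev' = \<tau> y * r ^ (e - y)" if "event \<tau> L l e y" for y
      using that cond_ev by (auto simp: Ev'_def)
    show "Ev' = 0" if "\<And>x. \<not> event \<tau> L l e x"
      using that cond_ev by (simp add: Ev'_def)
  qed
  define tin where "tin = (if \<tau> e < L then \<tau> e else 0)"
  have trin: "tr (L - 1) (\<tau> e) = tin" using l by (auto simp: tr_def tin_def)
  define h1 where "h1 = (hh r (wv \<tau> L l e) l mod p * r + tin + (p - Vo mod p) + (p - Ev mod p)) mod p"
  have h1: "h1 = hh r (wv \<tau> L l (Suc e)) l mod p"
  proof -
    have "Vo mod p = (wv \<tau> L l e 0 * r ^ l) mod p" unfolding wv0[symmetric] by (rule mod_mult_right_eq)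
    then show ?thesis unfolding h1_def using mod_sub_update[OF pp(3) step] evmod trin by simp
  qed
  define f where "f \<longleftrightarrow> \<tau> e \<noteq> 0 \<and> \<tau> e < L \<and> L - l < \<tau> e"
  define s3 where "s3 = setr H h1 (setr rEv Ev (setr rX1 X (setr rVo Vo s)))"
  have cx: "0 < X \<and> X - Suc 0 < e \<and> e < X - Suc 0 + l \<and> arr s aTr ((X - Suc 0) mod C) + e = X - Suc 0 + L \<longleftrightarrow> cond"
    by (simp add: cond_def x_def)
  have cEv: "cond \<Longrightarrow> arr s aTr ((X - Suc 0) mod C) * arr s aPw (e - (X - Suc 0)) = Ev"
  proof -
    assume c: cond
    then have X: "X - Suc 0 = x" by (simp add: x_def)
    have "x < e" "e < x + l" using c by (auto simp: cond_def)
    then show ?thesis unfolding X using tr[of x] pw[of "e - x"] c by (simp add: Ev_def)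
  qed
  have nEv: "\<not> cond \<Longrightarrow> Ev = 0" by (simp add: Ev_def)
  have evEv: "ev (Ite (An (V rX1) (An (Lt (Sb (V rX1) (N 1)) (V rI))
             (An (Lt (V rI) (Plus (Sb (V rX1) (N 1)) (V Wr)))
               (Eqq (Plus (Arr aTr (Modu (Sb (V rX1) (N 1)) (V rC))) (V rI))
                    (Plus (Sb (V rX1) (N 1)) (V Lr))))))
          (Times (Arr aTr (Modu (Sb (V rX1) (N 1)) (V rC))) (Arr aPw (Sb (V rI) (Sb (V rX1) (N 1)))))
          (N 0)) (setr rX1 X (setr rVo Vo s)) = Ev"
  proof (cases cond)
    case True
    then have X: "X = Suc x" by (auto simp: cond_def x_def)
    have "x < e" "e < x + l" "arr s aTr (x mod C) + e = x + L" using True by (auto simp: cond_def)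
    then show ?thesis using cEv[OF True] by (simp add: X)
  next
    case False
    then have "\<not> (0 < X \<and> X - Suc 0 < e \<and> e < X - Suc 0 + l \<and> arr s aTr ((X - Suc 0) mod C) + e = X - Suc 0 + L)"
      using cx by blast
    then show ?thesis using nEv[OF False] by (simp only: ev.simps ev_An_0 ev_An ev_Arr ev_Eqq aval.simps fst_setr arr_setr) auto
  qed
  have X1: "ev (Arr S (Modu (V rI) (V rC))) (setr rVo Vo s) = X" by (simp add: X_def)
  have s: "cex (bWin H Lr Wr S) s = (if f then seta S ((e + L - \<tau> e) mod C) (Suc e) s3 else s3)"
    unfolding bWin_def cex.simps evVo X1 evEv
    by (simp add: s3_def f_def h1_def tin_def)
  have bnd: "\<tau> y \<le> y" for y by (rule \<tau>_le)
  have ml: "y mod p \<le> p" for y using pp by (simp add: less_imp_le)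
  have prod: "a * (b mod p) \<le> p * p" if "a \<le> p" for a b using that ml by (intro mult_le_mono) auto
  have Vob: "\<tau> (e - l) * (r ^ l mod p) < 2 ^ w"
  proof -
    have "\<tau> (e - l) \<le> p" using bnd[of "e - l"] e p(2) by linarith
    from prod[OF this, of "r ^ l"] show ?thesis using pp(5) by linarith
  qed
  have xb: "cond \<Longrightarrow> x < e" by (simp add: cond_def)
  have Evb: "Ev < 2 ^ w"
  proof (cases cond)
    case True
    have "\<tau> x \<le> p" using bnd[of x] xb[OF True] e p(2) by linarith
    from prod[OF this, of "r ^ (e - x)"] have "\<tau> x * (r ^ (e - x) mod p) < 2 ^ w" using pp(5) by linarith
    then show ?thesis using True by (simp add: Ev_def)
  qed (use pp in \<open>simp add: Ev_def\<close>)
  have Hr: "hh r (wv \<tau> L l e) l mod p * r \<le> p * p" using ml rp by (intro mult_le_mono) auto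
  have te: "\<tau> e \<le> p" using bnd[of e] e p by simp
  have tinb: "tin \<le> \<tau> e" by (simp add: tin_def)
  have sums: "hh r (wv \<tau> L l e) l mod p * r < 2 ^ w"
    "hh r (wv \<tau> L l e) l mod p * r + tin < 2 ^ w"
    "hh r (wv \<tau> L l e) l mod p * r + tin + (p - Vo mod p) < 2 ^ w"
    "hh r (wv \<tau> L l e) l mod p * r + tin + (p - Vo mod p) + (p - Ev mod p) < 2 ^ w"
    using Hr te tinb p pp by linarith+
  have sm: "(1::nat) < 2 ^ w" "Suc e < 2 ^ w" "e + L < 2 ^ w" using e p Lm pp by (auto intro!: small)
  have xs: "\<And>y. y < e \<Longrightarrow> y + l < 2 ^ w" "\<And>y. y < e \<Longrightarrow> y + L < 2 ^ w" "\<And>y. y < e \<Longrightarrow> \<tau> y + e < 2 ^ w"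
  proof -
    fix y assume y: "y < e"
    show "y + l < 2 ^ w" "y + L < 2 ^ w" using y e p(2,4) Lm l(2) pp(7) by linarith+
    show "\<tau> y + e < 2 ^ w" using y bnd[of y] e p(2) pp(7) by linarith
  qed
  have ix: "AK * ((y::nat) mod C) + k < J" if "k < AK" for y k using idx(1)[of "y mod C" k] C that by simp
  have ixd: "AK * d + aPw < J" if "d \<le> l" for d using idx(1)[of d aPw] l that by (simp add: AK_def)
  have ok1: "ok w J (Ite (Lt (V rI) (V Wr)) (N 0)
         (Ite (Lt (Sb (V Lr) (V Wr)) (Arr aTr (Modu (Sb (V rI) (V Wr)) (V rC)))) (N 0)
           (Times (Arr aTr (Modu (Sb (V rI) (V Wr)) (V rC))) (Arr aPw (V Wr))))) s"
    using tro pw[of l] Vob sm mCs C ix[of aTr "e - l"] ixd[of l] by (simp add: Vo_def AK_def)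
  have ok2: "ok w J (Ite (An (V rX1) (An (Lt (Sb (V rX1) (N 1)) (V rI))
             (An (Lt (V rI) (Plus (Sb (V rX1) (N 1)) (V Wr)))
               (Eqq (Plus (Arr aTr (Modu (Sb (V rX1) (N 1)) (V rC))) (V rI))
                    (Plus (Sb (V rX1) (N 1)) (V Lr))))))
          (Times (Arr aTr (Modu (Sb (V rX1) (N 1)) (V rC))) (Arr aPw (Sb (V rI) (Sb (V rX1) (N 1)))))
          (N 0)) (setr rX1 X (setr rVo Vo s))"
  proof (cases X)
    case 0
    then show ?thesis using sm by simp
  next
    case (Suc y)
    have y: "x = y" using Suc by (simp add: x_def)
    have c: "y < e \<Longrightarrow> e < y + l \<Longrightarrow> arr s aTr (y mod C) + e = y + L \<Longrightarrow>
       arr s aTr (y mod C) * arr s aPw (e - y) < 2 ^ w"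
      using cEv Evb Suc unfolding cond_def y by simp
    have t: "y < e \<Longrightarrow> e < y + l \<Longrightarrow> arr s aTr (y mod C) + e < 2 ^ w" using tr[of y] xs(3)[of y] by simp
    have i: "e < y + l \<Longrightarrow> AK * (e - y) + aPw < J" using ixd[of "e - y"] by simp
    show ?thesis
      using c t i xs(1,2)[of y] sm mCs[OF C] ix[of aTr y] by (simp add: Suc AK_def)
  qed
  let ?EH = "Modu (Plus (Plus (Plus (Times (V H) (V rR)) (Ite (Lt (V rTau) (V Lr)) (V rTau) (N 0)))
            (Sb (V rP) (Modu (V rVo) (V rP)))) (Sb (V rP) (Modu (V rEv) (V rP)))) (V rP)"
  let ?s2 = "setr rEv Ev (setr rX1 X (setr rVo Vo s))"
  have evH: "ev ?EH ?s2 = h1" by (simp add: h1_def tin_def)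
  have s3': "setr H h1 ?s2 = s3" by (simp add: s3_def)
  have okH: "ok w J ?EH ?s2" using sums mps by (cases "\<tau> e < L") (simp_all add: tin_def)
  have okX: "ok w J (Arr S (Modu (V rI) (V rC))) (setr rVo Vo s)" using ix[of S e] mCs[OF C] by simp
  have okI: "cok w J (If (An (V rTau) (An (Lt (V rTau) (V Lr)) (Lt (Sb (V Lr) (V Wr)) (V rTau))))
       (StA S (Modu (Sb (Plus (V rI) (V Lr)) (V rTau)) (V rC)) (Plus (V rI) (N 1)))
       Skip) s3"
    using sm mCs[OF C] ix[of S] by (simp add: s3_def)
  show "cok w J (bWin H Lr Wr S) s"
    unfolding bWin_def cok.simps(1-4) cex.simps(1-4) evVo X1 evEv evH s3'
    using ok1 ok2 okX okH okI by blast
  show "fst (cex (bWin H Lr Wr S) s) H = hh r (wv \<tau> L l (Suc e)) l mod p"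
    unfolding s using h1 by (simp add: s3_def)
  have "arr (cex (bWin H Lr Wr S) s) S = (if f then (arr s S)((e + L - \<tau> e) mod C := Suc e) else arr s S)"
    unfolding s by (simp add: s3_def arr_seta_same)
  then show "sched L l (Suc e) (arr (cex (bWin H Lr Wr S) s) S)"
    using sched_Suc[OF S(2) l(3,2)] by (simp add: f_def)
  show "same {rVo, rX1, rEv, H} {S} s (cex (bWin H Lr Wr S) s)"
    by (rule same_cex) (simp_all add: bWin_def)
qed

end

text \<open>Kind 0 is a run (\<open>Aa\<close> the period, \<open>Bb\<close> the length of the run),
  kind 1 a zero (\<open>Aa\<close> the prefix length), kind 2 a fingerprinted extension
  (\<open>Aa\<close> the power of \<open>r\<close>, \<open>Bb\<close> the fingerprint).
  \<open>good1\<close> and \<open>good2\<close> state that no comparison is fooled; they are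
  discharged later for all bases outside a small bad set.\<close>

locale level_stream = text_stream T P n m sg w J p r C
  for T P :: "nat list" and n m sg w J p r C :: nat +
  fixes \<rho> L0 l0 lam lw h :: nat and Lv ln Aa Bb kd :: "nat \<Rightarrow> nat"
  assumes mn: "1 \<le> m" "m \<le> n" and lenP: "length P = m"
    and rho: "1 \<le> \<rho>" "\<rho> < C" and L0: "1 \<le> L0" "L0 \<le> m" "perd \<pi> (L0 - 1) \<rho>"
    and l0: "l0 = min (\<rho> + 1) L0" "l0 < C"
    and lw: "1 \<le> lw" "lw \<le> m" "lw < C" "lam \<le> lw" "lam < C"
    and Lv: "Lv 0 = L0" "Lv h + lam = m" "\<And>g. g \<le> h \<Longrightarrow> L0 \<le> Lv g \<and> Lv g \<le> m"
    and hC: "h < C" "2 * h \<le> C" and tail: "2 * h \<le> lam" "lam < per \<pi> (Lv h)"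
    and room: "\<And>g. g < h \<Longrightarrow> 2 * h + ln g \<le> per \<pi> (Lv g)"
    and kd: "\<And>g. g < h \<Longrightarrow> kd g < 3"
    and kd0: "\<And>g. g < h \<Longrightarrow> kd g = 0 \<Longrightarrow> ln g = 0 \<and> Aa g = per \<pi> (Lv g) \<and>
       (\<exists>t. Bb g = t * per \<pi> (Lv g) \<and> Lv (Suc g) = Lv g + t * per \<pi> (Lv g) \<and>
         perd \<pi> (Lv (Suc g)) (per \<pi> (Lv g)) \<and> nz \<pi> (Lv g - per \<pi> (Lv g)) (Lv g))"
    and kd1: "\<And>g. g < h \<Longrightarrow> kd g = 1 \<Longrightarrow> ln g = 1 \<and> Aa g = Lv g \<and> Lv (Suc g) = Suc (Lv g) \<and> \<pi> (Lv g) = 0"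
    and kd2: "\<And>g. g < h \<Longrightarrow> kd g = 2 \<Longrightarrow> 1 \<le> ln g \<and> Lv (Suc g) = Lv g + ln g \<and> nz \<pi> (Lv g) (Lv (Suc g)) \<and>
       Aa g = r ^ ln g mod p \<and> Bb g = hh r (\<lambda>j. \<pi> (Lv g + j)) (ln g) mod p"
    and good1: "\<And>x L l. x + l \<le> n \<Longrightarrow> L + l \<le> m \<Longrightarrow>
       hh r (\<lambda>j. \<tau> (x + j)) l mod p = hh r (\<lambda>j. \<pi> (L + j)) l mod p \<Longrightarrow> \<forall>j<l. \<tau> (x + j) = \<pi> (L + j)"
    and good2: "\<And>e L l. e \<le> n \<Longrightarrow> l \<le> L \<Longrightarrow> L \<le> m \<Longrightarrow> L \<le> e \<Longrightarrow>
       hh r (wv \<tau> L l e) l mod p = hh r (\<lambda>j. \<pi> (L - l + j)) l mod p \<Longrightarrow>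
       \<forall>j<l. wv \<tau> L l e j = \<pi> (L - l + j)"
begin

abbreviation "Eg g \<equiv> em \<pi> \<tau> (Lv g)"

lemma Lv_pos: "g \<le> h \<Longrightarrow> 1 \<le> Lv g"
  using Lv(3)[of g] L0(1) by linarith

lemma win_iff:
  assumes "e \<le> n" "l \<le> L" "L \<le> m" "L \<le> e"
  shows "hh r (wv \<tau> L l e) l mod p = hh r (\<lambda>j. \<pi> (L - l + j)) l mod p \<longleftrightarrow>
    (\<forall>j<l. tr (L - l + j) (\<tau> (e - l + j)) = \<pi> (L - l + j))"
proof -
  have "hh r (wv \<tau> L l e) l mod p = hh r (\<lambda>j. \<pi> (L - l + j)) l mod p \<longleftrightarrow> (\<forall>j<l. wv \<tau> L l e j = \<pi> (L - l + j))"
  proof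
    assume "\<forall>j<l. wv \<tau> L l e j = \<pi> (L - l + j)"
    then have "hh r (wv \<tau> L l e) l = hh r (\<lambda>j. \<pi> (L - l + j)) l" by (intro hh_cong) simp
    then show "hh r (wv \<tau> L l e) l mod p = hh r (\<lambda>j. \<pi> (L - l + j)) l mod p" by (rule arg_cong)
  qed (rule good2[OF assms])
  then show ?thesis by (simp only: wv_match[OF assms(2,4)])
qed

lemma base_iff:
  assumes e: "e < n" and a: "run_start \<rho> e a"
  shows "em \<pi> \<tau> L0 (Suc e) \<longleftrightarrow> L0 \<le> Suc e \<and> a + L0 \<le> Suc e \<and>
    hh r (wv \<tau> L0 l0 (Suc e)) l0 mod p = hh r (\<lambda>j. \<pi> (L0 - l0 + j)) l0 mod p"
proof (cases "L0 \<le> Suc e")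
  case True
  have "em \<pi> \<tau> L0 (Suc e) \<longleftrightarrow> runok \<tau> \<rho> (Suc e - L0) e \<and>
     (\<forall>j<l0. tr (L0 - l0 + j) (\<tau> (Suc e - l0 + j)) = \<pi> (L0 - l0 + j))"
    using em_base[OF L0(3) rho(1) L0(1), of \<tau> "Suc e", folded l0(1)] True
    by (simp only: diff_Suc_1 simp_thms)
  also have "runok \<tau> \<rho> (Suc e - L0) e \<longleftrightarrow> a + L0 \<le> Suc e"
  proof -
    have "a \<le> Suc e - L0 \<longleftrightarrow> runok \<tau> \<rho> (Suc e - L0) e" using a unfolding run_start_def by blast
    then show ?thesis using True by linarith
  qed
  also have "(\<forall>j<l0. tr (L0 - l0 + j) (\<tau> (Suc e - l0 + j)) = \<pi> (L0 - l0 + j)) \<longleftrightarrow>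
      hh r (wv \<tau> L0 l0 (Suc e)) l0 mod p = hh r (\<lambda>j. \<pi> (L0 - l0 + j)) l0 mod p"
    using win_iff[of "Suc e" l0 L0] e True L0(2) l0(1) by simp
  finally show ?thesis using True by (simp only: simp_thms)
qed (simp add: em_def)

lemma step_run:
  assumes g: "g < h" "kd g = 0"
  shows "Eg (Suc g) y \<longleftrightarrow> (\<forall>k\<le>Bb g div per \<pi> (Lv g). k * per \<pi> (Lv g) \<le> y \<and> Eg g (y - k * per \<pi> (Lv g)))"
    and "Bb g div per \<pi> (Lv g) * per \<pi> (Lv g) = Bb g"
proof -
  obtain t where t: "Bb g = t * per \<pi> (Lv g)" "Lv (Suc g) = Lv g + t * per \<pi> (Lv g)"
     "perd \<pi> (Lv (Suc g)) (per \<pi> (Lv g))" "nz \<pi> (Lv g - per \<pi> (Lv g)) (Lv g)"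
    using kd0[OF g] by blast
  have p0: "0 < per \<pi> (Lv g)" using per(1)[of \<pi> "Lv g"] by simp
  then have d: "Bb g div per \<pi> (Lv g) = t" using t by simp
  then show "Bb g div per \<pi> (Lv g) * per \<pi> (Lv g) = Bb g" using t by simp
  show "Eg (Suc g) y \<longleftrightarrow> (\<forall>k\<le>Bb g div per \<pi> (Lv g). k * per \<pi> (Lv g) \<le> y \<and> Eg g (y - k * per \<pi> (Lv g)))"
    unfolding d t(2) using em_run[OF \<pi>_le per(1) per_le_length, of "Lv g" t] t Lv_pos[of g] g by simp
qed

lemma step_zero:
  assumes g: "g < h" "kd g = 1" and y: "0 < y"
  shows "Eg (Suc g) y \<longleftrightarrow> Eg g (y - 1) \<and> (\<tau> (y - 1) = 0 \<or> Lv g < \<tau> (y - 1))"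
  using em_zero[of \<pi> "Lv g" y \<tau>] kd1[OF g] y by (auto simp: tr_def)

text \<open>The fingerprint at the checkpoint splits into the shifted one at \<open>x\<close> and
  that of the new segment. The former cancels modulo \<open>p\<close>, and the absence of collisions
  does the rest.\<close>

lemma step_hash:
  assumes g: "g < h" "kd g = 2" and x: "Eg g x" "x + ln g \<le> n"
  shows "Eg (Suc g) (x + ln g) \<longleftrightarrow>
     hh r \<tau> (x + ln g) mod p = (hh r \<tau> x mod p * Aa g + Bb g) mod p"
proof -
  have k: "Lv (Suc g) = Lv g + ln g" "nz \<pi> (Lv g) (Lv (Suc g))" "Aa g = r ^ ln g mod p"
    "Bb g = hh r (\<lambda>j. \<pi> (Lv g + j)) (ln g) mod p" using kd2[OF g] by auto
  have xl: "Lv g \<le> x" using x by (simp add: em_def)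
  have Lm: "Lv g + ln g \<le> m" using Lv(3)[of "Suc g"] g k by simp
  have "hh r \<tau> (x + ln g) mod p = (hh r \<tau> x mod p * Aa g + Bb g) mod p \<longleftrightarrow>
     (hh r \<tau> x * r ^ ln g + hh r (\<lambda>j. \<tau> (x + j)) (ln g)) mod p = (hh r \<tau> x * r ^ ln g + hh r (\<lambda>j. \<pi> (Lv g + j)) (ln g)) mod p"
  proof -
    have "(hh r \<tau> x mod p * (r ^ ln g mod p) + z) mod p = (hh r \<tau> x * r ^ ln g + z) mod p" for z
      by (metis mod_add_left_eq mod_mult_eq)
    then show ?thesis unfolding hh_split k by (simp add: mod_add_right_eq)
  qed
  also have "\<dots> \<longleftrightarrow> hh r (\<lambda>j. \<tau> (x + j)) (ln g) mod p = hh r (\<lambda>j. \<pi> (Lv g + j)) (ln g) mod p"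
    using cong_add_lcancel_nat[of "hh r \<tau> x * r ^ ln g" "hh r (\<lambda>j. \<tau> (x + j)) (ln g)" "hh r (\<lambda>j. \<pi> (Lv g + j)) (ln g)" p]
    by (simp add: cong_def)
  also have "\<dots> \<longleftrightarrow> (\<forall>j<ln g. \<tau> (x + j) = \<pi> (Lv g + j))"
  proof
    assume "\<forall>j<ln g. \<tau> (x + j) = \<pi> (Lv g + j)"
    then have "hh r (\<lambda>j. \<tau> (x + j)) (ln g) = hh r (\<lambda>j. \<pi> (Lv g + j)) (ln g)" by (intro hh_cong) simp
    then show "hh r (\<lambda>j. \<tau> (x + j)) (ln g) mod p = hh r (\<lambda>j. \<pi> (Lv g + j)) (ln g) mod p" by (rule arg_cong)
  qed (rule good1[OF x(2) Lm])
  also have "\<dots> \<longleftrightarrow> Eg (Suc g) (x + ln g)"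
    using em_nonzero[of "Lv g" "Lv (Suc g)" \<pi> \<tau> "x + ln g"] k \<pi>_le x xl by simp
  finally show ?thesis by simp
qed

sublocale sw: sweep Eg h ln "\<lambda>g. per \<pi> (Lv g)" kd
proof
  show "Eg g x \<Longrightarrow> Eg g y \<Longrightarrow> x < y \<Longrightarrow> x + per \<pi> (Lv g) \<le> y" for g x y by (rule em_gap)
  show "g \<le> h \<Longrightarrow> Eg g x \<Longrightarrow> 0 < x" for g x using Lv_pos[of g] by (auto simp: em_def)
  show "g < h \<Longrightarrow> 2 * h + ln g \<le> per \<pi> (Lv g)" for g by (rule room)
  show "g < h \<Longrightarrow> kd g = 0 \<Longrightarrow> ln g = 0" for g using kd0 by blast
  fix g y assume g: "g < h" and E: "Eg (Suc g) y"
  consider "kd g = 0" | "kd g = 1" | "kd g = 2" using kd[OF g] by linarith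
  then show "ln g \<le> y \<and> Eg g (y - ln g)"
  proof cases
    case 1
    then have "Eg g (y - 0 * per \<pi> (Lv g))" using step_run(1)[OF g 1] E by blast
    then show ?thesis using kd0[OF g 1] by simp
  next
    case 2
    have "0 < y" using E Lv_pos[of "Suc g"] g by (auto simp: em_def)
    then show ?thesis using step_zero[OF g 2] E kd1[OF g 2] by simp
  next
    case 3
    have k: "Lv (Suc g) = Lv g + ln g" using kd2[OF g 3] by simp
    then have "Lv (Suc g) \<le> y" using E by (simp add: em_def)
    then show ?thesis using em_append[of "Lv g" "Lv (Suc g)" \<pi> \<tau> y] E k by simp
  qed
qed

section \<open>Level-side invariants along a sweep\<close>

definition cnst :: "st \<Rightarrow> bool" where
  "cnst s \<longleftrightarrow> fst s rP = p \<and> fst s rR = r \<and> fst s rC = C \<and> fst s rRho = \<rho> \<and> fst s rL0 = L0 \<and>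
     fst s rW0 = l0 \<and> fst s rT0 = hh r (\<lambda>j. \<pi> (L0 - l0 + j)) l0 mod p \<and> fst s rD = lam \<and> fst s rW1 = lw \<and>
     fst s rM = m \<and> fst s rT1 = hh r (\<lambda>j. \<pi> (m - lw + j)) lw mod p \<and> fst s rNh = h \<and>
     (\<forall>d<C. arr s aPw d = r ^ d mod p) \<and>
     (\<forall>g<h. arr s aLen g = ln g \<and> arr s aA g = Aa g \<and> arr s aB g = Bb g \<and> arr s aKd g = kd g)"

definition pf_ok :: "st \<Rightarrow> bool" where
  "pf_ok s \<longleftrightarrow> (\<forall>g\<le>h. \<forall>x. arr s aPend g = Suc x \<longrightarrow> arr s aPf g = hh r \<tau> x mod p)"

definition lev_ok :: "nat \<Rightarrow> nat \<Rightarrow> nat \<Rightarrow> st \<Rightarrow> bool" where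
  "lev_ok e gp \<kappa> s \<longleftrightarrow> sw.pend_ok e gp \<kappa> (arr s aPend) \<and> sw.runs_ok gp \<kappa> (arr s aLx) (arr s aRs) \<and> pf_ok s"

lemma lev_ok_cong:
  assumes "arr s' aPend = arr s aPend" "arr s' aLx = arr s aLx" "arr s' aRs = arr s aRs" "arr s' aPf = arr s aPf"
  shows "lev_ok e gp \<kappa> s' \<longleftrightarrow> lev_ok e gp \<kappa> s"
  using assms by (simp add: lev_ok_def pf_ok_def)

lemma bBase:
  assumes c: "cnst s" and e: "e < n" and I: "fst s rI = Suc e" and a: "run_start \<rho> e (fst s rO)"
    and H: "fst s rH0 = hh r (wv \<tau> L0 l0 (Suc e)) l0 mod p" and F: "fst s rF = hh r \<tau> (Suc e) mod p"
    and l: "lev_ok e gp \<kappa> s" "h \<noteq> 0 \<Longrightarrow> Suc e \<le> \<kappa> + h" "gp \<le> h" "\<kappa> \<le> e"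
  shows "cok w J bBase s" "lev_ok (Suc e) gp \<kappa> (cex bBase s)" "same {} {aPend, aPf} s (cex bBase s)"
proof -
  note [simp] = fit I F H
  have [simp]: "fst s rL0 = L0" "fst s rT0 = hh r (\<lambda>j. \<pi> (L0 - l0 + j)) l0 mod p" using c by (auto simp: cnst_def)
  have S: "fst s rO + L0 < 2 ^ w" "Suc (Suc e) < 2 ^ w"
    using a L0 p e by (auto simp: run_start_def intro!: small)
  have J: "AK * 0 + aPend < J" "AK * 0 + aPf < J" using idx(2)[of 0] by (simp_all add: AK_def)
  show "cok w J bBase s" using S J by (simp add: bBase_def AK_def del: hh.simps)
  have ev: "ev (An (Nt (Lt (V rI) (V rL0))) (An (Nt (Lt (V rI) (Plus (V rO) (V rL0)))) (Eqq (V rH0) (V rT0)))) s \<noteq> 0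
     \<longleftrightarrow> em \<pi> \<tau> L0 (Suc e)"
    unfolding base_iff[OF e a] by (simp add: not_less)
  have s: "cex bBase s = (if em \<pi> \<tau> L0 (Suc e) then seta aPf 0 (hh r \<tau> (Suc e) mod p) (seta aPend 0 (Suc (Suc e)) s) else s)"
    unfolding bBase_def cex.simps(5) ev by (simp del: hh.simps)
  have pe: "arr (cex bBase s) aPend = (arr s aPend)(0 := if Eg 0 (Suc e) then Suc (Suc e) else arr s aPend 0)"
    unfolding s by (simp add: arr_seta_other arr_seta_same AK_def Lv)
  have ot: "arr (cex bBase s) aLx = arr s aLx" "arr (cex bBase s) aRs = arr s aRs"
    unfolding s by (simp_all add: arr_seta_other AK_def)
  have "pf_ok (cex bBase s)"
    using l(1) unfolding s lev_ok_def pf_ok_def by (auto simp: AK_def simp del: hh.simps)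
  then show "lev_ok (Suc e) gp \<kappa> (cex bBase s)"
    using sw.pend_arrive[of e gp \<kappa> "arr s aPend"] l unfolding lev_ok_def pe ot by blast
  show "same {} {aPend, aPf} s (cex bBase s)"
    by (rule same_cex) (simp_all add: bBase_def AK_def)
qed

lemma cnstD:
  assumes "cnst s" "g < h"
  shows "arr s aLen g = ln g" "arr s aA g = Aa g" "arr s aB g = Bb g" "arr s aKd g = kd g"
  using assms by (auto simp: cnst_def)

lemma lev_bounds:
  assumes g: "g < h"
  shows "kd g = 0 \<Longrightarrow> Aa g \<le> m \<and> Bb g \<le> m" "kd g = 1 \<Longrightarrow> Aa g \<le> m" "kd g = 2 \<Longrightarrow> Aa g < p \<and> Bb g < p" "ln g \<le> m"
proof -
  have m: "Lv g \<le> m" "1 \<le> Lv g" "Lv (Suc g) \<le> m" using Lv(3)[of g] Lv(3)[of "Suc g"] Lv_pos[of g] g by auto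
  have pm: "per \<pi> (Lv g) \<le> m" using per_le_length[OF m(2), of \<pi>] m by linarith
  show "kd g = 0 \<Longrightarrow> Aa g \<le> m \<and> Bb g \<le> m" using kd0[OF g] pm m by auto
  show "kd g = 1 \<Longrightarrow> Aa g \<le> m" using kd1[OF g] m by auto
  show "kd g = 2 \<Longrightarrow> Aa g < p \<and> Bb g < p" using kd2[OF g] pp by simp
  show "ln g \<le> m" using room[OF g] pm by linarith
qed

context
  fixes s e g \<kappa> x y
  assumes c: "cnst s" and e: "e \<le> n" and g: "g < h" and k: "\<kappa> \<le> e" "e < \<kappa> + h"
    and tr: "ring_tr e (arr s aTr)" and fr: "ring_fr e (arr s aFr)"
    and pok: "sw.pend_ok e g \<kappa> (arr s aPend)" and pf: "pf_ok s"
    and rG: "fst s rG = g" and x: "arr s aPend g = Suc x" and y: "y = x + ln g" "y \<le> \<kappa>"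
begin

lemma pend_x: "Eg g x" "\<kappa> - h < y" "1 \<le> x"
proof -
  have "Eg g x \<and> x \<le> sw.al e g \<kappa> g \<and> sw.om g \<kappa> g < x + ln g"
    using pok g x unfolding sw.pend_ok_def by blast
  then show "Eg g x" "\<kappa> - h < y" using y by (auto simp: sw.om_def)
  then show "1 \<le> x" using sw.pos[of g x] g by auto
qed

text \<open>The checkpoint lies less than \<open>h\<close> before \<kappa>, and \<kappa> less than
  \<open>h\<close> before \<open>e\<close>; a ring with at least \<open>2 * h\<close> entries still
  contains it.\<close>

lemma fr_y: "arr s aFr (y mod C) = hh r \<tau> y mod p"
  using fr pend_x(2,3) k y hC(2) unfolding ring_fr_def by auto

lemma tr_x: "ln g = 1 \<Longrightarrow> arr s aTr (x mod C) = \<tau> x"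
  by (rule ring_trD[OF tr]) (use pend_x(2,3) k y hC(2) in linarith)+

lemma bVerd:
  assumes X: "fst s rX1 = x" and Y: "fst s rEv = y" and rok: "sw.runs_ok g \<kappa> (arr s aLx) (arr s aRs)"
  shows "cok w J bVerd s" "fst (cex bVerd s) rB \<noteq> 0 \<longleftrightarrow> Eg (Suc g) y"
    "sw.runs_ok (Suc g) \<kappa> (arr (cex bVerd s) aLx) (arr (cex bVerd s) aRs)"
    "same {rB} {aLx, aRs} s (cex bVerd s)"
proof -
  have C: "0 < C" using hC g by linarith
  note cs = cnstD[OF c g]
  have regs: "fst s rC = C" "fst s rP = p" using c by (auto simp: cnst_def)
  note [simp] = fit X Y rG cs regs
  have ix: "AK * g + i < J" if "i < AK" for i using idx(1)[of g i] that g hC by simp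
  have ixm: "AK * (z mod C) + i < J" if "i < AK" for z i using idx(1)[of "z mod C" i] that C by simp
  have bd: "x \<le> n" "y \<le> n" using y k e by auto
  have sm: "(1::nat) < 2 ^ w" "(2::nat) < 2 ^ w" "Suc x < 2 ^ w" using bd p pp by (auto intro!: small)
  have run_other: "sw.runs_ok (Suc g) \<kappa> (arr s aLx) (arr s aRs)" if "kd g \<noteq> 0"
    unfolding sw.runs_ok_def
  proof (intro allI impI)
    fix i assume i: "i < h" "kd i = 0"
    then have "sw.om (Suc g) \<kappa> i = sw.om g \<kappa> i" using that by (cases "i = g") (auto simp: sw.om_def)
    then show "sw.run_ok i (sw.om (Suc g) \<kappa> i) (per \<pi> (Lv i)) (arr s aLx i) (arr s aRs i)"
      using rok i unfolding sw.runs_ok_def by simp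
  qed
  consider (0) "kd g = 0" | (1) "kd g = 1" | (2) "kd g = 2" using kd[OF g] by linarith
  then have "cok w J bVerd s \<and> (fst (cex bVerd s) rB \<noteq> 0 \<longleftrightarrow> Eg (Suc g) y) \<and>
    sw.runs_ok (Suc g) \<kappa> (arr (cex bVerd s) aLx) (arr (cex bVerd s) aRs)"
  proof cases
    case 0
    have l0: "ln g = 0" "Aa g = per \<pi> (Lv g)" using kd0[OF g 0] by auto
    then have yx: "y = x" using y by simp
    let ?lx = "arr s aLx" and ?rs = "arr s aRs" and ?r = "per \<pi> (Lv g)"
    have ro: "sw.run_ok g (\<kappa> - h) ?r (?lx g) (?rs g)"
      using rok g 0 unfolding sw.runs_ok_def by (auto simp: sw.om_def)
    define rs' where "rs' = (if \<not> (?lx g \<noteq> 0 \<and> ?lx g + ?r = Suc x) then x else ?rs g)"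
    have rn: "sw.run_ok g \<kappa> ?r (Suc x) rs'"
      using sw.run_visit[OF pok g k(1) 0 ro] x yx y(2) by (simp add: rs'_def)
    have rsx: "rs' + t * ?r \<le> x \<longleftrightarrow> (\<forall>k\<le>t. k * ?r \<le> x \<and> Eg g (x - k * ?r))" for t
      using rn by (simp add: sw.run_ok_def)
    have verd: "rs' + Bb g \<le> x \<longleftrightarrow> Eg (Suc g) x"
      using rsx[of "Bb g div ?r"] step_run[OF g 0] by simp
    have rsn: "rs' \<le> x" using rsx[of 0] pend_x(1) by simp
    have lxn: "?lx g \<le> Suc n"
    proof (cases "?lx g")
      case (Suc z)
      then have "z \<le> \<kappa> - h" using ro by (auto simp: sw.run_ok_def sw.is_last_def)
      then show ?thesis using Suc k e by linarith
    qed simp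
    have b: "Aa g \<le> m" "Bb g \<le> m" using lev_bounds(1)[OF g 0] by auto
    have sm2: "?lx g + Aa g < 2 ^ w" "rs' + Bb g < 2 ^ w" using lxn rsn b bd p pp by (auto intro!: small)
    define s1 where "s1 = (if ?lx g \<noteq> 0 \<and> ?lx g + Aa g = Suc x then s else seta aRs g x s)"
    have s1: "cex (If (An (Arr aLx (V rG)) (Eqq (Plus (Arr aLx (V rG)) (Arr aA (V rG))) (Plus (V rX1) (N 1))))
          Skip (StA aRs (V rG) (V rX1))) s = s1"
      by (auto simp: s1_def)
    have fs1: "fst s1 = fst s" by (simp add: s1_def)
    have ars: "arr s1 aRs g = rs'" by (simp add: s1_def rs'_def l0 AK_def)
    have arss: "arr s1 aRs = ?rs(g := rs')"
      by (auto simp: s1_def rs'_def l0 arr_seta_same AK_def)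
    have aot: "arr s1 k' = arr s k'" if "k' < AK" "k' \<noteq> aRs" for k'
      using that by (auto simp: s1_def arr_seta_other AK_def)
    have cx: "cex bVerd s = setr rB (if Eg (Suc g) x then 1 else 0) (seta aLx g (Suc x) s1)"
    proof -
      have kdz: "ev (Arr aKd (V rG)) s = 0" using 0 by simp
      have "cex bVerd s = cex (Asg rB (Nt (Lt (V rX1) (Plus (Arr aRs (V rG)) (Arr aB (V rG))))))
          (cex (StA aLx (V rG) (Plus (V rX1) (N 1))) s1)"
        unfolding bVerd_def by (simp only: cex.simps(4) cex.simps(5)[of "Arr aKd (V rG)"] kdz s1 simp_thms if_False)
      also have "cex (StA aLx (V rG) (Plus (V rX1) (N 1))) s1 = seta aLx g (Suc x) s1" by (simp add: fs1)
      finally have cv: "cex bVerd s = setr rB (if x < rs' + Bb g then 0 else 1) (seta aLx g (Suc x) s1)"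
        using ars aot[of aB] by (simp add: fs1 AK_def)
      have "x < rs' + Bb g \<longleftrightarrow> \<not> Eg (Suc g) x" using verd by linarith
      then show ?thesis unfolding cv by simp
    qed
    have ok: "cok w J bVerd s"
      unfolding bVerd_def cok.simps(4,5) cex.simps(4) s1
      using 0 ars aot[of aB] sm sm2 ix[of aLx] ix[of aA] ix[of aB] ix[of aRs] ix[of aKd]
      by (simp add: fs1 AK_def)
    have run: "sw.runs_ok (Suc g) \<kappa> (arr (cex bVerd s) aLx) (arr (cex bVerd s) aRs)"
    proof -
      have a: "arr (cex bVerd s) aLx = ?lx(g := Suc x)" "arr (cex bVerd s) aRs = ?rs(g := rs')"
        unfolding cx using aot[of aLx] arss by (simp_all add: arr_seta_same arr_seta_other AK_def)
      show ?thesis unfolding sw.runs_ok_def a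
      proof (intro allI impI)
        fix i assume i: "i < h" "kd i = 0"
        show "sw.run_ok i (sw.om (Suc g) \<kappa> i) (per \<pi> (Lv i)) ((?lx(g := Suc x)) i) ((?rs(g := rs')) i)"
        proof (cases "i = g")
          case True
          then show ?thesis using rn by (simp add: sw.om_def)
        next
          case False
          then have "sw.om (Suc g) \<kappa> i = sw.om g \<kappa> i" by (auto simp: sw.om_def)
          then show ?thesis using rok i False unfolding sw.runs_ok_def by simp
        qed
      qed
    qed
    show ?thesis using ok run cx yx by simp
  next
    case 1
    have z: "ln g = 1" "Aa g = Lv g" using kd1[OF g 1] by auto
    have yx: "y - Suc 0 = x" "0 < y" using y z by auto
    have cx: "cex bVerd s = setr rB (ev (Or (Nt (Arr aTr (Modu (V rX1) (V rC)))) (Lt (Arr aA (V rG)) (Arr aTr (Modu (V rX1) (V rC))))) s) s"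
      using 1 by (simp add: bVerd_def)
    have "ev (Or (Nt (Arr aTr (Modu (V rX1) (V rC)))) (Lt (Arr aA (V rG)) (Arr aTr (Modu (V rX1) (V rC))))) s \<noteq> 0
       \<longleftrightarrow> Eg (Suc g) y"
      using step_zero[OF g 1 yx(2)] pend_x(1) tr_x[OF z(1)] z by (simp add: yx)
    moreover have "cok w J bVerd s"
      using 1 sm mCs[OF C] ixm[of aTr x] ix[of aA] ix[of aKd] by (simp add: bVerd_def AK_def)
    ultimately show ?thesis
      unfolding cx using run_other 1 by simp
  next
    case 2
    have b: "Aa g < p" "Bb g < p" using lev_bounds(3)[OF g 2] by auto
    have pf: "arr s aPf g = hh r \<tau> x mod p" using pf x g unfolding pf_ok_def by simp
    have pr: "hh r \<tau> x mod p * Aa g \<le> p * p" using b pp by (intro mult_le_mono) (simp_all add: less_imp_le)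
    have cx: "cex bVerd s = setr rB (if Eg (Suc g) y then 1 else 0) s"
      using 2 step_hash[OF g 2 pend_x(1)] bd y(1) fr_y pf by (simp add: bVerd_def)
    have "hh r \<tau> x mod p * Aa g + Bb g < 2 ^ w" "hh r \<tau> x mod p * Aa g < 2 ^ w" using pr b pp by linarith+
    then have "cok w J bVerd s"
      using 2 sm mCs[OF C] mps pf ixm[of aFr y] ix[of aA] ix[of aKd] ix[of aB] ix[of aPf]
      by (simp add: bVerd_def AK_def)
    then show ?thesis unfolding cx using run_other 2 by simp
  qed
  then show "cok w J bVerd s" "fst (cex bVerd s) rB \<noteq> 0 \<longleftrightarrow> Eg (Suc g) y"
    "sw.runs_ok (Suc g) \<kappa> (arr (cex bVerd s) aLx) (arr (cex bVerd s) aRs)" by blast+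
  show "same {rB} {aLx, aRs} s (cex bVerd s)"
    by (rule same_cex) (simp_all add: bVerd_def AK_def)
qed

lemma bProm:
  assumes X: "fst s rX1 = x" and Y: "fst s rEv = y" and V: "fst s rB \<noteq> 0 \<longleftrightarrow> Eg (Suc g) y"
  shows "cok w J bProm s" "arr (cex bProm s) aPend = sw.visit g \<kappa> (arr s aPend)" "pf_ok (cex bProm s)"
    "same {} {aPend, aPf} s (cex bProm s)"
proof -
  have C: "0 < C" using hC g by linarith
  have regs: "fst s rC = C" using c by (auto simp: cnst_def)
  note [simp] = fit X Y rG regs fr_y
  have ix: "AK * g + i < J" "AK * Suc g + i < J" if "i < AK" for i using idx(2)[of g i] idx(2)[of "Suc g" i] that g hC by auto
  have ixm: "AK * (y mod C) + i < J" if "i < AK" for i using idx(1)[of "y mod C" i] that C by simp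
  have bd: "y \<le> n" "Suc g \<le> C" using y k e g hC by auto
  have sm: "(1::nat) < 2 ^ w" "Suc y < 2 ^ w" "Suc g < 2 ^ w" using bd p pp by (auto intro!: small)
  show "cok w J bProm s"
    using sm mCs[OF C] ixm[of aFr] ix[of aPend] ix[of aPf] by (simp add: bProm_def AK_def)
  have cx: "cex bProm s = seta aPend g 0 (if Eg (Suc g) y
      then seta aPf (Suc g) (hh r \<tau> y mod p) (seta aPend (Suc g) (Suc y) s) else s)"
    using V by (simp add: bProm_def AK_def)
  show a: "arr (cex bProm s) aPend = sw.visit g \<kappa> (arr s aPend)"
    unfolding cx using x y by (simp add: sw.visit_def arr_seta_same arr_seta_other AK_def)
  show "pf_ok (cex bProm s)"
    unfolding pf_ok_def
  proof (intro allI impI)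
    fix i z assume i: "i \<le> h" and z: "arr (cex bProm s) aPend i = Suc z"
    have old: "arr s aPend i = Suc z \<Longrightarrow> arr s aPf i = hh r \<tau> z mod p"
      using pf i unfolding pf_ok_def by blast
    show "arr (cex bProm s) aPf i = hh r \<tau> z mod p"
      using z old unfolding cx by (auto simp: AK_def split: if_splits)
  qed
  show "same {} {aPend, aPf} s (cex bProm s)"
    by (rule same_cex) (simp_all add: bProm_def AK_def)
qed

end

lemma sameD:
  assumes "same Rg As s s'"
  shows "y \<notin> Rg \<Longrightarrow> fst s' y = fst s y" "k < AK \<Longrightarrow> k \<notin> As \<Longrightarrow> arr s' k = arr s k"
  using assms by (auto simp: same_def)

lemma bVisit:
  assumes c: "cnst s" and e: "e \<le> n" and g: "g < h" and k: "\<kappa> \<le> e" "e < \<kappa> + h"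
    and tr: "ring_tr e (arr s aTr)" and fr: "ring_fr e (arr s aFr)" and lv: "lev_ok e g \<kappa> s"
    and rG: "fst s rG = g" and rK: "fst s rK = \<kappa>"
  shows "cok w J bVisit s" "lev_ok e (Suc g) \<kappa> (cex bVisit s)"
    "same {rX1, rEv, rB} {aPend, aPf, aLx, aRs} s (cex bVisit s)"
proof -
  show "same {rX1, rEv, rB} {aPend, aPf, aLx, aRs} s (cex bVisit s)"
    by (rule same_cex) (simp_all add: bVisit_def bVerd_def bProm_def AK_def)
  note cs = cnstD[OF c g]
  note [simp] = fit rG rK cs
  have pok: "sw.pend_ok e g \<kappa> (arr s aPend)" and rok: "sw.runs_ok g \<kappa> (arr s aLx) (arr s aRs)" and pf: "pf_ok s"
    using lv by (simp_all add: lev_ok_def)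
  have ix: "AK * g + i < J" if "i < AK" for i using idx(1)[of g i] that g hC by simp
  have idle: "sw.runs_ok (Suc g) \<kappa> (arr s aLx) (arr s aRs)"
    if "\<And>x. arr s aPend g = Suc x \<Longrightarrow> \<kappa> < x + ln g"
    unfolding sw.runs_ok_def
  proof (intro allI impI)
    fix i assume i: "i < h" "kd i = 0"
    show "sw.run_ok i (sw.om (Suc g) \<kappa> i) (per \<pi> (Lv i)) (arr s aLx i) (arr s aRs i)"
    proof (cases "i = g")
      case True
      have ro: "sw.run_ok g (\<kappa> - h) (per \<pi> (Lv g)) (arr s aLx g) (arr s aRs g)"
        using rok i True unfolding sw.runs_ok_def by (auto simp: sw.om_def)
      have l: "(case arr s aPend g of 0 \<Rightarrow> a | Suc x \<Rightarrow> if x \<le> \<kappa> then b x else a) = a" for a :: nat and b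
        using that sw.run_len[OF g] i True by (fastforce split: nat.split)
      have l': "(case arr s aPend g of 0 \<Rightarrow> a | Suc x \<Rightarrow> if x \<le> \<kappa> \<and> q x then b x else a) = a" for a :: nat and b q
        using that sw.run_len[OF g] i True by (fastforce split: nat.split)
      show ?thesis using sw.run_visit[OF pok g k(1) _ ro] i True unfolding l l' by (simp add: sw.om_def)
    next
      case False
      then have "sw.om (Suc g) \<kappa> i = sw.om g \<kappa> i" by (auto simp: sw.om_def)
      then show ?thesis using rok i unfolding sw.runs_ok_def by simp
    qed
  qed
  have "cok w J bVisit s \<and> lev_ok e (Suc g) \<kappa> (cex bVisit s)"
  proof (cases "arr s aPend g")
    case 0
    have cx: "cex bVisit s = s" using 0 by (simp add: bVisit_def)
    have "sw.visit g \<kappa> (arr s aPend) = arr s aPend" using 0 by (simp add: sw.visit_def)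
    then have "sw.pend_ok e (Suc g) \<kappa> (arr s aPend)" using sw.pend_visit[OF pok g k(1)] by simp
    then have "lev_ok e (Suc g) \<kappa> s" using idle pf 0 by (simp add: lev_ok_def)
    moreover have "cok w J bVisit s" using 0 ix[of aPend] by (simp add: bVisit_def AK_def)
    ultimately show ?thesis unfolding cx by simp
  next
    case (Suc x)
    define y where "y = x + ln g"
    define s2 where "s2 = setr rEv y (setr rX1 x s)"
    have xb: "Eg g x \<and> x \<le> sw.al e g \<kappa> g" using pok g Suc unfolding sw.pend_ok_def by blast
    then have xe: "x \<le> e" using k by (auto simp: sw.al_def sw.om_def split: if_splits)
    have sm: "(1::nat) < 2 ^ w" "x + ln g < 2 ^ w" using xe e lev_bounds(4)[OF g] p pp by (auto intro!: small)
    have a2: "arr s2 = arr s" by (simp add: s2_def)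
    have cx: "cex bVisit s = (if \<kappa> < y then s2 else cex bProm (cex bVerd s2))"
      using Suc by (simp add: bVisit_def s2_def y_def)
    have ok: "cok w J bVisit s \<longleftrightarrow> (\<kappa> < y \<or> cok w J bVerd s2 \<and> cok w J bProm (cex bVerd s2))"
      using Suc sm ix[of aPend] ix[of aLen] by (auto simp: bVisit_def s2_def y_def AK_def)
    show ?thesis
    proof (cases "\<kappa> < y")
      case True
      have "sw.visit g \<kappa> (arr s aPend) = arr s aPend" using Suc True by (simp add: sw.visit_def y_def)
      then have "sw.pend_ok e (Suc g) \<kappa> (arr s aPend)" using sw.pend_visit[OF pok g k(1)] by simp
      then have "lev_ok e (Suc g) \<kappa> s2" using idle pf Suc True a2 by (simp add: lev_ok_def pf_ok_def y_def)
      then show ?thesis using ok cx True by simp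
    next
      case False
      have c2: "cnst s2" using c by (simp add: cnst_def s2_def)
      have pok2: "sw.pend_ok e g \<kappa> (arr s2 aPend)" "sw.runs_ok g \<kappa> (arr s2 aLx) (arr s2 aRs)"
        using pok rok a2 by simp_all
      have pf2: "pf_ok s2" using pf a2 by (simp add: pf_ok_def)
      have H: "ring_tr e (arr s2 aTr)" "ring_fr e (arr s2 aFr)" "fst s2 rG = g" "arr s2 aPend g = Suc x" "y \<le> \<kappa>"
        "fst s2 rX1 = x" "fst s2 rEv = y"
        using tr fr a2 Suc False by (simp_all add: s2_def)
      note V = bVerd[OF c2 e g k H(1,2) pok2(1) pf2 H(3,4) y_def H(5,6,7) pok2(2)]
      define s3 where "s3 = cex bVerd s2"
      have sm3: "fst s3 z = fst s2 z" if "z \<noteq> rB" for z using sameD(1)[OF V(4)] that by (simp add: s3_def)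
      have sa3: "arr s3 i = arr s2 i" if "i < AK" "i \<noteq> aLx" "i \<noteq> aRs" for i
        using sameD(2)[OF V(4)] that by (simp add: s3_def)
      have c3: "cnst s3" using c2 by (simp add: cnst_def sm3 sa3 AK_def)
      have a3: "arr s3 aPend = arr s2 aPend" "arr s3 aPf = arr s2 aPf" "arr s3 aTr = arr s2 aTr" "arr s3 aFr = arr s2 aFr"
        by (simp_all add: sa3 AK_def)
      have pf3: "pf_ok s3" using pf2 by (simp add: pf_ok_def a3)
      have H3: "ring_tr e (arr s3 aTr)" "ring_fr e (arr s3 aFr)" "sw.pend_ok e g \<kappa> (arr s3 aPend)" "fst s3 rG = g"
        "arr s3 aPend g = Suc x" "fst s3 rX1 = x" "fst s3 rEv = y"
        using H pok2 by (simp_all add: a3 sm3)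
      note W = bProm[OF c3 e g k H3(1,2,3) pf3 H3(4,5) y_def H(5) H3(6,7) V(2)[folded s3_def]]
      define s4 where "s4 = cex bProm s3"
      have "arr s4 aLx = arr s3 aLx" "arr s4 aRs = arr s3 aRs"
        using sameD(2)[OF W(4)] by (simp_all add: s4_def AK_def)
      then have "lev_ok e (Suc g) \<kappa> s4"
        using V(3) W(2,3) sw.pend_visit[OF pok2(1) g k(1)] a3 unfolding lev_ok_def s3_def[symmetric] s4_def[symmetric] by simp
      then show ?thesis using ok cx False V(1) W(1) by (simp add: s3_def s4_def)
    qed
  qed
  then show "cok w J bVisit s" "lev_ok e (Suc g) \<kappa> (cex bVisit s)" by blast+
qed

text \<open>The sweep moves by one level per symbol, so its start and its position are tied to
  \<open>e\<close>. The initial state pretends that a sweep has just ended.\<close>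

definition pos_ok :: "nat \<Rightarrow> nat \<Rightarrow> nat \<Rightarrow> bool" where
  "pos_ok e gp \<kappa> \<longleftrightarrow> \<kappa> \<le> e \<and> gp \<le> h \<and> (h = 0 \<or> e = 0 \<and> \<kappa> = 0 \<and> gp = h \<or> e + 1 = \<kappa> + gp \<and> 1 \<le> gp)"

lemma bSweep:
  assumes c: "cnst s" and e: "Suc e \<le> n" and po: "pos_ok e gp \<kappa>"
    and tr: "ring_tr (Suc e) (arr s aTr)" and fr: "ring_fr (Suc e) (arr s aFr)" and lv: "lev_ok (Suc e) gp \<kappa> s"
    and rI: "fst s rI = Suc e" and rG: "fst s rG = gp" and rK: "fst s rK = \<kappa>"
  shows "cok w J bSweep s" "\<exists>gp' \<kappa>'. fst (cex bSweep s) rG = gp' \<and> fst (cex bSweep s) rK = \<kappa>' \<and>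
      pos_ok (Suc e) gp' \<kappa>' \<and> lev_ok (Suc e) gp' \<kappa>' (cex bSweep s)"
    "same {rX1, rEv, rB, rG, rK} {aPend, aPf, aLx, aRs} s (cex bSweep s)"
proof -
  show "same {rX1, rEv, rB, rG, rK} {aPend, aPf, aLx, aRs} s (cex bSweep s)"
    by (rule same_cex) (simp_all add: bSweep_def bReset_def bVisit_def bVerd_def bProm_def AK_def)
  have rN: "fst s rNh = h" using c by (simp add: cnst_def)
  note [simp] = fit rI rG rK rN
  define g1 where "g1 = (if gp < h then gp else 0)"
  define k1 where "k1 = (if gp < h then \<kappa> else Suc e)"
  define s1 where "s1 = cex bReset s"
  have s1: "s1 = (if gp < h then s else setr rG 0 (setr rK (Suc e) s))"
    by (simp add: s1_def bReset_def)
  have sm: "(0::nat) < 2 ^ w" "Suc h < 2 ^ w" using hC p pp by (auto intro!: small)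
  have ok1: "cok w J bReset s" using sm by (simp add: bReset_def)
  have c1: "cnst s1" using c by (simp add: cnst_def s1)
  have a1: "arr s1 = arr s" by (simp add: s1)
  have r1: "fst s1 rG = g1" "fst s1 rK = k1" "fst s1 rNh = h" by (simp_all add: s1 g1_def k1_def)
  have lv1: "lev_ok (Suc e) g1 k1 s1"
  proof (cases "gp < h")
    case True
    then show ?thesis using lv by (simp add: g1_def k1_def s1)
  next
    case False
    then have gp: "gp = h" using po by (simp add: pos_ok_def)
    have "sw.pend_ok (Suc e) 0 (Suc e) (arr s aPend) \<and> sw.runs_ok 0 (Suc e) (arr s aLx) (arr s aRs)"
    proof (cases "h = 0")
      case True
      then show ?thesis using lv[unfolded lev_ok_def sw.pend_ok_def sw.runs_ok_def sw.al_def]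
        unfolding sw.pend_ok_def sw.runs_ok_def sw.al_def by simp
    next
      case False
      \<comment> \<open>The finished sweep took \<open>h\<close> symbols. At the very first symbol
        the equation holds because subtraction stops at 0.\<close>
      then have "Suc e - h = \<kappa>" using po gp by (auto simp: pos_ok_def)
      then show ?thesis using lv gp sw.pend_reset sw.runs_reset unfolding lev_ok_def by blast
    qed
    then show ?thesis using False lv a1 by (simp add: lev_ok_def g1_def k1_def pf_ok_def)
  qed
  show "cok w J bSweep s" "\<exists>gp' \<kappa>'. fst (cex bSweep s) rG = gp' \<and> fst (cex bSweep s) rK = \<kappa>' \<and>
      pos_ok (Suc e) gp' \<kappa>' \<and> lev_ok (Suc e) gp' \<kappa>' (cex bSweep s)"
  proof (atomize (full), cases "h = 0")
    case True
    have cx: "cex bSweep s = s1" using True r1 by (simp add: bSweep_def s1_def[symmetric])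
    have "cok w J bSweep s" using True ok1 r1 by (simp add: bSweep_def s1_def[symmetric])
    moreover have "pos_ok (Suc e) g1 k1" unfolding pos_ok_def g1_def k1_def using True by simp
    ultimately show "cok w J bSweep s \<and> (\<exists>gp' \<kappa>'. fst (cex bSweep s) rG = gp' \<and> fst (cex bSweep s) rK = \<kappa>' \<and>
      pos_ok (Suc e) gp' \<kappa>' \<and> lev_ok (Suc e) gp' \<kappa>' (cex bSweep s))" unfolding cx using r1 lv1 by blast
  next
    case False
    then have g: "g1 < h" by (simp add: g1_def)
    have kk: "k1 \<le> Suc e" "Suc e < k1 + h" "Suc (Suc e) = k1 + Suc g1"
      using po False by (auto simp: pos_ok_def k1_def g1_def split: if_splits)
    note V = bVisit[OF c1 e g kk(1,2) _ _ lv1 r1(1,2)]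
    have V1: "cok w J bVisit s1" and V2: "lev_ok (Suc e) (Suc g1) k1 (cex bVisit s1)"
      and V3: "same {rX1, rEv, rB} {aPend, aPf, aLx, aRs} s1 (cex bVisit s1)"
      using V tr fr a1 by auto
    define s2 where "s2 = cex bVisit s1"
    have r2: "fst s2 rG = g1" "fst s2 rK = k1" using sameD(1)[OF V3] r1 by (simp_all add: s2_def)
    have cx: "cex bSweep s = setr rG (Suc g1) s2"
      using g r1 r2 by (simp add: bSweep_def s1_def[symmetric] s2_def[symmetric])
    have "cok w J bSweep s"
      using ok1 V1 g r1 r2 sm by (simp add: bSweep_def s1_def[symmetric] s2_def[symmetric])
    moreover have "lev_ok (Suc e) (Suc g1) k1 (cex bSweep s)"
      using V2 unfolding cx s2_def[symmetric] by (simp add: lev_ok_def pf_ok_def)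
    moreover have "pos_ok (Suc e) (Suc g1) k1" using kk g by (simp add: pos_ok_def)
    ultimately show "cok w J bSweep s \<and> (\<exists>gp' \<kappa>'. fst (cex bSweep s) rG = gp' \<and> fst (cex bSweep s) rK = \<kappa>' \<and>
      pos_ok (Suc e) gp' \<kappa>' \<and> lev_ok (Suc e) gp' \<kappa>' (cex bSweep s))"
      using r2 unfolding cx by auto
  qed
qed

text \<open>The sliding window must not be empty, so \<open>lw\<close> may exceed
  \<open>lam\<close>. What it compares in addition belongs to the match anyway.\<close>

lemma tail_iff:
  assumes e: "e \<le> n"
  shows "em \<pi> \<tau> m e \<longleftrightarrow> lam \<le> e \<and> Eg h (e - lam) \<and>
    hh r (wv \<tau> m lw e) lw mod p = hh r (\<lambda>j. \<pi> (m - lw + j)) lw mod p"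
proof (cases "m \<le> e")
  case True
  have lm: "Lv h \<le> m" "m - Lv h = lam" using Lv(2) by auto
  have w: "hh r (wv \<tau> m lw e) lw mod p = hh r (\<lambda>j. \<pi> (m - lw + j)) lw mod p \<longleftrightarrow>
      (\<forall>j<lw. tr (m - lw + j) (\<tau> (e - lw + j)) = \<pi> (m - lw + j))"
    by (rule win_iff[OF e lw(2) le_refl True])
  have a: "em \<pi> \<tau> m e \<longleftrightarrow> Eg h (e - lam) \<and> (\<forall>j<lam. tr (Lv h + j) (\<tau> (e - lam + j)) = \<pi> (Lv h + j))"
    using em_append[OF lm(1), of \<pi> \<tau> e] True unfolding lm(2) by blast
  have b: "em \<pi> \<tau> m e \<longleftrightarrow> em \<pi> \<tau> (m - lw) (e - lw) \<and>
      (\<forall>j<lw. tr (m - lw + j) (\<tau> (e - lw + j)) = \<pi> (m - lw + j))"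
    using em_append[of "m - lw" m \<pi> \<tau> e] True lw(2) by (simp only: diff_le_self diff_diff_cancel simp_thms)
  have d: "(\<forall>j<lw. tr (m - lw + j) (\<tau> (e - lw + j)) = \<pi> (m - lw + j)) \<Longrightarrow>
     (\<forall>j<lam. tr (Lv h + j) (\<tau> (e - lam + j)) = \<pi> (Lv h + j))"
  proof (intro allI impI)
    fix j assume A: "\<forall>j<lw. tr (m - lw + j) (\<tau> (e - lw + j)) = \<pi> (m - lw + j)" and j: "j < lam"
    have i: "m - lw + (lw - lam + j) = Lv h + j" "e - lw + (lw - lam + j) = e - lam + j" "lw - lam + j < lw"
      using lw Lv(2) True j by auto
    show "tr (Lv h + j) (\<tau> (e - lam + j)) = \<pi> (Lv h + j)"
      using A[rule_format, OF i(3)] unfolding i .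
  qed
  have "lam \<le> e" using True Lv(2) by linarith
  then show ?thesis unfolding w using a b d by blast
next
  case False
  then have "\<not> (lam \<le> e \<and> Eg h (e - lam))" using Lv(2) by (auto simp: em_def)
  then show ?thesis using False by (auto simp: em_def)
qed

lemma bAns:
  assumes c: "cnst s" and e: "e \<le> n" and po: "pos_ok e gp \<kappa>" and lv: "lev_ok e gp \<kappa> s" and e1: "1 \<le> e"
    and rI: "fst s rI = e" and H: "fst s rH1 = hh r (wv \<tau> m lw e) lw mod p"
  shows "cok w J bAns s" "fst (cex bAns s) rZ \<noteq> 0 \<longleftrightarrow> em \<pi> \<tau> m e" "same {rZ} {} s (cex bAns s)"
proof -
  have r: "fst s rNh = h" "fst s rD = lam" "fst s rT1 = hh r (\<lambda>j. \<pi> (m - lw + j)) lw mod p"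
    using c by (simp_all add: cnst_def)
  note [simp] = fit rI H r
  have pok: "sw.pend_ok e gp \<kappa> (arr s aPend)" using lv by (simp add: lev_ok_def)
  have pb: "arr s aPend h \<le> Suc e"
  proof (cases "arr s aPend h")
    case (Suc x)
    then have "sw.is_last (Eg h) (sw.al e gp \<kappa> h) x" using pok unfolding sw.pend_ok_def by blast
    moreover have "sw.al e gp \<kappa> h \<le> e" using po by (auto simp: sw.al_def sw.om_def pos_ok_def)
    ultimately show ?thesis using Suc by (auto simp: sw.is_last_def)
  qed simp
  have sm: "arr s aPend h + lam < 2 ^ w" "Suc e < 2 ^ w" "(1::nat) < 2 ^ w"
    using pb e p lw by (auto intro!: small)
  have ix: "AK * h + aPend < J" using idx(1)[of h aPend] hC by (simp add: AK_def)
  show "cok w J bAns s" using sm ix by (simp add: bAns_def AK_def)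
  show "same {rZ} {} s (cex bAns s)" by (rule same_cex) (simp_all add: bAns_def)
  have ke: "\<kappa> \<le> e" "h \<noteq> 0 \<Longrightarrow> e < \<kappa> + h" "gp \<le> h" using po e1 by (auto simp: pos_ok_def)
  have "fst (cex bAns s) rZ \<noteq> 0 \<longleftrightarrow> (arr s aPend h \<noteq> 0 \<and> arr s aPend h + lam = Suc e) \<and>
      hh r (wv \<tau> m lw e) lw mod p = hh r (\<lambda>j. \<pi> (m - lw + j)) lw mod p"
    by (simp add: bAns_def)
  also have "arr s aPend h \<noteq> 0 \<and> arr s aPend h + lam = Suc e \<longleftrightarrow> lam \<le> e \<and> arr s aPend h = Suc (e - lam)"
    by auto
  also have "\<dots> \<longleftrightarrow> lam \<le> e \<and> Eg h (e - lam)"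
    using sw.tail_pend[OF pok ke(1,2,3) _ tail] by blast
  finally show "fst (cex bAns s) rZ \<noteq> 0 \<longleftrightarrow> em \<pi> \<tau> m e" unfolding tail_iff[OF e] by simp
qed

end

section \<open>The invariant of a whole streaming step\<close>

context level_stream
begin

definition inv :: "nat \<Rightarrow> st \<Rightarrow> bool" where
  "inv e s \<longleftrightarrow> cnst s \<and> fst s rI = e \<and> fst s rF = hh r \<tau> e mod p \<and> run_start \<rho> e (fst s rA) \<and>
     fst s rH0 = hh r (wv \<tau> L0 l0 e) l0 mod p \<and> fst s rH1 = hh r (wv \<tau> m lw e) lw mod p \<and>
     last_ok e (arr s aLast) \<and> ring_tr e (arr s aTr) \<and> ring_fr e (arr s aFr) \<and>
     sched L0 l0 e (arr s aS0) \<and> sched m lw e (arr s aS1) \<and>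
     pos_ok e (fst s rG) (fst s rK) \<and> lev_ok e (fst s rG) (fst s rK) s"

lemma cnst_cong:
  assumes "same Rg As s s'" "Rg \<inter> {10..21} = {}" "As \<inter> {aPw, aLen, aA, aB, aKd} = {}"
  shows "cnst s' \<longleftrightarrow> cnst s"
proof -
  have "fst s' z = fst s z" if "z \<in> {10..21}" for z using sameD(1)[OF assms(1)] assms(2) that by blast
  moreover have "arr s' k = arr s k" if "k \<in> {aPw, aLen, aA, aB, aKd}" for k
    using sameD(2)[OF assms(1)] assms(3) that by (auto simp: AK_def)
  ultimately show ?thesis unfolding cnst_def by simp
qed

lemma bAll:
  assumes i: "inv e s" and e: "e < n" and X: "fst s rX = T ! e"
  shows "cok w J bAll s" "inv (Suc e) (cex bAll s)" "fst (cex bAll s) rZ \<noteq> 0 \<longleftrightarrow> em \<pi> \<tau> m (Suc e)"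
proof -
  define s1 where "s1 = cex bIn s"
  define s2 where "s2 = cex bRun s1"
  define s3 where "s3 = cex (bWin rH0 rL0 rW0 aS0) s2"
  define s4 where "s4 = cex (bWin rH1 rM rW1 aS1) s3"
  define s5 where "s5 = cex bAdv s4"
  define s6 where "s6 = cex bBase s5"
  define s7 where "s7 = cex bSweep s6"
  define s8 where "s8 = cex bAns s7"
  have c0: "cnst s" and I: "fst s rI = e" and F: "fst s rF = hh r \<tau> e mod p" and A: "run_start \<rho> e (fst s rA)"
    and H: "fst s rH0 = hh r (wv \<tau> L0 l0 e) l0 mod p" "fst s rH1 = hh r (wv \<tau> m lw e) lw mod p"
    and R: "last_ok e (arr s aLast)" "ring_tr e (arr s aTr)" "ring_fr e (arr s aFr)"
    and S: "sched L0 l0 e (arr s aS0)" "sched m lw e (arr s aS1)"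
    and po: "pos_ok e (fst s rG) (fst s rK)" and lv: "lev_ok e (fst s rG) (fst s rK) s"
    using i by (simp_all add: inv_def)
  have base: "base z s'" if "cnst s'" "fst s' rI = z" for s' z using that by (simp add: base_def cnst_def)
  note B1 = bIn[OF base[OF c0 I] e X F R(1,2), folded s1_def]
  have r1: "fst s1 z = fst s z" if "z \<noteq> rTau" "z \<noteq> rF" for z using sameD(1)[OF B1(6)] that by simp
  have a1: "arr s1 k = arr s k" if "k < AK" "k \<noteq> aLast" "k \<noteq> aTr" for k using sameD(2)[OF B1(6)] that by simp
  have c1: "cnst s1" using cnst_cong[OF B1(6)] c0 by simp
  have "fst s1 rRho = \<rho>" "run_start \<rho> e (fst s1 rA)" "fst s1 rI = e" using c1 A I r1 by (simp_all add: cnst_def)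
  note B2 = bRun[OF base[OF c1 this(3)] e B1(2,5) this(2,1) rho, folded s2_def]
  have r2: "fst s2 z = fst s1 z" if "z \<noteq> rO" "z \<noteq> rU" "z \<noteq> rB" "z \<noteq> rA" for z using sameD(1)[OF B2(4)] that by simp
  have a2: "arr s2 k = arr s1 k" if "k < AK" for k using sameD(2)[OF B2(4)] that by simp
  have c2: "cnst s2" using cnst_cong[OF B2(4)] c1 by simp
  have q2: "fst s2 rI = e" "fst s2 rTau = \<tau> e" "ring_tr (Suc e) (arr s2 aTr)"
    "fst s2 rH0 = hh r (wv \<tau> L0 l0 e) l0 mod p" "fst s2 rL0 = L0" "fst s2 rW0 = l0" "sched L0 l0 e (arr s2 aS0)"
    using r1 r2 a1 a2 I B1 H S c2 by (simp_all add: cnst_def AK_def)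
  have pw: "arr s' aPw d = r ^ d mod p" if "cnst s'" "d < C" for s' d using that by (simp add: cnst_def)
  have l0': "1 \<le> l0" "l0 \<le> L0" using l0 L0 rho by auto
  have B3: "cok w J (bWin rH0 rL0 rW0 aS0) s2" "fst s3 rH0 = hh r (wv \<tau> L0 l0 (Suc e)) l0 mod p"
    "sched L0 l0 (Suc e) (arr s3 aS0)" "same {rVo, rX1, rEv, rH0} {aS0} s2 s3"
    unfolding s3_def
    by (rule bWin[OF base[OF c2 q2(1)] e q2(2,3) _ q2(4) _ q2(5) _ q2(6) _ q2(7) l0' l0(2) L0(2)];
        use pw[OF c2] l0 in auto)+
  have r3: "fst s3 z = fst s2 z" if "z \<noteq> rVo" "z \<noteq> rX1" "z \<noteq> rEv" "z \<noteq> rH0" for z using sameD(1)[OF B3(4)] that by simp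
  have a3: "arr s3 k = arr s2 k" if "k < AK" "k \<noteq> aS0" for k using sameD(2)[OF B3(4)] that by simp
  have c3: "cnst s3" using cnst_cong[OF B3(4)] c2 by simp
  have q3: "fst s3 rI = e" "fst s3 rTau = \<tau> e" "ring_tr (Suc e) (arr s3 aTr)"
    "fst s3 rH1 = hh r (wv \<tau> m lw e) lw mod p" "fst s3 rM = m" "fst s3 rW1 = lw" "sched m lw e (arr s3 aS1)"
    using q2 r1 r2 r3 a1 a2 a3 H S c3 by (simp_all add: cnst_def AK_def)
  have B4: "cok w J (bWin rH1 rM rW1 aS1) s3" "fst s4 rH1 = hh r (wv \<tau> m lw (Suc e)) lw mod p"
    "sched m lw (Suc e) (arr s4 aS1)" "same {rVo, rX1, rEv, rH1} {aS1} s3 s4"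
    unfolding s4_def
    by (rule bWin[OF base[OF c3 q3(1)] e q3(2,3) _ q3(4) _ q3(5) _ q3(6) _ q3(7) lw(1,2,3) le_refl];
        use pw[OF c3] lw in auto)+
  have r4: "fst s4 z = fst s3 z" if "z \<noteq> rVo" "z \<noteq> rX1" "z \<noteq> rEv" "z \<noteq> rH1" for z using sameD(1)[OF B4(4)] that by simp
  have a4: "arr s4 k = arr s3 k" if "k < AK" "k \<noteq> aS1" for k using sameD(2)[OF B4(4)] that by simp
  have c4: "cnst s4" using cnst_cong[OF B4(4)] c3 by simp
  have f4: "fst s4 rF = hh r \<tau> (Suc e) mod p" "fst s4 rI = e" "fst s4 rC = C" "fst s4 rO = fst s rA"
    "fst s4 rA = fst s2 rA" "fst s4 rG = fst s rG" "fst s4 rK = fst s rK"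
    "fst s4 rH0 = hh r (wv \<tau> L0 l0 (Suc e)) l0 mod p"
    using r1 r2 r3 r4 B1 B2 B3(2) I c4 by (simp_all add: cnst_def del: hh.simps)
  have C: "0 < C" using hC by linarith
  have s5: "s5 = seta aFr (Suc e mod C) (hh r \<tau> (Suc e) mod p) (setr rI (Suc e) s4)"
    using f4 by (simp add: s5_def bAdv_def del: hh.simps)
  have ok5: "cok w J bAdv s4"
    using f4 idx(1)[of "Suc e mod C" aFr] C mCs[OF C] small[of "Suc e"] small[of 1] e p fit
    by (simp add: bAdv_def AK_def del: hh.simps)
  have r5: "fst s5 z = (if z = rI then Suc e else fst s4 z)" for z by (simp add: s5)
  have a5: "arr s5 k = arr s4 k" if "k < AK" "k \<noteq> aFr" for k using that by (simp add: s5 arr_seta_other AK_def)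
  have c5: "cnst s5" using c4 a5 by (simp add: cnst_def r5 AK_def)
  have "arr s5 aFr = (arr s aFr)(Suc e mod C := hh r \<tau> (Suc e) mod p)"
    using a1 a2 a3 a4 by (simp add: s5 arr_seta_same AK_def del: hh.simps)
  then have R5: "ring_fr (Suc e) (arr s5 aFr)" using ring_fr_Suc[OF R(3)] by simp
  have lv5: "lev_ok e (fst s rG) (fst s rK) s5"
    using lv lev_ok_cong[of s5 s] a1 a2 a3 a4 a5 by (simp add: AK_def)
  have po': "h \<noteq> 0 \<Longrightarrow> Suc e \<le> fst s rK + h" "fst s rG \<le> h" "fst s rK \<le> e"
    using po by (auto simp: pos_ok_def)
  have B6: "cok w J bBase s5" "lev_ok (Suc e) (fst s rG) (fst s rK) s6" "same {} {aPend, aPf} s5 s6"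
    unfolding s6_def
    by (rule bBase[OF c5 e _ _ _ _ lv5 po']; use r5 f4 A in \<open>simp_all del: hh.simps\<close>)+
  have r6: "fst s6 z = fst s5 z" for z using sameD(1)[OF B6(3)] by simp
  have a6: "arr s6 k = arr s5 k" if "k < AK" "k \<noteq> aPend" "k \<noteq> aPf" for k using sameD(2)[OF B6(3)] that by simp
  have c6: "cnst s6" using cnst_cong[OF B6(3)] c5 by simp
  have q6: "ring_tr (Suc e) (arr s6 aTr)" "ring_fr (Suc e) (arr s6 aFr)" "fst s6 rI = Suc e" "fst s6 rG = fst s rG" "fst s6 rK = fst s rK"
    using q3 R5 f4 a4 a5 a6 r5 r6 by (simp_all add: AK_def)
  have B7: "cok w J bSweep s6" "\<exists>gp' \<kappa>'. fst s7 rG = gp' \<and> fst s7 rK = \<kappa>' \<and>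
      pos_ok (Suc e) gp' \<kappa>' \<and> lev_ok (Suc e) gp' \<kappa>' s7"
    "same {rX1, rEv, rB, rG, rK} {aPend, aPf, aLx, aRs} s6 s7"
    unfolding s7_def by (rule bSweep[OF c6 _ po q6(1,2) B6(2) q6(3,4,5)]; use e in simp)+
  have r7: "fst s7 z = fst s6 z" if "z \<noteq> rX1" "z \<noteq> rEv" "z \<noteq> rB" "z \<noteq> rG" "z \<noteq> rK" for z using sameD(1)[OF B7(3)] that by simp
  have a7: "arr s7 k = arr s6 k" if "k < AK" "k \<noteq> aPend" "k \<noteq> aPf" "k \<noteq> aLx" "k \<noteq> aRs" for k using sameD(2)[OF B7(3)] that by simp
  have c7: "cnst s7" using cnst_cong[OF B7(3)] c6 by simp
  have po7: "pos_ok (Suc e) (fst s7 rG) (fst s7 rK)" "lev_ok (Suc e) (fst s7 rG) (fst s7 rK) s7" using B7(2) by auto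
  have q7: "fst s7 rI = Suc e" "fst s7 rH1 = hh r (wv \<tau> m lw (Suc e)) lw mod p"
    using r7 q6 r6 r5 B4 by simp_all
  have B8: "cok w J bAns s7" "fst s8 rZ \<noteq> 0 \<longleftrightarrow> em \<pi> \<tau> m (Suc e)" "same {rZ} {} s7 s8"
    unfolding s8_def by (rule bAns[OF c7 _ po7 _ q7]; use e in simp)+
  have r8: "fst s8 z = fst s7 z" if "z \<noteq> rZ" for z using sameD(1)[OF B8(3)] that by simp
  have a8: "arr s8 k = arr s7 k" if "k < AK" for k using sameD(2)[OF B8(3)] that by simp
  have c8: "cnst s8" using cnst_cong[OF B8(3)] c7 by simp
  have all: "cex bAll s = s8"
    by (simp add: bAll_def s1_def s2_def s3_def s4_def s5_def s6_def s7_def s8_def)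
  show "cok w J bAll s"
    using B1(1) B2(1) B3(1) B4(1) ok5 B6(1) B7(1) B8(1)
    by (simp add: bAll_def s1_def s2_def s3_def s4_def s5_def s6_def s7_def s8_def)
  show "fst (cex bAll s) rZ \<noteq> 0 \<longleftrightarrow> em \<pi> \<tau> m (Suc e)" unfolding all by (rule B8(2))
  have "lev_ok (Suc e) (fst s8 rG) (fst s8 rK) s8"
    using po7(2) lev_ok_cong[of s8 s7] a8 r8 by (simp add: AK_def)
  moreover have "last_ok (Suc e) (arr s8 aLast)" "ring_tr (Suc e) (arr s8 aTr)" "ring_fr (Suc e) (arr s8 aFr)"
    "sched L0 l0 (Suc e) (arr s8 aS0)" "sched m lw (Suc e) (arr s8 aS1)"
    using B1(4) q6 B3(3) B4(3) a2 a3 a4 a5 a6 a7 a8 by (simp_all add: AK_def)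
  moreover have "run_start \<rho> (Suc e) (fst s8 rA)" "fst s8 rI = Suc e" "fst s8 rF = hh r \<tau> (Suc e) mod p"
    "fst s8 rH0 = hh r (wv \<tau> L0 l0 (Suc e)) l0 mod p" "fst s8 rH1 = hh r (wv \<tau> m lw (Suc e)) lw mod p"
    using B2(3) f4 B4(2) r5 r6 r7 r8 by (simp_all del: hh.simps)
  moreover have "pos_ok (Suc e) (fst s8 rG) (fst s8 rK)" using po7(1) r8 by simp
  ultimately show "inv (Suc e) (cex bAll s)" unfolding all inv_def using c8 by blast
qed

end

section \<open>The streaming program as machine code\<close>

definition progQ :: prog where
  "progQ = [Const 1 0, Arith Add (TD + rX) 0 1] @ ccomp bAll 2 @ comp (V rZ) (2 + cclen bAll) 0"

lemma bAll_wf: "cwf bAll" "clf bAll"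
  by (simp_all add: bAll_def bIn_def bRun_def bWin_def bAdv_def bBase_def bSweep_def bReset_def bVisit_def
    bVerd_def bProm_def bAns_def Arr_def StA_def Ne_def Eqq_def An_def Nt_def Or_def TD_def NR_def)

lemma code_at_self: "code_at (a @ xs @ b) (length a) xs"
  by (auto simp: code_at_def nth_append)

lemma run_halted: "halted Q c \<Longrightarrow> run w Q t c = return_pmf c"
  by (induction t) (simp_all add: step_def bind_return_pmf)

lemma rt_extend:
  assumes "rt w Q t c c'" "halted Q c'" "t \<le> t'"
  shows "run w Q t' c = return_pmf c'"
proof -
  have "run w Q (t + (t' - t)) c = return_pmf c'"
    unfolding run_add using assms(1,2) by (simp add: rt_def bind_return_pmf run_halted)
  then show ?thesis using assms(3) by simp
qed

lemma progQ_step: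
  assumes s: "sim w J s M" and x: "x < 2 ^ w" and ok: "cok w J bAll (setr rX x s)"
  shows "\<exists>M'. run w progQ (length progQ) (0, M[0 := x]) = return_pmf (length progQ, M') \<and>
     sim w J (cex bAll (setr rX x s)) M' \<and> rd M' 0 = fst (cex bAll (setr rX x s)) rZ"
proof -
  have t: "0 < TD" "1 < TD" "2 < TD" by (auto simp: TD_def)
  have m: "0 < length M" "1 < length M" using sim_D(1)[OF s] t by auto
  have X: "rX < NR" "rZ < NR" by (auto simp: NR_def)
  let ?M1 = "M[0 := x, 1 := 0, TD + rX := x]"
  have f: "fold (mx w) [Const 1 0, Arith Add (TD + rX) 0 1] (M[0 := x]) = ?M1"
    using m x by (simp add: rd_def nth_list_update)
  have c1: "code_at progQ 0 [Const 1 0, Arith Add (TD + rX) 0 1]"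
    using code_at_self[of "[]" "[Const 1 0, Arith Add (TD + rX) 0 1]"] unfolding progQ_def by (simp only: append_Nil list.size)
  have 1: "rt w progQ 2 (0, M[0 := x]) (2, ?M1)"
    using rt_simple[OF c1, of w "M[0 := x]"] unfolding f by (simp add: eval_nat_numeral)
  have s1: "sim w J (setr rX x s) ?M1"
    using sim_reg[OF sim_temp[OF sim_temp[OF s t(1) x] t(2), of 0] X(1) x] by simp
  have c2: "code_at progQ 2 (ccomp bAll 2)"
    using code_at_self[of "[Const 1 0, Arith Add (TD + rX) 0 1]" "ccomp bAll 2" "comp (V rZ) (2 + cclen bAll) 0"]
    unfolding progQ_def by (simp add: eval_nat_numeral)
  obtain t2 M2 where 2: "rt w progQ t2 (2, ?M1) (2 + cclen bAll, M2)" "sim w J (cex bAll (setr rX x s)) M2"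
    "t2 \<le> cclen bAll"
    using ccompiledD[OF ccompiled c2 s1 ok bAll_wf(1)] bAll_wf(2) by metis
  have c3: "code_at progQ (2 + cclen bAll) (comp (V rZ) (2 + cclen bAll) 0)"
    using code_at_self[of "[Const 1 0, Arith Add (TD + rX) 0 1] @ ccomp bAll 2" "comp (V rZ) (2 + cclen bAll) 0" "[]"]
    unfolding progQ_def by (simp add: eval_nat_numeral)
  have w3: "ok w J (V rZ) (cex bAll (setr rX x s))" "wf (V rZ) 0" using X t by simp_all
  obtain t3 M3 where 3: "rt w progQ t3 (2 + cclen bAll, M2) (2 + cclen bAll + clen (V rZ), M3)"
    "sim w J (cex bAll (setr rX x s)) M3" "M3 ! 0 = ev (V rZ) (cex bAll (setr rX x s))" "t3 \<le> clen (V rZ)"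
    using compiledD[OF compiled c3 2(2) w3] by (metis lf.simps(2))
  have len: "length progQ = 2 + cclen bAll + clen (V rZ)" by (simp add: progQ_def)
  have "rt w progQ (2 + t2 + t3) (0, M[0 := x]) (length progQ, M3)"
    using rt_trans[OF rt_trans[OF 1 2(1)] 3(1)] by (simp only: len)
  moreover have "2 + t2 + t3 \<le> length progQ" using 2(3) 3(4) unfolding len by linarith
  ultimately have "run w progQ (length progQ) (0, M[0 := x]) = return_pmf (length progQ, M3)"
    by (intro rt_extend) (auto simp: halted_def)
  moreover have "rd M3 0 = fst (cex bAll (setr rX x s)) rZ" using 3(3) sim_rd(1)[OF 3(2) t(1)] by simp
  ultimately show ?thesis using 3(2) by blast
qed

context level_stream
begin

lemma inv_setr_X: "inv e (setr rX x s) \<longleftrightarrow> inv e s"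
  by (simp add: inv_def cnst_def lev_ok_def pf_ok_def)

lemma stream_correct:
  assumes "e \<le> n" "inv e s" "sim w J s M" "sg \<le> 2 ^ w"
  shows "stream w progQ (length progQ) (drop e T) M =
    return_pmf (map (\<lambda>i. Some (em \<pi> \<tau> m (Suc i))) [e..<n])"
  using assms
proof (induction "n - e" arbitrary: e s M)
  case 0
  then show ?case using lenT by simp
next
  case (Suc d)
  then have e: "e < n" by simp
  have x: "T ! e < 2 ^ w" using setT lenT e Suc(6)
    by (metis atLeastLessThan_iff less_le_trans nth_mem subsetD)
  have i: "inv e (setr rX (T ! e) s)" using Suc(4) by (simp add: inv_setr_X)
  note B = bAll[OF i e]
  let ?s = "cex bAll (setr rX (T ! e) s)"
  obtain M' where M': "run w progQ (length progQ) (0, M[0 := T ! e]) = return_pmf (length progQ, M')"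
     "sim w J ?s M'" "rd M' 0 = fst ?s rZ"
    using progQ_step[OF Suc(5) x] B(1) by auto
  have ih: "stream w progQ (length progQ) (drop (Suc e) T) M' =
    return_pmf (map (\<lambda>i. Some (em \<pi> \<tau> m (Suc i))) [Suc e..<n])"
    by (rule Suc(1)) (use Suc(2) e B(2) M'(2) Suc(6) in auto)
  have a: "answer progQ (length progQ, M') = Some (em \<pi> \<tau> m (Suc e))"
    using B(3) M'(3) by (simp add: answer_def halted_def)
  have d: "drop e T = T ! e # drop (Suc e) T" using e lenT by (simp add: Cons_nth_drop_Suc)
  have u: "[e..<n] = e # [Suc e..<n]" using e by (simp add: upt_conv_Cons)
  show ?case unfolding d u by (simp add: M'(1) bind_return_pmf a ih)
qed

end

section \<open>The preprocessing program\<close>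

text \<open>The bounded quantifier searches for a counterexample, so \<open>e\<close> is the negated condition.\<close>

definition FA :: "nat \<Rightarrow> exp \<Rightarrow> exp \<Rightarrow> exp" where
  "FA x b e = Eqq (Lst x b e) b"

lemma Least_bounded_cong:
  assumes "\<And>v. v < b \<Longrightarrow> Q v \<longleftrightarrow> R v"
  shows "(LEAST v. b \<le> v \<or> Q v) = (LEAST v. b \<le> (v::nat) \<or> R v)"
proof -
  have "(b \<le> v \<or> Q v) = (b \<le> v \<or> R v)" for v using assms[of v] by (cases "b \<le> v") auto
  then show ?thesis by presburger
qed

lemma ev_Lst:
  assumes "ev b s = n" "\<And>v. v < n \<Longrightarrow> ev e (setr x v s) \<noteq> 0 \<longleftrightarrow> Q v"
  shows "ev (Lst x b e) s = (LEAST v. n \<le> v \<or> Q v)"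
  using Least_bounded_cong[of n "\<lambda>v. ev e (setr x v s) \<noteq> 0" Q] assms by simp

lemma Least_bounded:
  fixes n :: nat and Q :: "nat \<Rightarrow> bool"
  defines "k \<equiv> LEAST v. n \<le> v \<or> Q v"
  shows "k \<le> n" "k < n \<Longrightarrow> Q k" "v < k \<Longrightarrow> \<not> Q v"
proof -
  have "n \<le> k \<or> Q k" unfolding k_def by (rule LeastI[of _ n]) simp
  then show "k < n \<Longrightarrow> Q k" by simp
  show "k \<le> n" unfolding k_def by (rule Least_le) simp
  show "v < k \<Longrightarrow> \<not> Q v" using not_less_Least unfolding k_def by blast
qed

lemma ev_FA:
  assumes "ev b s = n" "\<And>v. v < n \<Longrightarrow> ev e (setr x v s) = 0 \<longleftrightarrow> Q v"
  shows "ev (FA x b e) s = (if \<forall>v<n. Q v then 1 else 0)"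
proof -
  have l: "ev (Lst x b e) s = (LEAST v. n \<le> v \<or> \<not> Q v)" by (rule ev_Lst) (use assms in auto)
  have "(LEAST v. n \<le> v \<or> \<not> Q v) = n \<longleftrightarrow> (\<forall>v<n. Q v)"
    using Least_bounded[where n=n and Q="\<lambda>v. \<not> Q v"] by (metis le_neq_implies_less)
  then show ?thesis unfolding FA_def ev_Eqq l assms(1) by simp
qed

lemma ok_Lst:
  assumes "ok w J b s" "ev b s = n" "\<And>v. v < n \<Longrightarrow> ok w J e (setr x v s)"
  shows "ok w J (Lst x b e) s"
  using assms by simp

lemma ok_FA:
  assumes "fits w J" "ok w J b s" "ev b s = n" "\<And>v. v < n \<Longrightarrow> ok w J e (setr x v s)"
  shows "ok w J (FA x b e) s"
  using assms by (simp add: FA_def)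

lemma For_rule:
  assumes n: "ev e s = n" and ok: "ok w J e s" and I0: "I 0 (setr y n s)"
    and step: "\<And>j s'. j < n \<Longrightarrow> I j s' \<Longrightarrow> cok w J c (setr x j s') \<and> I (Suc j) (cex c (setr x j s'))"
  shows "cok w J (For x y e c) s" "\<exists>s'. I n s' \<and> cex (For x y e c) s = setr x n s'"
proof -
  define st where "st j = fold (\<lambda>j s. cex c (setr x j s)) [0..<j] (setr y n s)" for j
  have I: "I j (st j)" if "j \<le> n" for j
    using that by (induction j) (use I0 step in \<open>auto simp: st_def\<close>)
  show "cok w J (For x y e c) s" using ok step I n by (simp add: st_def)
  show "\<exists>s'. I n s' \<and> cex (For x y e c) s = setr x n s'" using I[of n] n by (intro exI[of _ "st n"]) (simp add: st_def)
qed

text \<open>Registers of the preprocessing: \<open>qS\<close> leads to the saved input,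
  \<open>qs\<close> is the alphabet size, \<open>qlg\<close> the bit length of \<open>m\<close>,
  \<open>qhc\<close> the bound on the number of levels, \<open>qdl\<close> the period threshold,
  \<open>qX\<close> the lower bound for the prime, \<open>qHi\<close> a staging area,
  \<open>qE\<close> the end of the level chain, \<open>qr\<close> the random word. The names
  starting with \<open>b\<close> are search variables.\<close>

abbreviation (input) "qn \<equiv> 40::nat"
abbreviation (input) "qS \<equiv> 41::nat"
abbreviation (input) "qs \<equiv> 42::nat"
abbreviation (input) "qlg \<equiv> 43::nat"
abbreviation (input) "qhc \<equiv> 44::nat"
abbreviation (input) "qX \<equiv> 45::nat"
abbreviation (input) "qHi \<equiv> 46::nat"
abbreviation (input) "qdl \<equiv> 47::nat"
abbreviation (input) "qE \<equiv> 48::nat"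
abbreviation (input) "qj \<equiv> 50::nat"
abbreviation (input) "qb \<equiv> 51::nat"
abbreviation (input) "b1 \<equiv> 52::nat"
abbreviation (input) "b2 \<equiv> 53::nat"
abbreviation (input) "b4 \<equiv> 55::nat"
abbreviation (input) "qL \<equiv> 56::nat"
abbreviation (input) "qq \<equiv> 57::nat"
abbreviation (input) "qt \<equiv> 58::nat"
abbreviation (input) "ql \<equiv> 59::nat"
abbreviation (input) "qpk \<equiv> 60::nat"
abbreviation (input) "qr \<equiv> 61::nat"
abbreviation (input) "aPd \<equiv> 15::nat"
abbreviation (input) "aLv \<equiv> 16::nat"

text \<open>The number of cells below the heap that the input may fill with pattern symbols: three
  parameters come first.\<close>

definition c0 :: nat where "c0 = KC - 3"

primrec epow :: "nat \<Rightarrow> exp" where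
  "epow 0 = N 1"
| "epow (Suc k) = Times (epow k) (Plus (V qn) (V qn))"

lemma ev_epow: "ev (epow k) s = (2 * fst s qn) ^ k"
  by (induction k) (simp_all add: mult.commute)

lemma wf_epow: "wf (epow k) 1"
  by (induction k) (simp_all add: TD_def NR_def)

lemma ok_epow: "1 \<le> fst s qn \<Longrightarrow> (2 * fst s qn) ^ k < 2 ^ w \<Longrightarrow> 2 * fst s qn < 2 ^ w \<Longrightarrow> ok w J (epow k) s"
proof (induction k)
  case (Suc k)
  have "(2 * fst s qn) ^ k \<le> (2 * fst s qn) ^ Suc k" using Suc.prems(1) by (intro power_increasing) auto
  then have "(2 * fst s qn) ^ k < 2 ^ w" using Suc.prems(2) by linarith
  then show ?case using Suc by (simp add: ev_epow mult.commute mult_2)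
qed (use one_less_power in \<open>auto\<close>)

text \<open>The first \<open>c0\<close> symbols have been moved by the prologue and lie in
  descending order below \<open>qS\<close>; the others are still in cell \<open>k + 3\<close>, where
  the input put them.\<close>

definition Pe :: "exp \<Rightarrow> exp" where
  "Pe k = Ite (Lt k (N c0)) (Ld (Sb (V qS) (Plus k (N 1)))) (Ld (Sb (Plus k (N 3)) (N KC)))"

text \<open>Alphabet size and pattern length arrive packed into one word as
  \<open>s * n + m\<close>. As \<open>m\<close> ranges from 1 to \<open>n\<close>, one is subtracted
  before dividing by \<open>n\<close>.\<close>

definition rInit :: "nat \<Rightarrow> com" where
  "rInit A = Sq (Asg qS (Sb (V qS) (N 3)))
    (Sq (Asg qpk (Sb (Ld (V qS)) (N 1)))
    (Sq (Asg qs (B Di (V qpk) (V qn)))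
    (Sq (Asg rM (Plus (Modu (V qpk) (V qn)) (N 1)))
    (Sq (Asg qX (epow A))
        (Asg qHi (Plus (Times (N AK) (V qX)) (N AK)))))))"

text \<open>The distances first go to a staging area above all arrays; writing them into an
  interleaved array at once would overwrite pattern symbols that are still to be read.\<close>

definition rPd :: com where
  "rPd = For qj qb (V rM)
     (Sq (Asg qt (Lst b1 (Plus (V qj) (N 1)) (An (V b1) (Eqq (Pe (Sb (V qj) (V b1))) (Pe (V qj))))))
         (Sto (Plus (V qHi) (V qj)) (Ite (Lt (V qt) (Plus (V qj) (N 1))) (V qt) (N 0))))"

definition rCp :: com where
  "rCp = For qj qb (V rM) (StA aPd (V qj) (Ld (Plus (V qHi) (V qj))))"

definition rPar :: com where
  "rPar = Sq (Asg qlg (Lst b1 (Plus (V rM) (N 1)) (Lt (V rM) (B Sh (N 1) (V b1)))))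
    (Sq (Asg qhc (Times (N 52) (Times (V qs) (V qlg))))
    (Sq (Asg qdl (Times (N 4) (V qhc)))
    (Sq (Asg rC (Plus (V qdl) (N 2)))
        (Asg rP (Lst b1 (Plus (Times (N 2) (Times (V qX) (V qX))) (N 2))
           (An (Lt (V qX) (V b1)) (FA b2 (V b1) (An (Lt (N 1) (V b2)) (Eqq (Modu (V b1) (V b2)) (N 0))))))))))"

definition rFirst :: "nat \<Rightarrow> com" where
  "rFirst A = Sq (rInit A) (Sq rPd (Sq rCp rPar))"

definition lgm :: "nat \<Rightarrow> nat" where
  "lgm m = (LEAST k. m < 2 ^ k)"

text \<open>\<open>X\<close> exceeds \<open>n\<close> and all table lengths. The prime is taken
  between \<open>X\<close> and \<open>2 * X ^ 2 + 1\<close>, so that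
  \<open>X ^ 6 \<le> 2 ^ w\<close> leaves room for products of two residues.\<close>

locale pattern_prep =
  fixes P :: "nat list" and n m sg w X :: nat
  assumes mn: "1 \<le> m" "m \<le> n" and lenP: "length P = m" and setP: "set P \<subseteq> {0..<sg}"
    and big: "m + (4 * (52 * (sg * lgm m)) + 2) + n + 20 \<le> X" "4096 \<le> X" "X ^ 6 \<le> 2 ^ w"
begin

definition \<pi> :: "nat \<Rightarrow> nat" where "\<pi> = pd P"

lemma \<pi>_le: "\<pi> j \<le> j" by (simp add: \<pi>_def pd_le)

definition J :: nat where "J = 2 ^ w - KC"
text \<open>\<open>hc\<close> bounds the number of levels: \<open>(4 k + 2) (Z + 1)\<close> steps suffice, where \<open>k = 6 lgm m\<close>
  because \<open>(9/8)\<^sup>6 > 2\<close>, and \<open>Z + 1 \<le> 2 sg\<close> because a zero distance is the first occurrence of a symbol.\<close>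

definition hc :: nat where "hc = 52 * (sg * lgm m)"
definition C :: nat where "C = 4 * hc + 2"
definition Hi :: nat where "Hi = AK * X + AK"

lemma X_bounds: "X \<le> X * X" "4096 * X \<le> X * X" "X * X \<le> X ^ 4" "4096 * X ^ 4 \<le> X ^ 6" "X ^ 4 * 4096 \<le> 2 ^ w" "1 \<le> X"
proof -
  show 1: "1 \<le> X" using big by simp
  show "X \<le> X * X" by simp
  show a: "4096 * X \<le> X * X" using big(2) by (rule mult_le_mono1)
  show "X * X \<le> X ^ 4" using 1 power_increasing[of 2 4 X] by (simp add: power2_eq_square)
  have "4096 \<le> X * X" using a 1 by (metis le_trans mult_le_mono2 nat_mult_1_right)
  then have "4096 * X ^ 4 \<le> (X * X) * X ^ 4" by (rule mult_le_mono1)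
  also have "(X * X) * X ^ 4 = X ^ 6" by (simp add: eval_nat_numeral)
  finally show "4096 * X ^ 4 \<le> X ^ 6" .
  then show "X ^ 4 * 4096 \<le> 2 ^ w" using big(3) by linarith
qed

lemma sq_small: "x \<le> 200 * (X * X) \<Longrightarrow> x < 2 ^ w"
  using X_bounds by linarith

lemma lin_small: "x \<le> 4096 * X \<Longrightarrow> x < 2 ^ w"
  using X_bounds by linarith

lemma fitJ: "fits w J" "KC + J = 2 ^ w"
proof -
  have "KC < 2 ^ w" using lin_small[of KC] big(2) by (simp add: KC_def TD_def NR_def)
  then show "fits w J" "KC + J = 2 ^ w" by (simp_all add: fits_def J_def)
qed

lemma ixJ: "j \<le> 2 * X \<Longrightarrow> k < AK \<Longrightarrow> AK * j + k < J"
  using fitJ(2) lin_small[of "AK * j + k + KC"] big(2) by (simp add: KC_def TD_def NR_def AK_def)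

lemma hi_J: "j \<le> X \<Longrightarrow> Hi + j < J"
  using fitJ(2) lin_small[of "Hi + j + KC"] big(2) by (simp add: KC_def TD_def NR_def AK_def Hi_def)

text \<open>The heap index of cell \<open>2 ^ w - n\<close>. The program does not know
  \<open>w\<close>; computing \<open>0 - n\<close> with wrap-around leads it to the upper end of the
  memory.\<close>

definition Hs :: nat where "Hs = 2 ^ w - n - KC"

lemma Hs: "Hi + X + KC < Hs" "Hs < J" "n + KC + Hs = 2 ^ w"
proof -
  have "n + KC + Hi + X + KC + 1 < 2 ^ w" using lin_small[of "n + KC + Hi + X + KC + 1"] big
    by (simp add: KC_def TD_def NR_def AK_def Hi_def)
  then show "Hi + X + KC < Hs" "n + KC + Hs = 2 ^ w" unfolding Hs_def by linarith+
  then show "Hs < J" using fitJ(2) mn by linarith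
qed

definition psrc :: "st \<Rightarrow> bool" where
  "psrc s \<longleftrightarrow> fst s qS = Hs \<and> (\<forall>k<m. (if k < c0 then snd s (Hs - (k + 1)) else snd s (k + 3 - KC)) = P ! k)"

lemma psrc_setr: "x \<noteq> qS \<Longrightarrow> psrc (setr x v s) = psrc s"
  by (simp add: psrc_def)

lemma c0: "c0 + 3 = KC" by (simp add: c0_def KC_def TD_def)

lemma Pe:
  assumes "psrc s" "ev k s < m" "ok w J k s"
  shows "ev (Pe k) s = P ! ev k s" "ok w J (Pe k) s"
proof -
  have a: "fst s qS = Hs" "(if ev k s < c0 then snd s (Hs - (ev k s + 1)) else snd s (ev k s + 3 - KC)) = P ! ev k s"
    using assms by (auto simp: psrc_def)
  show "ev (Pe k) s = P ! ev k s" using a by (cases "ev k s < c0") (simp_all add: Pe_def)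
  have "ev k s + 3 < 2 ^ w" "c0 < 2 ^ w" "KC < 2 ^ w" using lin_small[of "ev k s + 3"] lin_small[of KC] assms(2) big c0
    by (simp_all add: KC_def TD_def NR_def) 
  moreover have "ev k s + 3 - KC < J" "Hs - (ev k s + 1) < J" using ixJ[of "m" 0] assms(2) big Hs by (auto simp: AK_def)
  ultimately show "ok w J (Pe k) s" using assms(3) a(1) by (simp add: Pe_def)
qed

lemma lgm: "m < 2 ^ lgm m" "lgm m \<le> m"
proof -
  show "m < 2 ^ lgm m" unfolding lgm_def by (rule LeastI[of "\<lambda>k. m < 2 ^ k" m]) (rule less_exp)
  show "lgm m \<le> m" unfolding lgm_def by (rule Least_le) (rule less_exp)
qed

lemma lgm_pos: "1 \<le> lgm m"
  using lgm(1) mn by (cases "lgm m") auto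

lemma rInit:
  assumes q: "fst s qn = n" "fst s qS = Hs + 3" "snd s Hs = sg * n + m" and X: "X = (2 * n) ^ A"
    and src: "\<forall>k<m. (if k < c0 then snd s (Hs - (k + 1)) else snd s (k + 3 - KC)) = P ! k"
  shows "cok w J (rInit A) s" "psrc (cex (rInit A) s)" "fst (cex (rInit A) s) rM = m" "fst (cex (rInit A) s) qs = sg"
    "fst (cex (rInit A) s) qX = X" "fst (cex (rInit A) s) qHi = Hi"
proof -
  have d: "(sg * n + m - 1) div n = sg" "(sg * n + m - 1) mod n + 1 = m"
  proof -
    have e: "sg * n + m - 1 = (m - 1) + sg * n" and l: "m - 1 < n" using mn by auto
    show "(sg * n + m - 1) div n = sg" unfolding e using l by simp
    show "(sg * n + m - 1) mod n + 1 = m" unfolding e mod_mult_self1 using l mn by simp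
  qed
  have b: "2 * n < 2 ^ w" "(2 * n) ^ A < 2 ^ w" "m < 2 ^ w" "AK * X < 2 ^ w" "AK * X + AK < 2 ^ w" "AK < 2 ^ w"
     "(3::nat) < 2 ^ w" "(1::nat) < 2 ^ w"
    unfolding X[symmetric] AK_def by (rule lin_small; use mn big in linarith)+
  have oke: "ok w J (epow A) s'" "ev (epow A) s' = X" if "fst s' qn = n" for s'
    using ok_epow[of s' A w J] b mn that X by (simp_all add: ev_epow)
  have d2: "Suc ((sg * n + m - Suc 0) mod n) = m" "(sg * n + m - Suc 0) div n = sg" using d by simp_all
  have "sg * n + m < 2 ^ w"
  proof -
    have "sg \<le> sg * lgm m" using lgm_pos by simp
    then have "sg \<le> X" "n \<le> X" "m \<le> X" using big by linarith+
    then have "sg * n \<le> X * X" by (intro mult_le_mono)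
    then show ?thesis using \<open>m \<le> X\<close> X_bounds(1) by (intro sq_small) linarith
  qed
  moreover have "sg < 2 ^ w" by (rule le_less_trans[OF _ calculation]) (use mn in \<open>simp add: trans_le_add1\<close>)
  ultimately show "cok w J (rInit A) s" using q b Hs(2) oke d2 by (simp add: rInit_def)
  have fst: "fst (cex (rInit A) s) z = (if z = qHi then Hi else if z = qX then X else if z = rM then m else
     if z = qs then sg else if z = qpk then sg * n + m - 1 else if z = qS then Hs else fst s z)"
    and snd: "snd (cex (rInit A) s) = snd s" for z
    using q oke d2 by (simp_all add: rInit_def Hi_def)
  show "psrc (cex (rInit A) s)" using src unfolding psrc_def snd by (simp add: fst)
  show "fst (cex (rInit A) s) rM = m" "fst (cex (rInit A) s) qs = sg"
    "fst (cex (rInit A) s) qX = X" "fst (cex (rInit A) s) qHi = Hi" by (simp_all add: fst)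
qed

lemma rPd:
  assumes "psrc s" "fst s rM = m" "fst s qHi = Hi"
  shows "cok w J rPd s" "\<forall>k<m. snd (cex rPd s) (Hi + k) = \<pi> k"
proof -
  define I where "I = (\<lambda>j s'. psrc s' \<and> fst s' rM = m \<and> fst s' qHi = Hi \<and> (\<forall>k<j. snd s' (Hi + k) = \<pi> k))"
  define body where "body = Sq (Asg qt (Lst b1 (Plus (V qj) (N 1)) (An (V b1) (Eqq (Pe (Sb (V qj) (V b1))) (Pe (V qj))))))
         (Sto (Plus (V qHi) (V qj)) (Ite (Lt (V qt) (Plus (V qj) (N 1))) (V qt) (N 0)))"
  have step: "cok w J body (setr qj j s') \<and> I (Suc j) (cex body (setr qj j s'))" if j: "j < m" and I: "I j s'" for j s'
  proof -
    let ?s = "setr qj j s'"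
    define e where "e = Lst b1 (Plus (V qj) (N 1)) (An (V b1) (Eqq (Pe (Sb (V qj) (V b1))) (Pe (V qj))))"
    define t where "t = ev e ?s"
    have ps: "psrc (setr b1 v ?s)" for v using I by (simp add: I_def psrc_setr)
    have jw: "Suc j < 2 ^ w" using lin_small[of "Suc j"] j big by simp
    have p1: "ev (Pe (Sb (V qj) (V b1))) (setr b1 v ?s) = P ! (j - v)"
             "ok w J (Pe (Sb (V qj) (V b1))) (setr b1 v ?s)" if "v < Suc j" for v
      using Pe[of "setr b1 v ?s" "Sb (V qj) (V b1)", OF ps] that j by simp_all
    have p2: "ev (Pe (V qj)) (setr b1 v ?s) = P ! j" "ok w J (Pe (V qj)) (setr b1 v ?s)" for v
      using Pe[of "setr b1 v ?s" "V qj", OF ps] j by simp_all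
    have t: "t = (LEAST v. Suc j \<le> v \<or> (v \<noteq> 0 \<and> P ! (j - v) = P ! j))"
      unfolding t_def e_def by (rule ev_Lst) (use p1 p2 in auto)
    have oke: "ok w J e ?s" unfolding e_def
      by (rule ok_Lst[of _ _ _ _ "Suc j"]) (use p1 p2 jw fitJ in auto)
    have pdt: "(if t < Suc j then t else 0) = \<pi> j"
    proof -
      note L = Least_bounded[where n="Suc j" and Q="\<lambda>v. v \<noteq> 0 \<and> P ! (j - v) = P ! j", folded t]
      show ?thesis
      proof (cases "t < Suc j")
        case True
        have "pd P j = t" by (rule pd_eqI) (use L(2)[OF True] L(3) True in auto)
        then show ?thesis using True by (simp add: \<pi>_def)
      next
        case False
        have "pd P j = 0"
          proof (rule pd_0I)
            fix d assume "1 \<le> d" "d \<le> j"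
            then show "P ! (j - d) \<noteq> P ! j" using L(3)[of d] False by linarith
          qed
        then show ?thesis using False by (simp add: \<pi>_def)
      qed
    qed
    have f: "fst s' rM = m" "fst s' qHi = Hi" "\<forall>k<j. snd s' (Hi + k) = \<pi> k" "psrc s'" using I by (auto simp: I_def)
    have hJ: "Hi + j < J" "Hi + j < 2 ^ w" using hi_J[of j] j big fitJ(2) by auto
    have c: "cex body ?s = seth (Hi + j) (\<pi> j) (setr qt t ?s)"
      unfolding body_def e_def[symmetric] using f unfolding pdt[symmetric] by (simp add: t_def)
    \<comment> \<open>The staging area lies above the symbols left in place and below the saved
      ones.\<close>
    have ps': "psrc (cex body ?s)"
    proof -
      have "Hs - (k + 1) \<noteq> Hi + j" if "k < c0" for k using Hs(1) j big that c0 by linarith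
      moreover have "k + 3 - KC \<noteq> Hi + j" if "k < m" for k using that big unfolding Hi_def AK_def by linarith
      ultimately have "(if k < c0 then snd (cex body ?s) (Hs - (k + 1)) else snd (cex body ?s) (k + 3 - KC)) = P ! k" if "k < m" for k
        using that f(4)[unfolded psrc_def, THEN conjunct2, rule_format, OF that] unfolding c
        by (cases "k < c0") (simp_all add: seth_def)
      then show ?thesis using f(4) unfolding psrc_def by (simp add: c)
    qed
    have "I (Suc j) (cex body ?s)"
      unfolding I_def using ps' f(1,2,3) unfolding c by (simp add: less_Suc_eq seth_def)
    moreover have "cok w J body ?s"
      unfolding body_def e_def[symmetric] using oke f hJ jw fitJ by simp
    ultimately show ?thesis by simp
  qed
  note F = For_rule[of "V rM" s m w J I qb body qj, OF _ _ _ step]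
  have i0: "I 0 (setr qb m s)" using assms by (simp add: I_def psrc_setr)
  have "cok w J (For qj qb (V rM) body) s" by (rule F(1)) (use assms i0 in auto)
  then show "cok w J rPd s" by (simp only: rPd_def body_def)
  have "\<exists>s'. I m s' \<and> cex (For qj qb (V rM) body) s = setr qj m s'" by (rule F(2)) (use assms i0 in auto)
  then obtain s' where s': "I m s'" "cex (For qj qb (V rM) body) s = setr qj m s'" by blast
  show "\<forall>k<m. snd (cex rPd s) (Hi + k) = \<pi> k" unfolding rPd_def body_def[symmetric] s'(2) using s'(1) by (simp add: I_def)
qed

lemma rCp:
  assumes "\<forall>k<m. snd s (Hi + k) = \<pi> k" "fst s rM = m" "fst s qHi = Hi"
  shows "cok w J rCp s" "\<forall>k<m. arr (cex rCp s) aPd k = \<pi> k"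
proof -
  define I where "I = (\<lambda>j s'. (\<forall>k<m. snd s' (Hi + k) = \<pi> k) \<and> fst s' rM = m \<and> fst s' qHi = Hi \<and> (\<forall>k<j. arr s' aPd k = \<pi> k))"
  define body where "body = StA aPd (V qj) (Ld (Plus (V qHi) (V qj)))"
  have step: "cok w J body (setr qj j s') \<and> I (Suc j) (cex body (setr qj j s'))" if j: "j < m" and I: "I j s'" for j s'
  proof -
    have f: "fst s' rM = m" "fst s' qHi = Hi" "\<forall>k<j. arr s' aPd k = \<pi> k" "\<forall>k<m. snd s' (Hi + k) = \<pi> k"
      using I by (auto simp: I_def)
    have hJ: "Hi + j < J" "Hi + j < 2 ^ w" "AK * j + aPd < J" using hi_J[of j] ixJ[of j aPd] j big fitJ(2) by (auto simp: AK_def)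
    have c: "cex body (setr qj j s') = seta aPd j (\<pi> j) (setr qj j s')" using f j by (simp add: body_def)
    have "Hi + k \<noteq> AK * j + aPd" for k using j big by (simp add: Hi_def AK_def)
    then have "I (Suc j) (cex body (setr qj j s'))"
      unfolding I_def c using f by (simp add: seta_def seth_def arr_def AK_inj AK_def less_Suc_eq)
    moreover have "cok w J body (setr qj j s')" using f hJ fitJ by (simp add: body_def)
    ultimately show ?thesis by simp
  qed
  note F = For_rule[of "V rM" s m w J I qb body qj, OF _ _ _ step]
  have i0: "I 0 (setr qb m s)" using assms by (simp add: I_def)
  have "cok w J (For qj qb (V rM) body) s" by (rule F(1)) (use assms i0 in auto)
  then show "cok w J rCp s" by (simp only: rCp_def body_def)
  have "\<exists>s'. I m s' \<and> cex (For qj qb (V rM) body) s = setr qj m s'" by (rule F(2)) (use assms i0 in auto)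
  then obtain s' where s': "I m s'" "cex (For qj qb (V rM) body) s = setr qj m s'" by blast
  show "\<forall>k<m. arr (cex rCp s) aPd k = \<pi> k" unfolding rCp_def body_def[symmetric] s'(2) using s'(1) by (simp add: I_def)
qed

definition pp :: nat where "pp = (LEAST v. 2 * (X * X) + 2 \<le> v \<or> (X < v \<and> (\<forall>u<v. 1 < u \<longrightarrow> v mod u \<noteq> 0)))"

text \<open>The least number above \<open>X\<close> without a proper divisor is found by trial
  division; \<open>prime_between\<close> guarantees that the search succeeds before its
  bound.\<close>

lemma pp: "prime pp" "X < pp" "pp < 2 * (X * X) + 2"
proof -
  obtain q :: nat where q: "prime q" "X < q" "q \<le> 2 * X ^ 2 + 1" using prime_between[of X] big by auto
  have q': "X < q \<and> (\<forall>u<q. 1 < u \<longrightarrow> q mod u \<noteq> 0)"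
    using q(1,2) by (auto simp: prime_nat_iff mod_eq_0_iff_dvd)
  note L = Least_bounded[where n="2 * (X * X) + 2" and Q="\<lambda>v. X < v \<and> (\<forall>u<v. 1 < u \<longrightarrow> v mod u \<noteq> 0)", folded pp_def]
  have "pp \<le> q" using L(3)[of q] q' by (meson not_le)
  then show lt: "pp < 2 * (X * X) + 2" using q(3) by (simp add: power2_eq_square)
  then show gt: "X < pp" using L(2) by simp
  show "prime pp"
    unfolding prime_nat_iff
  proof (intro conjI allI impI)
    show "1 < pp" using gt big by linarith
    fix u assume u: "u dvd pp"
    then have "u \<noteq> 0" "u \<le> pp" using gt by (auto dest: dvd_imp_le intro: Nat.gr0I)
    then show "u = 1 \<or> u = pp" using L(2)[OF lt] u by (metis le_neq_implies_less less_one linorder_neqE_nat mod_0_imp_dvd mod_eq_0_iff_dvd)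
  qed
qed

lemma rPar:
  assumes "fst s rM = m" "fst s qs = sg" "fst s qX = X"
  defines "s' \<equiv> cex rPar s"
  shows "cok w J rPar s" "fst s' qlg = lgm m" "fst s' qhc = hc" "fst s' qdl = 4 * hc" "fst s' rC = C" "fst s' rP = pp"
    "snd s' = snd s"
proof -
  \<comment> \<open>The search shifts 1 by exponents up to \<open>lgm m\<close> only, where the
    power is at most \<open>2 * m\<close> and cannot overflow.\<close>
  have m2: "2 ^ v \<le> 2 * m" if "v \<le> lgm m" for v
  proof (cases "lgm m")
    case 0
    then show ?thesis using that lgm(1) mn by simp
  next
    case (Suc k)
    have "\<not> m < 2 ^ k" using not_less_Least[of k "\<lambda>k. m < 2 ^ k"] Suc by (simp add: lgm_def)
    then have "2 ^ lgm m \<le> 2 * m" using Suc by simp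
    moreover have "(2::nat) ^ v \<le> 2 ^ lgm m" using that by (intro power_increasing) auto
    ultimately show ?thesis by linarith
  qed
  define el where "el = Lst b1 (Plus (V rM) (N 1)) (Lt (V rM) (B Sh (N 1) (V b1)))"
  have el: "ev el z = lgm m" "ok w J el z" if "fst z rM = m" for z
  proof -
    have "ev el z = (LEAST v. Suc m \<le> v \<or> m < 2 ^ v)" unfolding el_def by (rule ev_Lst) (use that in auto)
    also have "\<dots> = lgm m" unfolding lgm_def
    proof (rule arg_cong[of _ _ Least], rule ext)
      fix v :: nat
      have "v < 2 ^ v" by (rule less_exp)
      then show "(Suc m \<le> v \<or> m < 2 ^ v) = (m < 2 ^ v)" by linarith
    qed
    finally show "ev el z = lgm m" .
    have s: "(1::nat) < 2 ^ w" "Suc m < 2 ^ w" using lin_small[of 1] lin_small[of "Suc m"] big by auto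
    have "ok w J (Lt (V rM) (B Sh (N 1) (V b1))) (setr b1 v z)" if "\<forall>u<v. ev (Lt (V rM) (B Sh (N 1) (V b1))) (setr b1 u z) = 0" for v
    proof -
      have "v \<le> lgm m"
      proof (rule ccontr)
        assume "\<not> v \<le> lgm m"
        then show False using that[rule_format, of "lgm m"] \<open>fst z rM = m\<close> lgm(1) by (simp split: if_splits)
      qed
      then have "2 ^ v < (2::nat) ^ w" using m2[of v] lin_small[of "2 * m"] big by linarith
      then show ?thesis using s by simp
    qed
    then show "ok w J el z" unfolding el_def using that s by simp
  qed
  define ep where "ep = Lst b1 (Plus (Times (N 2) (Times (V qX) (V qX))) (N 2))
           (An (Lt (V qX) (V b1)) (FA b2 (V b1) (An (Lt (N 1) (V b2)) (Eqq (Modu (V b1) (V b2)) (N 0)))))"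
  have ep: "ev ep z = pp" "ok w J ep z" if "fst z qX = X" for z
  proof -
    let ?b = "2 * (X * X) + 2"
    have fa: "ev (FA b2 (V b1) (An (Lt (N 1) (V b2)) (Eqq (Modu (V b1) (V b2)) (N 0)))) (setr b1 v z)
       = (if \<forall>u<v. 1 < u \<longrightarrow> v mod u \<noteq> 0 then 1 else 0)" for v
      by (rule ev_FA) auto
    show "ev ep z = pp" unfolding ep_def pp_def by (rule ev_Lst) (use that fa in auto)
    have s: "(1::nat) < 2 ^ w" "?b < 2 ^ w" using X_bounds(1) big by (intro lin_small sq_small, linarith)+
    have of: "ok w J (FA b2 (V b1) (An (Lt (N 1) (V b2)) (Eqq (Modu (V b1) (V b2)) (N 0)))) (setr b1 v z)" if "v < ?b" for v
    proof (rule ok_FA[of _ _ _ _ v])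
      fix u assume "u < v"
      have "v mod u < 2 ^ w" using that s(2) mod_less_eq_dividend[of v u] by linarith
      then show "ok w J (An (Lt (N 1) (V b2)) (Eqq (Modu (V b1) (V b2)) (N 0))) (setr b2 u (setr b1 v z))"
        using fitJ s by simp
    qed (use fitJ in auto)
    show "ok w J ep z" unfolding ep_def
      by (rule ok_Lst[of _ _ _ _ ?b]) (use that of fitJ s in auto)
  qed
  have hcs: "52 * (sg * lgm m) < 2 ^ w" "sg * lgm m < 2 ^ w" "4 * (52 * (sg * lgm m)) < 2 ^ w" "4 * (52 * (sg * lgm m)) + 2 < 2 ^ w"
     "(52::nat) < 2 ^ w" "(4::nat) < 2 ^ w" "(2::nat) < 2 ^ w"
    by (rule lin_small; use big in linarith)+
  show "cok w J rPar s" unfolding rPar_def el_def[symmetric] ep_def[symmetric]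
    using el ep assms(1-3) hcs by simp
  show "fst s' qlg = lgm m" "fst s' qhc = hc" "fst s' qdl = 4 * hc" "fst s' rC = C" "fst s' rP = pp"
    "snd s' = snd s"
    unfolding s'_def rPar_def el_def[symmetric] ep_def[symmetric]
    using el ep assms(1-3) by (simp_all add: hc_def C_def)
qed

lemma rFirst:
  assumes q: "fst s qn = n" "fst s qS = Hs + 3" "snd s Hs = sg * n + m" and X: "X = (2 * n) ^ A"
    and src: "\<forall>k<m. (if k < c0 then snd s (Hs - (k + 1)) else snd s (k + 3 - KC)) = P ! k"
  defines "s' \<equiv> cex (rFirst A) s"
  shows "cok w J (rFirst A) s" "fst s' rM = m" "fst s' qlg = lgm m" "fst s' qhc = hc"
    "fst s' qdl = 4 * hc" "fst s' rC = C" "fst s' rP = pp" "\<forall>k<m. arr s' aPd k = \<pi> k"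
proof -
  define s1 where "s1 = cex (rInit A) s"
  define s2 where "s2 = cex rPd s1"
  define s3 where "s3 = cex rCp s2"
  note i = rInit[OF q X src, folded s1_def]
  note pd = rPd[OF i(2,3,6), folded s2_def]
  have f2: "fst s2 x = fst s1 x" if "x \<in> {rM, qs, qX, qHi}" for x
    unfolding s2_def by (rule cex_unassigned) (use that in \<open>auto simp: rPd_def\<close>)
  have cp: "cok w J rCp s2" "\<forall>k<m. arr s3 aPd k = \<pi> k"
    using rCp[OF pd(2)] f2 i unfolding s3_def by auto
  have f3: "fst s3 x = fst s1 x" if "x \<in> {rM, qs, qX, qHi}" for x
    unfolding s3_def f2[OF that, symmetric] by (rule cex_unassigned) (use that in \<open>auto simp: rCp_def StA_def\<close>)
  have g: "fst s3 rM = m" "fst s3 qs = sg" "fst s3 qX = X" using f3 i by auto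
  note pa = rPar[OF g]
  have e: "s' = cex rPar s3" by (simp add: s'_def rFirst_def s1_def s2_def s3_def)
  show "cok w J (rFirst A) s" using i(1) pd(1) cp(1) pa(1) by (simp add: rFirst_def s1_def s2_def s3_def)
  have "fst s' rM = m" unfolding e g(1)[symmetric] by (rule cex_unassigned) (simp add: rPar_def)
  then show "fst s' rM = m" "fst s' qlg = lgm m" "fst s' qhc = hc"
    "fst s' qdl = 4 * hc" "fst s' rC = C" "fst s' rP = pp" "\<forall>k<m. arr s' aPd k = \<pi> k"
    using pa cp(2) unfolding e by (simp_all add: arr_def)
qed

lemma rFirst_wf: "cwf (rFirst A)"
proof -
  have "wf (epow k) 1" for k by (rule wf_epow)
  then show ?thesis
    by (simp add: rFirst_def rInit_def rPd_def rCp_def rPar_def Pe_def FA_def StA_def Arr_def Eqq_def Ne_def An_def Nt_def TD_def NR_def)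
qed

end

section \<open>The parameters of the level decomposition\<close>

context pattern_prep
begin

text \<open>The threshold \<open>4 * hc\<close> is twice the slack \<open>2 * hc\<close> of the
  level steps, as \<open>levels\<close> demands, and the slack covers the delay
  \<open>2 * hl\<close> because \<open>hl \<le> hc\<close>.\<close>

definition L0 :: nat where "L0 = (LEAST l. m \<le> l \<or> (\<forall>q<4 * hc + 1. q = 0 \<or> \<not> perd \<pi> l q))"
definition rho :: nat where "rho = (LEAST q. 4 * hc + 1 \<le> q \<or> q \<noteq> 0 \<and> perd \<pi> (L0 - 1) q)"
definition l0 :: nat where "l0 = min (rho + 1) L0"
text \<open>If fewer than \<open>2 * hc\<close> symbols follow the first \<open>L0\<close>, all of
  them become the tail and there are no levels.\<close>

definition lam :: nat where "lam = (if m < L0 + 2 * hc then m - L0 else 2 * hc)"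
definition E :: nat where "E = m - lam"
definition lw :: nat where "lw = (if lam = 0 then 1 else lam)"
definition Lv :: "nat \<Rightarrow> nat" where "Lv g = (nxt \<pi> E (2 * hc) ^^ g) L0"
definition kdf :: "nat \<Rightarrow> nat" where
  "kdf g = (if \<pi> (Lv g) = 0 then 1 else if 0 < nt \<pi> E (Lv g) then 0 else 2)"
definition lnf :: "nat \<Rightarrow> nat" where
  "lnf g = (if \<pi> (Lv g) = 0 then 1 else if 0 < nt \<pi> E (Lv g) then 0 else hs \<pi> E (2 * hc) (Lv g) - Lv g)"
definition Aaf :: "nat \<Rightarrow> nat \<Rightarrow> nat" where
  "Aaf r g = (if \<pi> (Lv g) = 0 then Lv g else if 0 < nt \<pi> E (Lv g) then per \<pi> (Lv g) else r ^ lnf g mod pp)"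
definition Bbf :: "nat \<Rightarrow> nat \<Rightarrow> nat" where
  "Bbf r g = (if \<pi> (Lv g) = 0 then 0 else if 0 < nt \<pi> E (Lv g) then nt \<pi> E (Lv g) * per \<pi> (Lv g)
     else hh r (\<lambda>j. \<pi> (Lv g + j)) (lnf g) mod pp)"
text \<open>The number of levels actually needed; \<open>hc\<close> is an upper bound known before
  the levels are.\<close>

definition hl :: nat where "hl = (LEAST v. hc \<le> v \<or> Lv v = E)"

lemma sg_pos: "1 \<le> sg"
proof -
  have "P ! 0 \<in> set P" using lenP mn by simp
  then show ?thesis using setP by fastforce
qed

lemma hc_pos: "52 \<le> hc" "52 * lgm m * sg \<le> hc"
proof -
  have "1 * 1 \<le> sg * lgm m" using sg_pos lgm_pos by (rule mult_le_mono)
  then show "52 \<le> hc" unfolding hc_def by simp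
qed (simp add: hc_def)

text \<open>\<open>rho\<close> exists by minimality of \<open>L0\<close>: the prefix shorter by one
  still has a period of at most \<open>4 * hc\<close>.\<close>

lemma L0: "1 \<le> L0" "L0 \<le> m" "L0 < m \<Longrightarrow> 4 * hc < per \<pi> L0"
  and rho: "1 \<le> rho" "rho < 4 * hc + 1" "perd \<pi> (L0 - 1) rho"
proof -
  note L = Least_bounded[where n=m and Q="\<lambda>l. \<forall>q<4 * hc + 1. q = 0 \<or> \<not> perd \<pi> l q", folded L0_def]
  have z: "perd \<pi> 0 1" by (simp add: perd_def)
  have hc1: "1 < 4 * hc + 1" using hc_pos by simp
  show 1: "1 \<le> L0"
  proof (rule ccontr)
    assume "\<not> 1 \<le> L0"
    then have e: "L0 = 0" by simp
    then have "0 < m" using mn by simp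
    then show False using L(2) z hc1 unfolding e by fastforce
  qed
  show "L0 \<le> m" by (rule L(1))
  show "4 * hc < per \<pi> L0" if "L0 < m"
  proof (rule ccontr)
    assume "\<not> 4 * hc < per \<pi> L0"
    then have "per \<pi> L0 < 4 * hc + 1" by simp
    then show False using L(2)[OF that] per[of \<pi> L0] by force
  qed
  have "\<exists>q<4 * hc + 1. q \<noteq> 0 \<and> perd \<pi> (L0 - 1) q" using L(3)[of "L0 - 1"] 1 by auto
  then obtain q where q: "q < 4 * hc + 1" "q \<noteq> 0 \<and> perd \<pi> (L0 - 1) q" by blast
  note R = Least_bounded[where n="4 * hc + 1" and Q="\<lambda>q. q \<noteq> 0 \<and> perd \<pi> (L0 - 1) q", folded rho_def]
  have "\<not> q < rho" using R(3) q by blast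
  then show "rho < 4 * hc + 1" using q by linarith
  then show "1 \<le> rho" "perd \<pi> (L0 - 1) rho" using R(2) by auto
qed

lemma E: "L0 \<le> E" "E \<le> m" "E + lam = m" "lam \<le> 2 * hc" "lam \<le> m" "E = L0 \<or> L0 < m \<and> lam = 2 * hc"
  using L0(2) hc_pos unfolding E_def lam_def by (auto split: if_splits)

lemma lev: "L0 < m \<Longrightarrow> levels \<pi> (2 * hc) L0"
  using L0 \<pi>_le by unfold_locales auto

lemma Lv_reach: "Lv hc = E" "L0 \<le> Lv g" "Lv g \<le> E"
proof -
  have "Lv hc = E \<and> L0 \<le> Lv g \<and> Lv g \<le> E"
  proof (cases "E = L0")
    case True
    have "Lv g = L0" for g by (induction g) (simp_all add: Lv_def nxt_def True)
    then show ?thesis using True by simp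
  next
    case False
    then have L: "L0 < m" using E(6) by simp
    interpret lv: levels \<pi> E "2 * hc" L0 by (rule lev[OF L])
    have mono: "L0 \<le> Lv g \<and> Lv g \<le> E" for g
    proof (induction g)
      case (Suc g)
      have "Lv (Suc g) = nxt \<pi> E (2 * hc) (Lv g)" by (simp add: Lv_def)
      then show ?case using lv.nx_le_E[of "Lv g"] lv.nx_ge[of "Lv g"] Suc by simp
    qed (use E in \<open>simp add: Lv_def\<close>)
    let ?l = "lgm m"
    let ?z = "lv.Z L0"
    have "(8::nat) ^ (6 * ?l) * 2 ^ ?l \<le> 9 ^ (6 * ?l)"
    proof -
      \<comment> \<open>Six factors 9/8 exceed 2: \<open>8 ^ 6 * 2 = 524288\<close> and
        \<open>9 ^ 6 = 531441\<close>.\<close>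
      have "((8::nat) ^ 6 * 2) ^ ?l \<le> (9 ^ 6) ^ ?l" by (rule power_mono) simp_all
      then show ?thesis by (simp only: power_mult power_mult_distrib)
    qed
    moreover have "(8::nat) ^ (6 * ?l) * E < 8 ^ (6 * ?l) * 2 ^ ?l" using lgm(1) E(2) by simp
    ultimately have "(8::nat) ^ (6 * ?l) * E < 9 ^ (6 * ?l)" by linarith
    from lv.steps_bound[OF le_refl E(1) this]
    have s: "(nxt \<pi> E (2 * hc) ^^ ((4 * (6 * ?l) + 2) * Suc ?z)) L0 = E" .
    have "?z \<le> card {j. j < length P \<and> pd P j = 0}"
      unfolding lv.Z_def using E(2) lenP by (intro card_mono) (auto simp: \<pi>_def)
    also have "\<dots> \<le> card (set P)" by (rule card_pd_zeros)
    also have "\<dots> \<le> card {0..<sg}" by (rule card_mono) (use setP in auto)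
    finally have z: "Suc ?z \<le> 2 * sg" using sg_pos by simp
    have "(4 * (6 * ?l) + 2) * Suc ?z \<le> (26 * ?l) * (2 * sg)" using z lgm_pos by (intro mult_le_mono) auto
    then have "(4 * (6 * ?l) + 2) * Suc ?z \<le> hc" using hc_pos(2) by (simp add: mult_ac)
    from lv.nx_pow_mono[OF le_refl this] s have "E \<le> Lv hc" by (simp add: Lv_def)
    then show ?thesis using mono le_antisym by blast
  qed
  then show "Lv hc = E" "L0 \<le> Lv g" "Lv g \<le> E" by auto
qed

lemma hl: "hl \<le> hc" "Lv hl = E" "g < hl \<Longrightarrow> Lv g < E"
proof -
  note H = Least_bounded[where n=hc and Q="\<lambda>v. Lv v = E", folded hl_def]
  show "hl \<le> hc" by (rule H(1))
  then show "Lv hl = E" using H(2) Lv_reach(1) by (cases "hl < hc") auto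
  show "Lv g < E" if "g < hl" using H(3)[OF that] Lv_reach(3)[of g] by linarith
qed

definition JQ :: nat where "JQ = AK * C + AK"

lemma C_le: "C + m + n + 20 \<le> X" "1 \<le> C"
  using big unfolding C_def hc_def by auto

lemma pp_sq: "4 * pp * pp < 2 ^ w"
proof -
  have "pp \<le> 3 * (X * X)" using pp(3) X_bounds(1,6) by linarith
  then have "pp * pp \<le> (3 * (X * X)) * (3 * (X * X))" by (intro mult_le_mono)
  also have "(3 * (X * X)) * (3 * (X * X)) = 9 * X ^ 4" by (simp add: power4_eq_xxxx mult_ac)
  finally have "4 * (pp * pp) \<le> 36 * X ^ 4" by simp
  moreover have "36 * X ^ 4 < 4096 * X ^ 4" using X_bounds(6) by simp
  ultimately show ?thesis using X_bounds(5) by (simp only: mult.assoc mult.commute[of "X ^ 4"])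
qed

lemma text_stream: "length T = n \<Longrightarrow> set T \<subseteq> {0..<sg} \<Longrightarrow> r < pp \<Longrightarrow> text_stream T n m sg w JQ pp r C"
proof
  have "sg \<le> hc" using hc_pos(2) lgm_pos by (metis dual_order.trans mult.commute mult_le_mono2 nat_mult_1_right one_le_numeral mult_le_mono)
  then show "sg \<le> C" by (simp add: C_def)
  show "fits w JQ" using ixJ[of "C + 1" 0] C_le fitJ by (simp add: JQ_def fits_def J_def AK_def)
qed (use pp C_le pp_sq in \<open>auto simp: JQ_def\<close>)

lemma level_stream:
  assumes T: "length T = n" "set T \<subseteq> {0..<sg}" and r: "r < pp"
    and good1: "\<And>x L l. x + l \<le> n \<Longrightarrow> L + l \<le> m \<Longrightarrow>
       hh r (\<lambda>j. pd T (x + j)) l mod pp = hh r (\<lambda>j. \<pi> (L + j)) l mod pp \<Longrightarrow> \<forall>j<l. pd T (x + j) = \<pi> (L + j)"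
    and good2: "\<And>e L l. e \<le> n \<Longrightarrow> l \<le> L \<Longrightarrow> L \<le> m \<Longrightarrow> L \<le> e \<Longrightarrow>
       hh r (wv (pd T) L l e) l mod pp = hh r (\<lambda>j. \<pi> (L - l + j)) l mod pp \<Longrightarrow>
       \<forall>j<l. wv (pd T) L l e j = \<pi> (L - l + j)"
  shows "level_stream T P n m sg w JQ pp r C rho L0 l0 lam lw hl Lv lnf (Aaf r) (Bbf r) kdf"
proof -
  interpret ts: text_stream T P n m sg w JQ pp r C by (rule text_stream[OF T r])
  have e: "ts.\<pi> = \<pi>" "ts.\<tau> = pd T" by (simp_all add: ts.\<pi>_def \<pi>_def ts.\<tau>_def)
  have big_per: "4 * hc < per \<pi> (Lv g)" if "g < hl" for g
  proof -
    have "L0 < m" using hl(3)[OF that] Lv_reach(2)[of g] E(2) by linarith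
    then show ?thesis using L0(3) per_mono[OF Lv_reach(2)[of g], of \<pi>] by linarith
  qed
  have Ls: "Lv (Suc g) = (if \<pi> (Lv g) = 0 then Suc (Lv g) else if nt \<pi> E (Lv g) > 0
      then Lv g + nt \<pi> E (Lv g) * per \<pi> (Lv g) else hs \<pi> E (2 * hc) (Lv g))" if "g < hl" for g
    using hl(3)[OF that] by (simp add: Lv_def nxt_def)
  show ?thesis
  proof
    show "1 \<le> m" "m \<le> n" "length P = m" by (rule mn lenP)+
    show "1 \<le> rho" "rho < C" "1 \<le> L0" "L0 \<le> m" "perd ts.\<pi> (L0 - 1) rho" "l0 = min (rho + 1) L0"
      using rho L0 by (auto simp: C_def l0_def e)
    show "l0 < C" using rho by (simp add: C_def l0_def min_less_iff_disj)
    show "1 \<le> lw" "lw \<le> m" "lw < C" "lam \<le> lw" "lam < C" using E mn hc_pos by (auto simp: lw_def C_def)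
    show "Lv 0 = L0" by (simp add: Lv_def)
    show "Lv hl + lam = m" using hl(2) E(3) by simp
    show "L0 \<le> Lv g \<and> Lv g \<le> m" for g using Lv_reach(2,3)[of g] E(2) by simp
    show "hl < C" "2 * hl \<le> C" using hl(1) by (auto simp: C_def)
    show "2 * hl \<le> lam"
    proof (cases "E = L0")
      case True
      have "\<not> 0 < hl" using hl(3)[of 0] True by (auto simp: Lv_def)
      then show ?thesis by simp
    qed (use E(6) hl(1) in simp)
    show "lam < per ts.\<pi> (Lv hl)"
    proof (cases "L0 < m")
      case True
      then show ?thesis unfolding e using L0(3) per_mono[OF Lv_reach(2)[of hl], of \<pi>] E(4) hc_pos by linarith
    next
      case False
      then have "lam = 0" using E by auto
      then show ?thesis using per(1)[of \<pi> "Lv hl"] by (simp add: e)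
    qed
    show "kdf g < 3" for g by (simp add: kdf_def)
    fix g assume g: "g < hl"
    have hsp: "Lv g < hs \<pi> E (2 * hc) (Lv g)" "nz \<pi> (Lv g) (hs \<pi> E (2 * hc) (Lv g))"
      "hs \<pi> E (2 * hc) (Lv g) + 2 * hc \<le> Lv g + per \<pi> (Lv g) \<or> hs \<pi> E (2 * hc) (Lv g) = Suc (Lv g)" if "\<pi> (Lv g) \<noteq> 0"
    proof -
      have "2 * hc < per \<pi> (Lv g)" using big_per[OF g] by simp
      note H = hs_props[OF hl(3)[OF g] this that]
      show "Lv g < hs \<pi> E (2 * hc) (Lv g)" "nz \<pi> (Lv g) (hs \<pi> E (2 * hc) (Lv g))"
        "hs \<pi> E (2 * hc) (Lv g) + 2 * hc \<le> Lv g + per \<pi> (Lv g) \<or> hs \<pi> E (2 * hc) (Lv g) = Suc (Lv g)" by (rule H(1,3,4))+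
    qed
    show "2 * hl + lnf g \<le> per ts.\<pi> (Lv g)"
      using hsp big_per[OF g] hl(1) hc_pos unfolding e by (auto simp: lnf_def)
    show "kdf g = 0 \<Longrightarrow> lnf g = 0 \<and> Aaf r g = per ts.\<pi> (Lv g) \<and>
       (\<exists>t. Bbf r g = t * per ts.\<pi> (Lv g) \<and> Lv (Suc g) = Lv g + t * per ts.\<pi> (Lv g) \<and>
         perd ts.\<pi> (Lv (Suc g)) (per ts.\<pi> (Lv g)) \<and> nz ts.\<pi> (Lv g - per ts.\<pi> (Lv g)) (Lv g))"
    proof -
      assume k: "kdf g = 0"
      then have k: "\<pi> (Lv g) \<noteq> 0" "0 < nt \<pi> E (Lv g)" by (auto simp: kdf_def split: if_splits)
      have R: "runs \<pi> E (Lv g) (per \<pi> (Lv g)) (nt \<pi> E (Lv g))" by (rule nt_runs) (rule k)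
      then have "nz \<pi> (Lv g - per \<pi> (Lv g)) (Lv g)" by (auto simp: runs_def intro: nz_mono)
      then show ?thesis using R k Ls[OF g] unfolding e runs_def lnf_def Aaf_def Bbf_def by auto
    qed
    show "kdf g = 1 \<Longrightarrow> lnf g = 1 \<and> Aaf r g = Lv g \<and> Lv (Suc g) = Suc (Lv g) \<and> ts.\<pi> (Lv g) = 0"
      using Ls[OF g] unfolding e kdf_def lnf_def Aaf_def by (auto split: if_splits)
    show "kdf g = 2 \<Longrightarrow> 1 \<le> lnf g \<and> Lv (Suc g) = Lv g + lnf g \<and> nz ts.\<pi> (Lv g) (Lv (Suc g)) \<and>
       Aaf r g = r ^ lnf g mod pp \<and> Bbf r g = hh r (\<lambda>j. ts.\<pi> (Lv g + j)) (lnf g) mod pp"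
      using Ls[OF g] hsp unfolding e kdf_def lnf_def Aaf_def Bbf_def by (auto split: if_splits)
  qed (use good1 good2 in \<open>simp_all only: e\<close>)
qed

definition fin :: "nat \<Rightarrow> st \<Rightarrow> bool" where
  "fin r s \<longleftrightarrow> fst s rP = pp \<and> fst s rR = r \<and> fst s rC = C \<and> fst s rRho = rho \<and> fst s rL0 = L0 \<and>
     fst s rW0 = l0 \<and> fst s rT0 = hh r (\<lambda>j. \<pi> (L0 - l0 + j)) l0 mod pp \<and> fst s rD = lam \<and> fst s rW1 = lw \<and>
     fst s rM = m \<and> fst s rT1 = hh r (\<lambda>j. \<pi> (m - lw + j)) lw mod pp \<and> fst s rNh = hl \<and>
     (\<forall>d<C. arr s aPw d = r ^ d mod pp) \<and>
     (\<forall>g<hl. arr s aLen g = lnf g \<and> arr s aA g = Aaf r g \<and> arr s aB g = Bbf r g \<and> arr s aKd g = kdf g) \<and>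
     (\<forall>j<C. arr s aLast j = 0 \<and> arr s aPend j = 0 \<and> arr s aLx j = 0) \<and>
     (\<forall>z\<in>{rI, rF, rA, rH0, rH1, rK}. fst s z = 0) \<and> fst s rG = hl"

lemma stream_fin:
  assumes "level_stream T P n m sg w JQ pp r C rho L0 l0 lam lw hl Lv lnf (Aaf r) (Bbf r) kdf" "fin r s"
    and M: "sim w JQ s M"
  shows "stream w progQ (length progQ) T M = return_pmf (map (\<lambda>i. Some (em \<pi> (pd T) m (Suc i))) [0..<n])"
proof -
  interpret ls: level_stream T P n m sg w JQ pp r C rho L0 l0 lam lw hl Lv lnf "Aaf r" "Bbf r" kdf by (rule assms(1))
  have e: "ls.\<pi> = \<pi>" by (simp add: ls.\<pi>_def \<pi>_def)
  have c: "ls.cnst s" using assms(2) unfolding ls.cnst_def fin_def e by simp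
  \<comment> \<open>Before the first symbol all window entries read as 0, so 0 is the right initial
    fingerprint.\<close>
  have wz: "hh r (wv ls.\<tau> L l 0) l = 0" for L l
  proof -
    have "hh r (wv ls.\<tau> L l 0) l = hh r (\<lambda>_. 0) l" by (rule hh_cong) (simp add: wv_def)
    also have "hh r (\<lambda>_. 0) l = 0" by (induction l) auto
    finally show ?thesis .
  qed
  have z: "arr s aLast j = 0" "arr s aPend j = 0" "arr s aLx j = 0" if "j < C" for j using assms(2) that by (auto simp: fin_def)
  have rg: "fst s rI = 0" "fst s rF = 0" "fst s rA = 0" "fst s rH0 = 0" "fst s rH1 = 0" "fst s rK = 0" "fst s rG = hl"
    using assms(2) by (auto simp: fin_def)
  have sgC: "sg \<le> C" by (rule ls.sgC)
  have "ls.last_ok 0 (arr s aLast)" unfolding ls.last_ok_def using z(1) sgC by simp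
  moreover have "ls.lev_ok 0 hl 0 s" unfolding ls.lev_ok_def ls.pf_ok_def
    using z ls.hC by (intro conjI ls.sw.pend_init ls.sw.runs_init) auto
  moreover have "ls.run_start rho 0 0" unfolding ls.run_start_def runok_def by auto
  ultimately have i: "ls.inv 0 s"
    unfolding ls.inv_def rg wz ls.ring_tr_def ls.ring_fr_def ls.sched_def ls.pos_ok_def using c by simp
  have "sg \<le> X" using sgC C_le by linarith
  then have "sg \<le> 2 ^ w" using lin_small[of sg] by simp
  from ls.stream_correct[OF _ i M this] show ?thesis unfolding e by (simp add: ls.\<tau>_def)
qed

end

section \<open>The second phase of the preprocessing: tables and levels\<close>

definition PERD :: "exp \<Rightarrow> nat \<Rightarrow> exp" where
  "PERD l x = FA b4 (Sb l (V x)) (Ne (Arr aPd (V b4))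
     (Ite (Lt (V b4) (Arr aPd (Plus (V b4) (V x)))) (N 0) (Arr aPd (Plus (V b4) (V x)))))"

definition NZ :: "exp \<Rightarrow> exp \<Rightarrow> exp" where
  "NZ a b = FA b4 b (An (Nt (Lt (V b4) a)) (Nt (Arr aPd (V b4))))"

definition RUNS :: exp where
  "RUNS = An (Nt (Lt (V qE) (Plus (V qL) (Times (Plus (V b1) (N 1)) (V qq)))))
     (An (PERD (Plus (V qL) (Times (Plus (V b1) (N 1)) (V qq))) qq)
         (NZ (Sb (V qL) (V qq)) (Plus (V qL) (Times (Plus (V b1) (N 1)) (V qq)))))"

text \<open>The prefix fingerprint up to \<open>a + l\<close> minus the shifted one up to
  \<open>a\<close>. During the preprocessing \<open>aFr\<close> is a plain table over the pattern;
  the streaming program reuses the array as a ring over the text.\<close>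

definition SEG :: "exp \<Rightarrow> exp \<Rightarrow> exp" where
  "SEG a l = Modu (Plus (Arr aFr (Plus a l)) (Sb (V rP) (Modu (Times (Arr aFr a) (Arr aPw l)) (V rP)))) (V rP)"

definition tab :: "nat \<Rightarrow> exp \<Rightarrow> exp \<Rightarrow> com" where
  "tab k b v = For qj qb b (StA k (V qj) v)"

definition rPw :: com where
  "rPw = tab aPw (Plus (Plus (V rM) (V rC)) (N 1))
     (Ite (V qj) (Modu (Times (Arr aPw (Sb (V qj) (N 1))) (V rR)) (V rP)) (N 1))"

definition rFr :: com where
  "rFr = tab aFr (Plus (V rM) (N 1))
     (Ite (V qj) (Modu (Plus (Times (Arr aFr (Sb (V qj) (N 1))) (V rR)) (Arr aPd (Sb (V qj) (N 1)))) (V rP)) (N 0))"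

text \<open>Arrays whose initial contents are interpreted must be cleared. Rings and calendars may
  start with leftovers: a ring entry is read only after it has been written, and a calendar entry is
  checked before use.\<close>

definition rZero :: com where
  "rZero = Sq (tab aLast (V rC) (N 0)) (Sq (tab aPend (V rC) (N 0)) (tab aLx (V rC) (N 0)))"

definition rBase :: com where
  "rBase = Sq (Asg rL0 (Lst b1 (V rM) (FA b2 (Plus (V qdl) (N 1)) (An (V b2) (PERD (V b1) b2)))))
    (Sq (Asg rRho (Lst b2 (Plus (V qdl) (N 1)) (An (V b2) (PERD (Sb (V rL0) (N 1)) b2))))
    (Sq (Asg rW0 (Ite (Lt (Plus (V rRho) (N 1)) (V rL0)) (Plus (V rRho) (N 1)) (V rL0)))
    (Sq (Asg rD (Ite (Lt (V rM) (Plus (V rL0) (Times (N 2) (V qhc)))) (Sb (V rM) (V rL0)) (Times (N 2) (V qhc))))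
    (Sq (Asg qE (Sb (V rM) (V rD)))
        (Asg rW1 (Ite (V rD) (V rD) (N 1)))))))"

definition rReg :: com where
  "rReg = Sq (Asg qL (Arr aLv (V qj)))
    (Sq (Asg qq (Lst b1 (Plus (V rM) (N 2)) (An (V b1) (PERD (V qL) b1))))
    (Sq (Asg qt (Lst b1 (V qE) (Nt RUNS)))
        (Asg ql (Lst b1 (V qE) (An (Lt (V qL) (V b1)) (Or (Nt (Arr aPd (V b1)))
           (Nt (Lt (Plus (V b1) (Times (N 2) (V qhc))) (Plus (V qL) (V qq))))))))))"

definition rSto :: com where
  "rSto = Sq (StA aLv (Plus (V qj) (N 1)) (Ite (Lt (V qL) (V qE))
      (Ite (Arr aPd (V qL)) (Ite (V qt) (Plus (V qL) (Times (V qt) (V qq))) (V ql)) (Plus (V qL) (N 1))) (V qL)))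
  (Sq (StA aKd (V qj) (Ite (Arr aPd (V qL)) (Ite (V qt) (N 0) (N 2)) (N 1)))
  (Sq (StA aLen (V qj) (Ite (Arr aPd (V qL)) (Ite (V qt) (N 0) (Sb (V ql) (V qL))) (N 1)))
  (Sq (StA aA (V qj) (Ite (Arr aPd (V qL)) (Ite (V qt) (V qq) (Arr aPw (Sb (V ql) (V qL)))) (V qL)))
      (StA aB (V qj) (Ite (Arr aPd (V qL)) (Ite (V qt) (Times (V qt) (V qq)) (SEG (V qL) (Sb (V ql) (V qL)))) (N 0))))))"

definition rLev :: com where
  "rLev = Sq (StA aLv (N 0) (V rL0)) (For qj qb (V qhc) (Sq rReg rSto))"

definition rEnd :: com where
  "rEnd = Sq (Asg rNh (Lst b1 (V qhc) (Eqq (Arr aLv (V b1)) (V qE))))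
    (Sq (Asg rT0 (SEG (Sb (V rL0) (V rW0)) (V rW0)))
    (Sq (Asg rT1 (SEG (Sb (V rM) (V rW1)) (V rW1)))
    (Sq (Asg rI (N 0)) (Sq (Asg rF (N 0)) (Sq (Asg rA (N 0)) (Sq (Asg rH0 (N 0))
    (Sq (Asg rH1 (N 0)) (Sq (Asg rK (N 0)) (Asg rG (V rNh))))))))))"

definition rSecond :: com where
  "rSecond = Sq (Asg rR (Modu (V qr) (V rP))) (Sq rPw (Sq rFr (Sq rZero (Sq rBase (Sq rLev rEnd)))))"

lemma rSecond_wf: "cwf rSecond"
  by (simp add: rSecond_def rPw_def rFr_def rZero_def rBase_def rLev_def rReg_def rSto_def rEnd_def
    tab_def SEG_def RUNS_def NZ_def PERD_def FA_def
    Arr_def StA_def Ne_def Eqq_def An_def Nt_def Or_def TD_def NR_def)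

context pattern_prep
begin

definition pdok :: "st \<Rightarrow> bool" where
  "pdok s \<longleftrightarrow> fst s rM = m \<and> (\<forall>k<m. arr s aPd k = \<pi> k)"

lemma pdok_setr [simp]: "x \<noteq> rM \<Longrightarrow> pdok (setr x v s) \<longleftrightarrow> pdok s"
  by (simp add: pdok_def)

lemma pdokD: "pdok s \<Longrightarrow> k < m \<Longrightarrow> arr s aPd k = \<pi> k"
  by (simp add: pdok_def)

lemma ixm: "j \<le> m + C \<Longrightarrow> k < AK \<Longrightarrow> AK * j + k < J"
  by (rule ixJ) (use C_le in auto)

lemma small_idx: "x \<le> 3 * X \<Longrightarrow> x < 2 ^ w" "x \<le> 100 \<Longrightarrow> x < 2 ^ w"
  using big(2) by (auto intro!: lin_small)

lemma PERD:
  assumes pd: "pdok s" and l: "ev l s = lv" "lv \<le> m" "ok w J l s" and x: "x \<noteq> b4"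
  shows "ev (PERD l x) s = (if perd \<pi> lv (fst s x) then 1 else 0)" "ok w J (PERD l x) s"
proof -
  let ?e = "Ne (Arr aPd (V b4)) (Ite (Lt (V b4) (Arr aPd (Plus (V b4) (V x)))) (N 0) (Arr aPd (Plus (V b4) (V x))))"
  have P: "arr s aPd j = \<pi> j" "arr s aPd (j + fst s x) = \<pi> (j + fst s x)"
    "AK * j + aPd < J" "AK * (j + fst s x) + aPd < J" "j + fst s x < 2 ^ w" if "j < lv - fst s x" for j
    using that l(2) C_le ixm[of j aPd] ixm[of "j + fst s x" aPd]
    by (auto intro!: pdokD[OF pd] small_idx(1) simp: AK_def)
  have e: "ev ?e (setr b4 j s) = 0 \<longleftrightarrow> \<pi> j = tr j (\<pi> (j + fst s x))" if "j < lv - fst s x" for j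
    using P[OF that] x by (simp add: tr_def)
  have o: "ok w J ?e (setr b4 j s)" if "j < lv - fst s x" for j
    using P[OF that] x fitJ by (simp add: AK_def)
  show "ev (PERD l x) s = (if perd \<pi> lv (fst s x) then 1 else 0)"
    unfolding PERD_def perd_def by (rule ev_FA) (use l e in auto)
  show "ok w J (PERD l x) s"
    unfolding PERD_def by (rule ok_FA[of _ _ _ _ "lv - fst s x"]) (use l o fitJ in auto)
qed

lemma NZ:
  assumes pd: "pdok s" and b: "ev b s = bv" "bv \<le> m" "ok w J b s"
    and a: "\<And>j. ev a (setr b4 j s) = av" "\<And>j. ok w J a (setr b4 j s)"
  shows "ev (NZ a b) s = (if nz \<pi> av bv then 1 else 0)" "ok w J (NZ a b) s"
proof -
  let ?e = "An (Nt (Lt (V b4) a)) (Nt (Arr aPd (V b4)))"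
  have P: "arr s aPd j = \<pi> j" "AK * j + aPd < J" if "j < bv" for j
    using that b(2) ixm[of j aPd] by (auto intro!: pdokD[OF pd] simp: AK_def)
  have e: "ev ?e (setr b4 j s) = 0 \<longleftrightarrow> (av \<le> j \<longrightarrow> \<pi> j \<noteq> 0)" if "j < bv" for j
    using P[OF that] a by auto
  have o: "ok w J ?e (setr b4 j s)" if "j < bv" for j
    using P[OF that] a fitJ by (simp add: AK_def)
  have "ev (NZ a b) s = (if \<forall>j<bv. av \<le> j \<longrightarrow> \<pi> j \<noteq> 0 then 1 else 0)"
    unfolding NZ_def by (rule ev_FA) (use b e in auto)
  also have "(\<forall>j<bv. av \<le> j \<longrightarrow> \<pi> j \<noteq> 0) \<longleftrightarrow> nz \<pi> av bv" by (auto simp: nz_def)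
  finally show "ev (NZ a b) s = (if nz \<pi> av bv then 1 else 0)" .
  show "ok w J (NZ a b) s"
    unfolding NZ_def by (rule ok_FA[of _ _ _ _ bv]) (use b o fitJ in auto)
qed

lemma RUNS:
  assumes pd: "pdok s" and E: "fst s qE = E" and q: "fst s qq \<le> m + 1" "fst s qL \<le> m" and t: "fst s b1 < m"
  shows "ev RUNS s \<noteq> 0 \<longleftrightarrow> runs \<pi> E (fst s qL) (fst s qq) (Suc (fst s b1))" "ok w J RUNS s"
proof -
  let ?L = "fst s qL" and ?q = "fst s qq" and ?t = "fst s b1"
  let ?e = "Plus (V qL) (Times (Plus (V b1) (N 1)) (V qq))"
  have tq: "Suc ?t * ?q \<le> X * X" by (rule mult_le_mono) (use t q C_le in auto)
  have "?L + Suc ?t * ?q \<le> 200 * (X * X)" using tq q(2) C_le X_bounds(1) by linarith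
  then have sm: "Suc ?t * ?q < 2 ^ w" "?L + Suc ?t * ?q < 2 ^ w" "Suc ?t < 2 ^ w"
    using sq_small[of "Suc ?t * ?q"] sq_small small_idx(1)[of "Suc ?t"] t C_le by auto
  have ev: "ev ?e s = ?L + Suc ?t * ?q" by simp
  have oe: "ok w J ?e s" using sm small_idx(2)[of 1] by simp
  have a: "ev (Sb (V qL) (V qq)) (setr b4 j s) = ?L - ?q" "ok w J (Sb (V qL) (V qq)) (setr b4 j s)" for j by simp_all
  show "ev RUNS s \<noteq> 0 \<longleftrightarrow> runs \<pi> E ?L ?q (Suc ?t)"
  proof (cases "?L + Suc ?t * ?q \<le> E")
    case True
    then have m: "?L + Suc ?t * ?q \<le> m" using E_def by linarith
    show ?thesis
      using PERD(1)[OF pd ev m oe, of qq] NZ(1)[OF pd ev m oe a] True E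
      unfolding RUNS_def runs_def ev_An by simp
  next
    case False
    then show ?thesis using E unfolding RUNS_def runs_def ev_An by simp
  qed
  show "ok w J RUNS s"
  proof (cases "?L + Suc ?t * ?q \<le> E")
    case True
    then have m: "?L + Suc ?t * ?q \<le> m" using E_def by linarith
    show ?thesis
      using PERD(2)[OF pd ev m oe, of qq] NZ(2)[OF pd ev m oe a] oe fitJ unfolding RUNS_def by simp
  next
    case False
    then show ?thesis using oe fitJ E unfolding RUNS_def by simp
  qed
qed

definition tabs :: "nat \<Rightarrow> st \<Rightarrow> bool" where
  "tabs r s \<longleftrightarrow> fst s rP = pp \<and> (\<forall>j\<le>m. arr s aFr j = hh r \<pi> j mod pp) \<and> (\<forall>d\<le>m + C. arr s aPw d = r ^ d mod pp)"

lemma pp_lt: "x \<le> 4 * (pp * pp) \<Longrightarrow> x < 2 ^ w" "x \<le> 4 * pp \<Longrightarrow> x < 2 ^ w" "0 < pp"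
proof -
  show "x \<le> 4 * (pp * pp) \<Longrightarrow> x < 2 ^ w" using pp_sq by (simp add: mult.assoc)
  moreover have "4 * pp \<le> 4 * (pp * pp)" by simp
  ultimately show "x \<le> 4 * pp \<Longrightarrow> x < 2 ^ w" by linarith
  show "0 < pp" using pp(2) by simp
qed

lemma SEG:
  assumes t: "tabs r s" and a: "ev a s = av" "ok w J a s" and l: "ev l s = lv" "ok w J l s" and m: "av + lv \<le> m"
  shows "ev (SEG a l) s = hh r (\<lambda>j. \<pi> (av + j)) lv mod pp" "ok w J (SEG a l) s"
proof -
  have f: "fst s rP = pp" "arr s aFr (av + lv) = hh r \<pi> (av + lv) mod pp" "arr s aFr av = hh r \<pi> av mod pp"
    "arr s aPw lv = r ^ lv mod pp" using t m by (auto simp: tabs_def)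
  let ?A = "hh r \<pi> av * r ^ lv" and ?X = "hh r (\<lambda>j. \<pi> (av + j)) lv"
  have z: "(hh r \<pi> av mod pp) * (r ^ lv mod pp) mod pp = ?A mod pp" by (rule mod_mult_eq)
  have "ev (SEG a l) s = ((?A + ?X) mod pp + (pp - ?A mod pp)) mod pp"
    unfolding SEG_def using a l f z hh_split[of r \<pi> av lv] by simp
  also have "\<dots> = (?A + ?X + (pp - ?A mod pp)) mod pp" by (rule mod_add_left_eq)
  also have "?A + ?X + (pp - ?A mod pp) = ?X + pp * (?A div pp + 1)"
  proof -
    have "?A mod pp \<le> pp" using pp_lt(3) by (simp add: less_imp_le)
    moreover have "?A = pp * (?A div pp) + ?A mod pp" by simp
    ultimately show ?thesis by (simp only: distrib_left mult_1_right)
  qed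
  also have "(?X + pp * (?A div pp + 1)) mod pp = ?X mod pp" by (rule mod_mult_self2)
  finally show "ev (SEG a l) s = ?X mod pp" .
  have b: "hh r \<pi> av mod pp < pp" "r ^ lv mod pp < pp" "hh r \<pi> (av + lv) mod pp < pp" using pp_lt(3) by simp_all
  then have "(hh r \<pi> av mod pp) * (r ^ lv mod pp) \<le> pp * pp" by (intro mult_le_mono) auto
  then have o1: "(hh r \<pi> av mod pp) * (r ^ lv mod pp) < 2 ^ w" by (intro pp_lt(1)) linarith
  have o2: "x mod pp < 2 ^ w" for x using pp_lt(2)[of "x mod pp"] pp_lt(3) mod_less_divisor[of pp x] by linarith
  have o3: "hh r \<pi> (av + lv) mod pp + (pp - y) < 2 ^ w" for y using b(3) by (intro pp_lt(2)) linarith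
  have o4: "av + lv < 2 ^ w" using m C_le by (intro small_idx(1)) linarith
  have ix: "AK * (av + lv) + aFr < J" "AK * av + aFr < J" "AK * lv + aPw < J"
    using m ixm[of "av + lv" aFr] ixm[of av aFr] ixm[of lv aPw] by (auto simp: AK_def)
  show "ok w J (SEG a l) s"
    unfolding SEG_def using a l f o1 o2 o3 o4 ix fitJ by simp
qed

text \<open>The value at \<open>j\<close> may use the entries before it, which covers recursively
  filled tables such as those of powers and prefix fingerprints.\<close>

lemma tab:
  assumes k: "k < AK" and b: "ev b s = M" "ok w J b s" and ix: "\<And>j. j < M \<Longrightarrow> AK * j + k < J"
    and val: "\<And>j s'. j < M \<Longrightarrow> same {qj, qb} {k} s s' \<Longrightarrow> (\<And>i. i < j \<Longrightarrow> arr s' k i = f i) \<Longrightarrow> fst s' qj = j \<Longrightarrow>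
      ev v s' = f j \<and> ok w J v s'"
  shows "cok w J (tab k b v) s" "\<forall>i<M. arr (cex (tab k b v) s) k i = f i"
    "same {qj, qb} {k} s (cex (tab k b v) s)"
proof -
  define I where "I = (\<lambda>j s'. same {qj, qb} {k} s s' \<and> (\<forall>i<j. arr s' k i = f i))"
  have step: "cok w J (StA k (V qj) v) (setr qj j s') \<and> I (Suc j) (cex (StA k (V qj) v) (setr qj j s'))"
    if j: "j < M" and I: "I j s'" for j s'
  proof -
    have s: "same {qj, qb} {k} s (setr qj j s')" using I by (auto simp: I_def same_def)
    have V: "ev v (setr qj j s') = f j" "ok w J v (setr qj j s')"
      using val[OF j s] I by (auto simp: I_def)
    have "same {qj, qb} {k} s (seta k j (f j) (setr qj j s'))"
      using s k by (auto simp: same_def arr_seta_other)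
    moreover have "\<forall>i<Suc j. arr (seta k j (f j) (setr qj j s')) k i = f i"
      using I k by (auto simp: I_def less_Suc_eq)
    ultimately show ?thesis using V ix[OF j] fitJ by (simp add: I_def)
  qed
  note F = For_rule[of b s M w J I qb "StA k (V qj) v" qj, OF b(1,2) _ step]
  have i0: "I 0 (setr qb M s)" by (auto simp: I_def same_def)
  show "cok w J (tab k b v) s" unfolding tab_def by (rule F(1)[OF i0])
  obtain s' where s': "I M s'" "cex (tab k b v) s = setr qj M s'" using F(2)[OF i0] unfolding tab_def by blast
  show "\<forall>i<M. arr (cex (tab k b v) s) k i = f i" using s' by (simp add: I_def)
  show "same {qj, qb} {k} s (cex (tab k b v) s)" by (rule same_cex) (use k in \<open>auto simp: tab_def\<close>)
qed

lemma rPw: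
  assumes s: "fst s rM = m" "fst s rC = C" "fst s rP = pp" "fst s rR = r" and r: "r < pp"
  shows "cok w J rPw s" "\<forall>d\<le>m + C. arr (cex rPw s) aPw d = r ^ d mod pp" "same {qj, qb} {aPw} s (cex rPw s)"
proof -
  let ?b = "Plus (Plus (V rM) (V rC)) (N 1)"
  let ?v = "Ite (V qj) (Modu (Times (Arr aPw (Sb (V qj) (N 1))) (V rR)) (V rP)) (N 1)"
  have sm: "m + C < 2 ^ w" "m + C + 1 < 2 ^ w" "(1::nat) < 2 ^ w" using C_le small_idx by auto
  have b: "ev ?b s = m + C + 1" "ok w J ?b s" using s sm by simp_all
  have ix: "AK * j + aPw < J" if "j < m + C + 1" for j using that by (intro ixm) (auto simp: AK_def)
  have val: "ev ?v s' = j' \<and> ok w J ?v s'"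
    if j: "j < m + C + 1" and s': "same {qj, qb} {aPw} s s'" and IH: "\<And>i. i < j \<Longrightarrow> arr s' aPw i = r ^ i mod pp"
      and q: "fst s' qj = j" and j': "j' = r ^ j mod pp" for j j' s'
  proof -
    have rg: "fst s' rP = pp" "fst s' rR = r" using s' s by (auto simp: same_def)
    show ?thesis
    proof (cases j)
      case 0
      then show ?thesis using q j' pp(2) sm big(2) by simp
    next
      case (Suc i)
      have I: "arr s' aPw i = r ^ i mod pp" by (rule IH) (use Suc in simp)
      have e: "(r ^ i mod pp) * r mod pp = r ^ j mod pp" unfolding Suc power_Suc2 by (rule mod_mult_left_eq)
      have "(r ^ i mod pp) * r \<le> pp * pp" by (rule mult_le_mono) (use pp_lt(3) r in \<open>auto intro: less_imp_le\<close>)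
      then have o: "(r ^ i mod pp) * r < 2 ^ w" by (intro pp_lt(1)) linarith
      then have o': "(r ^ i mod pp) * r mod pp < 2 ^ w" by (rule le_less_trans[OF mod_less_eq_dividend])
      have "AK * i + aPw < J" using ix j Suc by simp
      then show ?thesis using q Suc rg I e j' o o' sm fitJ by simp
    qed
  qed
  have k: "aPw < AK" by (simp add: AK_def)
  note T = tab[of aPw ?b s "m + C + 1" "\<lambda>d. r ^ d mod pp" ?v, OF k b ix val[OF _ _ _ _ refl]]
  show "cok w J rPw s" unfolding rPw_def by (rule T(1))
  show "same {qj, qb} {aPw} s (cex rPw s)" unfolding rPw_def by (rule T(3))
  have B: "\<forall>d<m + C + 1. arr (cex rPw s) aPw d = r ^ d mod pp" unfolding rPw_def by (rule T(2))
  show "\<forall>d\<le>m + C. arr (cex rPw s) aPw d = r ^ d mod pp"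
  proof (intro allI impI)
    fix d assume "d \<le> m + C"
    then have "d < m + C + 1" by simp
    then show "arr (cex rPw s) aPw d = r ^ d mod pp" using B by blast
  qed
qed

lemma rFr:
  assumes s: "pdok s" "fst s rP = pp" "fst s rR = r" and r: "r < pp"
  shows "cok w J rFr s" "\<forall>j\<le>m. arr (cex rFr s) aFr j = hh r \<pi> j mod pp" "same {qj, qb} {aFr} s (cex rFr s)"
proof -
  let ?b = "Plus (V rM) (N 1)"
  let ?v = "Ite (V qj) (Modu (Plus (Times (Arr aFr (Sb (V qj) (N 1))) (V rR)) (Arr aPd (Sb (V qj) (N 1)))) (V rP)) (N 0)"
  have sm: "m + 1 < 2 ^ w" "(1::nat) < 2 ^ w" "(0::nat) < 2 ^ w" using C_le small_idx by auto
  have b: "ev ?b s = m + 1" "ok w J ?b s" using s sm by (simp_all add: pdok_def)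
  have ix: "AK * j + aFr < J" "AK * j + aPd < J" if "j < m + 1" for j using that by (intro ixm; simp add: AK_def)+
  have val: "ev ?v s' = j' \<and> ok w J ?v s'"
    if j: "j < m + 1" and s': "same {qj, qb} {aFr} s s'" and IH: "\<And>i. i < j \<Longrightarrow> arr s' aFr i = hh r \<pi> i mod pp"
      and q: "fst s' qj = j" and j': "j' = hh r \<pi> j mod pp" for j j' s'
  proof -
    have rg: "fst s' rP = pp" "fst s' rR = r" using s' s by (auto simp: same_def)
    have pd: "arr s' aPd = arr s aPd" using s' by (auto simp: same_def AK_def)
    show ?thesis
    proof (cases j)
      case 0
      then show ?thesis using q j' by simp
    next
      case (Suc i)
      have I: "arr s' aFr i = hh r \<pi> i mod pp" by (rule IH) (use Suc in simp)
      have P: "arr s' aPd i = \<pi> i" using pdokD[OF s(1), of i] pd j Suc by simp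
      have e: "((hh r \<pi> i mod pp) * r + \<pi> i) mod pp = hh r \<pi> j mod pp" unfolding Suc hh.simps
        by (metis mod_add_left_eq mod_mult_left_eq)
      have "(hh r \<pi> i mod pp) * r \<le> pp * pp" by (rule mult_le_mono) (use pp_lt(3) r in \<open>auto intro: less_imp_le\<close>)
      moreover have "\<pi> i \<le> pp" using \<pi>_le[of i] j Suc C_le pp(2) by linarith
      moreover have "pp \<le> pp * pp" by simp
      ultimately have o: "(hh r \<pi> i mod pp) * r < 2 ^ w" "(hh r \<pi> i mod pp) * r + \<pi> i < 2 ^ w" by (intro pp_lt(1); linarith)+
      have o': "((hh r \<pi> i mod pp) * r + \<pi> i) mod pp < 2 ^ w" using o(2) by (rule le_less_trans[OF mod_less_eq_dividend])
      have "AK * i + aFr < J" "AK * i + aPd < J" using ix j Suc by simp_all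
      then show ?thesis using q Suc rg I P e j' o o' sm fitJ by simp
    qed
  qed
  have k: "aFr < AK" by (simp add: AK_def)
  note T = tab[of aFr ?b s "m + 1" "\<lambda>d. hh r \<pi> d mod pp" ?v, OF k b ix(1) val[OF _ _ _ _ refl]]
  show "cok w J rFr s" unfolding rFr_def by (rule T(1))
  show "same {qj, qb} {aFr} s (cex rFr s)" unfolding rFr_def by (rule T(3))
  have B: "\<forall>d<m + 1. arr (cex rFr s) aFr d = hh r \<pi> d mod pp" unfolding rFr_def by (rule T(2))
  show "\<forall>j\<le>m. arr (cex rFr s) aFr j = hh r \<pi> j mod pp"
  proof (intro allI impI)
    fix d assume "d \<le> m"
    then have "d < m + 1" by simp
    then show "arr (cex rFr s) aFr d = hh r \<pi> d mod pp" using B by blast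
  qed
qed

lemma rZero:
  assumes s: "fst s rC = C"
  shows "cok w J rZero s" "\<forall>j<C. arr (cex rZero s) aLast j = 0 \<and> arr (cex rZero s) aPend j = 0 \<and> arr (cex rZero s) aLx j = 0"
    "same {qj, qb} {aLast, aPend, aLx} s (cex rZero s)"
proof -
  have one: "cok w J (tab k (V rC) (N 0)) s'" "\<forall>j<C. arr (cex (tab k (V rC) (N 0)) s') k j = 0"
    "same {qj, qb} {k} s' (cex (tab k (V rC) (N 0)) s')" if "k < AK" "fst s' rC = C" for k s'
    using tab[of k "V rC" s' C "\<lambda>_. 0" "N 0"] that ixm[of _ k] by auto
  define s1 where "s1 = cex (tab aLast (V rC) (N 0)) s"
  define s2 where "s2 = cex (tab aPend (V rC) (N 0)) s1"
  define s3 where "s3 = cex (tab aLx (V rC) (N 0)) s2"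
  have k: "aLast < AK" "aPend < AK" "aLx < AK" by (simp_all add: AK_def)
  note 1 = one[OF k(1) s, folded s1_def]
  have c1: "fst s1 rC = C" using 1(3) s by (simp add: same_def)
  note 2 = one[OF k(2) c1, folded s2_def]
  have c2: "fst s2 rC = C" using 2(3) c1 by (simp add: same_def)
  note 3 = one[OF k(3) c2, folded s3_def]
  have e: "cex rZero s = s3" by (simp add: rZero_def s1_def s2_def s3_def)
  show "cok w J rZero s" using 1 2 3 by (simp add: rZero_def s1_def s2_def)
  have "arr s3 aLast = arr s1 aLast" "arr s3 aPend = arr s2 aPend" using 2(3) 3(3) k by (auto simp: same_def)
  then show "\<forall>j<C. arr (cex rZero s) aLast j = 0 \<and> arr (cex rZero s) aPend j = 0 \<and> arr (cex rZero s) aLx j = 0"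
    unfolding e using 1(2) 2(2) 3(2) by auto
  show "same {qj, qb} {aLast, aPend, aLx} s (cex rZero s)"
    by (rule same_cex) (auto simp: rZero_def tab_def AK_def)
qed

end

context pattern_prep
begin

lemma rBase:
  assumes s: "pdok s" "fst s qhc = hc" "fst s qdl = 4 * hc"
  defines "s' \<equiv> cex rBase s"
  shows "cok w J rBase s" "fst s' rL0 = L0" "fst s' rRho = rho" "fst s' rW0 = l0" "fst s' rD = lam"
    "fst s' qE = E" "fst s' rW1 = lw" "same {rL0, rRho, rW0, rD, qE, rW1} {} s s'"
proof -
  define e1 where "e1 = Lst b1 (V rM) (FA b2 (Plus (V qdl) (N 1)) (An (V b2) (PERD (V b1) b2)))"
  define e2 where "e2 = Lst b2 (Plus (V qdl) (N 1)) (An (V b2) (PERD (Sb (V rL0) (N 1)) b2))"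
  have sm: "4 * hc + 1 < 2 ^ w" "(1::nat) < 2 ^ w" "(2::nat) < 2 ^ w" "(0::nat) < 2 ^ w" "rho + 1 < 2 ^ w"
    "2 * hc < 2 ^ w" "L0 + 2 * hc < 2 ^ w"
    using C_le(1) rho(2) L0(2) unfolding C_def by (intro small_idx; linarith)+
  have e1: "ev e1 z = L0" "ok w J e1 z" if z: "pdok z" "fst z qdl = 4 * hc" for z
  proof -
    have M: "fst z rM = m" using z by (simp add: pdok_def)
    have P: "ev (PERD (V b1) b2) (setr b2 q (setr b1 v z)) = (if perd \<pi> v q then 1 else 0)"
      "ok w J (PERD (V b1) b2) (setr b2 q (setr b1 v z))" if "v < m" for v q
      using PERD[of "setr b2 q (setr b1 v z)" "V b1" v b2] z that by simp_all
    have f: "ev (FA b2 (Plus (V qdl) (N 1)) (An (V b2) (PERD (V b1) b2))) (setr b1 v z) =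
       (if \<forall>q<4 * hc + 1. q = 0 \<or> \<not> perd \<pi> v q then 1 else 0)" if "v < m" for v
      by (rule ev_FA) (use z P[OF that] in auto)
    have o: "ok w J (FA b2 (Plus (V qdl) (N 1)) (An (V b2) (PERD (V b1) b2))) (setr b1 v z)" if "v < m" for v
      by (rule ok_FA[of _ _ _ _ "4 * hc + 1"]) (use z P[OF that] fitJ sm in auto)
    show "ev e1 z = L0" unfolding e1_def L0_def by (rule ev_Lst) (use M f in auto)
    show "ok w J e1 z" unfolding e1_def by (rule ok_Lst[of _ _ _ _ m]) (use M o in auto)
  qed
  have e2: "ev e2 z = rho" "ok w J e2 z" if z: "pdok z" "fst z qdl = 4 * hc" "fst z rL0 = L0" for z
  proof -
    have P: "ev (PERD (Sb (V rL0) (N 1)) b2) (setr b2 q z) = (if perd \<pi> (L0 - 1) q then 1 else 0)"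
      "ok w J (PERD (Sb (V rL0) (N 1)) b2) (setr b2 q z)" for q
      using PERD[of "setr b2 q z" "Sb (V rL0) (N 1)" "L0 - 1" b2] z L0(2) sm by simp_all
    show "ev e2 z = rho" unfolding e2_def rho_def by (rule ev_Lst) (use z P in \<open>auto simp: ev_An simp del: ev_An_pos\<close>)
    show "ok w J e2 z" unfolding e2_def by (rule ok_Lst[of _ _ _ _ "4 * hc + 1"]) (use z P fitJ sm in auto)
  qed
  have p1: "pdok (setr rL0 L0 s)" using s by simp
  have M: "fst s rM = m" using s by (simp add: pdok_def)
  note E1 = e1[OF s(1,3)]
  have E2: "ev e2 (setr rL0 L0 s) = rho" "ok w J e2 (setr rL0 L0 s)" using e2[OF p1] s by simp_all
  show "cok w J rBase s"
    unfolding rBase_def e1_def[symmetric] e2_def[symmetric] using E1 E2 s sm M by simp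
  show "fst s' rL0 = L0" "fst s' rRho = rho" "fst s' rW0 = l0" "fst s' rD = lam" "fst s' qE = E" "fst s' rW1 = lw"
    unfolding s'_def rBase_def e1_def[symmetric] e2_def[symmetric] using E1 E2 s M
    by (simp_all add: l0_def lam_def E_def lw_def min_def)
  show "same {rL0, rRho, rW0, rD, qE, rW1} {} s s'"
    unfolding s'_def by (rule same_cex) (auto simp: rBase_def)
qed

lemma per_bound: "L \<le> m \<Longrightarrow> per \<pi> L \<le> m + 1"
  using per_le[of "Suc L" \<pi> L] per_ex[of L \<pi>] by simp

lemma nt_le: "nt \<pi> E L \<le> E"
  unfolding nt_def by (rule Least_le) simp

lemma hs_le: "hs \<pi> E (2 * hc) L \<le> E"
  unfolding hs_def by (rule Least_le) simp

lemma rReg: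
  assumes s: "pdok s" "fst s qE = E" "fst s qhc = hc" "arr s aLv (fst s qj) = L" and L: "L \<le> m"
    and j: "fst s qj \<le> hc"
  defines "s' \<equiv> cex rReg s"
  shows "cok w J rReg s" "fst s' qL = L" "fst s' qq = per \<pi> L" "fst s' qt = nt \<pi> E L"
    "fst s' ql = hs \<pi> E (2 * hc) L" "same {qL, qq, qt, ql} {} s s'"
proof -
  define e1 where "e1 = Lst b1 (Plus (V rM) (N 2)) (An (V b1) (PERD (V qL) b1))"
  define e2 where "e2 = Lst b1 (V qE) (Nt RUNS)"
  define e3 where "e3 = Lst b1 (V qE) (An (Lt (V qL) (V b1)) (Or (Nt (Arr aPd (V b1)))
           (Nt (Lt (Plus (V b1) (Times (N 2) (V qhc))) (Plus (V qL) (V qq))))))"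
  have Em: "E \<le> m" using E by simp
  have sm: "m + 2 < 2 ^ w" "(2::nat) < 2 ^ w" "2 * hc < 2 ^ w" "L + per \<pi> L < 2 ^ w"
    "v \<le> m \<Longrightarrow> v + 2 * hc < 2 ^ w" for v
    using C_le(1) L per_bound[OF L] unfolding C_def by (intro small_idx; linarith)+
  have e1: "ev e1 z = per \<pi> L" "ok w J e1 z" if z: "pdok z" "fst z qL = L" for z
  proof -
    have M: "fst z rM = m" using z by (simp add: pdok_def)
    have P: "ev (PERD (V qL) b1) (setr b1 v z) = (if perd \<pi> L v then 1 else 0)"
      "ok w J (PERD (V qL) b1) (setr b1 v z)" for v
      using PERD[of "setr b1 v z" "V qL" L b1] z L by simp_all
    have "ev e1 z = (LEAST v. m + 2 \<le> v \<or> v \<noteq> 0 \<and> perd \<pi> L v)" unfolding e1_def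
      by (rule ev_Lst) (use M P in \<open>auto simp: ev_An simp del: ev_An_pos\<close>)
    also have "\<dots> = per \<pi> L"
    proof -
      \<comment> \<open>The least period is at most \<open>m + 1\<close>, so the bounded search
        finds it.\<close>
      note B = Least_bounded[where n="m + 2" and Q="\<lambda>v. v \<noteq> 0 \<and> perd \<pi> L v"]
      have "per \<pi> L \<noteq> 0 \<and> perd \<pi> L (per \<pi> L)" using per[of \<pi> L] by simp
      then have "\<not> per \<pi> L < (LEAST v. m + 2 \<le> v \<or> v \<noteq> 0 \<and> perd \<pi> L v)" using B(3) by blast
      then have le: "(LEAST v. m + 2 \<le> v \<or> v \<noteq> 0 \<and> perd \<pi> L v) \<le> per \<pi> L" by simp
      then have "(LEAST v. m + 2 \<le> v \<or> v \<noteq> 0 \<and> perd \<pi> L v) < m + 2" using per_bound[OF L] by linarith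
      from B(2)[OF this] have "per \<pi> L \<le> (LEAST v. m + 2 \<le> v \<or> v \<noteq> 0 \<and> perd \<pi> L v)" by (intro per_le) simp_all
      then show ?thesis using le by simp
    qed
    finally show "ev e1 z = per \<pi> L" .
    show "ok w J e1 z" unfolding e1_def by (rule ok_Lst[of _ _ _ _ "m + 2"]) (use M P fitJ sm in auto)
  qed
  have e2: "ev e2 z = nt \<pi> E L" "ok w J e2 z" if z: "pdok z" "fst z qL = L" "fst z qq = per \<pi> L" "fst z qE = E" for z
  proof -
    have R: "ev RUNS (setr b1 v z) \<noteq> 0 \<longleftrightarrow> runs \<pi> E L (per \<pi> L) (Suc v)" "ok w J RUNS (setr b1 v z)" if "v < E" for v
      using RUNS[of "setr b1 v z"] z that L Em per_bound[OF L] by simp_all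
    show "ev e2 z = nt \<pi> E L" unfolding e2_def nt_def
    proof (rule ev_Lst)
      fix v assume "v < E"
      from R(1)[OF this] show "ev (Nt RUNS) (setr b1 v z) \<noteq> 0 \<longleftrightarrow> \<not> runs \<pi> E L (per \<pi> L) (Suc v)" by auto
    qed (use z in simp)
    show "ok w J e2 z" unfolding e2_def by (rule ok_Lst[of _ _ _ _ E]) (use z R fitJ in auto)
  qed
  have e3: "ev e3 z = hs \<pi> E (2 * hc) L" "ok w J e3 z"
    if z: "pdok z" "fst z qL = L" "fst z qq = per \<pi> L" "fst z qE = E" "fst z qhc = hc" for z
  proof -
    have P: "arr z aPd v = \<pi> v" "AK * v + aPd < J" "v + 2 * hc < 2 ^ w" if "v < E" for v
      using that Em pdokD[OF z(1), of v] ixm[of v aPd] sm(5)[of v] by (auto simp: AK_def)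
    show "ev e3 z = hs \<pi> E (2 * hc) L" unfolding e3_def hs_def
      by (rule ev_Lst) (use z P in \<open>auto simp: not_less\<close>)
    show "ok w J e3 z" unfolding e3_def by (rule ok_Lst[of _ _ _ _ E]) (use z P fitJ sm in auto)
  qed
  let ?s1 = "setr qL L s"
  let ?s2 = "setr qq (per \<pi> L) ?s1"
  let ?s3 = "setr qt (nt \<pi> E L) ?s2"
  have E1: "ev e1 ?s1 = per \<pi> L" "ok w J e1 ?s1" using e1[of ?s1] s by simp_all
  have E2: "ev e2 ?s2 = nt \<pi> E L" "ok w J e2 ?s2" using e2[of ?s2] s by simp_all
  have E3: "ev e3 ?s3 = hs \<pi> E (2 * hc) L" "ok w J e3 ?s3" using e3[of ?s3] s by simp_all
  have ix: "AK * fst s qj + aLv < J" using j by (intro ixm) (auto simp: C_def AK_def)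
  show "cok w J rReg s"
    unfolding rReg_def e1_def[symmetric] e2_def[symmetric] e3_def[symmetric] using E1 E2 E3 s(4) ix fitJ by simp
  show "fst s' qL = L" "fst s' qq = per \<pi> L" "fst s' qt = nt \<pi> E L" "fst s' ql = hs \<pi> E (2 * hc) L"
    unfolding s'_def rReg_def e1_def[symmetric] e2_def[symmetric] e3_def[symmetric] using E1 E2 E3 s(4) by simp_all
  show "same {qL, qq, qt, ql} {} s s'"
    unfolding s'_def by (rule same_cex) (auto simp: rReg_def)
qed

lemma tabs_seta: "k < AK \<Longrightarrow> k \<noteq> aFr \<Longrightarrow> k \<noteq> aPw \<Longrightarrow> tabs r (seta k j v s) \<longleftrightarrow> tabs r s"
  unfolding tabs_def by (simp add: arr_seta_other AK_def)

lemma rSto: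
  assumes s: "pdok s" "tabs r s" "fst s qE = E" "fst s qj = j" "fst s qL = L" "fst s qq = per \<pi> L"
     "fst s qt = nt \<pi> E L" "fst s ql = hs \<pi> E (2 * hc) L" and L: "L \<le> E" and j: "j < hc"
  defines "s' \<equiv> cex rSto s"
  shows "cok w J rSto s" "arr s' aLv = (arr s aLv)(Suc j := nxt \<pi> E (2 * hc) L)"
    "i \<noteq> j \<Longrightarrow> k \<in> {aKd, aLen, aA, aB} \<Longrightarrow> arr s' k i = arr s k i"
    "L < E \<Longrightarrow> L = Lv j \<Longrightarrow> arr s' aKd j = kdf j \<and> arr s' aLen j = lnf j \<and> arr s' aA j = Aaf r j \<and> arr s' aB j = Bbf r j"
    "same {} {aLv, aKd, aLen, aA, aB} s s'"
proof -
  let ?d = "hs \<pi> E (2 * hc) L - L" and ?tq = "nt \<pi> E L * per \<pi> L"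
  let ?S = "SEG (V qL) (Sb (V ql) (V qL))"
  define v0 where "v0 = (if L < E then if arr s aPd L = 0 then L + 1 else if nt \<pi> E L = 0 then hs \<pi> E (2 * hc) L else L + ?tq else L)"
  define v1 where "v1 = (if arr s aPd L = 0 then 1 else if nt \<pi> E L = 0 then 2 else (0::nat))"
  define v2 where "v2 = (if arr s aPd L = 0 then 1 else if nt \<pi> E L = 0 then ?d else 0)"
  define v3 where "v3 = (if arr s aPd L = 0 then L else if nt \<pi> E L = 0 then r ^ ?d mod pp else per \<pi> L)"
  define v4 where "v4 = (if arr s aPd L = 0 then 0 else if nt \<pi> E L = 0 then hh r (\<lambda>j. \<pi> (L + j)) ?d mod pp else ?tq)"
  define s1 where "s1 = seta aLv (Suc j) v0 s"
  define s2 where "s2 = seta aKd j v1 s1"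
  define s3 where "s3 = seta aLen j v2 s2"
  define s4 where "s4 = seta aA j v3 s3"
  define s5 where "s5 = seta aB j v4 s4"
  have k: "aLv < AK" "aKd < AK" "aLen < AK" "aA < AK" "aB < AK" "aPd < AK" "aPw < AK" by (simp_all add: AK_def)
  have Em: "E \<le> m" using E by simp
  have d: "?d \<le> m" "L + ?d \<le> m" using hs_le[of L] L Em by auto
  have pw: "arr s aPw ?d = r ^ ?d mod pp" using s(2) d by (simp add: tabs_def)
  have pd: "arr s1 aPd = arr s aPd" "arr s2 aPd = arr s aPd" "arr s3 aPd = arr s aPd" "arr s4 aPd = arr s aPd"
    and pw3: "arr s3 aPw = arr s aPw"
    by (simp_all add: s1_def s2_def s3_def s4_def arr_seta_other AK_def)
  have fs: "fst s1 = fst s" "fst s2 = fst s" "fst s3 = fst s" "fst s4 = fst s" "fst s5 = fst s"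
    by (simp_all add: s1_def s2_def s3_def s4_def s5_def)
  have t4: "tabs r s4" using s(2) by (simp add: s1_def s2_def s3_def s4_def tabs_seta AK_def)
  note S = SEG[OF t4, of "V qL" L "Sb (V ql) (V qL)" ?d]
  have S: "ev ?S s4 = hh r (\<lambda>j. \<pi> (L + j)) ?d mod pp" "ok w J ?S s4"
    using S d s fs by simp_all
  have x1: "cex (StA aLv (Plus (V qj) (N 1)) (Ite (Lt (V qL) (V qE))
      (Ite (Arr aPd (V qL)) (Ite (V qt) (Plus (V qL) (Times (V qt) (V qq))) (V ql)) (Plus (V qL) (N 1))) (V qL))) s = s1"
    using s by (simp add: s1_def v0_def)
  have x2: "cex (StA aKd (V qj) (Ite (Arr aPd (V qL)) (Ite (V qt) (N 0) (N 2)) (N 1))) s1 = s2"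
    using s fs pd by (simp add: s2_def v1_def)
  have x3: "cex (StA aLen (V qj) (Ite (Arr aPd (V qL)) (Ite (V qt) (N 0) (Sb (V ql) (V qL))) (N 1))) s2 = s3"
    using s fs pd by (simp add: s3_def v2_def)
  have x4: "cex (StA aA (V qj) (Ite (Arr aPd (V qL)) (Ite (V qt) (V qq) (Arr aPw (Sb (V ql) (V qL)))) (V qL))) s3 = s4"
    using s fs pd pw pw3 by (simp add: s4_def v3_def)
  have x5: "cex (StA aB (V qj) (Ite (Arr aPd (V qL)) (Ite (V qt) (Times (V qt) (V qq)) ?S) (N 0))) s4 = s5"
    using s fs pd S by (simp add: s5_def v4_def)
  have e: "s' = s5" unfolding s'_def rSto_def cex.simps x1 x2 x3 x4 x5 by (rule refl)
  have tq: "?tq \<le> X * X"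
    by (rule mult_le_mono) (use nt_le[of L] per_bound[of L] L Em C_le in auto)
  then have "L + ?tq \<le> 200 * (X * X)" "?tq \<le> 200 * (X * X)" using L Em C_le X_bounds(1) by linarith+
  then have b1: "?tq < 2 ^ w" "L + ?tq < 2 ^ w" by (auto intro!: sq_small)
  have b2: "L + 1 < 2 ^ w" "Suc j < 2 ^ w" "(2::nat) < 2 ^ w" "(1::nat) < 2 ^ w" "(0::nat) < 2 ^ w"
    using C_le(1) L Em j unfolding C_def by (intro small_idx; linarith)+
  have ix: "AK * Suc j + aLv < J" "AK * j + aKd < J" "AK * j + aLen < J" "AK * j + aA < J" "AK * j + aB < J"
    "AK * L + aPd < J" "AK * ?d + aPw < J"
    by (rule ixm; use j d L Em in \<open>simp add: C_def AK_def\<close>)+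
  have o1: "cok w J (StA aLv (Plus (V qj) (N 1)) (Ite (Lt (V qL) (V qE))
      (Ite (Arr aPd (V qL)) (Ite (V qt) (Plus (V qL) (Times (V qt) (V qq))) (V ql)) (Plus (V qL) (N 1))) (V qL))) s"
    using s b1 b2 ix fitJ by simp
  have o2: "cok w J (StA aKd (V qj) (Ite (Arr aPd (V qL)) (Ite (V qt) (N 0) (N 2)) (N 1))) s1"
    using s fs b1 b2 ix fitJ by simp
  have o3: "cok w J (StA aLen (V qj) (Ite (Arr aPd (V qL)) (Ite (V qt) (N 0) (Sb (V ql) (V qL))) (N 1))) s2"
    using s fs b1 b2 ix fitJ by simp
  have o4: "cok w J (StA aA (V qj) (Ite (Arr aPd (V qL)) (Ite (V qt) (V qq) (Arr aPw (Sb (V ql) (V qL)))) (V qL))) s3"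
    using s fs b1 b2 ix fitJ by simp
  have o5: "cok w J (StA aB (V qj) (Ite (Arr aPd (V qL)) (Ite (V qt) (Times (V qt) (V qq)) ?S) (N 0))) s4"
    using s fs b1 b2 ix S(2) fitJ by simp
  show "cok w J rSto s" unfolding rSto_def cok.simps x1 x2 x3 x4 x5 using o1 o2 o3 o4 o5 by blast
  have Lm: "arr s aPd L = \<pi> L" if "L < E" using pdokD[OF s(1)] that Em by simp
  have v0: "v0 = nxt \<pi> E (2 * hc) L" using Lm by (auto simp: v0_def nxt_def)
  show "arr s' aLv = (arr s aLv)(Suc j := nxt \<pi> E (2 * hc) L)"
    unfolding e v0[symmetric] s5_def s4_def s3_def s2_def s1_def by (simp add: arr_seta_other arr_seta_same AK_def)
  show "i \<noteq> j \<Longrightarrow> k \<in> {aKd, aLen, aA, aB} \<Longrightarrow> arr s' k i = arr s k i"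
    unfolding e s5_def s4_def s3_def s2_def s1_def by (auto simp: AK_def)
  have "arr s5 aKd j = v1" "arr s5 aLen j = v2" "arr s5 aA j = v3" "arr s5 aB j = v4"
    unfolding s5_def s4_def s3_def s2_def s1_def by (simp_all add: AK_def)
  then show "L < E \<Longrightarrow> L = Lv j \<Longrightarrow> arr s' aKd j = kdf j \<and> arr s' aLen j = lnf j \<and> arr s' aA j = Aaf r j \<and> arr s' aB j = Bbf r j"
    unfolding e using Lm by (simp add: v1_def v2_def v3_def v4_def kdf_def lnf_def Aaf_def Bbf_def)
  show "same {} {aLv, aKd, aLen, aA, aB} s s'"
    unfolding s'_def by (rule same_cex) (auto simp: rSto_def AK_def)
qed

lemma same_trans: "same R A s s' \<Longrightarrow> same R' A' s' s'' \<Longrightarrow> R \<subseteq> R0 \<Longrightarrow> R' \<subseteq> R0 \<Longrightarrow> A \<subseteq> A0 \<Longrightarrow> A' \<subseteq> A0 \<Longrightarrow> same R0 A0 s s''"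
  unfolding same_def by (metis subsetD)

lemma tabs_cong: "same R A s s' \<Longrightarrow> rP \<notin> R \<Longrightarrow> aFr \<notin> A \<Longrightarrow> aPw \<notin> A \<Longrightarrow> tabs r s \<Longrightarrow> tabs r s'"
  unfolding same_def tabs_def by (simp add: AK_def)

lemma pdok_cong: "same R A s s' \<Longrightarrow> rM \<notin> R \<Longrightarrow> aPd \<notin> A \<Longrightarrow> pdok s \<Longrightarrow> pdok s'"
  unfolding same_def pdok_def by (simp add: AK_def)

lemma rLev:
  assumes s: "pdok s" "tabs r s" "fst s qE = E" "fst s qhc = hc" "fst s rL0 = L0"
  defines "s' \<equiv> cex rLev s"
  shows "cok w J rLev s" "\<forall>i\<le>hc. arr s' aLv i = Lv i"
    "\<forall>g<hc. Lv g < E \<longrightarrow> arr s' aKd g = kdf g \<and> arr s' aLen g = lnf g \<and> arr s' aA g = Aaf r g \<and> arr s' aB g = Bbf r g"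
    "same {qj, qb, qL, qq, qt, ql} {aLv, aKd, aLen, aA, aB} s s'"
proof -
  let ?R = "{qj, qb, qL, qq, qt, ql}" and ?A = "{aLv, aKd, aLen, aA, aB}"
  let ?s = "seta aLv 0 L0 s"
  define I where "I = (\<lambda>j z. same ?R ?A s z \<and> (\<forall>i\<le>j. arr z aLv i = Lv i) \<and>
    (\<forall>g<j. Lv g < E \<longrightarrow> arr z aKd g = kdf g \<and> arr z aLen g = lnf g \<and> arr z aA g = Aaf r g \<and> arr z aB g = Bbf r g))"
  have step: "cok w J (Sq rReg rSto) (setr qj j z) \<and> I (Suc j) (cex (Sq rReg rSto) (setr qj j z))" if j: "j < hc" and I: "I j z" for j z
  proof -
    let ?z = "setr qj j z"
    define z1 where "z1 = cex rReg ?z"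
    define z2 where "z2 = cex rSto z1"
    have sz: "same ?R ?A s ?z" using I by (auto simp: I_def same_def)
    have p: "pdok ?z" by (rule pdok_cong[OF sz _ _ s(1)]) auto
    have q: "fst ?z qE = E" "fst ?z qhc = hc" using sz s by (auto simp: same_def)
    have Lj: "arr ?z aLv (fst ?z qj) = Lv j" using I by (simp add: I_def)
    have Lm: "Lv j \<le> m" "Lv j \<le> E" using Lv_reach(3)[of j] E(2) by linarith+
    have jj: "fst ?z qj \<le> hc" using j by simp
    note R = rReg[OF p q Lj Lm(1) jj, folded z1_def]
    have s1: "same ?R ?A s z1" by (rule same_trans[OF sz R(6)]) auto
    have p1: "pdok z1" by (rule pdok_cong[OF s1 _ _ s(1)]) auto
    have t1: "tabs r z1" by (rule tabs_cong[OF s1 _ _ _ s(2)]) auto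
    have q1: "fst z1 qE = E" "fst z1 qj = j" using R(6) q by (auto simp: same_def)
    note S = rSto[OF p1 t1 q1 R(2-5) Lm(2) j, folded z2_def]
    have s2: "same ?R ?A s z2" by (rule same_trans[OF s1 S(5)]) auto
    have a1: "arr z1 k = arr z k" if "k < AK" for k using R(6) that by (simp add: same_def)
    have lv: "\<forall>i\<le>Suc j. arr z2 aLv i = Lv i"
      using I unfolding S(2) a1[of aLv, unfolded AK_def, simplified] by (auto simp: I_def le_Suc_eq Lv_def)
    have "\<forall>g<Suc j. Lv g < E \<longrightarrow> arr z2 aKd g = kdf g \<and> arr z2 aLen g = lnf g \<and> arr z2 aA g = Aaf r g \<and> arr z2 aB g = Bbf r g"
    proof (intro allI impI)
      fix g assume g: "g < Suc j" "Lv g < E"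
      show "arr z2 aKd g = kdf g \<and> arr z2 aLen g = lnf g \<and> arr z2 aA g = Aaf r g \<and> arr z2 aB g = Bbf r g"
      proof (cases "g = j")
        case True
        then show ?thesis using S(4) g(2) by simp
      next
        case False
        have "arr z2 k g = arr z k g" if "k \<in> {aKd, aLen, aA, aB}" for k
          using S(3)[OF False that] a1[of k] that by (auto simp: AK_def)
        then show ?thesis using I g False by (simp add: I_def)
      qed
    qed
    then have "I (Suc j) z2" using s2 lv by (simp add: I_def)
    then show ?thesis using R(1) S(1) by (simp add: z1_def z2_def)
  qed
  note F = For_rule[of "V qhc" ?s hc w J I qb "Sq rReg rSto" qj, OF _ _ _ step]
  have i0: "I 0 (setr qb hc ?s)"
    by (auto simp: I_def same_def arr_seta_other AK_def Lv_def)
  have ix: "AK * 0 + aLv < J" by (rule ixm) (auto simp: AK_def)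
  have z0: "(0::nat) < 2 ^ w" by simp
  have c0: "cex (StA aLv (N 0) (V rL0)) s = ?s" using s by simp
  have k: "cok w J (For qj qb (V qhc) (Sq rReg rSto)) ?s" by (rule F(1)) (use s i0 in auto)
  have "cok w J (StA aLv (N 0) (V rL0)) s" using s ix fitJ by simp
  then show "cok w J rLev s" unfolding rLev_def cok.simps(4) c0 using k by blast
  have "\<exists>z. I hc z \<and> cex (For qj qb (V qhc) (Sq rReg rSto)) ?s = setr qj hc z" by (rule F(2)) (use s i0 in auto)
  then obtain z where z: "I hc z" "cex (For qj qb (V qhc) (Sq rReg rSto)) ?s = setr qj hc z" by blast
  have e: "s' = setr qj hc z" unfolding s'_def rLev_def cex.simps(4) c0 by (rule z(2))
  show "\<forall>i\<le>hc. arr s' aLv i = Lv i"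
    "\<forall>g<hc. Lv g < E \<longrightarrow> arr s' aKd g = kdf g \<and> arr s' aLen g = lnf g \<and> arr s' aA g = Aaf r g \<and> arr s' aB g = Bbf r g"
    using z(1) unfolding e arr_setr I_def by blast+
  show "same ?R ?A s s'" using z(1) unfolding e by (auto simp: I_def same_def)
qed

lemma rEnd:
  assumes s: "pdok s" "tabs r s" "fst s qE = E" "fst s qhc = hc" "fst s rL0 = L0" "fst s rW0 = l0" "fst s rW1 = lw"
    "\<forall>i\<le>hc. arr s aLv i = Lv i"
  defines "s' \<equiv> cex rEnd s"
  shows "cok w J rEnd s" "fst s' rNh = hl" "fst s' rT0 = hh r (\<lambda>j. \<pi> (L0 - l0 + j)) l0 mod pp"
    "fst s' rT1 = hh r (\<lambda>j. \<pi> (m - lw + j)) lw mod pp" "\<forall>z\<in>{rI, rF, rA, rH0, rH1, rK}. fst s' z = 0" "fst s' rG = hl"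
    "same {rNh, rT0, rT1, rI, rF, rA, rH0, rH1, rK, rG} {} s s'"
proof -
  define e1 where "e1 = Lst b1 (V qhc) (Eqq (Arr aLv (V b1)) (V qE))"
  have M: "fst s rM = m" using s by (simp add: pdok_def)
  have e1: "ev e1 s = hl" unfolding e1_def hl_def by (rule ev_Lst) (use s in auto)
  have ix: "AK * v + aLv < J" if "v < hc" for v by (rule ixm) (use that in \<open>auto simp: AK_def C_def\<close>)
  have o1: "ok w J e1 s" unfolding e1_def by (rule ok_Lst[of _ _ _ _ hc]) (use s ix fitJ in auto)
  have l: "L0 - l0 + l0 \<le> m" "m - lw + lw \<le> m" using L0(2) E mn by (auto simp: l0_def lw_def)
  have t: "tabs r (setr x v z) = tabs r z" if "x \<noteq> rP" for x v z using that by (simp add: tabs_def)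
  let ?s1 = "setr rNh hl s"
  let ?h0 = "hh r (\<lambda>j. \<pi> (L0 - l0 + j)) l0 mod pp"
  let ?s2 = "setr rT0 ?h0 ?s1"
  have S0: "ev (SEG (Sb (V rL0) (V rW0)) (V rW0)) ?s1 = ?h0" "ok w J (SEG (Sb (V rL0) (V rW0)) (V rW0)) ?s1"
    using SEG[of r ?s1 "Sb (V rL0) (V rW0)" "L0 - l0" "V rW0" l0] l s t by simp_all
  have S1: "ev (SEG (Sb (V rM) (V rW1)) (V rW1)) ?s2 = hh r (\<lambda>j. \<pi> (m - lw + j)) lw mod pp"
      "ok w J (SEG (Sb (V rM) (V rW1)) (V rW1)) ?s2"
    using SEG[of r ?s2 "Sb (V rM) (V rW1)" "m - lw" "V rW1" lw] l s t M by simp_all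
  show "cok w J rEnd s" unfolding rEnd_def e1_def[symmetric] using e1 o1 S0 S1 by simp
  show "fst s' rNh = hl" "fst s' rT0 = ?h0" "fst s' rT1 = hh r (\<lambda>j. \<pi> (m - lw + j)) lw mod pp"
    "\<forall>z\<in>{rI, rF, rA, rH0, rH1, rK}. fst s' z = 0" "fst s' rG = hl"
    unfolding s'_def rEnd_def e1_def[symmetric] using e1 S0 S1 by simp_all
  show "same {rNh, rT0, rT1, rI, rF, rA, rH0, rH1, rK, rG} {} s s'"
    unfolding s'_def by (rule same_cex) (auto simp: rEnd_def)
qed

lemma rSecond:
  assumes s: "pdok s" "fst s qhc = hc" "fst s qdl = 4 * hc" "fst s rC = C" "fst s rP = pp"
  defines "r \<equiv> fst s qr mod pp"
  shows "cok w J rSecond s" "fin r (cex rSecond s)"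
proof -
  define s0 where "s0 = setr rR r s"
  define s1 where "s1 = cex rPw s0"
  define s2 where "s2 = cex rFr s1"
  define s3 where "s3 = cex rZero s2"
  define s4 where "s4 = cex rBase s3"
  define s5 where "s5 = cex rLev s4"
  define s6 where "s6 = cex rEnd s5"
  have r: "r < pp" using pp_lt(3) by (simp add: r_def)
  have M: "fst s rM = m" using s(1) by (simp add: pdok_def)
  have p0: "fst s0 rM = m" "fst s0 rC = C" "fst s0 rP = pp" "fst s0 rR = r" using s M by (simp_all add: s0_def)
  have k0: "pdok s0" using s(1) by (simp add: s0_def)
  note B1 = rPw[OF p0 r, folded s1_def]
  have k1: "pdok s1" by (rule pdok_cong[OF B1(3) _ _ k0]) auto
  have p1: "fst s1 rP = pp" "fst s1 rR = r" using B1(3) p0 by (auto simp: same_def)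
  note B2 = rFr[OF k1 p1 r, folded s2_def]
  have k2: "pdok s2" by (rule pdok_cong[OF B2(3) _ _ k1]) auto
  have f2: "fst s2 z = fst s0 z" if "z \<notin> {qj, qb}" for z using B1(3) B2(3) that by (auto simp: same_def)
  have "arr s2 aPw = arr s1 aPw" using B2(3) by (auto simp: same_def AK_def)
  then have t2: "tabs r s2" using B1(2) B2(2) f2[of rP] p0 by (simp add: tabs_def)
  have c2: "fst s2 rC = C" using f2[of rC] p0 by simp
  note B3 = rZero[OF c2, folded s3_def]
  have k3: "pdok s3" by (rule pdok_cong[OF B3(3) _ _ k2]) auto
  have t3: "tabs r s3" by (rule tabs_cong[OF B3(3) _ _ _ t2]) auto
  have f3: "fst s3 z = fst s0 z" if "z \<notin> {qj, qb}" for z using f2[OF that] B3(3) that by (auto simp: same_def)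
  have h3: "fst s3 qhc = hc" "fst s3 qdl = 4 * hc" using f3 s by (auto simp: s0_def)
  note B4 = rBase[OF k3 h3, folded s4_def]
  have k4: "pdok s4" by (rule pdok_cong[OF B4(8) _ _ k3]) auto
  have t4: "tabs r s4" by (rule tabs_cong[OF B4(8) _ _ _ t3]) auto
  have h4: "fst s4 qhc = hc" using B4(8) h3 by (auto simp: same_def)
  note B5 = rLev[OF k4 t4 B4(6) h4 B4(2), folded s5_def]
  have k5: "pdok s5" by (rule pdok_cong[OF B5(4) _ _ k4]) auto
  have t5: "tabs r s5" by (rule tabs_cong[OF B5(4) _ _ _ t4]) auto
  have f5: "fst s5 z = fst s4 z" if "z \<notin> {qj, qb, qL, qq, qt, ql}" for z using B5(4) that by (auto simp: same_def)
  have h5: "fst s5 qE = E" "fst s5 qhc = hc" "fst s5 rL0 = L0" "fst s5 rW0 = l0" "fst s5 rW1 = lw"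
    using f5 B4 h4 by auto
  note B6 = rEnd[OF k5 t5 h5 B5(2), folded s6_def]
  have e: "cex rSecond s = s6"
    by (simp add: rSecond_def s0_def s1_def s2_def s3_def s4_def s5_def s6_def s(5) r_def)
  have "r < 2 ^ w" using r by (intro pp_lt(2)) linarith
  then have "cok w J (Asg rR (Modu (V qr) (V rP))) s" using s(5) by (simp add: r_def)
  then show "cok w J rSecond s" using B1(1) B2(1) B3(1) B4(1) B5(1) B6(1)
    by (simp add: rSecond_def s0_def s1_def s2_def s3_def s4_def s5_def s(5) r_def)
  have f6: "fst s6 z = fst s5 z" if "z \<notin> {rNh, rT0, rT1, rI, rF, rA, rH0, rH1, rK, rG}" for z using B6(7) that by (auto simp: same_def)
  have f4: "fst s4 z = fst s3 z" if "z \<notin> {rL0, rRho, rW0, rD, qE, rW1}" for z using B4(8) that by (auto simp: same_def)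
  have q: "fst s6 rP = pp" "fst s6 rR = r" "fst s6 rC = C" "fst s6 rRho = rho" "fst s6 rL0 = L0" "fst s6 rW0 = l0"
    "fst s6 rD = lam" "fst s6 rW1 = lw" "fst s6 rM = m"
    using f6 f5 f4 f3 B4 p0 by auto
  have a6: "arr s6 k = arr s5 k" if "k < AK" for k using B6(7) that by (simp add: same_def)
  have a5: "arr s5 k = arr s3 k" if "k < AK" "k \<notin> {aLv, aKd, aLen, aA, aB}" for k
    using B5(4) B4(8) that by (auto simp: same_def)
  have z: "arr s6 aLast = arr s3 aLast" "arr s6 aPend = arr s3 aPend" "arr s6 aLx = arr s3 aLx"
    using a6 a5 by (auto simp: AK_def)
  have pw: "\<forall>d<C. arr s6 aPw d = r ^ d mod pp" using t5 a6[of aPw] by (simp add: tabs_def AK_def)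
  have lvl: "\<forall>g<hl. arr s6 aLen g = lnf g \<and> arr s6 aA g = Aaf r g \<and> arr s6 aB g = Bbf r g \<and> arr s6 aKd g = kdf g"
  proof (intro allI impI)
    fix g assume g: "g < hl"
    then have "g < hc" "Lv g < E" using hl by auto
    then show "arr s6 aLen g = lnf g \<and> arr s6 aA g = Aaf r g \<and> arr s6 aB g = Bbf r g \<and> arr s6 aKd g = kdf g"
      using B5(3) a6 by (simp add: AK_def)
  qed
  show "fin r (cex rSecond s)" unfolding e fin_def using q B6(2-6) z pw lvl B3(2) by simp
qed

end

section \<open>Programs without backward jumps halt\<close>

fun ahead :: "nat \<Rightarrow> instr \<Rightarrow> bool" where
  "ahead pc (Jump l) \<longleftrightarrow> pc < l"
| "ahead pc (Jump_less i j l) \<longleftrightarrow> pc < l"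
| "ahead pc _ \<longleftrightarrow> True"

primrec fwd :: "nat \<Rightarrow> instr list \<Rightarrow> bool" where
  "fwd pc [] \<longleftrightarrow> True"
| "fwd pc (x # xs) \<longleftrightarrow> ahead pc x \<and> fwd (Suc pc) xs"

lemma fwd_append [simp]: "fwd pc (xs @ ys) \<longleftrightarrow> fwd pc xs \<and> fwd (pc + length xs) ys"
  by (induction xs arbitrary: pc) simp_all

lemma fwd_nth: "fwd pc xs \<Longrightarrow> i < length xs \<Longrightarrow> ahead (pc + i) (xs ! i)"
proof (induction xs arbitrary: pc i)
  case (Cons x xs)
  then show ?case by (cases i) (simp, metis add_Suc_shift fwd.simps(2) length_Cons nth_Cons_Suc Suc_less_eq)
qed simp

lemma fwd_comp: "lf e \<Longrightarrow> fwd pc (comp e pc k)"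
  by (induction e arbitrary: pc k) (simp_all add: ac_simps eval_nat_numeral)

lemma fwd_ccomp: "clf c \<Longrightarrow> fwd pc (ccomp c pc)"
  by (induction c arbitrary: pc) (simp_all add: fwd_comp ac_simps eval_nat_numeral)

lemma fwd_progQ: "fwd 0 progQ"
  using bAll_wf(2) by (simp add: progQ_def fwd_comp fwd_ccomp eval_nat_numeral)

lemma exec_ahead: "ahead pc x \<Longrightarrow> c' \<in> set_pmf (exec w x (pc, M)) \<Longrightarrow> pc < fst c'"
  by (cases x) (auto split: if_splits)

text \<open>Every executed instruction raises the program counter, so after as many steps as there
  are instructions the code has been left.\<close>

lemma fwd_run:
  assumes "fwd 0 Q" "c' \<in> set_pmf (run w Q t c)"
  shows "length Q \<le> fst c' \<or> fst c + t \<le> fst c'"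
  using assms(2)
proof (induction t arbitrary: c)
  case (Suc t)
  then obtain c1 where c1: "c1 \<in> set_pmf (step w Q c)" "c' \<in> set_pmf (run w Q t c1)" by auto
  show ?case
  proof (cases "halted Q c")
    case True
    then have "c' = c" using Suc.prems unfolding run_halted[OF True, of w "Suc t"] by simp
    then show ?thesis using True by (simp add: halted_def)
  next
    case False
    then have "c1 \<in> set_pmf (exec w (Q ! fst c) (fst c, snd c))" using c1(1) by (simp add: step_def)
    moreover have "ahead (fst c) (Q ! fst c)" using fwd_nth[OF assms(1), of "fst c"] False by (simp add: halted_def)
    ultimately have "fst c < fst c1" using exec_ahead by blast
    then show ?thesis using Suc.IH[OF c1(2)] by linarith
  qed
qed simp

text \<open>Stated for arbitrary memory: on unlucky random words the invariants may be lost, but an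
  answer must still be given in time.\<close>

lemma stream_answers:
  assumes "fwd 0 Q" "out \<in> set_pmf (stream w Q (length Q) T M)"
  shows "None \<notin> set out"
  using assms(2)
proof (induction T arbitrary: M out)
  case (Cons x T)
  then obtain c o' where c: "c \<in> set_pmf (run w Q (length Q) (0, M[0 := x]))" "out = answer Q c # o'"
    "o' \<in> set_pmf (stream w Q (length Q) T (snd c))" by auto
  have "halted Q c" using fwd_run[OF assms(1) c(1)] by (auto simp: halted_def)
  then show ?case using Cons.IH[OF c(3)] c(2) by (simp add: answer_def)
qed simp

section \<open>Counting the bad fingerprint bases\<close>

text \<open>A number is determined by its residue and its quotient, and \<open>N div p + 1\<close>
  quotients are possible.\<close>

lemma card_mod_in:
  fixes p N :: nat
  assumes "finite D" "0 < p"
  shows "card {x \<in> {0..<N}. x mod p \<in> D} \<le> card D * (N div p + 1)"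
proof -
  have "card {x \<in> {0..<N}. x mod p \<in> D} \<le> card (D \<times> {..N div p})"
  proof (rule card_inj_on_le[where f = "\<lambda>x. (x mod p, x div p)"])
    show "inj_on (\<lambda>x. (x mod p, x div p)) {x \<in> {0..<N}. x mod p \<in> D}"
      by (rule inj_onI) (metis div_mult_mod_eq prod.inject)
    show "(\<lambda>x. (x mod p, x div p)) ` {x \<in> {0..<N}. x mod p \<in> D} \<subseteq> D \<times> {..N div p}"
      by (auto intro: div_le_mono)
  qed (use assms in auto)
  then show ?thesis by (simp add: card_cartesian_product)
qed

definition coll :: "nat \<Rightarrow> (nat \<Rightarrow> nat) \<Rightarrow> (nat \<Rightarrow> nat) \<Rightarrow> nat \<Rightarrow> nat set" where
  "coll p u v l = {r \<in> {0..<p}. hh r u l mod p = hh r v l mod p \<and> (\<exists>j<l. u j \<noteq> v j)}"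

lemma card_coll:
  assumes "prime p" "\<And>i. i < l \<Longrightarrow> u i < p" "\<And>i. i < l \<Longrightarrow> v i < p"
  shows "card (coll p u v l) \<le> l" "finite (coll p u v l)"
proof -
  show "finite (coll p u v l)" by (simp add: coll_def)
  show "card (coll p u v l) \<le> l"
  proof (cases "\<exists>j<l. u j \<noteq> v j")
    case True
    then obtain j where j: "j < l" "u j \<noteq> v j" by blast
    have "coll p u v l = {r \<in> {0..<p}. hh r u l mod p = hh r v l mod p}" using True by (auto simp: coll_def)
    then show ?thesis using card_collisions[of p l u v j, OF assms j] by simp
  next
    case False
    then have "coll p u v l = {}" by (auto simp: coll_def)
    then show ?thesis by simp
  qed
qed

text \<open>All comparisons that could ever be made, at every alignment and length. The set depends
  on text and pattern but not on the run, so a union bound applies although the comparisons made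
  depend on the random base.\<close>

definition bad :: "nat list \<Rightarrow> (nat \<Rightarrow> nat) \<Rightarrow> nat \<Rightarrow> nat \<Rightarrow> nat \<Rightarrow> nat set" where
  "bad T \<pi> n m p =
     (\<Union>(x, L, l) \<in> {(x, L, l). x + l \<le> n \<and> L + l \<le> m}. coll p (\<lambda>j. pd T (x + j)) (\<lambda>j. \<pi> (L + j)) l) \<union>
     (\<Union>(e, L, l) \<in> {(e, L, l). e \<le> n \<and> l \<le> L \<and> L \<le> m}. coll p (wv (pd T) L l e) (\<lambda>j. \<pi> (L - l + j)) l)"

lemma card_UN_bound:
  assumes "finite I" "\<And>i. i \<in> I \<Longrightarrow> card (f i) \<le> k"
  shows "card (\<Union> (f ` I)) \<le> card I * k"
proof -
  have "card (\<Union> (f ` I)) \<le> (\<Sum>i\<in>I. card (f i))" using assms(1) by (rule card_UN_le)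
  also have "\<dots> \<le> of_nat (card I) * k" by (rule sum_bounded_above) (rule assms(2))
  finally show ?thesis by simp
qed

text \<open>There are at most \<open>(n + 1) ^ 3\<close> index triples of each of the two kinds,
  each with at most \<open>n\<close> collisions, and \<open>n + 1 \<le> 2 * n\<close>.\<close>

lemma card_bad:
  assumes p: "prime p" "n < p" and m: "1 \<le> m" "m \<le> n" and \<pi>: "\<And>j. \<pi> j \<le> j"
  shows "card (bad T \<pi> n m p) \<le> (2 * n) ^ 4" "finite (bad T \<pi> n m p)"
proof -
  let ?A = "{(x, L, l). x + l \<le> n \<and> L + l \<le> m}" and ?B = "{(e, L, l). e \<le> n \<and> l \<le> L \<and> L \<le> m}"
  let ?I = "{..n} \<times> {..n} \<times> {..n}"
  let ?f = "\<lambda>(x, L, l). coll p (\<lambda>j. pd T (x + j)) (\<lambda>j. \<pi> (L + j)) l"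
  let ?g = "\<lambda>(e, L, l). coll p (wv (pd T) L l e) (\<lambda>j. \<pi> (L - l + j)) l"
  have AI: "?A \<subseteq> ?I" and BI: "?B \<subseteq> ?I" using m by auto
  then have fin: "finite ?A" "finite ?B" by (auto intro: finite_subset)
  have "card ?I = (n + 1) ^ 3" by (simp add: card_cartesian_product eval_nat_numeral)
  then have cA: "card ?A \<le> (n + 1) ^ 3" "card ?B \<le> (n + 1) ^ 3"
    using card_mono[OF _ AI] card_mono[OF _ BI] by auto
  have f: "card (?f t) \<le> n \<and> finite (?f t)" if tA: "t \<in> ?A" for t
  proof -
    obtain x L l where t: "t = (x, L, l)" "x + l \<le> n" "L + l \<le> m" using tA by auto
    have w: "pd T (x + i) < p" "\<pi> (L + i) < p" if i: "i < l" for i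
    proof -
      show "pd T (x + i) < p" using pd_le[of T "x + i"] i t p(2) by linarith
      show "\<pi> (L + i) < p" using \<pi>[of "L + i"] i t p(2) m by linarith
    qed
    have "card (coll p (\<lambda>j. pd T (x + j)) (\<lambda>j. \<pi> (L + j)) l) \<le> l" "finite (coll p (\<lambda>j. pd T (x + j)) (\<lambda>j. \<pi> (L + j)) l)"
      using card_coll[OF p(1), of l "\<lambda>j. pd T (x + j)" "\<lambda>j. \<pi> (L + j)"] w by auto
    then show ?thesis using t by auto
  qed
  have g: "card (?g t) \<le> n \<and> finite (?g t)" if tB: "t \<in> ?B" for t
  proof -
    obtain e L l where t: "t = (e, L, l)" "e \<le> n" "l \<le> L" "L \<le> m" using tB by auto
    have w: "wv (pd T) L l e i < p" "\<pi> (L - l + i) < p" if i: "i < l" for i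
    proof -
      have "wv (pd T) L l e i \<le> L - l + i" by (auto simp: wv_def tr_def)
      then show "wv (pd T) L l e i < p" using i t p(2) m by linarith
      show "\<pi> (L - l + i) < p" using \<pi>[of "L - l + i"] i t p(2) m by linarith
    qed
    have "card (coll p (wv (pd T) L l e) (\<lambda>j. \<pi> (L - l + j)) l) \<le> l" "finite (coll p (wv (pd T) L l e) (\<lambda>j. \<pi> (L - l + j)) l)"
      using card_coll[OF p(1), of l "wv (pd T) L l e" "\<lambda>j. \<pi> (L - l + j)"] w by auto
    then show ?thesis using t m by auto
  qed
  have "card (\<Union> (?f ` ?A)) \<le> card ?A * n" using f by (intro card_UN_bound fin) auto
  also have "\<dots> \<le> (n + 1) ^ 3 * n" using cA(1) by (rule mult_le_mono1)
  finally have c1: "card (\<Union> (?f ` ?A)) \<le> (n + 1) ^ 3 * n" .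
  have "card (\<Union> (?g ` ?B)) \<le> card ?B * n" using g by (intro card_UN_bound fin) auto
  also have "\<dots> \<le> (n + 1) ^ 3 * n" using cA(2) by (rule mult_le_mono1)
  finally have c2: "card (\<Union> (?g ` ?B)) \<le> (n + 1) ^ 3 * n" .
  have "card (bad T \<pi> n m p) \<le> card (\<Union> (?f ` ?A)) + card (\<Union> (?g ` ?B))"
    unfolding bad_def by (rule card_Un_le)
  also have "\<dots> \<le> (n + 1) ^ 3 * (2 * n)" using c1 c2 by simp
  also have "\<dots> \<le> (2 * n) ^ 3 * (2 * n)" by (intro mult_le_mono1 power_mono) (use m in auto)
  finally show "card (bad T \<pi> n m p) \<le> (2 * n) ^ 4" by (simp add: eval_nat_numeral)
  show "finite (bad T \<pi> n m p)" unfolding bad_def using fin f g by auto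
qed

lemma not_bad:
  assumes "r < p" "r \<notin> bad T \<pi> n m p"
  shows "x + l \<le> n \<Longrightarrow> L + l \<le> m \<Longrightarrow>
       hh r (\<lambda>j. pd T (x + j)) l mod p = hh r (\<lambda>j. \<pi> (L + j)) l mod p \<Longrightarrow> \<forall>j<l. pd T (x + j) = \<pi> (L + j)"
    and "e \<le> n \<Longrightarrow> l \<le> L \<Longrightarrow> L \<le> m \<Longrightarrow>
       hh r (wv (pd T) L l e) l mod p = hh r (\<lambda>j. \<pi> (L - l + j)) l mod p \<Longrightarrow>
       \<forall>j<l. wv (pd T) L l e j = \<pi> (L - l + j)"
proof -
  show "x + l \<le> n \<Longrightarrow> L + l \<le> m \<Longrightarrow>
       hh r (\<lambda>j. pd T (x + j)) l mod p = hh r (\<lambda>j. \<pi> (L + j)) l mod p \<Longrightarrow> \<forall>j<l. pd T (x + j) = \<pi> (L + j)"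
  proof (rule ccontr)
    assume a: "x + l \<le> n" "L + l \<le> m" "hh r (\<lambda>j. pd T (x + j)) l mod p = hh r (\<lambda>j. \<pi> (L + j)) l mod p"
      "\<not> (\<forall>j<l. pd T (x + j) = \<pi> (L + j))"
    then have "r \<in> coll p (\<lambda>j. pd T (x + j)) (\<lambda>j. \<pi> (L + j)) l" using assms(1) by (auto simp: coll_def)
    then have "r \<in> bad T \<pi> n m p" unfolding bad_def using a(1,2) by blast
    then show False using assms(2) by blast
  qed
  show "e \<le> n \<Longrightarrow> l \<le> L \<Longrightarrow> L \<le> m \<Longrightarrow>
       hh r (wv (pd T) L l e) l mod p = hh r (\<lambda>j. \<pi> (L - l + j)) l mod p \<Longrightarrow>
       \<forall>j<l. wv (pd T) L l e j = \<pi> (L - l + j)"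
  proof (rule ccontr)
    assume a: "e \<le> n" "l \<le> L" "L \<le> m" "hh r (wv (pd T) L l e) l mod p = hh r (\<lambda>j. \<pi> (L - l + j)) l mod p"
      "\<not> (\<forall>j<l. wv (pd T) L l e j = \<pi> (L - l + j))"
    then have "r \<in> coll p (wv (pd T) L l e) (\<lambda>j. \<pi> (L - l + j)) l" using assms(1) by (auto simp: coll_def)
    then have "r \<in> bad T \<pi> n m p" unfolding bad_def using a(1-3) by blast
    then show False using assms(2) by blast
  qed
qed

section \<open>From counting to probability\<close>

lemma prob_bind_ge:
  assumes "\<And>x. x \<in> A \<Longrightarrow> f x = return_pmf y" "y \<in> G"
  shows "measure_pmf.prob U A \<le> measure_pmf.prob (bind_pmf U f) G"
proof -
  have "emeasure (measure_pmf U) A = (\<integral>\<^sup>+x. indicator A x \<partial>measure_pmf U)" by simp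
  also have "\<dots> \<le> (\<integral>\<^sup>+x. emeasure (measure_pmf (f x)) G \<partial>measure_pmf U)"
    by (rule nn_integral_mono) (use assms in \<open>auto split: split_indicator simp: indicator_def\<close>)
  also have "\<dots> = emeasure (measure_pmf (bind_pmf U f)) G" by (rule emeasure_bind_pmf[symmetric])
  finally show ?thesis by (simp add: measure_pmf.emeasure_eq_measure)
qed

text \<open>A random word reduced modulo \<open>p\<close> is not uniform, but a residue is hit at
  most \<open>2 ^ w div p + 1\<close> times, which is at most twice \<open>2 ^ w div p\<close> as
  \<open>p \<le> 2 ^ w\<close>. This costs the factor 2.\<close>

lemma prob_good_word:
  fixes p w :: nat
  assumes "finite D" "0 < p" "p \<le> 2 ^ w"
  shows "1 - 2 * real (card D) / p \<le> measure_pmf.prob (pmf_of_set {0..<2 ^ w}) {x. x < 2 ^ w \<and> x mod p \<notin> D}"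
proof -
  let ?N = "2 ^ w :: nat"
  let ?bad = "{x \<in> {0..<?N}. x mod p \<in> D}"
  have ne: "{0..<?N} \<noteq> {}" by auto
  have i: "{0..<?N} \<inter> {x. x < ?N \<and> x mod p \<notin> D} = {0..<?N} - ?bad" by auto
  have "card ({0..<?N} - ?bad) = ?N - card ?bad" by (subst card_Diff_subset) auto
  moreover have "card ?bad \<le> card {0..<?N}" by (rule card_mono) auto
  then have "card ?bad \<le> ?N" by simp
  ultimately have c: "real (card ({0..<?N} - ?bad)) = real ?N - real (card ?bad)" by (simp only: of_nat_diff)
  have "?N div p + 1 \<le> 2 * (?N div p)" using assms by (simp add: Suc_le_eq div_greater_zero_iff)
  then have "card ?bad \<le> card D * (2 * (?N div p))" using card_mod_in[OF assms(1,2), of ?N] mult_le_mono2 le_trans by blast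
  then have "real (card ?bad) \<le> real (card D) * (2 * real (?N div p))" by (metis of_nat_le_iff of_nat_mult of_nat_numeral)
  moreover have "real (card D) * (2 * real (?N div p)) \<le> real (card D) * (2 * (real ?N / p))"
    by (intro mult_left_mono of_nat_div_le_of_nat) auto
  ultimately have b: "real (card ?bad) \<le> 2 * real (card D) / p * real ?N" by (simp add: mult_ac)
  have "measure_pmf.prob (pmf_of_set {0..<?N}) {x. x < ?N \<and> x mod p \<notin> D} = (real ?N - real (card ?bad)) / real ?N"
    using measure_pmf_of_set[OF ne] i c by simp
  also have "\<dots> = 1 - real (card ?bad) / real ?N" by (simp add: diff_divide_distrib)
  also have "\<dots> \<ge> 1 - 2 * real (card D) / p" using b by (simp add: divide_le_eq)
  finally show ?thesis .
qed

text \<open>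
  The prologue moves the input, which occupies the cells used for temporaries and registers, to the
  upper end of memory. Being straight-line code it can address those cells only one by one.
\<close>

definition keep :: "nat \<Rightarrow> instr list" where
  "keep i = [Const 2 1, Arith Sub 1 1 2, Store 1 i]"

text \<open>Cell 2 becomes \<open>s * n + m\<close>, cell 1 the address \<open>2 ^ w - n\<close> by
  subtracting from 0 with wrap-around. Below that address the cells from 3 on are saved one after
  the other.\<close>

definition prologue :: prog where
  "prologue = [Arith Mul 2 2 0, Arith Add 2 2 1, Arith Sub 1 1 1, Arith Sub 1 1 0, Store 1 2] @
     concat (map keep [3..<KC]) @ [Const 2 0, Arith Add (TD + qn) 0 2, Arith Add (TD + qS) 1 2]"

definition progR :: "nat \<Rightarrow> prog" where
  "progR A = prologue @ ccomp (rFirst A) (length prologue) @ [Rand (TD + qr)] @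
     ccomp rSecond (length prologue + cclen (rFirst A) + 1)"

definition abst :: "memory \<Rightarrow> st" where
  "abst M = (\<lambda>x. M ! (TD + x), \<lambda>a. M ! (KC + a))"

lemma sim_abst: "length M = KC + J \<Longrightarrow> KC + J \<le> 2 ^ w \<Longrightarrow> (\<forall>i<length M. M ! i < 2 ^ w) \<Longrightarrow> sim w J (abst M) M"
  by (simp add: sim_def abst_def)

lemma sim_take:
  assumes "sim w J s M" "J' \<le> J"
  shows "sim w J' s (take (KC + J') M)"
  using assms by (auto simp: sim_def KC_def)

lemma prologue_simple: "list_all simple prologue"
  by (auto simp: prologue_def keep_def list_all_iff)

section \<open>Saving the input and running the preprocessing\<close>

context pattern_prep
begin

definition M0 :: memory where "M0 = [n, m, sg] @ P @ replicate (2 ^ w - (3 + m)) 0"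

lemma M0:
  "length M0 = 2 ^ w" "M0 ! 0 = n" "M0 ! 1 = m" "M0 ! 2 = sg" "k < m \<Longrightarrow> M0 ! (k + 3) = P ! k" "i < 2 ^ w \<Longrightarrow> M0 ! i < 2 ^ w"
  "n + 2 * KC + m < 2 ^ w" "sg * n + m < 2 ^ w" "sg * n < 2 ^ w" "sg < 2 ^ w"
proof -
  have b: "n + 2 * KC + m < 2 ^ w" by (rule lin_small) (use big in \<open>simp add: KC_def TD_def NR_def\<close>)
  then show "n + 2 * KC + m < 2 ^ w" .
  have m3: "3 + m \<le> 2 ^ w" using b by (simp add: KC_def TD_def NR_def)
  then show len: "length M0 = 2 ^ w" using lenP by (simp add: M0_def)
  show "M0 ! 0 = n" "M0 ! 1 = m" "M0 ! 2 = sg" by (simp_all add: M0_def)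
  show "k < m \<Longrightarrow> M0 ! (k + 3) = P ! k" using lenP by (simp add: M0_def nth_append)
  have "sg \<le> sg * lgm m" using lgm_pos by simp
  then have "sg \<le> X" "n \<le> X" "m \<le> X" using big by linarith+
  then have "sg * n \<le> X * X" by (intro mult_le_mono)
  then show "sg * n + m < 2 ^ w" using \<open>m \<le> X\<close> X_bounds(1) by (intro sq_small) linarith
  then show "sg * n < 2 ^ w" by linarith
  show sgw: "sg < 2 ^ w" using \<open>sg \<le> X\<close> by (intro lin_small) linarith
  show "M0 ! i < 2 ^ w" if "i < 2 ^ w"
  proof -
    have "M0 ! i \<in> set M0" using that len by simp
    then have "M0 ! i \<in> {n, m, sg, 0} \<or> M0 ! i \<in> set P" by (auto simp: M0_def)
    then show ?thesis using setP sgw b by auto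
  qed
qed

text \<open>Cell 1 works as a stack pointer going down from \<open>2 ^ w - n\<close>. The margin of
  \<open>KC\<close> cells below that address may be overwritten; the input ends before it.\<close>

definition upto_cell :: "nat \<Rightarrow> memory \<Rightarrow> bool" where
  "upto_cell k M \<longleftrightarrow> length M = 2 ^ w \<and> M ! 0 = n \<and> M ! 1 = 2 ^ w - n - (k - 3) \<and> (\<forall>i<2 ^ w. M ! i < 2 ^ w) \<and>
     (\<forall>i. 3 \<le> i \<and> i < 2 ^ w - n - KC \<longrightarrow> M ! i = M0 ! i) \<and> M ! (2 ^ w - n) = sg * n + m \<and>
     (\<forall>i. 3 \<le> i \<and> i < k \<longrightarrow> M ! (2 ^ w - n - (i - 2)) = M0 ! i)"

lemma keep_cell:
  assumes u: "upto_cell k M" and k: "3 \<le> k" "k < KC"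
  shows "upto_cell (Suc k) (fold (mx w) (keep k) M)"
proof -
  have b: "n + 2 * KC + m < 2 ^ w" by (rule M0)
  have w1: "(1::nat) < 2 ^ w" using b k by linarith
  have l: "length M = 2 ^ w" "M ! 0 = n" "M ! 1 = 2 ^ w - n - (k - 3)" "\<forall>i<2 ^ w. M ! i < 2 ^ w" "M ! (2 ^ w - n) = sg * n + m"
    and lo: "\<And>i. 3 \<le> i \<Longrightarrow> i < 2 ^ w - n - KC \<Longrightarrow> M ! i = M0 ! i"
    and hi: "\<And>i. 3 \<le> i \<Longrightarrow> i < k \<Longrightarrow> M ! (2 ^ w - n - (i - 2)) = M0 ! i" using u by (auto simp: upto_cell_def)
  define c where "c = 2 ^ w - n - (Suc k - 3)"
  have c: "c = 2 ^ w - n - (k - 2)" "2 ^ w - n - KC < c" "c < 2 ^ w" "M ! 1 = Suc c" "2 ^ w - n - KC > KC" "c < 2 ^ w - n"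
    using b k l(3) unfolding c_def by linarith+
  have wz: "w \<noteq> 0" using w1 by (cases w) auto
  let ?M = "M[2 := 1, 1 := c, c := M ! k]"
  have kl: "k < 2 ^ w" "2 < (2::nat) ^ w" "(1::nat) < 2 ^ w" "3 \<le> k" using b k by linarith+
  have e: "(Suc c + 2 ^ w - 1) mod 2 ^ w = c" using c(3) by simp
  have f: "fold (mx w) (keep k) M = ?M"
    using l(1) kl wz c(3,4) e by (simp add: keep_def rd_def nth_list_update)
  have n: "?M ! i = (if i = c then M ! k else if i = 1 then c else if i = 2 then 1 else M ! i)" if "i < 2 ^ w" for i
    using that l(1) by (simp add: nth_list_update)
  have c3: "c > 3" "c \<noteq> 0" "c \<noteq> 1" "c \<noteq> 2" using c k by linarith+
  show ?thesis
    unfolding f upto_cell_def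
  proof (intro conjI allI impI)
    show "length ?M = 2 ^ w" using l by simp
    show "?M ! 0 = n" using n[of 0] c3 l by simp
    show "?M ! 1 = 2 ^ w - n - (Suc k - 3)" using n[of 1] c3 kl unfolding c_def[symmetric] by simp
    show "?M ! i < 2 ^ w" if "i < 2 ^ w" for i using n[OF that] l(4) that kl c(3) by simp
    show "?M ! i = M0 ! i" if i: "3 \<le> i \<and> i < 2 ^ w - n - KC" for i
      using n[of i] lo[of i] i c(2) by simp
    have "2 ^ w - n < 2 ^ w" using mn b by linarith
    moreover have "2 ^ w - n \<noteq> c" "2 ^ w - n \<noteq> 1" "2 ^ w - n \<noteq> 2" using c k b by linarith+
    ultimately show "?M ! (2 ^ w - n) = sg * n + m" using n[of "2 ^ w - n"] l(5) by simp
    fix i assume i: "3 \<le> i \<and> i < Suc k"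
    show "?M ! (2 ^ w - n - (i - 2)) = M0 ! i"
    proof (cases "i = k")
      case True
      then show ?thesis using n[OF c(3)] lo[of k] k c(5) unfolding c(1)[symmetric] True by simp
    next
      case False
      have a: "2 ^ w - n - (i - 2) < 2 ^ w" "2 ^ w - n - (i - 2) \<noteq> c" "2 ^ w - n - (i - 2) \<noteq> 1" "2 ^ w - n - (i - 2) \<noteq> 2"
        using i False k b mn unfolding c(1) by linarith+
      then show ?thesis using n[OF a(1)] hi[of i] i False by simp
    qed
  qed
qed

lemma prologue:
  defines "M1 \<equiv> fold (mx w) prologue M0"
  shows "sim w J (abst M1) M1" "fst (abst M1) qn = n" "fst (abst M1) qS = Hs + 3" "snd (abst M1) Hs = sg * n + m"
    "\<forall>k<m. (if k < c0 then snd (abst M1) (Hs - (k + 1)) else snd (abst M1) (k + 3 - KC)) = P ! k"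
proof -
  have b: "n + 2 * KC + m < 2 ^ w" "sg * n + m < 2 ^ w" "sg * n < 2 ^ w" "sg < 2 ^ w" by (rule M0)+
  have kl: "0 < (2::nat) ^ w" "1 < (2::nat) ^ w" "2 < (2::nat) ^ w" "n < 2 ^ w" "2 ^ w - n < 2 ^ w" "2 ^ w - n > 2" "m < 2 ^ w"
    using b mn by (auto simp: KC_def TD_def NR_def)
  define Ma where "Ma = fold (mx w) [Arith Mul 2 2 0, Arith Add 2 2 1, Arith Sub 1 1 1, Arith Sub 1 1 0, Store 1 2] M0"
  have Ma: "Ma = M0[2 := sg * n + m, 1 := 2 ^ w - n, 2 ^ w - n := sg * n + m]"
  proof -
    let ?x = "sg * n + m"
    have 1: "mx w (Arith Mul 2 2 0) M0 = M0[2 := sg * n]" using M0(1-4) kl b by (simp add: rd_def)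
    have 2: "mx w (Arith Add 2 2 1) (M0[2 := sg * n]) = M0[2 := ?x]" using M0(1-4) kl b by (simp add: rd_def)
    have 3: "mx w (Arith Sub 1 1 1) (M0[2 := ?x]) = M0[2 := ?x, 1 := 0]" using M0(1-4) kl b by (simp add: rd_def)
    have 4: "mx w (Arith Sub 1 1 0) (M0[2 := ?x, 1 := 0]) = M0[2 := ?x, 1 := 2 ^ w - n]" using M0(1-4) kl b by (simp add: rd_def nth_list_update)
    have 5: "mx w (Store 1 2) (M0[2 := ?x, 1 := 2 ^ w - n]) = M0[2 := ?x, 1 := 2 ^ w - n, 2 ^ w - n := ?x]"
      using M0(1) kl by (simp add: rd_def nth_list_update)
    show ?thesis unfolding Ma_def by (simp only: fold_simps 1 2 3 4 5)
  qed
  have na: "Ma ! i = (if i = 2 ^ w - n then sg * n + m else if i = 1 then 2 ^ w - n else if i = 2 then sg * n + m else M0 ! i)"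
    if "i < 2 ^ w" for i
    using that M0(1) kl unfolding Ma by (simp add: nth_list_update)
  have ua: "upto_cell 3 Ma"
    unfolding upto_cell_def
  proof (intro conjI allI impI)
    show "length Ma = 2 ^ w" using M0(1) by (simp add: Ma)
    show "Ma ! 0 = n" using na[of 0] kl M0(2) by simp
    show "Ma ! 1 = 2 ^ w - n - (3 - 3)" using na[of 1] kl by simp
    show "Ma ! i < 2 ^ w" if "i < 2 ^ w" for i using na[OF that] M0(6)[OF that] kl b by simp
    show "Ma ! i = M0 ! i" if "3 \<le> i \<and> i < 2 ^ w - n - KC" for i
    proof -
      have "i < 2 ^ w" "i \<noteq> 2 ^ w - n" "i \<noteq> 1" "i \<noteq> 2" using that by linarith+
      then show ?thesis using na[of i] by simp
    qed
    show "Ma ! (2 ^ w - n) = sg * n + m" using na[of "2 ^ w - n"] kl by simp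
    show "Ma ! (2 ^ w - n - (i - 2)) = M0 ! i" if "3 \<le> i \<and> i < 3" for i using that by simp
  qed
  define Mb where "Mb k = fold (mx w) (concat (map keep [3..<k])) Ma" for k
  have ub: "upto_cell k (Mb k)" if "3 \<le> k" "k \<le> KC" for k
    using that
  proof (induction k rule: dec_induct)
    case base
    then show ?case using ua by (simp add: Mb_def)
  next
    case (step i)
    have "Mb (Suc i) = fold (mx w) (keep i) (Mb i)" using step.hyps by (simp add: Mb_def)
    then show ?case using keep_cell[of i "Mb i"] step by simp
  qed
  define Mc where "Mc = Mb KC"
  have k3: "3 \<le> KC" by (simp add: KC_def TD_def)
  have uc: "upto_cell KC Mc" unfolding Mc_def by (rule ub[OF k3 le_refl])
  have e: "M1 = fold (mx w) [Const 2 0, Arith Add (TD + qn) 0 2, Arith Add (TD + qS) 1 2] Mc"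
    unfolding M1_def prologue_def fold_append o_apply Mc_def Mb_def Ma_def by (rule refl)
  have c: "length Mc = 2 ^ w" "Mc ! 0 = n" "Mc ! 1 = 2 ^ w - n - c0" "\<forall>i<2 ^ w. Mc ! i < 2 ^ w" "Mc ! (2 ^ w - n) = sg * n + m"
    and lo: "\<And>i. 3 \<le> i \<Longrightarrow> i < 2 ^ w - n - KC \<Longrightarrow> Mc ! i = M0 ! i"
    and hi: "\<And>i. 3 \<le> i \<Longrightarrow> i < KC \<Longrightarrow> Mc ! (2 ^ w - n - (i - 2)) = M0 ! i" using uc by (auto simp: upto_cell_def c0_def)
  have T: "TD + qn = 80" "TD + qS = 81" "KC = 120" by (simp_all add: TD_def KC_def NR_def)
  have big120: "(120::nat) < 2 ^ w" using b T by simp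
  have "M1 = Mc[2 := 0, 80 := n, 81 := 2 ^ w - n - c0]"
    unfolding e T using c(1-3) big120 kl by (simp add: rd_def nth_list_update)
  then have n1: "M1 ! i = (if i = 81 then 2 ^ w - n - c0 else if i = 80 then n else if i = 2 then 0 else Mc ! i)" if "i < 2 ^ w" for i
    using that c(1) by (simp add: nth_list_update)
  have l1: "length M1 = 2 ^ w" unfolding e by (simp add: c(1))
  have "2 ^ w - (n + c0) < 2 ^ w" using mn kl(1) by linarith
  then have "M1 ! i < 2 ^ w" if "i < 2 ^ w" for i using n1[OF that] c(4) that kl by simp
  then show "sim w J (abst M1) M1" using l1 fitJ(2) by (intro sim_abst) auto
  show "fst (abst M1) qn = n" unfolding abst_def fst_conv T using n1[of 80] big120 by simp
  have HsK: "KC + Hs = 2 ^ w - n" using Hs(3) by linarith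
  have "2 ^ w - n - c0 = Hs + 3" using Hs(3) c0 by linarith
  then show "fst (abst M1) qS = Hs + 3" unfolding abst_def fst_conv T using n1[of 81] big120 by simp
  have hiK: "M1 ! (KC + a) = Mc ! (KC + a)" if "KC + a < 2 ^ w" for a using n1[OF that] T by simp
  show "snd (abst M1) Hs = sg * n + m" unfolding abst_def snd_conv using hiK[of Hs] HsK c(5) kl by simp
  show "\<forall>k<m. (if k < c0 then snd (abst M1) (Hs - (k + 1)) else snd (abst M1) (k + 3 - KC)) = P ! k"
  proof (intro allI impI)
    fix k assume k: "k < m"
    show "(if k < c0 then snd (abst M1) (Hs - (k + 1)) else snd (abst M1) (k + 3 - KC)) = P ! k"
    proof (cases "k < c0")
      case True
      have kK: "k + 3 < KC" using True c0 by linarith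
      have a: "KC + (Hs - (k + 1)) = 2 ^ w - n - (k + 3 - 2)" "KC + (Hs - (k + 1)) < 2 ^ w" using HsK Hs kK by linarith+
      have "Mc ! (2 ^ w - n - (k + 3 - 2)) = P ! k" using hi[of "k + 3"] kK M0(5)[OF k] by simp
      then show ?thesis using True hiK[OF a(2)] unfolding a(1) abst_def snd_conv by simp
    next
      case False
      have a: "KC + (k + 3 - KC) = k + 3" "k + 3 < 2 ^ w" "k + 3 < 2 ^ w - n - KC" using False c0 b(1) k by linarith+
      have "Mc ! (k + 3) = P ! k" using lo[of "k + 3"] a M0(5)[OF k] by simp
      then show ?thesis using False hiK[of "k + 3 - KC"] unfolding a(1) abst_def snd_conv using a(2) by simp
    qed
  qed
qed

text \<open>Between two deterministic phases stands a single \<open>Rand\<close>, so the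
  distribution of the outcome is an image of the uniform one on words.\<close>

lemma prep_run:
  assumes X: "X = (2 * n) ^ A"
  shows "\<exists>N F. run w (progR A) N (preproc_init w n sg P) = map_pmf (\<lambda>r. (length (progR A), F r)) (pmf_of_set {0..<2 ^ w}) \<and>
    (\<forall>r<2 ^ w. \<exists>s. sim w J s (F r) \<and> fin (r mod pp) s)"
proof -
  let ?Q = "progR A"
  define a where "a = length prologue"
  define b where "b = a + cclen (rFirst A)"
  have init: "preproc_init w n sg P = (0, M0)" using lenP by (simp add: preproc_init_def M0_def)
  have len: "length ?Q = b + 1 + cclen rSecond" by (simp add: progR_def a_def b_def)
  have "code_at ?Q 0 ?Q" by (simp add: code_at_def)
  then have "code_at ?Q 0 (prologue @ ccomp (rFirst A) a @ [Rand (TD + qr)] @ ccomp rSecond (b + 1))"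
    by (simp only: progR_def a_def b_def)
  then have k: "code_at ?Q 0 prologue" "code_at ?Q a (ccomp (rFirst A) a)" "code_at ?Q b [Rand (TD + qr)]"
    "code_at ?Q (b + 1) (ccomp rSecond (b + 1))"
    unfolding code_at_append length_ccomp a_def[symmetric] b_def[symmetric] by (simp_all add: b_def)
  define M1 where "M1 = fold (mx w) prologue M0"
  note P = prologue[folded M1_def]
  have 1: "rt w ?Q a (0, M0) (a, M1)"
    using rt_simple[OF k(1) prologue_simple, of w M0] by (simp add: a_def M1_def)
  note R1 = rFirst[OF P(2,3,4) X P(5)]
  define s2 where "s2 = cex (rFirst A) (abst M1)"
  obtain t2 M2 where 2: "rt w ?Q t2 (a, M1) (b, M2)" "sim w J s2 M2"
    using ccompiledD[OF ccompiled k(2) P(1) R1(1) rFirst_wf] unfolding b_def s2_def by blast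
  have ex: "\<exists>t M3. rt w ?Q t (Suc b, M2[TD + qr := r]) (length ?Q, M3) \<and> (\<exists>s. sim w J s M3 \<and> fin (r mod pp) s)" if r: "r < 2 ^ w" for r
  proof -
    let ?s = "setr qr r s2"
    have sm: "sim w J ?s (M2[TD + qr := r])" by (rule sim_reg[OF 2(2) _ r]) (simp add: NR_def)
    have h: "pdok ?s" "fst ?s qhc = hc" "fst ?s qdl = 4 * hc" "fst ?s rC = C" "fst ?s rP = pp"
      using R1 by (simp_all add: s2_def pdok_def)
    note S = rSecond[OF h]
    have S2: "fin (r mod pp) (cex rSecond ?s)" using S(2) by simp
    obtain t M3 where t: "rt w ?Q t (b + 1, M2[TD + qr := r]) (b + 1 + cclen rSecond, M3)" "sim w J (cex rSecond ?s) M3"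
      using ccompiledD[OF ccompiled k(4) sm S(1) rSecond_wf] by blast
    have "rt w ?Q t (Suc b, M2[TD + qr := r]) (length ?Q, M3)" using t(1) len by simp
    then show ?thesis using t(2) S2 by blast
  qed
  then obtain t3 F where F: "\<And>r. r < 2 ^ w \<Longrightarrow> rt w ?Q (t3 r) (Suc b, M2[TD + qr := r]) (length ?Q, F r)"
    "\<And>r. r < 2 ^ w \<Longrightarrow> \<exists>s. sim w J s (F r) \<and> fin (r mod pp) s" by metis
  \<comment> \<open>The second phase may take different times for different words. Halted
    configurations do not change, so the maximum serves all of them.\<close>
  define N3 where "N3 = Max (t3 ` {0..<2 ^ w})"
  have F': "run w ?Q N3 (Suc b, M2[TD + qr := r]) = return_pmf (length ?Q, F r)" if "r < 2 ^ w" for r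
    by (rule rt_extend[OF F(1)[OF that]]) (use that in \<open>auto simp: halted_def N3_def\<close>)
  have st: "step w ?Q (b, M2) = map_pmf (\<lambda>r. (Suc b, M2[TD + qr := r])) (pmf_of_set {0..<2 ^ w})"
    using k(3) by (simp add: step_def halted_def)
  have ne: "{0..<2 ^ w} \<noteq> ({} :: nat set)" by auto
  have "run w ?Q (a + t2 + Suc N3) (0, M0) = run w ?Q (Suc N3) (b, M2)"
    unfolding run_add[of w ?Q "a + t2"] using rt_trans[OF 1 2(1)] by (simp add: rt_def bind_return_pmf)
  also have "\<dots> = bind_pmf (pmf_of_set {0..<2 ^ w}) (\<lambda>r. run w ?Q N3 (Suc b, M2[TD + qr := r]))"
    by (simp add: st bind_map_pmf)
  also have "\<dots> = bind_pmf (pmf_of_set {0..<2 ^ w}) (\<lambda>r. return_pmf (length ?Q, F r))"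
    by (rule bind_pmf_cong[OF refl]) (use ne F' in simp)
  also have "\<dots> = map_pmf (\<lambda>r. (length ?Q, F r)) (pmf_of_set {0..<2 ^ w})" by (simp add: map_pmf_def)
  finally show ?thesis unfolding init using F(2) by blast
qed

end

section \<open>The choice of the constants\<close>

lemma nat_powr_bound:
  assumes "1 \<le> n" "\<kappa> = real k" "\<kappa> * (1 + log 2 n) \<le> w"
  shows "(2 * n) ^ k \<le> (2::nat) ^ w"
proof -
  have "1 + log 2 n = log 2 (2 * real n)" using assms(1) by (simp add: log_mult)
  then have "real k * log 2 (2 * real n) \<le> real w" using assms by simp
  then have "2 powr (real k * log 2 (2 * real n)) \<le> 2 powr real w" by (intro powr_mono) auto
  moreover have "2 powr (real k * log 2 (2 * real n)) = (2 * real n) ^ k"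
  proof -
    have "2 powr (real k * log 2 (2 * real n)) = (2 powr log 2 (2 * real n)) powr real k"
      by (simp add: powr_powr mult.commute)
    also have "2 powr log 2 (2 * real n) = 2 * real n" using assms(1) by (intro powr_log_cancel) auto
    also have "(2 * real n) powr real k = (2 * real n) ^ k" using assms(1) by (simp add: powr_realpow)
    finally show ?thesis .
  qed
  ultimately have "(2 * real n) ^ k \<le> 2 ^ w" by (simp add: powr_realpow)
  then have "real ((2 * n) ^ k) \<le> real (2 ^ w)" by simp
  then show ?thesis by (simp only: of_nat_le_iff)
qed

lemma lgm_log:
  assumes "1 \<le> m"
  shows "real (lgm m) \<le> 1 + log 2 m"
proof (cases "lgm m")
  case (Suc k)
  have "\<not> m < 2 ^ k" using not_less_Least[of k "\<lambda>k. m < 2 ^ k"] Suc by (simp add: lgm_def)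
  then have "(2::real) ^ k \<le> real m" by (metis not_less of_nat_le_iff of_nat_numeral of_nat_power)
  then have "log 2 (2 ^ k) \<le> log 2 (real m)" using assms by (intro log_mono) auto
  then show ?thesis using Suc by (simp add: log_nat_power)
qed (use assms in simp)

theorem theorem1:
  fixes c :: real and d :: nat
  shows "\<exists>\<kappa>\<^sub>0::real>0. \<forall>\<kappa>\<^sub>1::real. \<exists>(R::prog) (Q::prog) (t::nat) (K::real).
    \<forall>(n::nat) (m::nat) (s::nat) (w::nat) (P::nat list).
      1 \<le> m \<and> m \<le> n \<and> length P = m \<and> set P \<subseteq> {0..<s} \<and> s \<le> (2 * n) ^ d \<and>
      \<kappa>\<^sub>0 * (1 + log 2 n) \<le> w \<and> w \<le> \<kappa>\<^sub>1 * (1 + log 2 n) \<longrightarrow>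
      (\<exists>(S::nat) (N::nat).
         real S \<le> K * (s * (1 + log 2 m)) \<and>
         (\<forall>e\<in>set_pmf (run w R N (preproc_init w n s P)). halted R e) \<and>
         (\<forall>T::nat list. length T = n \<and> set T \<subseteq> {0..<s} \<longrightarrow>
            (\<forall>out\<in>set_pmf (transcript w R N Q t S s P T). None \<notin> set out) \<and>
            measure_pmf.prob (transcript w R N Q t S s P T)
              {out. \<forall>i. m \<le> i + 1 \<and> i < n \<longrightarrow>
                      out ! i = Some (p_match {0..<s} P (window T m i))}
              \<ge> 1 - 1 / real n powr c))"
proof -
  define a where "a = nat \<lceil>max c 0\<rceil>"
  define A where "A = d + a + 12"
  let ?\<kappa> = "real (6 * A)"
  have body: "\<exists>S N. real S \<le> 4340 * (real s * (1 + log 2 m)) \<and>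
         (\<forall>e\<in>set_pmf (run w (progR A) N (preproc_init w n s P)). halted (progR A) e) \<and>
         (\<forall>T::nat list. length T = n \<and> set T \<subseteq> {0..<s} \<longrightarrow>
            (\<forall>out\<in>set_pmf (transcript w (progR A) N progQ (length progQ) S s P T). None \<notin> set out) \<and>
            measure_pmf.prob (transcript w (progR A) N progQ (length progQ) S s P T)
              {out. \<forall>i. m \<le> i + 1 \<and> i < n \<longrightarrow>
                      out ! i = Some (p_match {0..<s} P (window T m i))}
              \<ge> 1 - 1 / real n powr c)"
    if mn: "1 \<le> m" "m \<le> n" and P: "length P = m" "set P \<subseteq> {0..<s}" and sd: "s \<le> (2 * n) ^ d"
      and w: "?\<kappa> * (1 + log 2 n) \<le> w" for n m s w P
  proof -
    define X where "X = (2 * n) ^ A"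
    have n2: "2 \<le> 2 * n" using mn by simp
    have pw: "2 ^ k \<le> (2 * n) ^ k" for k using n2 by (rule power_mono) simp
    have lg: "lgm m \<le> n"
    proof -
      have "lgm m \<le> m" unfolding lgm_def by (rule Least_le) (rule less_exp)
      then show ?thesis using mn by simp
    qed
    have "pattern_prep P n m s w X"
    proof
      have "208 * (s * lgm m) \<le> 2 ^ 8 * ((2 * n) ^ d * (2 * n))"
        by (intro mult_le_mono sd) (use lg in auto)
      also have "\<dots> \<le> (2 * n) ^ 8 * ((2 * n) ^ d * (2 * n))" by (intro mult_le_mono1 pw)
      also have "\<dots> = (2 * n) ^ (d + 9)" by (simp add: power_add[symmetric] flip: power_Suc2 add: eval_nat_numeral ac_simps power_add)
      finally have 1: "208 * (s * lgm m) \<le> (2 * n) ^ (d + 9)" .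
      have "m + n + 22 \<le> 2 ^ 4 * (2 * n)" using mn by simp
      also have "\<dots> \<le> (2 * n) ^ 4 * (2 * n)" by (intro mult_le_mono1 pw)
      also have "\<dots> = (2 * n) ^ 5" by (simp add: eval_nat_numeral)
      also have "\<dots> \<le> (2 * n) ^ (d + 9)" by (intro power_increasing) (use mn in auto)
      finally have "m + n + 22 + 208 * (s * lgm m) \<le> 2 * (2 * n) ^ (d + 9)" using 1 by linarith
      also have "\<dots> \<le> (2 * n) * (2 * n) ^ (d + 9)" by (intro mult_le_mono1 n2)
      also have "\<dots> = (2 * n) ^ Suc (d + 9)" by (rule power_Suc[symmetric])
      also have "\<dots> \<le> X" unfolding X_def A_def by (intro power_increasing) (use mn in auto)
      finally show "m + (4 * (52 * (s * lgm m)) + 2) + n + 20 \<le> X" by simp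
      have "(4096::nat) = 2 ^ 12" by simp
      also have "\<dots> \<le> (2 * n) ^ 12" by (rule pw)
      also have "\<dots> \<le> X" unfolding X_def A_def by (intro power_increasing) (use mn in auto)
      finally show "4096 \<le> X" .
      have "X ^ 6 = (2 * n) ^ (6 * A)" unfolding X_def power_mult[symmetric] by (simp only: mult.commute[of A 6])
      then show "X ^ 6 \<le> 2 ^ w" using nat_powr_bound[OF _ refl w] mn by simp
    qed (use mn P in auto)
    then interpret pattern_prep P n m s w X .
    obtain N F where R: "run w (progR A) N (preproc_init w n s P) = map_pmf (\<lambda>r. (length (progR A), F r)) (pmf_of_set {0..<2 ^ w})"
      and F: "\<And>r. r < 2 ^ w \<Longrightarrow> \<exists>z. sim w J z (F r) \<and> fin (r mod pp) z"
      using prep_run[OF X_def] by blast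
    define S where "S = KC + JQ"
    have JQJ: "JQ \<le> J" using ixm[of "C + 1" 0] C_le mn ixJ[of "C + 1" 0] by (simp add: JQ_def AK_def)
    \<comment> \<open>\<open>S = 180 + 4160 * (s * lgm m)\<close>, and both 1 and
      \<open>s * lgm m\<close> are at most \<open>s * (1 + log 2 m)\<close>; hence 4340.\<close>
    have "real S \<le> 4340 * (real s * (1 + log 2 m))"
    proof -
      have "S = 180 + 4160 * (s * lgm m)"
        by (simp add: S_def JQ_def C_def hc_def KC_def TD_def NR_def AK_def)
      then have "real S = 180 + 4160 * (real s * real (lgm m))" by simp
      moreover have "1 * 1 \<le> real s * (1 + log 2 m)"
        by (rule mult_mono) (use sg_pos mn in auto)
      moreover have "real s * real (lgm m) \<le> real s * (1 + log 2 m)"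
        using lgm_log[OF mn(1)] by (intro mult_left_mono) auto
      ultimately show ?thesis by linarith
    qed
    moreover have "\<forall>e\<in>set_pmf (run w (progR A) N (preproc_init w n s P)). halted (progR A) e"
      by (auto simp: R halted_def)
    moreover have "(\<forall>out\<in>set_pmf (transcript w (progR A) N progQ (length progQ) S s P T). None \<notin> set out) \<and>
            measure_pmf.prob (transcript w (progR A) N progQ (length progQ) S s P T)
              {out. \<forall>i. m \<le> i + 1 \<and> i < n \<longrightarrow> out ! i = Some (p_match {0..<s} P (window T m i))}
              \<ge> 1 - 1 / real n powr c" if T: "length T = n" "set T \<subseteq> {0..<s}" for T
    proof
      show "\<forall>out\<in>set_pmf (transcript w (progR A) N progQ (length progQ) S s P T). None \<notin> set out"
        unfolding transcript_def using stream_answers[OF fwd_progQ] by auto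
      define G where "G = {out. \<forall>i. m \<le> i + 1 \<and> i < n \<longrightarrow> out ! i = Some (p_match {0..<s} P (window T m i))}"
      define y where "y = map (\<lambda>i. Some (em \<pi> (pd T) m (Suc i))) [0..<n]"
      let ?f = "\<lambda>r. stream w progQ (length progQ) T (take S (F r))"
      let ?U = "pmf_of_set {0..<2 ^ w}"
      let ?D = "bad T \<pi> n m pp"
      have npp: "n < pp" using C_le(1) pp(2) by linarith
      note cb = card_bad[OF pp(1) npp mn \<pi>_le, of T]
      have tr: "transcript w (progR A) N progQ (length progQ) S s P T = bind_pmf ?U ?f"
        by (simp add: transcript_def T(1) R bind_map_pmf)
      \<comment> \<open>Outside the bad set the stream has the correct outcome with certainty, so
        only the choice of the word can fail.\<close>
      have good: "?f r = return_pmf y" if r: "r \<in> {x. x < 2 ^ w \<and> x mod pp \<notin> ?D}" for r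
      proof -
        obtain z where z: "sim w J z (F r)" "fin (r mod pp) z" using F r by blast
        have rp: "r mod pp < pp" using pp_lt(3) by simp
        have nb: "r mod pp \<notin> ?D" using r by simp
        have "level_stream T P n m s w JQ pp (r mod pp) C rho L0 l0 lam lw hl Lv lnf (Aaf (r mod pp)) (Bbf (r mod pp)) kdf"
          using level_stream[OF T rp not_bad(1)[OF rp nb] not_bad(2)[OF rp nb]] by blast
        from stream_fin[OF this z(2) sim_take[OF z(1) JQJ]] show ?thesis by (simp add: S_def y_def)
      qed
      have yG: "y \<in> G"
        unfolding G_def
      proof (intro CollectI allI impI)
        fix i assume i: "m \<le> i + 1 \<and> i < n"
        have W: "length (window T m i) = m" "set (window T m i) \<subseteq> {0..<s}"
          using i T by (auto simp: window_def dest: in_set_takeD in_set_dropD)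
        have "pd (window T m i) j = tr j (pd T (i + 1 - m + j))" if "j < m" for j
          unfolding window_def by (rule pd_drop_take) (use that i T in auto)
        then have "p_match {0..<s} P (window T m i) \<longleftrightarrow> em \<pi> (pd T) m (Suc i)"
          using p_match_iff_pd[OF _ P(2) W(2) P(1) W(1)] i by (auto simp: em_def \<pi>_def)
        then show "y ! i = Some (p_match {0..<s} P (window T m i))" using i by (simp add: y_def)
      qed
      have "1 - 1 / real n powr c \<le> 1 - 2 * real (card ?D) / real pp"
      proof -
        have "2 * card ?D * (2 * n) ^ a \<le> (2 * n) * (2 * n) ^ 4 * (2 * n) ^ a"
          using cb(1) n2 by (intro mult_le_mono1 mult_le_mono)
        also have "\<dots> = (2 * n) ^ (a + 5)" by (simp add: power_add eval_nat_numeral)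
        also have "\<dots> \<le> X" unfolding X_def A_def by (intro power_increasing) (use mn in auto)
        also have "\<dots> \<le> pp" using pp(2) by simp
        finally have "real (2 * card ?D * (2 * n) ^ a) \<le> real pp" by (simp only: of_nat_le_iff)
        then have 1: "2 * real (card ?D) * (2 * real n) ^ a \<le> real pp" by simp
        have "real n powr c \<le> real n powr real a"
          using mn by (intro powr_mono) (auto simp: a_def, linarith)
        also have "\<dots> = real n ^ a" using mn by (simp add: powr_realpow)
        also have "\<dots> \<le> (2 * real n) ^ a" by (intro power_mono) auto
        finally have "2 * real (card ?D) * (real n powr c) \<le> real pp"
          using 1 by (meson mult_left_mono order_trans of_nat_0_le_iff mult_nonneg_nonneg zero_le_numeral)
        moreover have "0 < real n powr c" using mn by simp
        moreover have "0 < real pp" using pp_lt(3) by simp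
        ultimately have "2 * real (card ?D) / real pp \<le> 1 / real n powr c" by (simp add: field_simps)
        then show ?thesis by simp
      qed
      also have "\<dots> \<le> measure_pmf.prob ?U {x. x < 2 ^ w \<and> x mod pp \<notin> ?D}"
        by (rule prob_good_word[OF cb(2) pp_lt(3)]) (rule less_imp_le, rule pp_lt(2), simp)
      also have "\<dots> \<le> measure_pmf.prob (bind_pmf ?U ?f) G"
        by (rule prob_bind_ge[where y = y]) (use good yG in blast)+
      finally show "1 - 1 / real n powr c \<le> measure_pmf.prob (transcript w (progR A) N progQ (length progQ) S s P T)
           {out. \<forall>i. m \<le> i + 1 \<and> i < n \<longrightarrow> out ! i = Some (p_match {0..<s} P (window T m i))}"
        unfolding tr G_def .
    qed
    ultimately show ?thesis by blast
  qed
  show ?thesis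
  proof (intro exI[of _ ?\<kappa>] conjI allI)
    show "0 < ?\<kappa>" by (simp add: A_def)
    fix \<kappa>\<^sub>1 :: real
    show "\<exists>(R::prog) (Q::prog) (t::nat) (K::real).
    \<forall>(n::nat) (m::nat) (s::nat) (w::nat) (P::nat list).
      1 \<le> m \<and> m \<le> n \<and> length P = m \<and> set P \<subseteq> {0..<s} \<and> s \<le> (2 * n) ^ d \<and>
      ?\<kappa> * (1 + log 2 n) \<le> w \<and> w \<le> \<kappa>\<^sub>1 * (1 + log 2 n) \<longrightarrow>
      (\<exists>(S::nat) (N::nat).
         real S \<le> K * (s * (1 + log 2 m)) \<and>
         (\<forall>e\<in>set_pmf (run w R N (preproc_init w n s P)). halted R e) \<and>
         (\<forall>T::nat list. length T = n \<and> set T \<subseteq> {0..<s} \<longrightarrow>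
            (\<forall>out\<in>set_pmf (transcript w R N Q t S s P T). None \<notin> set out) \<and>
            measure_pmf.prob (transcript w R N Q t S s P T)
              {out. \<forall>i. m \<le> i + 1 \<and> i < n \<longrightarrow>
                      out ! i = Some (p_match {0..<s} P (window T m i))}
              \<ge> 1 - 1 / real n powr c))"
    proof (rule exI[of _ "progR A"], rule exI[of _ progQ], rule exI[of _ "length progQ"],
        rule exI[of _ "4340::real"], intro allI impI)
      fix n m s w :: nat and P :: "nat list"
      assume h: "1 \<le> m \<and> m \<le> n \<and> length P = m \<and> set P \<subseteq> {0..<s} \<and> s \<le> (2 * n) ^ d \<and>
        ?\<kappa> * (1 + log 2 n) \<le> w \<and> w \<le> \<kappa>\<^sub>1 * (1 + log 2 n)"
      then have "1 \<le> m" "m \<le> n" "length P = m" "set P \<subseteq> {0..<s}" "s \<le> (2 * n) ^ d" "?\<kappa> * (1 + log 2 n) \<le> w" by blast+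
      from body[OF this] show "\<exists>(S::nat) (N::nat).
         real S \<le> 4340 * (s * (1 + log 2 m)) \<and>
         (\<forall>e\<in>set_pmf (run w (progR A) N (preproc_init w n s P)). halted (progR A) e) \<and>
         (\<forall>T::nat list. length T = n \<and> set T \<subseteq> {0..<s} \<longrightarrow>
            (\<forall>out\<in>set_pmf (transcript w (progR A) N progQ (length progQ) S s P T). None \<notin> set out) \<and>
            measure_pmf.prob (transcript w (progR A) N progQ (length progQ) S s P T)
              {out. \<forall>i. m \<le> i + 1 \<and> i < n \<longrightarrow>
                      out ! i = Some (p_match {0..<s} P (window T m i))}
              \<ge> 1 - 1 / real n powr c)" by blast
    qed
  qed
qed

end
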